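(* Assume that $q$ is not a root of unity and that no product $q^{a}t^{b}$ with $a,b\in\mathbb Q$ is a nontrivial root of unity (it may equal $1$). (i) An arbitrary irreducible finite dimensional representation $V$ of $\mathcal H\!\mathcal H$ is a quotient of either the polynomial representation $\mathcal P=\mathbb C[X^{\pm1}]$ or its image under one of the automorphisms $\iota,\ \varsigma_y,\ \iota\varsigma_y$. The representation $\mathcal P$ is $Y$-semisimple if and only if $k$ is not a negative integer. It is irreducible if and only if $k\ne -1/2-n$ for all $n\in\mathbb Z_+$. (ii) Let $k=-1/2-n$ for $n\in\mathbb Z_+$. The polynomials $e_m$ are well defined for all $m\in\mathbb Z$ and form a basis of $\mathcal P$. They are multiplied by $(-1)^m$ under the automorphism $\varsigma_x$ (i.e. under $X\mapsto -X$). The values $e_m(-k/2)$ are nonzero, and therefore the polynomials $\varepsilon_m=e_m/e_m(-k/2)$ exist, for $m\in M=\{-2n\le m\le 2n+1\}$. The series $\mu^0_k$ and the pairing $\langle f,g\rangle$ on $\mathcal P$ are well defined for $k=-1/2-n$. The scalar squares $\langle e_m,e_m\rangle$ are nonzero precisely for $m\in M$. The radical $Rad_0$ of the pairing $\langle f,g\rangle$ is $\oplus_{m\notin M}\mathbb C e_m$. (iii) Continuing (ii), $Rad_0=(e_{-2n-1})$ as an ideal in $\mathcal P$, and the $\mathcal H\!\mathcal H$-module $\mathcal P/Rad_0$ is the greatest finite dimensional quotient of $\mathcal P$. It is the direct sum of the two non-isomorphic $\mathcal H\!\mathcal H$-submodules of dimension $2n+1$ $$V^\pm_{2n+1}=\oplus_{m=1}^{2n+1}\mathbb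 C\,\varepsilon_m^\pm \bmod Rad_0,\qquad \varepsilon_m^\pm=\varepsilon_m\pm\varepsilon_{-2n-1+m},$$ $$V^\pm_{2n+1}\cong\mathbb C[X^{\pm1}]/(\varepsilon^\mp)\quad\text{for}\quad \varepsilon^\pm=\varepsilon_{n+1}\pm\varepsilon_{-n}.$$ These modules are orthogonal to each other with respect to $\langle\,,\rangle$, and $V^-_{2n+1}$ is isomorphic to the $\varsigma_x$-image of $V^+_{2n+1}$. (iv) The representation $V^+_{2n+1}$ is the quotient of $\mathcal P$ by the radical $Rad$ of the pairing $\{f,g\}=f(Y^{-1})(g)\big|_{X\mapsto t^{-1/2}}$, which is $V^-_{2n+1}+Rad_0$ (the preimage of $V^-_{2n+1}$ in $\mathcal P$). Respectively, $V^-_{2n+1}$ corresponds to the pairing $\{f,g\}_-=f(Y^{-1})(g)\big|_{X\mapsto -t^{-1/2}}$. The discretization map $f\mapsto f(z)$, $z\in\bowtie'=\{1/4+m/2\mid -n\le m\le n\}$, identifies $V^+_{2n+1}$ with the space $F_{2n+1}$ of functions on $\bowtie'$, where $\mathcal H\!\mathcal H$ acts by $(Xf)(z)=q^zf(z)$, $(\pi f)(z)=f(1/2-z)$ and $$(Tf)(z)=\frac{t^{1/2}q^{2z}-t^{-1/2}}{q^{2z}-1}f(-z)-\frac{t^{1/2}-t^{-1/2}}{q^{2z}-1}f(z).$$ The polynomials $\varepsilon^\pm$ from (iii) are proportional to $$e^\pm=e_{n+1}\pm t^{-1/2}e_{-n}=X^{-n}\prod_{m=-n}^n\bigl(X\pm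 q^{1/4+m/2}\bigr).$$
   Context: Parameters: $q\in\mathbb C^*$ with its fractional powers fixed compatibly, $t=q^k$, $t^{1/2}=q^{k/2}$; a condition such as $k=r$ with $r$ rational means $t^{1/2}=q^{r/2}$. The double affine Hecke algebra $\mathcal H\!\mathcal H$ (of type $A_1$) is generated by $X^{\pm1},Y^{\pm1},T$ with relations $TXT=X^{-1}$, $TY^{-1}T=Y$, $Y^{-1}X^{-1}YXT^2q^{1/2}=1$, $(T-t^{1/2})(T+t^{-1/2})=0$; $\pi=YT^{-1}$ satisfies $\pi^2=1$, $\pi X\pi^{-1}=q^{1/2}X^{-1}$. Polynomial representation $\mathcal P=\mathbb C[X^{\pm1}]$, $X=q^x$: $X$ acts by multiplication, $T=t^{1/2}s+\frac{t^{1/2}-t^{-1/2}}{X^2-1}(s-1)$, $Y=\pi T$, where $s(f)(x)=f(-x)$, $\pi(f)(x)=f(1/2-x)$ (i.e. $s(X)=X^{-1}$, $\pi(X)=q^{1/2}X^{-1}$). "$f(c)$" means the value of $f$ at $X=q^c$; in particular $f(-k/2)$ is the value at $X=t^{-1/2}$. (Auto)morphisms: $\iota$: $T\mapsto -T$, $X\mapsto X$, $Y\mapsto Y$, $q^{1/2}\mapsto q^{1/2}$, $t^{1/2}\mapsto t^{-1/2}$ (so the $\iota$-image of a polynomial representation is obtained from the polynomial representation with $t^{1/2}$ replaced by $t^{-1/2}$, $T$ acting with the opposite sign); $\varsigma_y$: $Y\mapsto -Y$, fixing $T,X,q^{1/2},t^{1/2}$; $\varsigma_x$: $X\mapsto -X$,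 fixing $T,Y,q^{1/2},t^{1/2}$. $\mu_k=\prod_{j\ge0}\frac{(1-q^{j}X^2)(1-q^{j+1}X^{-2})}{(1-tq^{j}X^2)(1-tq^{j+1}X^{-2})}$, $\langle\cdot\rangle$ is the constant term of a Laurent series in $X$, $\mu_k^0=\mu_k/\langle\mu_k\rangle$, a Laurent series whose coefficients are rational functions of $q,t$. The pairing is $\langle f,g\rangle=\langle f\bar g\mu_k^0\rangle$, where the bar inverts $X,q,t$ and their fractional powers (in statements involving this pairing $q$ is treated as a formal parameter over $\mathbb C$). Order: $X^m\prec X^n$ if $|m|<|n|$ or $m=-n>0$. For generic $q,t$ the nonsymmetric polynomials $e_n$ are determined by $e_n=X^n+(\text{lower terms with respect to }\prec)$ and $\langle e_nX^{-m}\mu_k^0\rangle=0$ for $X^m\prec X^n$; equivalently $Ye_n=q^{-n_\#}e_n$, $n_\#=(n+\mathrm{sgn}(n)k)/2$, $\mathrm{sgn}(0)=-1$. Their coefficients are rational functions of $q,t$; for special $q,t$ they are called well defined if these coefficients are. In $f(Y^{-1})$, the operator $Y^{-1}$ is substituted for $X$ in the Laurent polynomial $f$. $(g)$ denotes the ideal of $\mathcal P$ generated by $g$. *)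

theory Defs
  imports Complex_Main
    "HOL-Library.Poly_Mapping"
    "HOL-Computational_Algebra.Formal_Laurent_Series"
    "HOL-Computational_Algebra.Fraction_Field"
    "HOL-Algebra.Algebraic_Closure_Type"
begin

text \<open>
  The algebra is given by generators and relations, so a module over it is a vector space with
  operators \<open>X\<close>, \<open>Y\<close> (invertible) and \<open>T\<close> that satisfy the relations.  The vector space is a
  \<^const>\<open>module\<close> over the field \<open>ring_of_type_algebra\<close>, whose carrier is the whole scalar type.
  The \<open>mult\<close> and \<open>one\<close> fields inherited from the ring record play no role in the module structure;
  they are meaningful for the polynomial representation, where they serve to speak of ideals.
\<close>

record ('k, 'v) hh_module = "('k, 'v) module" +
  opX :: "'v \<Rightarrow> 'v"
  opY :: "'v \<Rightarrow> 'v"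
  opT :: "'v \<Rightarrow> 'v"

definition lin_op :: "('k::field, 'v, 'c) module_scheme \<Rightarrow> ('v \<Rightarrow> 'v) \<Rightarrow> bool" where
  "lin_op M A \<longleftrightarrow> A \<in> carrier M \<rightarrow> carrier M \<and>
     (\<forall>x\<in>carrier M. \<forall>y\<in>carrier M. A (x \<oplus>\<^bsub>M\<^esub> y) = A x \<oplus>\<^bsub>M\<^esub> A y) \<and>
     (\<forall>c. \<forall>x\<in>carrier M. A (c \<odot>\<^bsub>M\<^esub> x) = c \<odot>\<^bsub>M\<^esub> A x)"

text \<open>The parameters are \<open>qh = q\<^sup>1\<^sup>/\<^sup>2\<close> and \<open>th = t\<^sup>1\<^sup>/\<^sup>2\<close>.\<close>

definition HH_module :: "'k::field \<Rightarrow> 'k \<Rightarrow> ('k, 'v) hh_module \<Rightarrow> bool" where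
  "HH_module qh th M \<longleftrightarrow>
     module ring_of_type_algebra M \<and>
     lin_op M (opX M) \<and> lin_op M (opY M) \<and> lin_op M (opT M) \<and>
     bij_betw (opX M) (carrier M) (carrier M) \<and>
     bij_betw (opY M) (carrier M) (carrier M) \<and>
     (let gX = opX M; gY = opY M; gT = opT M;
          gXi = inv_into (carrier M) gX; gYi = inv_into (carrier M) gY
      in \<forall>v\<in>carrier M.
           gT (gX (gT v)) = gXi v \<and>
           gT (gYi (gT v)) = gY v \<and>
           qh \<odot>\<^bsub>M\<^esub> gYi (gXi (gY (gX (gT (gT v))))) = v \<and>
           (let u = gT v \<oplus>\<^bsub>M\<^esub> inverse th \<odot>\<^bsub>M\<^esub> v
            in gT u \<ominus>\<^bsub>M\<^esub> th \<odot>\<^bsub>M\<^esub> u = \<zero>\<^bsub>M\<^esub>))"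

definition hh_hom :: "('k::field, 'v) hh_module \<Rightarrow> ('k, 'w) hh_module \<Rightarrow> ('v \<Rightarrow> 'w) set" where
  "hh_hom M N = {\<phi> \<in> carrier M \<rightarrow> carrier N.
     (\<forall>x\<in>carrier M. \<forall>y\<in>carrier M. \<phi> (x \<oplus>\<^bsub>M\<^esub> y) = \<phi> x \<oplus>\<^bsub>N\<^esub> \<phi> y) \<and>
     (\<forall>c. \<forall>x\<in>carrier M. \<phi> (c \<odot>\<^bsub>M\<^esub> x) = c \<odot>\<^bsub>N\<^esub> \<phi> x) \<and>
     (\<forall>x\<in>carrier M. \<phi> (opX M x) = opX N (\<phi> x) \<and> \<phi> (opY M x) = opY N (\<phi> x) \<and>
                     \<phi> (opT M x) = opT N (\<phi> x))}"

definition hh_iso :: "('k::field, 'v) hh_module \<Rightarrow> ('k, 'w) hh_module \<Rightarrow> ('v \<Rightarrow> 'w) set" where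
  "hh_iso M N = {\<phi> \<in> hh_hom M N. bij_betw \<phi> (carrier M) (carrier N)}"

definition hh_isomorphic :: "('k::field, 'v) hh_module \<Rightarrow> ('k, 'w) hh_module \<Rightarrow> bool" where
  "hh_isomorphic M N \<longleftrightarrow> hh_iso M N \<noteq> {}"

definition is_quotient_of :: "('k::field, 'v) hh_module \<Rightarrow> ('k, 'w) hh_module \<Rightarrow> bool" where
  "is_quotient_of V M \<longleftrightarrow> (\<exists>\<phi>\<in>hh_hom M V. \<phi> ` carrier M = carrier V)"

text \<open>A submodule is stable under \<open>X\<^sup>-\<^sup>1\<close> and \<open>Y\<^sup>-\<^sup>1\<close> as well, hence the equalities.\<close>

definition subrep :: "'v set \<Rightarrow> ('k::field, 'v) hh_module \<Rightarrow> bool" where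
  "subrep N M \<longleftrightarrow> submodule N ring_of_type_algebra M \<and>
     opX M ` N = N \<and> opY M ` N = N \<and> opT M ` N \<subseteq> N"

definition irreducible_rep :: "('k::field, 'v) hh_module \<Rightarrow> bool" where
  "irreducible_rep M \<longleftrightarrow> carrier M \<noteq> {\<zero>\<^bsub>M\<^esub>} \<and>
     (\<forall>N. subrep N M \<longrightarrow> N = {\<zero>\<^bsub>M\<^esub>} \<or> N = carrier M)"

definition quot_rep :: "('k::field, 'v) hh_module \<Rightarrow> 'v set \<Rightarrow> ('k, 'v set) hh_module" where
  "quot_rep M N =
     \<lparr>carrier = a_rcosets\<^bsub>M\<^esub> N, monoid.mult = rcoset_mult M N, one = N +>\<^bsub>M\<^esub> \<one>\<^bsub>M\<^esub>,
      zero = N, add = set_add M,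
      module.smult = (\<lambda>c C. \<Union>x\<in>C. N +>\<^bsub>M\<^esub> (c \<odot>\<^bsub>M\<^esub> x)),
      opX = (\<lambda>C. \<Union>x\<in>C. N +>\<^bsub>M\<^esub> opX M x),
      opY = (\<lambda>C. \<Union>x\<in>C. N +>\<^bsub>M\<^esub> opY M x),
      opT = (\<lambda>C. \<Union>x\<in>C. N +>\<^bsub>M\<^esub> opT M x)\<rparr>"

definition has_basis :: "('k::field, 'v, 'c) module_scheme \<Rightarrow> ('i \<Rightarrow> 'v) \<Rightarrow> 'i set \<Rightarrow> bool" where
  "has_basis M b I \<longleftrightarrow> b \<in> I \<rightarrow> carrier M \<and>
     (\<forall>v\<in>carrier M. \<exists>!c :: 'i \<Rightarrow>\<^sub>0 'k. Poly_Mapping.keys c \<subseteq> I \<and>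
        v = (\<Oplus>\<^bsub>M\<^esub>i\<in>Poly_Mapping.keys c. Poly_Mapping.lookup c i \<odot>\<^bsub>M\<^esub> b i))"

definition has_dim :: "('k::field, 'v, 'c) module_scheme \<Rightarrow> nat \<Rightarrow> bool" where
  "has_dim M d \<longleftrightarrow> (\<exists>b. has_basis M b {..<d})"

definition finite_dim :: "('k::field, 'v, 'c) module_scheme \<Rightarrow> bool" where
  "finite_dim M \<longleftrightarrow> (\<exists>d. has_dim M d)"

definition lin_span :: "('k::field, 'v, 'c) module_scheme \<Rightarrow> ('i \<Rightarrow> 'v) \<Rightarrow> 'i set \<Rightarrow> 'v set" where
  "lin_span M b I =
     {(\<Oplus>\<^bsub>M\<^esub>i\<in>Poly_Mapping.keys c. Poly_Mapping.lookup c i \<odot>\<^bsub>M\<^esub> b i) | c :: 'i \<Rightarrow>\<^sub>0 'k.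
        Poly_Mapping.keys c \<subseteq> I}"

definition Y_semisimple :: "('k::field, 'v) hh_module \<Rightarrow> bool" where
  "Y_semisimple M \<longleftrightarrow>
     (\<exists>B. has_basis M (\<lambda>v. v) B \<and> (\<forall>v\<in>B. \<exists>c. opY M v = c \<odot>\<^bsub>M\<^esub> v))"

text \<open>\<open>M/N\<close> is finite dimensional and every finite dimensional quotient \<open>M/J\<close> factors through it.\<close>

definition greatest_fin_dim_quotient :: "('k::field, 'v) hh_module \<Rightarrow> 'v set \<Rightarrow> bool" where
  "greatest_fin_dim_quotient M N \<longleftrightarrow>
     subrep N M \<and> finite_dim (quot_rep M N) \<and>
     (\<forall>J. subrep J M \<and> finite_dim (quot_rep M J) \<longrightarrow> N \<subseteq> J)"

text \<open>
  Twists by the involutions \<open>X \<mapsto> -X\<close> and \<open>Y \<mapsto> -Y\<close>.  The image of a module under \<open>\<iota>\<close> is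
  the module for the parameter \<open>t\<^sup>-\<^sup>1\<^sup>/\<^sup>2\<close> in place of \<open>t\<^sup>1\<^sup>/\<^sup>2\<close>, with the sign of \<open>T\<close> changed
  by \<open>negate_T\<close>.
\<close>

definition sigma_x :: "('k::field, 'v) hh_module \<Rightarrow> ('k, 'v) hh_module" where
  "sigma_x M = M\<lparr>opX := \<lambda>v. \<ominus>\<^bsub>M\<^esub> opX M v\<rparr>"

definition sigma_y :: "('k::field, 'v) hh_module \<Rightarrow> ('k, 'v) hh_module" where
  "sigma_y M = M\<lparr>opY := \<lambda>v. \<ominus>\<^bsub>M\<^esub> opY M v\<rparr>"

definition negate_T :: "('k::field, 'v) hh_module \<Rightarrow> ('k, 'v) hh_module" where
  "negate_T M = M\<lparr>opT := \<lambda>v. \<ominus>\<^bsub>M\<^esub> opT M v\<rparr>"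

text \<open>Laurent polynomials are the group algebra of the integers; \<open>mon j\<close> is \<open>X\<^sup>j\<close>.\<close>

type_synonym 'k lpoly = "int \<Rightarrow>\<^sub>0 'k"

abbreviation mon :: "int \<Rightarrow> 'k::field lpoly" where
  "mon j \<equiv> Poly_Mapping.single j 1"

definition scal :: "'k::field \<Rightarrow> 'k lpoly \<Rightarrow> 'k lpoly" where
  "scal c f = Poly_Mapping.single 0 c * f"

definition ev :: "'k::field \<Rightarrow> 'k lpoly \<Rightarrow> 'k" where
  "ev a f = (\<Sum>j\<in>Poly_Mapping.keys f. Poly_Mapping.lookup f j * a powi j)"

text \<open>\<open>s(X) = X\<^sup>-\<^sup>1\<close>, \<open>\<pi>(X) = q\<^sup>1\<^sup>/\<^sup>2X\<^sup>-\<^sup>1\<close>, and the substitution \<open>X \<mapsto> -X\<close>.\<close>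

definition s_op :: "'k::field lpoly \<Rightarrow> 'k lpoly" where
  "s_op f = Poly_Mapping.map_key uminus f"

definition pi_op :: "'k::field \<Rightarrow> 'k lpoly \<Rightarrow> 'k lpoly" where
  "pi_op qh f = (\<Sum>j\<in>Poly_Mapping.keys f.
     Poly_Mapping.single (- j) (Poly_Mapping.lookup f j * qh powi j))"

definition flip_X :: "'k::field lpoly \<Rightarrow> 'k lpoly" where
  "flip_X f = (\<Sum>j\<in>Poly_Mapping.keys f.
     Poly_Mapping.single j (Poly_Mapping.lookup f j * (- 1) powi j))"

text \<open>The quotient of \<open>s f - f\<close> by \<open>X\<^sup>2 - 1\<close> is exact.\<close>

definition T_op :: "'k::field \<Rightarrow> 'k lpoly \<Rightarrow> 'k lpoly" where
  "T_op th f = scal th (s_op f) +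
     scal (th - inverse th) (THE g. (mon 2 - 1) * g = s_op f - f)"

text \<open>
  A system of fractional powers of \<open>q\<close> is a function \<open>p\<close> on the rationals with
  \<open>p a = q\<^sup>a\<close>.
\<close>

definition fractional_powers :: "'k::field \<Rightarrow> (rat \<Rightarrow> 'k) \<Rightarrow> bool" where
  "fractional_powers q p \<longleftrightarrow> q \<noteq> 0 \<and> p 1 = q \<and> (\<forall>a b. p (a + b) = p a * p b)"

definition polrep :: "(rat \<Rightarrow> 'k::field) \<Rightarrow> 'k \<Rightarrow> ('k, 'k lpoly) hh_module" where
  "polrep p th =
     \<lparr>carrier = UNIV, monoid.mult = (*), one = 1, zero = 0, add = (+), module.smult = scal,
      opX = (\<lambda>f. mon 1 * f), opY = (\<lambda>f. pi_op (p (1/2)) (T_op th f)), opT = T_op th\<rparr>"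

text \<open>
  \<open>\<mu>\<close> is a power series in \<open>q\<close> whose coefficients are Laurent series in \<open>X\<close> over the field of
  rational functions of \<open>t\<close>.  The only factor whose denominator is not \<open>1 + O(q)\<close> is
  \<open>1 - t X\<^sup>2\<close>; it is expanded in positive powers of \<open>X\<close>.  The product converges in the
  \<open>q\<close>-adic topology.
\<close>

type_synonym mu_ring = "int poly fract fls fps"

definition mu_t :: mu_ring where
  "mu_t = fps_const (fls_const (Fract [:0, 1:] 1))"

definition mu_X :: "int \<Rightarrow> mu_ring" where
  "mu_X j = fps_const (fls_X_intpow j)"

definition mu_factor :: "nat \<Rightarrow> mu_ring" where
  "mu_factor j =
     (1 - fps_X ^ j * mu_X 2) * (1 - fps_X ^ (j + 1) * mu_X (- 2)) *
     inverse ((1 - mu_t * fps_X ^ j * mu_X 2) * (1 - mu_t * fps_X ^ (j + 1) * mu_X (- 2)))"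

definition mu :: mu_ring where
  "mu = lim (\<lambda>N. \<Prod>j<N. mu_factor j)"

text \<open>The coefficient of \<open>X\<^sup>m\<close> in \<open>\<mu>\<close> and in \<open>\<mu>\<^sup>0 = \<mu>/\<langle>\<mu>\<rangle>\<close>, as a power series in \<open>q\<close>.\<close>

definition mu_coeff :: "int \<Rightarrow> int poly fract fps" where
  "mu_coeff m = Abs_fps (\<lambda>N. fls_nth (fps_nth mu N) m)"

definition mu0_series :: "int \<Rightarrow> int poly fract fps" where
  "mu0_series m = mu_coeff m * inverse (mu_coeff 0)"

text \<open>
  Rational functions of \<open>q\<close>, \<open>t\<close> are fractions of polynomials in \<open>q\<close> (outer variable) and \<open>t\<close>
  (inner variable).  Everything needed is defined over the integers, so integer coefficients
  suffice, and the functions can be specialized in every field.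
\<close>

type_synonym ratfun2 = "int poly poly fract"

definition poly2_eval :: "'k::field \<Rightarrow> 'k \<Rightarrow> int poly poly \<Rightarrow> 'k" where
  "poly2_eval q t A = poly (map_poly (\<lambda>a. poly (map_poly of_int a) t) A) q"

definition poly2_series :: "int poly poly \<Rightarrow> int poly fract fps" where
  "poly2_series A = Abs_fps (\<lambda>i. Fract (Polynomial.coeff A i) 1)"

definition mu0 :: "int \<Rightarrow> ratfun2" where
  "mu0 m = (THE r. \<exists>A B. B \<noteq> 0 \<and> r = Fract A B \<and>
     poly2_series B * mu0_series m = poly2_series A)"

text \<open>A rational function is well defined at \<open>(q, t)\<close> if it has a fraction whose denominator
  does not vanish there; its value is then independent of the fraction.\<close>

definition regular_at :: "'k::field \<Rightarrow> 'k \<Rightarrow> ratfun2 \<Rightarrow> bool" where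
  "regular_at q t r \<longleftrightarrow> (\<exists>A B. r = Fract A B \<and> poly2_eval q t B \<noteq> 0)"

definition spec :: "'k::field \<Rightarrow> 'k \<Rightarrow> ratfun2 \<Rightarrow> 'k" where
  "spec q t r = (THE a. \<exists>A B. r = Fract A B \<and> poly2_eval q t B \<noteq> 0 \<and>
     a = poly2_eval q t A / poly2_eval q t B)"

text \<open>\<open>const_term w f = \<langle>f w\<rangle>\<close>, where \<open>w m\<close> is the coefficient of \<open>X\<^sup>m\<close> in the series \<open>w\<close>.\<close>

definition const_term :: "(int \<Rightarrow> 'k::field) \<Rightarrow> 'k lpoly \<Rightarrow> 'k" where
  "const_term w f = (\<Sum>j\<in>Poly_Mapping.keys f. Poly_Mapping.lookup f j * w (- j))"

text \<open>\<open>prec m n\<close> stands for \<open>X\<^sup>m \<prec> X\<^sup>n\<close>.\<close>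

definition prec :: "int \<Rightarrow> int \<Rightarrow> bool" where
  "prec m n \<longleftrightarrow> \<bar>m\<bar> < \<bar>n\<bar> \<or> (m = - n \<and> - n > 0)"

definition e_gen :: "int \<Rightarrow> ratfun2 lpoly" where
  "e_gen n = (THE f. Poly_Mapping.lookup f n = 1 \<and>
     (\<forall>j\<in>Poly_Mapping.keys f. j = n \<or> prec j n) \<and>
     (\<forall>m. prec m n \<longrightarrow> const_term mu0 (f * mon (- m)) = 0))"

definition e_well_defined :: "'k::field \<Rightarrow> 'k \<Rightarrow> int \<Rightarrow> bool" where
  "e_well_defined q t m \<longleftrightarrow> (\<forall>j. regular_at q t (Poly_Mapping.lookup (e_gen m) j))"

definition e_pol :: "'k::field \<Rightarrow> 'k \<Rightarrow> int \<Rightarrow> 'k lpoly" where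
  "e_pol q t m = Poly_Mapping.map (spec q t) (e_gen m)"

definition bar_lpoly :: "('k::field \<Rightarrow> 'k) \<Rightarrow> 'k lpoly \<Rightarrow> 'k lpoly" where
  "bar_lpoly cj f = Poly_Mapping.map_key uminus (Poly_Mapping.map cj f)"

text \<open>Here \<open>cj\<close> is the bar involution on the scalars, and \<open>w\<close> is the series \<open>\<mu>\<^sup>0\<close>.\<close>

definition pairing :: "('k::field \<Rightarrow> 'k) \<Rightarrow> (int \<Rightarrow> 'k) \<Rightarrow> 'k lpoly \<Rightarrow> 'k lpoly \<Rightarrow> 'k" where
  "pairing cj w f g = const_term w (f * bar_lpoly cj g)"

definition pairing_radical :: "('k::field \<Rightarrow> 'k) \<Rightarrow> (int \<Rightarrow> 'k) \<Rightarrow> 'k lpoly set" where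
  "pairing_radical cj w = {f. \<forall>g. pairing cj w f g = 0}"

text \<open>
  For a number \<open>q\<close> there is no involution of the scalars inverting \<open>q\<close>.  But the pairing is linear
  in \<open>f\<close> and semilinear in \<open>g\<close>, so its radical is the set of \<open>f\<close> orthogonal to all monomials, and
  \<open>\<langle>f, X\<^sup>j\<rangle> = \<langle>f X\<^sup>-\<^sup>j w\<rangle>\<close> does not involve the bar on scalars.
\<close>

definition numeric_radical :: "(int \<Rightarrow> 'k::field) \<Rightarrow> 'k lpoly set" where
  "numeric_radical w = {f. \<forall>j. const_term w (f * mon (- j)) = 0}"

text \<open>\<open>subst_Yinv M f\<close> is the operator \<open>f(Y\<^sup>-\<^sup>1)\<close>, so that \<open>X\<^sup>j\<close> becomes \<open>Y\<^sup>-\<^sup>j\<close>.\<close>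

definition subst_Yinv :: "('k::field, 'k lpoly) hh_module \<Rightarrow> 'k lpoly \<Rightarrow> 'k lpoly \<Rightarrow> 'k lpoly" where
  "subst_Yinv M f g = (\<Sum>j\<in>Poly_Mapping.keys f. scal (Poly_Mapping.lookup f j)
     (if 0 \<le> j then (inv_into UNIV (opY M) ^^ nat j) g else (opY M ^^ nat (- j)) g))"

text \<open>
  The pairing \<open>{f, g} = f(Y\<^sup>-\<^sup>1)(g)\<close> evaluated at \<open>X = a\<close>.  It is symmetric for
  \<open>a = t\<^sup>-\<^sup>1\<^sup>/\<^sup>2\<close> but not for \<open>a = -t\<^sup>-\<^sup>1\<^sup>/\<^sup>2\<close>; its radical is taken in the argument
  \<open>g\<close>, where it is a submodule; the left radical for \<open>-t\<^sup>-\<^sup>1\<^sup>/\<^sup>2\<close> is the same as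
  the one for \<open>t\<^sup>-\<^sup>1\<^sup>/\<^sup>2\<close>.
\<close>

definition eval_pairing ::
  "('k::field, 'k lpoly) hh_module \<Rightarrow> 'k \<Rightarrow> 'k lpoly \<Rightarrow> 'k lpoly \<Rightarrow> 'k" where
  "eval_pairing M a f g = ev a (subst_Yinv M f g)"

definition eval_radical :: "('k::field, 'k lpoly) hh_module \<Rightarrow> 'k \<Rightarrow> 'k lpoly set" where
  "eval_radical M a = {g. \<forall>f. eval_pairing M a f g = 0}"

definition M_set :: "nat \<Rightarrow> int set" where
  "M_set n = {- 2 * int n .. 2 * int n + 1}"

definition bowtie :: "nat \<Rightarrow> rat set" where
  "bowtie n = {1/4 + of_int m / 2 | m. - int n \<le> m \<and> m \<le> int n}"

text \<open>
  At the point \<open>z = 1/4 + n/2\<close> of \<open>bowtie n\<close> (and only there) \<open>-z\<close> lies outside \<open>bowtie n\<close>; for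
  \<open>t\<^sup>1\<^sup>/\<^sup>2 = q\<^bsup>-1/4-n/2\<^esup>\<close> the coefficient of \<open>f (-z)\<close> in \<open>T f\<close> vanishes at this point.
\<close>

definition fun_T :: "(rat \<Rightarrow> 'k::field) \<Rightarrow> 'k \<Rightarrow> (rat \<Rightarrow> 'k) \<Rightarrow> rat \<Rightarrow> 'k" where
  "fun_T p th f z =
     (th * p (2 * z) - inverse th) / (p (2 * z) - 1) * f (- z)
     - (th - inverse th) / (p (2 * z) - 1) * f z"

definition fun_rep :: "(rat \<Rightarrow> 'k::field) \<Rightarrow> 'k \<Rightarrow> nat \<Rightarrow> ('k, rat \<Rightarrow> 'k) hh_module" where
  "fun_rep p th n =
     \<lparr>carrier = bowtie n \<rightarrow>\<^sub>E UNIV,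
      monoid.mult = (\<lambda>f g. \<lambda>z\<in>bowtie n. f z * g z), one = (\<lambda>z\<in>bowtie n. 1),
      zero = (\<lambda>z\<in>bowtie n. 0), add = (\<lambda>f g. \<lambda>z\<in>bowtie n. f z + g z),
      module.smult = (\<lambda>c f. \<lambda>z\<in>bowtie n. c * f z),
      opX = (\<lambda>f. \<lambda>z\<in>bowtie n. p z * f z),
      opY = (\<lambda>f. \<lambda>z\<in>bowtie n. fun_T p th f (1/2 - z)),
      opT = (\<lambda>f. \<lambda>z\<in>bowtie n. fun_T p th f z)\<rparr>"

definition discretize :: "(rat \<Rightarrow> 'k::field) \<Rightarrow> nat \<Rightarrow> 'k lpoly \<Rightarrow> rat \<Rightarrow> 'k" where
  "discretize p n f = (\<lambda>z\<in>bowtie n. ev (p z) f)"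

text \<open>
  The field generated over the complex numbers by a formal \<open>q\<close> and all its fractional powers:
  the fraction field of the group algebra of the rationals.  The involution \<open>formal_bar\<close> is linear
  over the complex numbers and inverts the powers of \<open>q\<close>.
\<close>

type_synonym formal = "(rat \<Rightarrow>\<^sub>0 complex) fract"

definition formal_q :: "rat \<Rightarrow> formal" where
  "formal_q a = Fract (Poly_Mapping.single a 1) 1"

definition formal_bar :: "formal \<Rightarrow> formal" where
  "formal_bar x = (THE y. \<exists>A B. B \<noteq> 0 \<and> x = Fract A B \<and>
     y = Fract (Poly_Mapping.map_key uminus A) (Poly_Mapping.map_key uminus B))"

end

theory Submission
  imports Defs "HOL-Computational_Algebra.Fundamental_Theorem_Algebra"
begin

text \<open>
  \<^bold>\<open>The polynomials.\<close>  The operators \<open>X \<pi>\<close> and \<open>T + const\<close> permute the eigenspaces of \<open>Y\<close>, so that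
  starting from \<open>1\<close> they produce a triangular family of eigenvectors \<open>E q t n\<close> by explicit formulas,
  without solving linear systems; the only denominators are \<open>1 - q\<^sup>m t\<close> with \<open>m > 0\<close>.  The operators
  \<open>T\<close> and \<open>\<pi>\<close> are self-adjoint for the bilinear form \<open>\<langle>f g \<mu>\<^sup>0\<rangle>\<close> (\<open>Th_adj\<close>, \<open>flipx_adj\<close>), because \<open>\<mu>\<close> is
  invariant under \<open>\<pi>\<close> and \<open>\<mu> (1 - t X\<^sup>2)/(1 - X\<^sup>2)\<close> is invariant under \<open>s\<close>.  Hence the adjoint of \<open>Y\<close> is
  triangular with the same eigenvalues, and comparing eigenvalues gives the orthogonality \<open>W_E_orth\<close>
  that characterizes \<open>e\<^sub>n\<close>.  The same two symmetries, compared coefficientwise, give a two-term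
  recursion for the coefficients of \<open>\<mu>\<^sup>0\<close>, whose solution \<open>wgt\<close> is a product of factors
  \<open>(t - q\<^sup>i)/(1 - t q\<^sup>i\<^sup>+\<^sup>1)\<close>.  So both \<open>e\<^sub>n\<close> and \<open>\<mu>\<^sup>0\<close> are rational functions of \<open>q\<close>, \<open>t\<close> that can be specialized
  wherever \<open>q\<^sup>m t \<noteq> 1\<close> for \<open>m > 0\<close> (\<open>e_pol_E\<close>, \<open>mu0_spec\<close>).

  \<^bold>\<open>The special parameter.\<close>  Let \<open>t = q\<^sup>-\<^sup>1\<^sup>/\<^sup>2\<^sup>-\<^sup>n\<close> and \<open>N = 2n + 1\<close>.  The norms of the \<open>e\<^sub>m\<close> are products of
  factors of which only \<open>1 - q\<^sup>N t\<^sup>2\<close> vanishes, so the radical \<open>Rad\<^sub>0\<close> is spanned by the \<open>e\<^sub>m\<close> beyond \<open>e\<^sub>N\<close>.  The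
  eigenvalues of \<open>Y\<close> at \<open>m\<close> and \<open>m - N\<close> coincide for \<open>1 \<le> m \<le> N\<close>; this is the only degeneration, and it pairs
  polynomials of opposite parity.  On the other side, the functions that vanish at the points \<open>q\<^sup>z\<close>,
  \<open>z\<close> in the set \<open>bowtie n\<close>, and those that vanish at the points \<open>-q\<^sup>z\<close> form two ideals stable under
  \<open>T\<close> and \<open>\<pi>\<close>: \<open>-z\<close> leaves the set only for its largest element, where the coefficient of \<open>f(-z)\<close> in
  \<open>T f\<close> is zero.  Each ideal is generated by an eigenvector of \<open>Y\<close>, which has to be
  \<open>e\<^bsub>n+1\<^esub> +- t\<^sup>-\<^sup>1\<^sup>/\<^sup>2 e\<^bsub>-n\<^esub>\<close>, and their intersection is \<open>Rad\<^sub>0\<close> (\<open>R0_eq\<close>) since both contain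
  \<open>e\<^bsub>-N\<^esub>\<close> and a Laurent polynomial of width \<open>2N\<close> has at most \<open>2N\<close> zeros.  The modules of parts (iii) and (iv)
  are the quotients of these ideals by \<open>Rad\<^sub>0\<close> and of \<open>P\<close> by these ideals, so claims about them
  become claims about values at the points \<open>q\<^sup>z\<close> and \<open>-q\<^sup>z\<close>.  A stable subspace of finite codimension contains some \<open>e\<^sub>m\<close> with
  \<open>m > N\<close>, because the eigenvalues of \<open>Y\<close> on these are distinct, and with it all of \<open>Rad\<^sub>0\<close>.

  \<^bold>\<open>Part (i).\<close>  For \<open>k\<close> not a negative integer the \<open>E q t n\<close> exist and form an eigenbasis; for \<open>k = -j\<close>
  the monomials \<open>X\<^sup>j\<close> and \<open>X\<^sup>-\<^sup>j\<close> span a Jordan block of \<open>Y\<close> modulo lower terms.  A non-zero proper stable ideal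
  has a non-empty finite set of common zeros.  It is nearly closed under \<open>z \<mapsto> z\<^sup>-\<^sup>1\<close> and closed under
  \<open>z \<mapsto> q\<^sup>1\<^sup>/\<^sup>2 z\<^sup>-\<^sup>1\<close>, so finiteness forces \<open>t\<^sup>2 q\<^sup>s = 1\<close> with an integer \<open>s > 0\<close>; for even \<open>s\<close> a multiplicity argument at
  \<open>z\<^sup>2 = 1\<close> gives a contradiction (\<open>no_common_zero\<close>), and odd \<open>s\<close> is the special parameter.  In an
  irreducible finite dimensional module the intertwiners move an eigenvector of \<open>Y\<close> along an
  infinite chain of eigenvalues, so they must fail somewhere; they fail at a common eigenvector
  of \<open>T\<close> and \<open>Y\<close>, which behaves like \<open>1\<close> in \<open>P\<close> up to signs (\<open>common_eigenvector\<close>, \<open>polynomial_cover\<close>).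
\<close>

section \<open>Linear operators on Laurent polynomials\<close>

abbreviation cf :: "('a \<Rightarrow>\<^sub>0 'b::zero) \<Rightarrow> 'a \<Rightarrow> 'b" where "cf \<equiv> Poly_Mapping.lookup"
abbreviation supp :: "('a \<Rightarrow>\<^sub>0 'b::zero) \<Rightarrow> 'a set" where "supp \<equiv> Poly_Mapping.keys"

text \<open>
  \<open>scal\<close> is not the scaling of a vector space class, so linearity is spelled out.
\<close>

definition lin :: "('k::field lpoly \<Rightarrow> 'k lpoly) \<Rightarrow> bool" where
  "lin A \<longleftrightarrow> (\<forall>f g. A (f + g) = A f + A g) \<and> (\<forall>c f. A (scal c f) = scal c (A f))"

definition linf :: "('k::field lpoly \<Rightarrow> 'k) \<Rightarrow> bool" where
  "linf L \<longleftrightarrow> (\<forall>f g. L (f + g) = L f + L g) \<and> (\<forall>c f. L (scal c f) = c * L f)"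

definition lincomb :: "('i \<Rightarrow> 'k::field lpoly) \<Rightarrow> ('i \<Rightarrow>\<^sub>0 'k) \<Rightarrow> 'k lpoly" where
  "lincomb b c = (\<Sum>i\<in>supp c. scal (cf c i) (b i))"

lemma cf_scal [simp]: "cf (scal c f) j = c * cf f j"
proof -
  have "scal c f = Poly_Mapping.map ((*) c) f"
    by (simp add: scal_def mult_map_scale_conv_mult)
  then show ?thesis by (simp add: Poly_Mapping.map.rep_eq when_def)
qed

lemma scal_add: "scal c (f + g) = scal c f + scal c g"
  and scal_diff: "scal c (f - g) = scal c f - scal c g"
  and scal_minus: "scal c (- f) = - scal c f"
  and scal_zero [simp]: "scal c 0 = 0"
  by (simp_all add: scal_def algebra_simps)

lemma scal_add_left: "scal (a + b) f = scal a f + scal b f"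
  by (rule poly_mapping_eqI) (simp add: lookup_add algebra_simps)

lemma scal_diff_left: "scal (a - b) f = scal a f - scal b f"
  by (rule poly_mapping_eqI) (simp add: lookup_minus algebra_simps)

lemma scal_minus_left: "scal (- a) f = - scal a f"
  by (rule poly_mapping_eqI) simp

lemma scal_scal [simp]: "scal a (scal b f) = scal (a * b) f"
  by (rule poly_mapping_eqI) (simp add: mult.assoc)

lemma scal_one [simp]: "scal 1 f = f"
  and scal_zero_left [simp]: "scal 0 f = 0"
  by (rule poly_mapping_eqI, simp)+

lemma scal_eq_0_iff [simp]: "scal c f = 0 \<longleftrightarrow> c = 0 \<or> f = 0"
  by (auto simp: scal_def) (metis lookup_single_eq lookup_zero)

lemma scal_mult_left: "scal c f * g = scal c (f * g)"
  and scal_mult_right: "f * scal c g = scal c (f * g)"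
  by (simp_all add: scal_def algebra_simps)

lemma scal_sum: "scal c (sum F A) = (\<Sum>i\<in>A. scal c (F i))"
  by (simp add: scal_def sum_distrib_left)

lemma scal_neg_one: "scal (- 1) f = - f"
  by (rule poly_mapping_eqI) simp

lemma single_eq_scal: "Poly_Mapping.single j c = scal c (mon j)"
  by (simp add: scal_def mult_single)

lemma mon_mult [simp]: "mon i * mon j = mon (i + j)"
  by (simp add: mult_single)

lemma mon_mult_assoc [simp]: "mon i * (mon j * f) = mon (i + j) * f"
  by (simp add: mult.assoc [symmetric])

lemma mon_nonzero [simp]: "mon j \<noteq> 0"
  by (metis lookup_single_eq lookup_zero zero_neq_one)

lemma mon_inj [simp]: "(mon i :: 'k::field lpoly) = mon j \<longleftrightarrow> i = j"
  by (metis (no_types) lookup_single_eq lookup_single_not_eq zero_neq_one)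

lemma cf_mon: "cf (mon i) j = (if i = j then 1 else 0)"
  by (simp add: lookup_single when_def)

lemma cf_mon_mult [simp]: "cf (mon i * f) j = cf f (j - i)"
proof -
  have eq: "(j = i + l) = (l = j - i)" for l by auto
  have "cf (mon i * f) j = (\<Sum>k. cf (mon i :: 'a lpoly) k * (\<Sum>l. cf f l when j = k + l))"
    by (rule lookup_mult)
  also have "\<dots> = (\<Sum>k. (\<Sum>l. cf f l when j = k + l) when k = i)"
    by (intro Sum_any.cong) (simp add: lookup_single when_def)
  also have "\<dots> = cf f (j - i)" by (simp add: eq)
  finally show ?thesis .
qed

lemma supp_scal: "supp (scal c f) \<subseteq> supp f"
  by (auto simp: in_keys_iff)

lemma lp_expand: "f = (\<Sum>j\<in>supp f. scal (cf f j) (mon j))"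
proof (rule poly_mapping_eqI)
  fix k
  have "cf (\<Sum>j\<in>supp f. scal (cf f j) (mon j)) k = (\<Sum>j\<in>supp f. if j = k then cf f j else 0)"
    unfolding lookup_sum by (intro sum.cong) (simp_all add: cf_mon)
  also have "\<dots> = cf f k" by (simp add: in_keys_iff)
  finally show "cf f k = cf (\<Sum>j\<in>supp f. scal (cf f j) (mon j)) k" by simp
qed

lemma linI: "(\<And>f g. A (f + g) = A f + A g) \<Longrightarrow> (\<And>c f. A (scal c f) = scal c (A f)) \<Longrightarrow> lin A"
  by (auto simp: lin_def)

lemma lin_add: "lin A \<Longrightarrow> A (f + g) = A f + A g"
  and lin_scal: "lin A \<Longrightarrow> A (scal c f) = scal c (A f)"
  by (auto simp: lin_def)

lemma lin_0: "lin A \<Longrightarrow> A 0 = 0"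
  by (metis lin_scal scal_zero_left)

lemma lin_minus: "lin A \<Longrightarrow> A (- f) = - A f"
  by (metis lin_scal scal_neg_one)

lemma lin_diff: "lin A \<Longrightarrow> A (f - g) = A f - A g"
  by (metis (no_types, opaque_lifting) lin_add lin_minus uminus_add_conv_diff add.commute)

lemma lin_sum: "lin A \<Longrightarrow> A (sum F I) = (\<Sum>i\<in>I. A (F i))"
  by (induction I rule: infinite_finite_induct) (auto simp: lin_0 lin_add)

lemmas lin_simps = lin_add lin_scal lin_0 lin_minus lin_diff lin_sum

lemma lin_compose: "lin A \<Longrightarrow> lin B \<Longrightarrow> lin (\<lambda>f. A (B f))"
  by (simp add: lin_def)

lemma lin_plus: "lin A \<Longrightarrow> lin B \<Longrightarrow> lin (\<lambda>f. A f + B f)"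
  by (simp add: lin_def scal_add)

lemma lin_sub: "lin A \<Longrightarrow> lin B \<Longrightarrow> lin (\<lambda>f. A f - B f)"
  by (simp add: lin_def scal_diff)

lemma lin_scale: "lin A \<Longrightarrow> lin (\<lambda>f. scal c (A f))"
  by (simp add: lin_def scal_add mult.commute)

lemma lin_id: "lin (\<lambda>f. f)"
  by (simp add: lin_def)

lemma lin_mult: "lin (\<lambda>f. h * f)"
  by (simp add: lin_def distrib_left scal_mult_right)

lemma lin_funpow: "lin A \<Longrightarrow> lin (A ^^ i)"
  by (induction i) (auto simp: lin_def)

lemma lin_eqI:
  assumes "lin A" "lin B" "\<And>j. A (mon j) = B (mon j)"
  shows "A f = B f"
proof -
  have "A (\<Sum>j\<in>supp f. scal (cf f j) (mon j)) = B (\<Sum>j\<in>supp f. scal (cf f j) (mon j))"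
    using assms by (simp add: lin_simps)
  then show ?thesis using lp_expand[of f] by simp
qed

lemma linf_add: "linf L \<Longrightarrow> L (f + g) = L f + L g"
  and linf_scal: "linf L \<Longrightarrow> L (scal c f) = c * L f"
  by (auto simp: linf_def)

lemma linf_0: "linf L \<Longrightarrow> L 0 = 0"
  by (metis linf_scal scal_zero_left mult_zero_left)

lemma linf_minus: "linf L \<Longrightarrow> L (- f) = - L f"
  by (metis linf_scal scal_neg_one mult_minus1)

lemma linf_diff: "linf L \<Longrightarrow> L (f - g) = L f - L g"
  by (metis (no_types, opaque_lifting) linf_add linf_minus uminus_add_conv_diff add.commute)

lemma linf_sum: "linf L \<Longrightarrow> L (sum F I) = (\<Sum>i\<in>I. L (F i))"
  by (induction I rule: infinite_finite_induct) (auto simp: linf_0 linf_add)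

lemmas linf_simps = linf_add linf_scal linf_0 linf_minus linf_diff linf_sum

lemma linf_compose: "linf L \<Longrightarrow> lin B \<Longrightarrow> linf (\<lambda>f. L (B f))"
  by (simp add: lin_def linf_def)

lemma linf_eqI:
  assumes "linf A" "linf B" "\<And>j. A (mon j) = B (mon j)"
  shows "A f = B f"
proof -
  have "A (\<Sum>j\<in>supp f. scal (cf f j) (mon j)) = B (\<Sum>j\<in>supp f. scal (cf f j) (mon j))"
    using assms by (simp add: linf_simps)
  then show ?thesis using lp_expand[of f] by simp
qed

lemma lincomb_superset:
  assumes "finite A" "supp c \<subseteq> A"
  shows "lincomb b c = (\<Sum>i\<in>A. scal (cf c i) (b i))"
  unfolding lincomb_def using assms
  by (intro sum.mono_neutral_left) (auto simp: in_keys_iff)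

lemma lincomb_add: "lincomb b (c + d) = lincomb b c + lincomb b d"
proof -
  let ?A = "supp c \<union> supp d"
  have "lincomb b (c + d) = (\<Sum>i\<in>?A. scal (cf (c + d) i) (b i))"
    by (rule lincomb_superset) (auto dest: subsetD[OF keys_add])
  also have "\<dots> = (\<Sum>i\<in>?A. scal (cf c i) (b i)) + (\<Sum>i\<in>?A. scal (cf d i) (b i))"
    by (simp add: lookup_add scal_add_left sum.distrib)
  also have "\<dots> = lincomb b c + lincomb b d"
    by (subst (1 2) lincomb_superset[of ?A]) auto
  finally show ?thesis .
qed

lemma lincomb_uminus: "lincomb b (- c) = - lincomb b c"
  unfolding lincomb_def by (simp add: scal_minus_left sum_negf in_keys_iff keys_def)

lemma lincomb_diff: "lincomb b (c - d) = lincomb b c - lincomb b d"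
  using lincomb_add[of b c "- d"] lincomb_uminus[of b d] by simp

lemma lincomb_zero [simp]: "lincomb b 0 = 0"
  by (simp add: lincomb_def)

lemma lincomb_single [simp]: "lincomb b (Poly_Mapping.single i a) = scal a (b i)"
  by (cases "a = 0") (auto simp: lincomb_def)

lemma ev_superset:
  assumes "finite A" "supp f \<subseteq> A"
  shows "ev a f = (\<Sum>j\<in>A. cf f j * a powi j)"
  unfolding ev_def using assms by (intro sum.mono_neutral_left) (auto simp: in_keys_iff)

lemma linf_ev: "linf (ev a)"
proof -
  have "ev a (f + g) = ev a f + ev a g" for f g
  proof -
    let ?A = "supp f \<union> supp g"
    have "ev a (f + g) = (\<Sum>i\<in>?A. cf (f + g) i * a powi i)"
      by (rule ev_superset) (auto dest: subsetD[OF keys_add])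
    also have "\<dots> = (\<Sum>i\<in>?A. cf f i * a powi i) + (\<Sum>i\<in>?A. cf g i * a powi i)"
      by (simp add: lookup_add sum.distrib algebra_simps)
    also have "\<dots> = ev a f + ev a g" by (subst (1 2) ev_superset[of ?A]) auto
    finally show ?thesis .
  qed
  moreover have "ev a (scal c f) = c * ev a f" for c f
    by (subst ev_superset[of "supp f"]) (auto simp: supp_scal ev_def sum_distrib_left mult.assoc)
  ultimately show ?thesis by (simp add: linf_def)
qed

lemmas ev_simps = linf_simps[OF linf_ev]

lemma ev_mon [simp]: "ev a (mon j) = a powi j"
  by (simp add: ev_def)

lemma ev_1 [simp]: "ev a 1 = 1"
  using ev_mon[of a 0] by simp

lemma ev_mult: "a \<noteq> 0 \<Longrightarrow> ev a (f * g) = ev a f * ev a g"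
proof -
  assume a: "a \<noteq> 0"
  have *: "ev a (mon i * g) = a powi i * ev a g" for i
    by (rule linf_eqI[where A = "\<lambda>g. ev a (mon i * g)" and f = g])
       (auto simp: linf_def distrib_left scal_mult_right ev_simps power_int_add a mult.left_commute)
  show ?thesis
    by (rule linf_eqI[where f = f])
       (auto simp: linf_def distrib_right scal_mult_left ev_simps * mult.assoc)
qed

lemma ev_single: "ev a (Poly_Mapping.single j c) = c * a powi j"
  unfolding single_eq_scal[of j c] by (simp add: ev_simps)

lemma ev_prod: "a \<noteq> 0 \<Longrightarrow> ev a (prod F A) = (\<Prod>i\<in>A. ev a (F i))"
  by (induction A rule: infinite_finite_induct) (auto simp: ev_mult)

text \<open>
  \<open>s\<close> is the case \<open>\<chi> j = 1\<close> and \<open>\<pi>\<close> the case \<open>\<chi> j = q\<^sup>j\<^sup>/\<^sup>2\<close>. Over the rational functions of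
  \<open>q\<close>, which have no square root of \<open>q\<close>, the exponent \<open>j/2\<close> is rounded down; only \<open>\<chi> (j + 2)
  = q \<chi> j\<close> matters, since all operators preserve the parity of exponents.
\<close>

definition flipx :: "(int \<Rightarrow> 'k::field) \<Rightarrow> 'k lpoly \<Rightarrow> 'k lpoly" where
  "flipx \<chi> f = (\<Sum>j\<in>supp f. Poly_Mapping.single (- j) (cf f j * \<chi> j))"

lemma cf_flipx [simp]: "cf (flipx \<chi> f) j = cf f (- j) * \<chi> (- j)"
proof -
  have "cf (flipx \<chi> f) j = (\<Sum>i\<in>supp f. if i = - j then cf f i * \<chi> i else 0)"
    unfolding flipx_def lookup_sum by (intro sum.cong) (auto simp: lookup_single when_def)
  then show ?thesis by (simp add: in_keys_iff)
qed

lemma lin_flipx: "lin (flipx \<chi>)"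
  by (rule linI; rule poly_mapping_eqI) (simp_all add: lookup_add algebra_simps)

lemma flipx_mon [simp]: "flipx \<chi> (mon j) = scal (\<chi> j) (mon (- j))"
  by (rule poly_mapping_eqI) (auto simp: cf_mon)

lemma cf_s_op [simp]: "cf (s_op f) j = cf f (- j)"
  by (simp add: s_op_def map_key.rep_eq)

lemma lin_s_op: "lin s_op"
  by (rule linI; rule poly_mapping_eqI) (simp_all add: lookup_add)

lemma s_op_mon [simp]: "s_op (mon j) = mon (- j)"
  by (rule poly_mapping_eqI) (auto simp: cf_mon)

lemma pi_op_flipx: "pi_op qh = flipx (\<lambda>j. qh powi j)"
  by (simp add: pi_op_def flipx_def fun_eq_iff)

lemma cf_flip_X [simp]: "cf (flip_X f) j = (- 1) powi j * cf f j"
proof -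
  have "cf (flip_X f) j = (\<Sum>i\<in>supp f. if i = j then cf f i * (- 1) powi i else 0)"
    unfolding flip_X_def lookup_sum by (intro sum.cong) (auto simp: lookup_single when_def)
  then show ?thesis by (simp add: in_keys_iff)
qed

lemma lin_flip_X: "lin flip_X"
  by (rule linI; rule poly_mapping_eqI) (simp_all add: lookup_add algebra_simps)

lemma flip_X_mon [simp]: "flip_X (mon j) = scal ((- 1) powi j) (mon j)"
  by (rule poly_mapping_eqI) (auto simp: cf_mon)

text \<open>
  A linear map is multiplicative as soon as it is so on monomials.
\<close>

lemma lin_mult_eqI:
  assumes A: "lin A" and m: "\<And>i j. A (mon i * mon j) = A (mon i) * A (mon j)"
  shows "A (f * g) = A f * A g"
proof -
  have *: "A (mon i * g) = A (mon i) * A g" for i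
    by (rule lin_eqI[where A = "\<lambda>g. A (mon i * g)" and f = g])
       (use A m in \<open>auto simp: lin_def distrib_left scal_mult_right\<close>)
  show ?thesis
    by (rule lin_eqI[where f = f])
       (use A * in \<open>auto simp: lin_def distrib_right scal_mult_left\<close>)
qed

lemma s_op_mult: "s_op (f * g) = s_op f * s_op g"
  by (rule lin_mult_eqI[OF lin_s_op]) simp

lemma flip_X_mult: "flip_X (f * g) = flip_X f * flip_X g"
  by (rule lin_mult_eqI[OF lin_flip_X]) (simp add: scal_mult_left scal_mult_right power_int_add mult.commute)

lemma flip_X_flip_X [simp]: "flip_X (flip_X f) = f"
  by (rule poly_mapping_eqI) (simp add: mult.assoc[symmetric] power_int_mult_distrib[symmetric])

lemma s_op_s_op [simp]: "s_op (s_op f) = f"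
  by (rule poly_mapping_eqI) simp

lemma s_op_1 [simp]: "s_op 1 = 1"
  using s_op_mon[of 0] by simp

lemma ev_s_op: "ev a (s_op f) = ev (inverse a) f"
  by (rule linf_eqI[where f = f])
     (auto intro: linf_compose[OF linf_ev lin_s_op] linf_ev simp: power_int_minus power_int_inverse)

lemma ev_pi_op: "ev a (pi_op qh f) = ev (qh / a) f"
  unfolding pi_op_flipx
  by (rule linf_eqI[where f = f])
     (auto intro: linf_compose[OF linf_ev lin_flipx] linf_ev
       simp: ev_simps power_int_minus power_int_mult_distrib power_int_inverse divide_inverse)

lemma ev_flip_X: "ev a (flip_X f) = ev (- a) f"
  by (rule linf_eqI[where f = f])
     (auto intro: linf_compose[OF linf_ev lin_flip_X] linf_ev
       simp: ev_simps power_int_mult_distrib[symmetric])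

section \<open>The Demazure-Lusztig operator\<close>

text \<open>
  The value of \<open>(s - 1)/(X\<^sup>2 - 1)\<close> at \<open>X\<^sup>j\<close>.
\<close>

definition dmon :: "int \<Rightarrow> 'k::field lpoly" where
  "dmon j = (if j \<le> 0 then \<Sum>i<nat (- j). mon (j + 2 * int i) else - (\<Sum>i<nat j. mon (- j + 2 * int i)))"

lemma telescope_mon: "(mon 2 - 1) * (\<Sum>i<m. mon (a + 2 * int i)) = mon (a + 2 * int m) - (mon a :: 'k::field lpoly)"
  by (induction m) (auto simp: algebra_simps)

lemma dmon: "(mon 2 - 1) * dmon j = mon (- j) - (mon j :: 'k::field lpoly)"
proof (cases "j \<le> 0")
  case True
  then show ?thesis
    using telescope_mon[of j "nat (- j)"] by (simp add: dmon_def)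
next
  case False
  then show ?thesis
    using telescope_mon[of "- j" "nat j", THEN arg_cong[where f = uminus]] by (simp add: dmon_def)
qed

lemma X2_nonzero [simp]: "mon 2 - 1 \<noteq> (0 :: 'k::field lpoly)"
proof
  assume "mon 2 - 1 = (0 :: 'k lpoly)"
  then have "cf (mon 2 - mon 0 :: 'k lpoly) 2 = cf 0 2" by simp
  then show False by (simp add: lookup_minus cf_mon lookup_one)
qed

lemma X2_cancel: "(mon 2 - 1) * f = (mon 2 - 1) * (g :: 'k::field lpoly) \<Longrightarrow> f = g"
  by (metis mult_left_cancel X2_nonzero)

definition Dop :: "'k::field lpoly \<Rightarrow> 'k lpoly" where
  "Dop f = (THE g. (mon 2 - 1) * g = s_op f - f)"

lemma Dop: "(mon 2 - 1) * Dop f = s_op f - f"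
  and Dop_eqI: "(mon 2 - 1) * g = s_op f - f \<Longrightarrow> Dop f = g"
proof -
  have "(mon 2 - 1) * (\<Sum>j\<in>supp f. scal (cf f j) (dmon j)) = (\<Sum>j\<in>supp f. scal (cf f j) (s_op (mon j) - mon j))"
    by (simp add: sum_distrib_left scal_mult_right dmon)
  also have "\<dots> = s_op (\<Sum>j\<in>supp f. scal (cf f j) (mon j)) - (\<Sum>j\<in>supp f. scal (cf f j) (mon j))"
    by (simp add: lin_simps[OF lin_s_op] sum_subtractf scal_diff)
  also have "\<dots> = s_op f - f" using lp_expand[of f] by simp
  finally have ex: "\<exists>g. (mon 2 - 1) * g = s_op f - f" by blast
  have ex1: "\<exists>!g. (mon 2 - 1) * g = s_op f - f"
    using ex by (metis X2_cancel)
  show "(mon 2 - 1) * Dop f = s_op f - f"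
    unfolding Dop_def by (rule theI'[OF ex1])
  then show "(mon 2 - 1) * g = s_op f - f \<Longrightarrow> Dop f = g"
    using X2_cancel by metis
qed

lemma Dop_mon: "Dop (mon j) = dmon j"
  by (rule Dop_eqI) (simp add: dmon)

lemma lin_Dop: "lin Dop"
  by (rule linI; rule Dop_eqI)
     (simp_all add: distrib_left scal_mult_right Dop lin_simps[OF lin_s_op] scal_diff)

text \<open>
  \<open>t\<^sup>1\<^sup>/\<^sup>2 T\<close>. Unlike \<open>T\<close> it involves only \<open>t\<close>, so it makes sense over the rational
  functions of \<open>q\<close> and \<open>t\<close>.
\<close>

definition Th :: "'k::field \<Rightarrow> 'k lpoly \<Rightarrow> 'k lpoly" where
  "Th t f = scal t (s_op f) + scal (t - 1) (Dop f)"

lemma lin_Th: "lin (Th t)"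
  unfolding Th_def by (intro lin_plus lin_scale lin_s_op lin_Dop)

lemma T_op_Th: "th \<noteq> 0 \<Longrightarrow> T_op th f = scal (inverse th) (Th (th\<^sup>2) f)"
  by (simp add: T_op_def Th_def Dop_def scal_add power2_eq_square field_simps)

lemma Th: "(mon 2 - 1) * Th t f = (scal t (mon 2) - 1) * s_op f - scal (t - 1) f"
proof -
  have "(mon 2 - 1) * Th t f = scal t (mon 2 * s_op f - s_op f) + scal (t - 1) ((mon 2 - 1) * Dop f)"
    by (simp add: Th_def distrib_left scal_mult_right left_diff_distrib)
  also have "\<dots> = (scal t (mon 2) - 1) * s_op f - scal (t - 1) f"
    unfolding Dop by (simp add: left_diff_distrib scal_mult_left scal_diff scal_diff_left)
  finally show ?thesis .
qed

lemma Th_eqI: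
  assumes "(mon 2 - 1) * g = (scal t (mon 2) - 1) * s_op f - scal (t - 1) f"
  shows "Th t f = g"
  using X2_cancel[of "Th t f" g] assms Th[of t f] by simp

lemma Th_X: "Th t (mon 1 * f) = mon (- 1) * Th t f - scal (t - 1) (mon (- 1) * f)"
proof (rule Th_eqI)
  have "(mon 2 - 1) * (mon (- 1) * Th t f - scal (t - 1) (mon (- 1) * f))
      = mon (- 1) * ((mon 2 - 1) * Th t f) - scal (t - 1) ((mon 2 - 1) * (mon (- 1) * f))"
    by (simp add: algebra_simps scal_mult_right scal_diff)
  also have "\<dots> = (scal t (mon 2) - 1) * s_op (mon 1 * f) - scal (t - 1) (mon 1 * f)"
    unfolding Th s_op_mult s_op_mon
    by (simp add: algebra_simps scal_mult_left scal_mult_right scal_diff scal_diff_left)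
  finally show "(mon 2 - 1) * (mon (- 1) * Th t f - scal (t - 1) (mon (- 1) * f))
      = (scal t (mon 2) - 1) * s_op (mon 1 * f) - scal (t - 1) (mon 1 * f)" .
qed

lemma Th_Xinv: "Th t (mon (- 1) * f) = mon 1 * Th t f + scal (t - 1) (mon (- 1) * f)"
proof -
  have "Th t f = Th t (mon 1 * (mon (- 1) * f))" by simp
  also have "\<dots> = mon (- 1) * Th t (mon (- 1) * f) - scal (t - 1) (mon (- 2) * f)"
    unfolding Th_X by simp
  finally have "mon 1 * Th t f = mon 1 * (mon (- 1) * Th t (mon (- 1) * f) - scal (t - 1) (mon (- 2) * f))"
    by simp
  then show ?thesis by (simp add: right_diff_distrib scal_mult_right)
qed

text \<open>
  The quadratic relation for \<open>Th\<close> with denominators cleared: \<open>x\<close>, \<open>y\<close> stand for \<open>X\<^sup>2\<close>,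
  \<open>X\<^sup>-\<^sup>2\<close>, further \<open>s\<close> for \<open>s f\<close>, \<open>h\<close> for \<open>Th f\<close>, \<open>sh\<close> for \<open>s (Th f)\<close> and \<open>hh\<close> for \<open>Th (Th
  f)\<close>.
\<close>

lemma hecke_cancel:
  fixes x :: "'a::comm_ring_1"
  assumes T: "(x - 1) * h = (c * x - 1) * s - (c - 1) * f"
    and TT: "(x - 1) * hh = (c * x - 1) * sh - (c - 1) * h"
    and sT: "(y - 1) * sh = (c * y - 1) * f - (c - 1) * s" and xy: "x * y = 1"
  shows "(x - 1) * ((x - 1) * hh) = (x - 1) * ((x - 1) * ((c - 1) * h + c * f))"
proof -
  have "x * ((y - 1) * sh) = x * ((c * y - 1) * f - (c - 1) * s)"
    by (simp only: sT)
  also have "\<dots> = c * (x * y) * f - x * f - (c - 1) * (x * s)"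
    by (simp add: algebra_simps)
  also have "x * ((y - 1) * sh) = (x * y) * sh - x * sh"
    by (simp add: algebra_simps)
  finally have "(1 - x) * sh = (c - x) * f - (c - 1) * (x * s)"
    unfolding xy by (simp add: algebra_simps)
  then have sh: "(1 - x) * sh = (c - x) * f - (c - 1) * (x * s)" .
  have "(x - 1) * ((x - 1) * hh) = - (c * x - 1) * ((1 - x) * sh) - (c - 1) * ((x - 1) * h)"
    unfolding TT by (simp add: algebra_simps)
  also have "\<dots> = (x - 1) * ((c - 1) * ((x - 1) * h) + (x - 1) * (c * f))"
    unfolding sh T by (simp add: algebra_simps)
  finally show ?thesis by (simp add: algebra_simps)
qed

lemma Th_Th: "Th t (Th t f) = scal (t - 1) (Th t f) + scal t f"
proof -
  define x :: "'a lpoly" where "x = mon 2"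
  define y :: "'a lpoly" where "y = mon (- 2)"
  define c :: "'a lpoly" where "c = Poly_Mapping.single 0 t"
  have xy: "x * y = 1" by (simp add: x_def y_def)
  have sx: "s_op x = y" "s_op y = x" and sc: "s_op c = c"
    by (simp_all add: x_def y_def c_def single_eq_scal[of 0 t] lin_simps[OF lin_s_op])
  have c1: "scal (t - 1) h = (c - 1) * h" and c2: "scal t h = c * h" for h
    by (simp_all add: scal_def c_def single_diff)
  have T: "(x - 1) * Th t f = (c * x - 1) * s_op f - (c - 1) * f"
    using Th[of t f] by (simp add: x_def c1 c2)
  have TT: "(x - 1) * Th t (Th t f) = (c * x - 1) * s_op (Th t f) - (c - 1) * Th t f"
    using Th[of t "Th t f"] by (simp add: x_def c1 c2)
  have "s_op ((x - 1) * Th t f) = s_op ((c * x - 1) * s_op f - (c - 1) * f)" by (simp only: T)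
  then have sT: "(y - 1) * s_op (Th t f) = (c * y - 1) * f - (c - 1) * s_op f"
    by (simp add: s_op_mult lin_simps[OF lin_s_op] sx sc)
  have "(x - 1) * ((x - 1) * Th t (Th t f)) = (x - 1) * ((x - 1) * ((c - 1) * Th t f + c * f))"
    using T TT sT xy by (rule hecke_cancel)
  then have "Th t (Th t f) = (c - 1) * Th t f + c * f"
    using X2_nonzero[where ?'k = 'a] by (simp add: x_def)
  then show ?thesis by (simp add: c1 c2)
qed

lemma Th_1 [simp]: "Th t 1 = scal t 1"
  by (rule Th_eqI) (simp add: algebra_simps scal_mult_left scal_mult_right scal_diff_left)

lemma Th_flip_X: "Th t (flip_X f) = flip_X (Th t f)"
proof (rule Th_eqI)
  have [simp]: "flip_X (1 :: 'a lpoly) = 1" using flip_X_mon[of 0] by simp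
  have [simp]: "(- 1) powi 2 = (1::'a)" using power_int_of_nat[of "-1::'a" 2] by simp
  have s: "s_op (flip_X f) = flip_X (s_op f)"
    by (rule poly_mapping_eqI) (simp add: power_int_minus_one_minus)
  have "(mon 2 - 1) * flip_X (Th t f) = flip_X ((mon 2 - 1) * Th t f)"
    by (simp add: flip_X_mult lin_simps[OF lin_flip_X])
  also have "\<dots> = (scal t (mon 2) - 1) * s_op (flip_X f) - scal (t - 1) (flip_X f)"
    unfolding Th by (simp add: flip_X_mult lin_simps[OF lin_flip_X] s)
  finally show "(mon 2 - 1) * flip_X (Th t f) = (scal t (mon 2) - 1) * s_op (flip_X f) - scal (t - 1) (flip_X f)" .
qed

text \<open>
  When \<open>t a\<^sup>2 = 1\<close> the value of \<open>f\<close> at \<open>1/a\<close> drops out. This is what keeps certain sets of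
  common zeros stable under \<open>T\<close> although they are not closed under inversion.
\<close>

lemma ev_Th: "a \<noteq> 0 \<Longrightarrow> (a\<^sup>2 - 1) * ev a (Th t f) = (t * a\<^sup>2 - 1) * ev (inverse a) f - (t - 1) * ev a f"
proof -
  assume a: "a \<noteq> 0"
  have p: "a powi 2 = a\<^sup>2" using power_int_of_nat[of a 2] by simp
  have "ev a ((mon 2 - 1) * Th t f) = ev a ((scal t (mon 2) - 1) * s_op f - scal (t - 1) f)"
    by (simp only: Th)
  then show ?thesis using a p by (simp add: ev_mult ev_simps ev_s_op)
qed

section \<open>Nonsymmetric polynomials\<close>

text \<open>
  The place of \<open>n\<close> in the enumeration \<open>0, 1, -1, 2, -2, \<dots>\<close> of the exponents in the order
  \<open>\<prec>\<close>.
\<close>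

definition rk :: "int \<Rightarrow> nat" where
  "rk n = (if n \<le> 0 then nat (- 2 * n) else nat (2 * n - 1))"

lemma prec_rk: "prec m n \<longleftrightarrow> rk m < rk n"
  by (auto simp: prec_def rk_def)

lemma rk_inj [simp]: "rk m = rk n \<longleftrightarrow> m = n"
  by (auto simp: rk_def eq_nat_nat_iff split: if_splits) presburger+

lemma rk_le: "rk m \<le> rk n \<longleftrightarrow> m = n \<or> prec m n"
  by (metis le_eq_less_or_eq prec_rk rk_inj)

text \<open>
  \<open>flipx \<chi>\<close> squares to a scalar only on Laurent polynomials all of whose exponents have the
  same parity; both \<open>T\<close> and \<open>\<pi>\<close> preserve this property.
\<close>

definition par :: "int \<Rightarrow> 'k::field lpoly \<Rightarrow> bool" where
  "par n f \<longleftrightarrow> (\<forall>j\<in>supp f. even (j - n))"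

lemma cf_dmon_aux: "(\<Sum>i<n. if a + 2 * int i = k then 1 else 0) =
    (if a \<le> k \<and> k < a + 2 * int n \<and> even (k - a) then (1::'k::field) else 0)"
proof (induction n)
  case (Suc n)
  consider "k = a + 2 * int n" | "k = a + 2 * int n + 1" | "k \<noteq> a + 2 * int n" "k \<noteq> a + 2 * int n + 1" by blast
  then show ?case using Suc by cases auto
qed auto

lemma cf_dmon: "cf (dmon j :: 'k::field lpoly) k =
   (if j \<le> 0 then if j \<le> k \<and> k < - j \<and> even (k - j) then 1 else 0
    else if - j \<le> k \<and> k < j \<and> even (k - j) then - 1 else 0)"
proof (cases "j \<le> 0")
  case True
  then have "cf (dmon j :: 'k lpoly) k = (\<Sum>i<nat (- j). if j + 2 * int i = k then 1 else 0)"
    by (simp add: dmon_def lookup_sum cf_mon)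
  with True show ?thesis by (subst (asm) cf_dmon_aux) auto
next
  case False
  then have "cf (dmon j :: 'k lpoly) k = - (\<Sum>i<nat j. if - j + 2 * int i = k then 1 else 0)"
    by (simp add: dmon_def lookup_sum cf_mon)
  with False show ?thesis by (subst (asm) cf_dmon_aux) auto
qed

lemma cf_Th_mon: "cf (Th t (mon j)) k = (if k = - j then t else 0) + (t - 1) * cf (dmon j) k"
  by (simp add: Th_def lookup_add cf_mon Dop_mon eq_commute)

lemma cf_Th_mon_lead: "cf (Th t (mon j)) (- j) = (if j \<le> 0 then t else 1)"
  by (auto simp: cf_Th_mon cf_dmon)

lemma supp_Th_mon:
  assumes "k \<in> supp (Th t (mon j))" "k \<noteq> - j"
  shows "prec (- k) j" "even (k - j)" "\<bar>k\<bar> \<le> \<bar>j\<bar>" "j > 0 \<Longrightarrow> \<bar>k\<bar> < j"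
  using assms by (auto simp: in_keys_iff cf_Th_mon cf_dmon prec_def split: if_splits)

lemma cf_Th_expand: "cf (Th t f) k = (\<Sum>j\<in>supp f. cf f j * cf (Th t (mon j)) k)"
proof -
  have "Th t f = Th t (\<Sum>j\<in>supp f. scal (cf f j) (mon j))" using lp_expand[of f] by simp
  then show ?thesis by (simp add: lin_simps[OF lin_Th] lookup_sum)
qed

lemma supp_Th:
  assumes "k \<in> supp (Th t f)"
  obtains j where "j \<in> supp f" "\<bar>k\<bar> \<le> \<bar>j\<bar>" "even (k - j)"
proof -
  have "\<exists>j\<in>supp f. k \<in> supp (Th t (mon j))"
  proof (rule ccontr)
    assume "\<not> ?thesis"
    then have "cf (Th t f) k = 0" by (subst cf_Th_expand) (auto simp: in_keys_iff intro!: sum.neutral)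
    with assms show False by (simp add: in_keys_iff)
  qed
  then obtain j where j: "j \<in> supp f" "k \<in> supp (Th t (mon j))" by blast
  show ?thesis
  proof (cases "k = - j")
    case True with j show ?thesis by (intro that[of j]) auto
  next
    case False with j supp_Th_mon[of k t j] show ?thesis by (intro that[of j]) auto
  qed
qed

lemma par_Th: "par n f \<Longrightarrow> par n (Th t f)"
  unfolding par_def
proof
  fix k assume *: "\<forall>j\<in>supp f. even (j - n)" and "k \<in> supp (Th t f)"
  then obtain j where "j \<in> supp f" "even (k - j)" using supp_Th by blast
  with * show "even (k - n)" by (auto simp: even_diff_iff)
qed

lemma par_scal: "par n f \<Longrightarrow> par n (scal c f)"
  using supp_scal unfolding par_def by blast

lemma supp_plus: "k \<in> supp (f + g) \<Longrightarrow> k \<in> supp f \<or> k \<in> supp g"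
  by (auto simp: in_keys_iff lookup_add)

lemma par_add: "par n f \<Longrightarrow> par n g \<Longrightarrow> par n (f + g)"
  unfolding par_def by (auto dest!: supp_plus)

lemma par_flip_X:
  assumes "par n f" shows "flip_X f = scal ((- 1) powi n) f"
proof (rule poly_mapping_eqI)
  fix j
  have "(- 1) powi j = ((- 1) powi n :: 'a)" if "cf f j \<noteq> 0"
    using that assms by (auto simp: par_def in_keys_iff power_int_minus_left)
  then show "cf (flip_X f) j = cf (scal ((- 1) powi n) f) j"
    by (cases "cf f j = 0") auto
qed

text \<open>
  On exponents of the parity of \<open>m\<close> this is the intertwiner \<open>X \<pi>\<close>, scaled such that only
  integral powers of \<open>q\<close> occur and \<open>X\<^sup>-\<^sup>m\<close> goes to \<open>X\<^sup>m\<^sup>+\<^sup>1\<close>.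
\<close>

definition up :: "'k::field \<Rightarrow> nat \<Rightarrow> 'k lpoly \<Rightarrow> 'k lpoly" where
  "up q m g = mon 1 * flipx (\<lambda>j. q powi ((j + int m) div 2)) g"

lemma cf_up: "cf (up q m g) j = cf g (1 - j) * q powi ((1 - j + int m) div 2)"
  by (simp add: up_def)

text \<open>
  The constant that turns \<open>Th + const\<close> into an intertwiner between the eigenvalues of \<open>Y\<close> at
  \<open>m\<close> and \<open>-m\<close>.
\<close>

definition alph :: "'k::field \<Rightarrow> 'k \<Rightarrow> nat \<Rightarrow> 'k" where
  "alph q t m = (t - 1) / (q ^ m * t - 1)"

text \<open>
  The chain \<open>e\<^sub>0 \<rightarrow> e\<^sub>1 \<rightarrow> e\<^bsub>-1\<^esub> \<rightarrow> e\<^sub>2 \<rightarrow> \<dots>\<close> of intertwiners, alternately \<open>X \<pi>\<close> and \<open>Th +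
  const\<close>.
\<close>

primrec Eneg :: "'k::field \<Rightarrow> 'k \<Rightarrow> nat \<Rightarrow> 'k lpoly" where
  "Eneg q t 0 = 1"
| "Eneg q t (Suc m) = Th t (up q m (Eneg q t m)) + scal (alph q t (Suc m)) (up q m (Eneg q t m))"

definition E :: "'k::field \<Rightarrow> 'k \<Rightarrow> int \<Rightarrow> 'k lpoly" where
  "E q t n = (if n \<le> 0 then Eneg q t (nat (- n)) else up q (nat (n - 1)) (Eneg q t (nat (n - 1))))"

lemma E_0 [simp]: "E q t 0 = 1"
  by (simp add: E_def)

lemma E_pos: "E q t (int m + 1) = up q m (E q t (- int m))"
  by (simp add: E_def)

lemma E_neg: "E q t (- int m - 1) =
    Th t (E q t (int m + 1)) + scal (alph q t (Suc m)) (E q t (int m + 1))"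
proof -
  have "nat (1 + int m) = Suc m" by simp
  then show ?thesis by (simp add: E_def)
qed

lemma E_neg': "m > 0 \<Longrightarrow> E q t (- int m) = Th t (E q t (int m)) + scal (alph q t m) (E q t (int m))"
proof -
  assume "m > 0"
  then obtain k where k: "m = Suc k" by (cases m) auto
  have "- int m = - int k - 1" "int m = int k + 1" using k by simp_all
  then show ?thesis using E_neg[of q t k] k by (simp only:)
qed

definition tri :: "int \<Rightarrow> 'k::field lpoly \<Rightarrow> bool" where
  "tri n f \<longleftrightarrow> cf f n = 1 \<and> (\<forall>j\<in>supp f. rk j \<le> rk n \<and> even (j - n))"

lemma tri_par: "tri n f \<Longrightarrow> par n f"
  by (auto simp: tri_def par_def)

lemma tri_up: "tri (- int m) f \<Longrightarrow> tri (int m + 1) (up q m f)"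
  unfolding tri_def
proof safe
  fix j assume *: "cf f (- int m) = 1" "\<forall>j\<in>supp f. rk j \<le> rk (- int m) \<and> even (j - - int m)"
    and "j \<in> supp (up q m f)"
  then have "1 - j \<in> supp f" by (auto simp: in_keys_iff cf_up)
  with * have "rk (1 - j) \<le> rk (- int m)" "even (1 - j + int m)" by auto
  then show "rk j \<le> rk (int m + 1)" "even (j - (int m + 1))"
    by (auto simp: rk_def split: if_splits)
qed (auto simp: cf_up)

text \<open>
  \<open>Th\<close> turns \<open>X\<^sup>n\<close> into \<open>X\<^sup>-\<^sup>n\<close> plus terms of smaller absolute degree, and does not raise
  absolute degrees.
\<close>

lemma
  assumes f: "tri n f" and n: "n > 0"
  shows tri_down: "tri (- n) (Th t f + scal c f)"
    and cf_down: "cf (Th t f + scal c f) n = c"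
proof -
  define r where "r = f - mon n"
  have r: "\<bar>j\<bar> < n" "even (j - n)" if "j \<in> supp r" for j
  proof -
    have jn: "j \<noteq> n" 
    proof
      assume "j = n"
      then have "cf r j = 0" using f by (simp add: r_def lookup_minus tri_def)
      with that show False by (simp add: in_keys_iff)
    qed
    then have "cf f j \<noteq> 0" using that by (simp add: r_def in_keys_iff lookup_minus cf_mon)
    then have "j \<in> supp f" by (simp add: in_keys_iff)
    then have "rk j \<le> rk n" "even (j - n)" "j \<noteq> n" using f jn unfolding tri_def by blast+
    then show "\<bar>j\<bar> < n" "even (j - n)" using n by (auto simp: rk_def split: if_splits)
  qed
  have f': "f = mon n + r" by (simp add: r_def)
  have Tr: "\<bar>j\<bar> < n" "even (j - n)" if jT: "j \<in> supp (Th t r)" for j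
  proof -
    obtain i where i: "i \<in> supp r" "\<bar>j\<bar> \<le> \<bar>i\<bar>" "even (j - i)" by (rule supp_Th[OF jT])
    with r[OF i(1)] show "\<bar>j\<bar> < n" "even (j - n)" by simp_all
  qed
  have cr: "cf r j = 0" "cf (Th t r) j = 0" if "\<bar>j\<bar> \<ge> n" for j
    using r[of j] Tr[of j] that by (auto simp: in_keys_iff)
  have eq: "Th t f + scal c f = Th t (mon n) + Th t r + scal c (mon n) + scal c r"
    by (simp add: f' lin_simps[OF lin_Th] scal_add)
  have L: "cf (Th t (mon n)) (- n) = 1" "cf (Th t (mon n)) n = 0"
    using n cf_Th_mon_lead[of t n] supp_Th_mon(4)[of n t n] by (auto simp: in_keys_iff)
  show "cf (Th t f + scal c f) n = c"
    unfolding eq using n L cr by (simp add: lookup_add cf_mon)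
  have "cf (Th t f + scal c f) (- n) = 1"
    unfolding eq using n L cr by (simp add: lookup_add cf_mon)
  moreover have "rk j \<le> rk (- n) \<and> even (j - - n)" if "j \<in> supp (Th t f + scal c f)" for j
  proof -
    have "j \<in> supp (Th t (mon n)) \<or> j \<in> supp (Th t r) \<or> j \<in> supp (scal c (mon n)) \<or> j \<in> supp (scal c r)"
      using supp_plus that unfolding eq by metis
    moreover have "\<bar>j\<bar> \<le> n \<and> even (j - n)" if "j \<in> supp (Th t (mon n))"
      using supp_Th_mon[OF that] n by (cases "j = - n") auto
    moreover have "\<bar>j\<bar> \<le> n \<and> even (j - n)" if "j \<in> supp (scal c (mon n))"
      using subsetD[OF supp_scal that] n by auto
    moreover have "\<bar>j\<bar> \<le> n \<and> even (j - n)" if "j \<in> supp (scal c r)"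
      using r[OF subsetD[OF supp_scal that]] by auto
    ultimately have "\<bar>j\<bar> \<le> n \<and> even (j - n)" using Tr by fastforce
    then show ?thesis using n by (auto simp: rk_def split: if_splits)
  qed
  ultimately show "tri (- n) (Th t f + scal c f)" by (auto simp: tri_def)
qed

lemma tri_Eneg: "tri (- int m) (E q t (- int m))"
proof (induction m)
  case 0
  then show ?case by (auto simp: tri_def lookup_one in_keys_iff when_def split: if_splits)
next
  case (Suc m)
  then have "tri (int m + 1) (E q t (int m + 1))" unfolding E_pos by (rule tri_up)
  then have "tri (- (int m + 1)) (E q t (- int m - 1))" unfolding E_neg by (rule tri_down) simp
  moreover have "- int (Suc m) = - (int m + 1)" "- (int m + 1) = - int m - 1" by simp_all
  ultimately show ?case by metis
qed

lemma E_cases: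
  obtains m where "n = - int m" | m where "n = int m + 1"
proof (cases "n \<le> 0")
  case True then show ?thesis by (intro that(1)[of "nat (- n)"]) simp
next
  case False then show ?thesis by (intro that(2)[of "nat (n - 1)"]) simp
qed

lemma tri_E: "tri n (E q t n)"
proof (cases n rule: E_cases)
  case (1 m) then show ?thesis using tri_Eneg by simp
next
  case (2 m) then show ?thesis unfolding 2 E_pos by (intro tri_up tri_Eneg)
qed

lemma cf_E_self [simp]: "cf (E q t n) n = 1"
  using tri_E[of n q t] by (simp add: tri_def)

lemma cf_E_neg: "m > 0 \<Longrightarrow> cf (E q t (- int m)) (int m) = alph q t m"
  unfolding E_neg' by (rule cf_down) (auto simp: tri_E)

lemma E_nonzero [simp]: "E q t n \<noteq> 0"
  by (metis cf_E_self lookup_zero zero_neq_one)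

lemma par_E: "par n (E q t n)"
  by (rule tri_par[OF tri_E])

section \<open>A triangular family is a basis\<close>

text \<open>
  The bound on the ranks says that the expansion respects the filtration by \<open>\<prec>\<close>.
\<close>

lemma tri_expand:
  fixes e :: "int \<Rightarrow> 'k::field lpoly"
  assumes "\<And>n. tri n (e n)"
  shows "\<exists>c. f = lincomb e c \<and> (\<forall>B. (\<forall>j\<in>supp f. rk j \<le> B) \<longrightarrow> (\<forall>j\<in>supp c. rk j \<le> B))"
proof -
  have "(\<forall>j\<in>supp f. rk j < B) \<Longrightarrow> \<exists>c. f = lincomb e c \<and> (\<forall>B. (\<forall>j\<in>supp f. rk j \<le> B) \<longrightarrow> (\<forall>j\<in>supp c. rk j \<le> B))" for B
  proof (induction B arbitrary: f)
    case 0
    then have "f = 0" by (metis all_not_in_conv keys_eq_empty less_nat_zero_code)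
    then show ?case by (intro exI[of _ 0]) auto
  next
    case (Suc B)
    show ?case
    proof (cases "\<exists>n\<in>supp f. rk n = B")
      case True
      then obtain n where n: "n \<in> supp f" "rk n = B" by blast
      define g where "g = f - scal (cf f n) (e n)"
      have g: "rk j < B" if "j \<in> supp g" for j
      proof -
        have "j \<noteq> n" using that assms[of n] by (auto simp: g_def in_keys_iff lookup_minus tri_def)
        have "j \<in> supp f \<or> j \<in> supp (e n)" using that by (auto simp: g_def in_keys_iff lookup_minus)
        then have "rk j \<le> B" using Suc.prems assms[of n] n by (auto simp: tri_def less_Suc_eq_le)
        with \<open>j \<noteq> n\<close> n show ?thesis by (metis le_neq_implies_less rk_inj)
      qed
      then obtain c where c: "g = lincomb e c" "\<forall>B. (\<forall>j\<in>supp g. rk j \<le> B) \<longrightarrow> (\<forall>j\<in>supp c. rk j \<le> B)"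
        using Suc.IH by blast
      have "f = lincomb e (c + Poly_Mapping.single n (cf f n))"
        using c(1) by (simp add: lincomb_add flip: c(1)) (simp add: g_def)
      moreover have "rk j \<le> D" if D: "\<forall>j\<in>supp f. rk j \<le> D" and j: "j \<in> supp (c + Poly_Mapping.single n (cf f n))" for D j
      proof -
        have "B \<le> D" using n D by blast
        then have "\<forall>j\<in>supp g. rk j \<le> D" using g by (meson le_trans less_imp_le)
        then have "\<forall>j\<in>supp c. rk j \<le> D" using c by blast
        moreover have "j \<in> supp c \<or> j = n" using supp_plus[OF j] by (auto split: if_splits)
        ultimately show ?thesis using n D by blast
      qed
      ultimately show ?thesis by blast
    next
      case False
      then show ?thesis using Suc by (metis less_SucE)
    qed
  qed
  moreover have "\<forall>j\<in>supp f. rk j < Suc (Max (rk ` supp f))"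
    by (simp add: less_Suc_eq_le)
  ultimately show ?thesis by blast
qed

lemma tri_lincomb_top:
  fixes e :: "int \<Rightarrow> 'k::field lpoly"
  assumes "\<And>n. tri n (e n)" and "i \<in> supp c" "\<And>j. j \<in> supp c \<Longrightarrow> rk j \<le> rk i"
  shows "cf (lincomb e c) i = cf c i"
proof -
  have "cf (lincomb e c) i = (\<Sum>j\<in>supp c. cf c j * cf (e j) i)"
    by (simp add: lincomb_def lookup_sum)
  also have "\<dots> = (\<Sum>j\<in>supp c. if j = i then cf c i else 0)"
  proof (intro sum.cong refl)
    fix j assume j: "j \<in> supp c"
    show "cf c j * cf (e j) i = (if j = i then cf c i else 0)"
    proof (cases "j = i \<or> cf (e j) i = 0")
      case True then show ?thesis using assms(1)[of j] by (auto simp: tri_def)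
    next
      case False
      then have "rk i \<le> rk j" using assms(1)[of j] by (auto simp: tri_def in_keys_iff)
      with assms(3)[OF j] False show ?thesis by (metis le_antisym rk_inj)
    qed
  qed
  finally show ?thesis using assms(2) by simp
qed

lemma tri_lincomb_eq_0:
  fixes e :: "int \<Rightarrow> 'k::field lpoly"
  assumes "\<And>n. tri n (e n)" and "lincomb e c = 0"
  shows "c = 0"
proof (rule ccontr)
  assume "c \<noteq> 0"
  then have ne: "supp c \<noteq> {}" by simp
  obtain i where i: "i \<in> supp c" "rk i = Max (rk ` supp c)"
    by (metis (mono_tags, lifting) Max_in finite_imageI finite_keys imageE image_is_empty ne)
  then have "cf (lincomb e c) i = cf c i" by (intro tri_lincomb_top assms) auto
  with i assms(2) show False by (simp add: in_keys_iff)
qed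

section \<open>Eigenvectors\<close>

text \<open>
  \<open>\<chi> j\<close> stands for \<open>q\<^sup>j\<^sup>/\<^sup>2\<close>, or for its rounded form over the rational functions. The
  operator \<open>Y'\<close> is \<open>t\<^sup>1\<^sup>/\<^sup>2 Y\<close>, and \<open>lam n\<close> its eigenvalue on \<open>e\<^sub>n\<close>.
\<close>

locale dunkl =
  fixes q t :: "'k::field" and \<chi> :: "int \<Rightarrow> 'k"
  assumes q0 [simp]: "q \<noteq> 0" and t0 [simp]: "t \<noteq> 0"
    and chi_nz [simp]: "\<chi> j \<noteq> 0" and chi_0: "\<chi> 0 = 1" and chi_step: "\<chi> (j + 2) = q * \<chi> j"
    and qt: "\<And>m::nat. m > 0 \<Longrightarrow> q ^ m * t \<noteq> 1"
begin

lemma chi_shift: "\<chi> (j + 2 * i) = q powi i * \<chi> j"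
proof (induction i rule: int_induct[of _ 0])
  case base
  then show ?case by simp
next
  case (step1 i)
  then show ?case using chi_step[of "j + 2 * i"] by (simp add: power_int_add algebra_simps)
next
  case (step2 i)
  then have "q * \<chi> (j + 2 * (i - 1)) = q powi i * \<chi> j"
    using chi_step[of "j + 2 * (i - 1)"] by (simp add: algebra_simps)
  also have "\<dots> = q * (q powi (i - 1) * \<chi> j)" by (simp add: power_int_diff)
  finally show ?case by simp
qed

lemma chi_par: "even (j - n) \<Longrightarrow> \<chi> j = q powi ((j - n) div 2) * \<chi> n"
  using chi_shift[of n "(j - n) div 2"] by simp

definition Y' :: "'k lpoly \<Rightarrow> 'k lpoly" where "Y' f = flipx \<chi> (Th t f)"

definition lam :: "int \<Rightarrow> 'k" where "lam n = \<chi> (- n) * (if n \<le> 0 then t else 1)"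

lemma lin_Y': "lin Y'"
  unfolding Y'_def by (rule lin_compose[OF lin_flipx lin_Th])

lemma lam_nz [simp]: "lam n \<noteq> 0"
  by (simp add: lam_def)

lemma flipx_flipx: "par n f \<Longrightarrow> flipx \<chi> (flipx \<chi> f) = scal (\<chi> n * \<chi> (- n)) f"
proof (rule poly_mapping_eqI)
  fix j assume f: "par n f"
  show "cf (flipx \<chi> (flipx \<chi> f)) j = cf (scal (\<chi> n * \<chi> (- n)) f) j"
  proof (cases "cf f j = 0")
    case False
    then have j: "even (j - n)" using f by (auto simp: par_def in_keys_iff)
    then obtain i where i: "j = n + 2 * i" by (metis add.commute diff_add_cancel evenE)
    have "\<chi> j = q powi i * \<chi> n" "\<chi> (- j) = q powi (- i) * \<chi> (- n)"
      using chi_shift[of n i] chi_shift[of "- n" "- i"] by (simp_all add: i)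
    then have "\<chi> j * \<chi> (- j) = \<chi> n * \<chi> (- n)" by (simp add: power_int_minus field_simps)
    then show ?thesis by (simp add: mult.commute mult.left_commute)
  qed simp
qed

lemma par_flipx: "par n f \<Longrightarrow> par n (flipx \<chi> f)"
  unfolding par_def
proof
  fix j assume f: "\<forall>j\<in>supp f. even (j - n)" and "j \<in> supp (flipx \<chi> f)"
  then have "- j \<in> supp f" by (simp add: in_keys_iff)
  with f have "even (- j - n)" by blast
  then show "even (j - n)" by simp
qed

text \<open>
  \<open>Y' = \<pi> Th\<close> and \<open>\<pi>\<^sup>2 = 1\<close> make \<open>\<pi> f\<close> proportional to \<open>Th f\<close> for an eigenvector \<open>f\<close>.
\<close>

lemma flipx_eigen:
  assumes f: "par n f" and Y: "Y' f = scal l f" and l: "l \<noteq> 0"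
  shows "flipx \<chi> f = scal (\<chi> n * \<chi> (- n) / l) (Th t f)"
proof -
  have "scal (\<chi> n * \<chi> (- n)) (Th t f) = flipx \<chi> (Y' f)"
    unfolding Y'_def by (rule flipx_flipx[symmetric, OF par_Th[OF f]])
  also have "\<dots> = scal l (flipx \<chi> f)" by (simp add: Y lin_simps[OF lin_flipx])
  finally have "scal (inverse l) (scal (\<chi> n * \<chi> (- n)) (Th t f)) = scal (inverse l) (scal l (flipx \<chi> f))"
    by simp
  then show ?thesis using l by (simp add: field_simps)
qed

text \<open>
  The intertwiner attached to \<open>T\<close>: the coefficient \<open>al\<close> is the one for which the two terms
  of \<open>Y' (Th f)\<close>, computed from the quadratic relation, recombine.
\<close>

lemma intertwine_T:
  assumes f: "par n f" and Y: "Y' f = scal l f" and l: "l \<noteq> 0"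
    and al: "al * (t * \<chi> n * \<chi> (- n) - l\<^sup>2) = (t - 1) * l\<^sup>2"
  shows "Y' (Th t f + scal al f) = scal (t * \<chi> n * \<chi> (- n) / l) (Th t f + scal al f)"
proof -
  have "Y' (Th t f) = flipx \<chi> (scal (t - 1) (Th t f) + scal t f)"
    by (simp add: Y'_def Th_Th)
  also have "\<dots> = scal ((t - 1) * l) f + scal (t * (\<chi> n * \<chi> (- n) / l)) (Th t f)"
    using Y by (simp add: lin_simps[OF lin_flipx] flipx_eigen[OF f Y l] flip: Y'_def)
  finally have "Y' (Th t f + scal al f)
      = scal (t * \<chi> n * \<chi> (- n) / l) (Th t f) + scal ((t - 1) * l + al * l) f"
    by (simp add: lin_simps[OF lin_Y'] Y scal_add_left mult.assoc)
  moreover have "(t - 1) * l + al * l = t * \<chi> n * \<chi> (- n) / l * al"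
    using al l by (simp add: field_simps power2_eq_square)
  ultimately show ?thesis by (simp add: scal_add)
qed

lemma flipx_Xinv:
  assumes f: "par n f"
  shows "flipx \<chi> (mon (- 1) * f) = scal (\<chi> (n - 1) / \<chi> n) (mon 1 * flipx \<chi> f)"
proof (rule poly_mapping_eqI)
  fix k
  have L: "cf (flipx \<chi> (mon (- 1) * f)) k = cf f (1 - k) * \<chi> (- k)"
    by (simp add: add.commute)
  have R: "cf (scal (\<chi> (n - 1) / \<chi> n) (mon 1 * flipx \<chi> f)) k = \<chi> (n - 1) / \<chi> n * (cf f (1 - k) * \<chi> (1 - k))"
    by simp
  show "cf (flipx \<chi> (mon (- 1) * f)) k = cf (scal (\<chi> (n - 1) / \<chi> n) (mon 1 * flipx \<chi> f)) k"
  proof (cases "cf f (1 - k) = 0")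
    case False
    then have "1 - k \<in> supp f" by (simp add: in_keys_iff)
    then have "even (1 - k - n)" using f unfolding par_def by blast
    then obtain i where i: "1 - k = n + 2 * i" by (metis add.commute diff_add_cancel evenE)
    then have k: "- k = n - 1 + 2 * i" by simp
    have "\<chi> (1 - k) = q powi i * \<chi> n" "\<chi> (- k) = q powi i * \<chi> (n - 1)"
      using chi_shift[of n i] chi_shift[of "n - 1" i] by (simp_all only: i k)
    then show ?thesis unfolding L R by (simp add: field_simps)
  qed (simp add: L R)
qed

text \<open>The intertwiner \<open>X \<pi>\<close>.\<close>

lemma intertwine_X:
  assumes f: "par n f" and Y: "Y' f = scal l f" and l: "l \<noteq> 0"
  shows "Y' (mon 1 * flipx \<chi> f) = scal (t * \<chi> (n - 1) * \<chi> (- n) / l) (mon 1 * flipx \<chi> f)"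
proof -
  let ?k = "\<chi> n * \<chi> (- n) / l"
  have "Th t (mon 1 * flipx \<chi> f) = mon (- 1) * scal ?k (Th t (Th t f)) - scal (t - 1) (mon (- 1) * scal ?k (Th t f))"
    by (simp add: Th_X flipx_eigen[OF f Y l] lin_simps[OF lin_Th])
  also have "\<dots> = scal (?k * t) (mon (- 1) * f)"
    by (simp add: Th_Th scal_mult_right distrib_left scal_add mult.commute)
  finally have "Y' (mon 1 * flipx \<chi> f) = scal (?k * t * (\<chi> (n - 1) / \<chi> n)) (mon 1 * flipx \<chi> f)"
    by (simp add: Y'_def lin_simps[OF lin_flipx] flipx_Xinv[OF f])
  then show ?thesis by (simp add: field_simps)
qed

lemma up_flipx:
  assumes f: "par (int m) f"
  shows "up q m f = scal (inverse (\<chi> (- int m))) (mon 1 * flipx \<chi> f)"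
proof (rule poly_mapping_eqI)
  fix k
  have R: "cf (scal (inverse (\<chi> (- int m))) (mon 1 * flipx \<chi> f)) k = inverse (\<chi> (- int m)) * (cf f (1 - k) * \<chi> (1 - k))"
    by simp
  show "cf (up q m f) k = cf (scal (inverse (\<chi> (- int m))) (mon 1 * flipx \<chi> f)) k"
  proof (cases "cf f (1 - k) = 0")
    case False
    then have "1 - k \<in> supp f" by (simp add: in_keys_iff)
    then have "even (1 - k - int m)" using f unfolding par_def by blast
    then have "even (1 - k - - int m)" by simp
    from chi_par[OF this] show ?thesis unfolding R cf_up by (simp add: field_simps)
  qed (simp add: cf_up)
qed

lemma par_neg: "par (- n) f = par n f"
  by (simp add: par_def)

lemma alph_eq: "m > 0 \<Longrightarrow> alph q t m * (q ^ m * t - 1) = t - 1"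
  using qt[of m] by (simp add: alph_def)

text \<open>
  The eigenvalue is carried along the chain of intertwiners that defines \<open>E\<close>.
\<close>

theorem Y'_E: "Y' (E q t n) = scal (lam n) (E q t n)"
proof -
  have up: "Y' (E q t (int m + 1)) = scal (lam (int m + 1)) (E q t (int m + 1))"
    if IH: "Y' (E q t (- int m)) = scal (lam (- int m)) (E q t (- int m))" for m
  proof -
    have p: "par (int m) (E q t (- int m))" using par_E[of "- int m" q t] by (simp add: par_neg)
    have "\<chi> (int m - 1) * \<chi> (- int m) = \<chi> (int m) * \<chi> (- int m - 1)"
      using chi_shift[of "int m - 1" "1 - int m"] chi_shift[of "int m" "- int m"]
        chi_shift[of "int m" "- 2 * int m"] 
      using chi_shift[of "- int m - 1" "int m"] chi_shift[of "- int m" "int m"]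
      by (simp add: algebra_simps)
    moreover have "lam (int m + 1) = \<chi> (- int m - 1)"
    proof -
      have e: "- (int m + 1) = - int m - 1" by simp
      show ?thesis unfolding lam_def e by simp
    qed
    ultimately have "t * \<chi> (int m - 1) * \<chi> (- int m) / lam (- int m) = lam (int m + 1)"
      by (simp add: lam_def field_simps)
    then show ?thesis
      unfolding E_pos up_flipx[OF p]
      using intertwine_X[OF p IH] by (simp add: lin_simps[OF lin_Y'] mult.commute)
  qed
  have down: "Y' (E q t (- int m - 1)) = scal (lam (- int m - 1)) (E q t (- int m - 1))"
    if IH: "Y' (E q t (int m + 1)) = scal (lam (int m + 1)) (E q t (int m + 1))" for m
  proof -
    let ?n = "int m + 1"
    have chi: "\<chi> ?n = q ^ Suc m * \<chi> (- ?n)"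
      using chi_shift[of "- ?n" ?n] power_int_of_nat[of q "Suc m"] by (simp add: algebra_simps)
    have "alph q t (Suc m) * (t * \<chi> ?n * \<chi> (- ?n) - (lam ?n)\<^sup>2)
        = alph q t (Suc m) * (q ^ Suc m * t - 1) * (lam ?n)\<^sup>2"
      unfolding chi by (simp add: lam_def power2_eq_square algebra_simps)
    then have al: "alph q t (Suc m) * (t * \<chi> ?n * \<chi> (- ?n) - (lam ?n)\<^sup>2) = (t - 1) * (lam ?n)\<^sup>2"
      by (simp only: alph_eq zero_less_Suc)
    have "t * \<chi> ?n * \<chi> (- ?n) / lam ?n = lam (- int m - 1)"
      by (simp add: lam_def field_simps)
    then show ?thesis
      unfolding E_neg using intertwine_T[OF par_E IH lam_nz al] by simp
  qed
  have neg: "Y' (E q t (- int m)) = scal (lam (- int m)) (E q t (- int m))" for m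
  proof (induction m)
    case 0
    show ?case using flipx_mon[of \<chi> 0] by (simp add: Y'_def lam_def lin_simps[OF lin_flipx] chi_0)
  next
    case (Suc m)
    have "- int (Suc m) = - int m - 1" by simp
    then show ?case using down[OF up[OF Suc]] by metis
  qed
  show ?thesis
    by (cases n rule: E_cases) (auto intro: neg up)
qed

end

section \<open>The linear functional\<close>

lemma const_term_superset:
  assumes "finite A" "supp f \<subseteq> A"
  shows "const_term w f = (\<Sum>j\<in>A. cf f j * w (- j))"
  unfolding const_term_def using assms by (intro sum.mono_neutral_left) (auto simp: in_keys_iff)

lemma linf_const_term: "linf (const_term w)"
proof -
  have "const_term w (f + g) = const_term w f + const_term w g" for f g
  proof -
    let ?A = "supp f \<union> supp g"
    have "const_term w (f + g) = (\<Sum>i\<in>?A. cf (f + g) i * w (- i))"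
      by (rule const_term_superset) (auto dest: subsetD[OF keys_add])
    also have "\<dots> = (\<Sum>i\<in>?A. cf f i * w (- i)) + (\<Sum>i\<in>?A. cf g i * w (- i))"
      by (simp add: lookup_add sum.distrib algebra_simps)
    also have "\<dots> = const_term w f + const_term w g" by (subst (1 2) const_term_superset[of ?A]) auto
    finally show ?thesis .
  qed
  moreover have "const_term w (scal c f) = c * const_term w f" for c f
    by (subst const_term_superset[of "supp f"]) (auto simp: supp_scal const_term_def sum_distrib_left mult.assoc)
  ultimately show ?thesis by (simp add: linf_def)
qed

lemmas ct_simps = linf_simps[OF linf_const_term]

lemma ct_mon [simp]: "const_term w (mon j) = w (- j)"
  by (simp add: const_term_def)

lemma bilin_eqI:
  assumes "\<And>g. linf (\<lambda>f. A f g)" "\<And>f. linf (\<lambda>g. A f g)" "\<And>g. linf (\<lambda>f. B f g)" "\<And>f. linf (\<lambda>g. B f g)"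
    and "\<And>i j. A (mon i) (mon j) = B (mon i) (mon j)"
  shows "A f g = B f g"
proof -
  have "A (mon i) g = B (mon i) g" for i
    by (rule linf_eqI[OF assms(2) assms(4)]) (rule assms(5))
  then show ?thesis by (rule linf_eqI[where A = "\<lambda>f. A f g" and B = "\<lambda>f. B f g", OF assms(1) assms(3)])
qed

lemma linf_left: "linf L \<Longrightarrow> lin A \<Longrightarrow> linf (\<lambda>f. L (A f * g))"
  and linf_right: "linf L \<Longrightarrow> lin A \<Longrightarrow> linf (\<lambda>g. L (f * A g))"
  by (auto simp: linf_def lin_def distrib_left distrib_right scal_mult_left scal_mult_right)

text \<open>
  The functional is \<open>f \<mapsto> \<langle>f \<mu>\<^sup>0\<rangle>\<close>, with \<open>w m\<close> the coefficient of \<open>X\<^sup>m\<close>. Assumption \<open>w_sym\<close>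
  expresses the invariance of \<open>\<mu>\<close> under \<open>\<pi>\<close>; together with it, \<open>w_rec\<close> expresses the
  invariance of \<open>\<mu> (1 - t X\<^sup>2)/(1 - X\<^sup>2)\<close> under \<open>s\<close>.
\<close>

locale dunkl_form = dunkl +
  fixes w :: "int \<Rightarrow> 'a"
  assumes w_odd: "odd j \<Longrightarrow> w j = 0" and w_0: "w 0 = 1"
    and w_sym: "w (- (2 * m)) = q powi m * w (2 * m)"
    and w_rec: "w (2 * m + 2) * (1 - t * q powi (m + 1)) = w (2 * m) * (t - q powi m)"
begin

abbreviation W where "W \<equiv> const_term w"

lemma flipx_adj: "W (flipx \<chi> f * g) = W (f * flipx \<chi> g)"
proof (rule bilin_eqI[where A = "\<lambda>f g. W (flipx \<chi> f * g)" and B = "\<lambda>f g. W (f * flipx \<chi> g)"])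
  fix i j
  show "W (flipx \<chi> (mon i) * mon j) = W (mon i * flipx \<chi> (mon j))"
  proof (cases "even (i - j)")
    case True
    then obtain m where m: "i = j + 2 * m" by (metis add.commute diff_add_cancel evenE)
    have "\<chi> i = q powi m * \<chi> j" using chi_shift[of j m] by (simp add: m)
    moreover have "w (- (j - i)) = w (2 * m)" "w (- (i - j)) = w (- (2 * m))" using m by simp_all
    ultimately show ?thesis using w_sym[of m]
      by (simp add: scal_mult_left scal_mult_right ct_simps algebra_simps)
  next
    case False
    then have "w (- (- i + j)) = 0" "w (- (i + - j)) = 0" by (auto intro!: w_odd)
    then show ?thesis by (simp add: scal_mult_left scal_mult_right ct_simps)
  qed
qed (rule linf_left[OF linf_const_term lin_flipx] linf_right[OF linf_const_term lin_flipx]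
   linf_left[OF linf_const_term lin_id] linf_right[OF linf_const_term lin_id])+

text \<open>
  \<open>(t X\<^sup>2 - 1)(s - 1)/(X\<^sup>2 - 1)\<close> of a monomial, times \<open>\<mu>\<close>, is antisymmetric under \<open>s\<close> and so
  has constant term zero. Coefficientwise, the step from \<open>j\<close> to \<open>j + 2\<close> is \<open>w_rec\<close>.
\<close>

lemma W_antisym_nat: "W ((scal t (mon 2) - 1) * dmon (int j)) = 0"
proof (induction j rule: induct_nat_012)
  case 0
  then show ?case by (simp add: dmon_def ct_simps)
next
  case 1
  have "dmon 1 = - (mon (- 1) :: 'a lpoly)" by (simp add: dmon_def)
  then show ?case
    by (simp add: left_diff_distrib scal_mult_left ct_simps w_odd)
next
  case (ge2 n)
  have "(mon 2 - 1) * dmon (int n + 2) = (mon 2 - 1) * (dmon (int n) - mon (- int n - 2) - mon (int n) :: 'a lpoly)"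
    by (simp add: right_diff_distrib dmon) (simp add: algebra_simps)
  then have d: "dmon (int (Suc (Suc n))) = dmon (int n) - mon (- int n - 2) - (mon (int n) :: 'a lpoly)"
  proof -
    have "int (Suc (Suc n)) = int n + 2" by simp
    then show ?thesis using X2_cancel[OF \<open>(mon 2 - 1) * dmon (int n + 2) = _\<close>] by (simp only:)
  qed
  have "W ((scal t (mon 2) - 1) * (mon (- int n - 2) + mon (int n))) =
      t * w (int n) - w (int n + 2) + (t * w (- int n - 2) - w (- int n))"
    by (simp add: left_diff_distrib distrib_left scal_mult_left ct_simps add.commute)
  also have "\<dots> = 0"
  proof (cases "even n")
    case True
    then obtain m where n: "n = 2 * m" by blast
    have *: "w (- int n) = q powi int m * w (int n)" "w (- int n - 2) = q powi (int m + 1) * w (int n + 2)"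
    proof -
      have e: "- int n - 2 = - (2 * (int m + 1))" "int n + 2 = 2 * (int m + 1)" "int n = 2 * int m" by (simp_all add: n)
      show "w (- int n) = q powi int m * w (int n)" unfolding e by (rule w_sym)
      show "w (- int n - 2) = q powi (int m + 1) * w (int n + 2)" unfolding e(1,2) by (rule w_sym)
    qed
    show ?thesis using w_rec[of "int m"] unfolding * by (simp add: n algebra_simps)
  next
    case False
    then show ?thesis by (simp add: w_odd)
  qed
  finally show ?case unfolding d using ge2(1)
    by (simp add: right_diff_distrib distrib_left ct_simps neg_eq_iff_add_eq_0)
qed

lemma W_antisym: "W ((scal t (mon 2) - 1) * dmon j) = 0"
proof (cases "j \<ge> 0")
  case True
  then show ?thesis using W_antisym_nat[of "nat j"] by simp
next
  case False
  have "(mon 2 - 1) * dmon j = (mon 2 - 1) * (- dmon (- j) :: 'a lpoly)"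
    by (simp add: dmon)
  then have "dmon j = - (dmon (- j) :: 'a lpoly)" by (rule X2_cancel)
  then show ?thesis using W_antisym_nat[of "nat (- j)"] False by (simp add: ct_simps)
qed

text \<open>
  For monomials the difference of the two sides has the form treated in \<open>W_antisym\<close>.
\<close>

lemma Th_adj: "W (Th t f * g) = W (f * Th t g)"
proof (rule bilin_eqI[where A = "\<lambda>f g. W (Th t f * g)" and B = "\<lambda>f g. W (f * Th t g)"])
  fix i j
  let ?f = "mon i :: 'a lpoly" and ?g = "mon j :: 'a lpoly"
  have "(mon 2 - 1) * (Th t ?f * ?g - ?f * Th t ?g)
      = ((mon 2 - 1) * Th t ?f) * ?g - ?f * ((mon 2 - 1) * Th t ?g)"
    by (simp add: algebra_simps)
  also have "\<dots> = (scal t (mon 2) - 1) * (mon (j - i) - mon (i - j))"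
    unfolding Th by (simp add: algebra_simps scal_mult_left scal_mult_right)
  also have "\<dots> = (mon 2 - 1) * ((scal t (mon 2) - 1) * dmon (i - j))"
    unfolding mult.left_commute[of "mon 2 - 1"] dmon by simp
  finally have "Th t ?f * ?g - ?f * Th t ?g = (scal t (mon 2) - 1) * dmon (i - j)"
    by (rule X2_cancel)
  then have "W (Th t ?f * ?g) - W (?f * Th t ?g) = 0"
    using W_antisym[of "i - j"] by (simp flip: ct_simps(5))
  then show "W (Th t ?f * ?g) = W (?f * Th t ?g)" by simp
qed (rule linf_left[OF linf_const_term lin_Th] linf_right[OF linf_const_term lin_Th]
   linf_left[OF linf_const_term lin_id] linf_right[OF linf_const_term lin_id])+

lemma Y'_adj: "W (Y' f * g) = W (f * Th t (flipx \<chi> g))"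
  by (simp add: Y'_def flipx_adj Th_adj)

lemma W_odd: "par n f \<Longrightarrow> odd (n - j) \<Longrightarrow> W (f * mon (- j)) = 0"
proof -
  assume f: "par n f" and o: "odd (n - j)"
  have "W (f * mon (- j)) = const_term w (mon (- j) * f)" by (simp add: mult.commute)
  also have "\<dots> = (\<Sum>i\<in>supp (mon (- j) * f). cf (mon (- j) * f) i * w (- i))" by (simp add: const_term_def)
  also have "\<dots> = 0"
  proof (intro sum.neutral ballI)
    fix i assume "i \<in> supp (mon (- j) * f)"
    then have "i + j \<in> supp f" by (simp add: in_keys_iff)
    then have "even (i + j - n)" using f unfolding par_def by blast
    then have "odd (- i)" using o by auto
    then show "cf (mon (- j) * f) i * w (- i) = 0" by (simp add: w_odd)
  qed
  finally show ?thesis .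
qed

text \<open>
  The adjoint of \<open>Y'\<close> is triangular as well, with the same diagonal entries: modulo lower
  monomials, on which the functional is already known to vanish, it multiplies \<open>X\<^sup>-\<^sup>m\<close> by
  \<open>lam m\<close>.
\<close>

lemma W_eigen_step:
  assumes f: "Y' f = scal l f"
    and low: "\<And>k. prec k m \<Longrightarrow> even (k - m) \<Longrightarrow> W (f * mon (- k)) = 0"
  shows "(l - lam m) * W (f * mon (- m)) = 0"
proof -
  define r where "r = Th t (mon m) - scal (if m \<le> 0 then t else 1) (mon (- m))"
  have r: "prec (- k) m" "even (k - m)" if k: "k \<in> supp r" for k
  proof -
    have ne: "k \<noteq> - m"
    proof
      assume "k = - m"
      then have "cf r k = 0" by (simp add: r_def lookup_minus cf_Th_mon_lead)
      with k show False by (simp add: in_keys_iff)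
    qed
    then have "k \<in> supp (Th t (mon m))" using k by (simp add: r_def in_keys_iff lookup_minus cf_mon)
    from supp_Th_mon[OF this ne] show "prec (- k) m" "even (k - m)" by auto
  qed
  have "W (f * r) = W (f * (\<Sum>j\<in>supp r. scal (cf r j) (mon j)))" using lp_expand[of r] by simp
  also have "\<dots> = (\<Sum>j\<in>supp r. cf r j * W (f * mon j))"
    by (simp add: sum_distrib_left scal_mult_right ct_simps)
  also have "\<dots> = 0"
  proof (intro sum.neutral ballI)
    fix j assume j: "j \<in> supp r"
    have "W (f * mon (- (- j))) = 0" using r[OF j] by (intro low) auto
    then show "cf r j * W (f * mon j) = 0" by simp
  qed
  finally have Wr: "W (f * r) = 0" .
  have "l * W (f * mon (- m)) = W (Y' f * mon (- m))"
    by (simp add: f scal_mult_left ct_simps)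
  also have "\<dots> = \<chi> (- m) * W (f * Th t (mon m))"
    by (simp add: Y'_adj lin_simps[OF lin_Th] scal_mult_right ct_simps)
  also have "Th t (mon m) = scal (if m \<le> 0 then t else 1) (mon (- m)) + r" by (simp add: r_def)
  also have "\<chi> (- m) * W (f * (scal (if m \<le> 0 then t else 1) (mon (- m)) + r)) = lam m * W (f * mon (- m))"
    by (simp add: distrib_left ct_simps Wr scal_mult_right lam_def)
  finally show ?thesis by (simp add: algebra_simps)
qed

end

text \<open>
  Simplicity of the spectrum within a parity class is what separates \<open>e\<^sub>n\<close> from the lower
  monomials.
\<close>

locale dunkl_sep = dunkl_form +
  assumes sep: "lam m = lam n \<Longrightarrow> even (m - n) \<Longrightarrow> m = n"
begin

lemma W_E_orth: "prec m n \<Longrightarrow> W (E q t n * mon (- m)) = 0"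
proof (induction "rk m" arbitrary: m rule: less_induct)
  case less
  show ?case
  proof (cases "even (m - n)")
    case True
    have "(lam n - lam m) * W (E q t n * mon (- m)) = 0"
    proof (rule W_eigen_step[OF Y'_E])
      fix k assume "prec k m" then show "W (E q t n * mon (- k)) = 0"
        using less by (auto simp: prec_rk)
    qed
    moreover have "lam n \<noteq> lam m" using sep[of n m] True less.prems by (auto simp: prec_def)
    ultimately show ?thesis by simp
  next
    case False
    then show ?thesis by (intro W_odd[OF par_E]) auto
  qed
qed

text \<open>
  By orthogonality to lower monomials this is the scalar square of \<open>e\<^sub>n\<close>.
\<close>

definition nrm :: "int \<Rightarrow> 'a" where "nrm n = W (E q t n * mon (- n))"

text \<open>
  If the pairing with \<open>X\<^sup>n\<close> vanishes too, the induction over all monomials in the order \<open>\<prec>\<close>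
  is not stopped at \<open>n\<close>.
\<close>

lemma W_E_null: "nrm n = 0 \<Longrightarrow> W (E q t n * mon (- m)) = 0"
proof (induction "rk m" arbitrary: m rule: less_induct)
  case less
  show ?case
  proof (cases "even (m - n) \<and> m \<noteq> n")
    case True
    have "(lam n - lam m) * W (E q t n * mon (- m)) = 0"
    proof (rule W_eigen_step[OF Y'_E])
      fix k assume "prec k m" then show "W (E q t n * mon (- k)) = 0"
        using less by (auto simp: prec_rk)
    qed
    moreover have "lam n \<noteq> lam m" using sep[of n m] True by auto
    ultimately show ?thesis by simp
  next
    case False
    then show ?thesis using W_odd[OF par_E, of n m] less.prems by (cases "m = n") (auto simp: nrm_def)
  qed
qed

lemma nrm_0: "nrm 0 = 1"
  using ct_mon[of w 0] by (simp add: nrm_def w_0)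

lemma nrm_up: "nrm (int m + 1) = nrm (- int m)"
proof -
  have p: "par (int m) (E q t (- int m))" using par_E[of "- int m" q t] by (simp add: par_neg)
  have e: "mon 1 * F * mon (- (int m + 1)) = F * mon (- int m)" for F :: "'a lpoly"
    unfolding mult.commute[of "mon 1 * F"] by (simp add: mult.commute)
  have "nrm (int m + 1) = inverse (\<chi> (- int m)) * W (flipx \<chi> (E q t (- int m)) * mon (- int m))"
    unfolding nrm_def E_pos up_flipx[OF p] scal_mult_left e by (simp add: ct_simps)
  also have "\<dots> = inverse (\<chi> (- int m)) * W (E q t (- int m) * flipx \<chi> (mon (- int m)))"
    by (simp add: flipx_adj)
  also have "\<dots> = nrm (- int m)"
    by (simp add: nrm_def scal_mult_right ct_simps)
  finally show ?thesis .
qed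

text \<open>
  Pair \<open>e\<^bsub>-m\<^esub> = (Th + \<alpha>) e\<^sub>m\<close> with \<open>X\<^sup>m\<close> and with \<open>X\<^sup>-\<^sup>m\<close>. Orthogonality makes one pairing
  zero and the other the norm; eliminating the unknown \<open>\<langle>e\<^sub>m X\<^sup>m\<rangle>\<close> from the two equations
  gives the ratio of the norms.
\<close>

lemma nrm_down:
  assumes m: "m > 0"
  shows "nrm (- int m) * (q ^ m * t - 1)\<^sup>2 = nrm (int m) * ((q ^ m * t\<^sup>2 - 1) * (q ^ m - 1))"
proof -
  let ?n = "int m" and ?a = "alph q t m"
  let ?E = "E q t (int m)"
  have n: "?n > 0" using m by simp
  have low: "W (?E * r) = 0" if "\<And>k. k \<in> supp r \<Longrightarrow> \<bar>k\<bar> < ?n" for r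
  proof -
    have "W (?E * r) = W (?E * (\<Sum>j\<in>supp r. scal (cf r j) (mon j)))" using lp_expand[of r] by simp
    also have "\<dots> = (\<Sum>j\<in>supp r. cf r j * W (?E * mon j))"
      by (simp add: sum_distrib_left scal_mult_right ct_simps)
    also have "\<dots> = 0"
    proof (intro sum.neutral ballI)
      fix j assume "j \<in> supp r"
      then have "prec (- j) ?n" using that[of j] by (simp add: prec_def)
      from W_E_orth[OF this] show "cf r j * W (?E * mon j) = 0" by simp
    qed
    finally show ?thesis .
  qed
  define x where "x = W (?E * mon ?n)"
  have adj: "W (E q t (- ?n) * g) = W (?E * Th t g) + ?a * W (?E * g)" for g
    unfolding E_neg'[OF m] by (simp add: distrib_right scal_mult_left ct_simps Th_adj)
  have Tp: "W (?E * Th t (mon ?n)) = nrm ?n"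
  proof -
    define r where "r = Th t (mon ?n) - (mon (- ?n) :: 'a lpoly)"
    have "W (?E * r) = 0"
    proof (rule low)
      fix k assume k: "k \<in> supp r"
      have "k \<noteq> - ?n" using k cf_Th_mon_lead[of t ?n] n by (auto simp: r_def in_keys_iff lookup_minus)
      then have "k \<in> supp (Th t (mon ?n))" using k by (simp add: r_def in_keys_iff lookup_minus cf_mon)
      then show "\<bar>k\<bar> < ?n" using supp_Th_mon(4) \<open>k \<noteq> - ?n\<close> n by blast
    qed
    moreover have "Th t (mon ?n) = mon (- ?n) + r" by (simp add: r_def)
    ultimately show ?thesis by (simp add: distrib_left ct_simps nrm_def)
  qed
  have Tm: "W (?E * Th t (mon (- ?n))) = t * x + (t - 1) * nrm ?n"
  proof -
    define r where "r = Th t (mon (- ?n)) - scal t (mon ?n) - scal (t - 1) (mon (- ?n) :: 'a lpoly)"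
    have cr: "cf r k = (t - 1) * (cf (dmon (- ?n)) k - (if k = - ?n then 1 else 0))" for k
      by (auto simp: r_def lookup_minus cf_Th_mon cf_mon right_diff_distrib)
    have "W (?E * r) = 0"
    proof (rule low)
      fix k assume k: "k \<in> supp r"
      then have "cf (dmon (- ?n)) k \<noteq> (if k = - ?n then 1 else (0::'a))" by (auto simp: in_keys_iff cr)
      then show "\<bar>k\<bar> < ?n" using n by (auto simp: cf_dmon split: if_splits)
    qed
    moreover have "Th t (mon (- ?n)) = scal t (mon ?n) + scal (t - 1) (mon (- ?n)) + r" by (simp add: r_def)
    ultimately show ?thesis by (simp add: distrib_left ct_simps nrm_def scal_mult_right x_def)
  qed
  have "prec ?n (- ?n)" using n by (simp add: prec_def)
  from W_E_orth[OF this] have 0: "t * x + (t - 1) * nrm ?n + ?a * nrm ?n = 0"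
    by (simp add: adj Tm) (simp add: nrm_def)
  have 1: "nrm (- ?n) = nrm ?n + ?a * x"
    using adj[of "mon ?n"] by (simp add: nrm_def[of "- ?n"] Tp x_def)
  define Q where "Q = q ^ m"
  have a: "?a * (Q * t - 1) = t - 1" using alph_eq[OF m] by (simp add: Q_def)
  have "t * (nrm (- ?n) * (Q * t - 1)\<^sup>2) = t * (nrm ?n * ((Q * t\<^sup>2 - 1) * (Q - 1)))"
  proof -
    have tx: "t * x = - (t - 1) * nrm ?n - ?a * nrm ?n" using 0 by (simp add: algebra_simps eq_neg_iff_add_eq_0)
    have "t * (nrm (- ?n) * (Q * t - 1)\<^sup>2)
        = t * nrm ?n * (Q * t - 1)\<^sup>2 + (?a * (Q * t - 1)) * ((Q * t - 1) * (t * x))"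
      unfolding 1 by (simp add: algebra_simps power2_eq_square)
    also have "\<dots> = t * nrm ?n * (Q * t - 1)\<^sup>2 - (t - 1) * ((t - 1) * (Q * t - 1) * nrm ?n + (?a * (Q * t - 1)) * nrm ?n)"
    proof -
      have "?a * (Q * t - 1) * ((Q * t - 1) * (t * x)) = (t - 1) * ((Q * t - 1) * (t * x))"
        by (simp only: a)
      also have "\<dots> = - ((t - 1) * ((t - 1) * (Q * t - 1) * nrm ?n + (?a * (Q * t - 1)) * nrm ?n))"
        unfolding tx by (simp add: algebra_simps)
      finally show ?thesis by simp
    qed
    also have "\<dots> = t * (nrm ?n * ((Q * t\<^sup>2 - 1) * (Q - 1)))"
      unfolding a by (simp add: algebra_simps power2_eq_square)
    finally show ?thesis .
  qed
  then show ?thesis by (simp add: Q_def)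
qed

lemma nrm_eq_0_iff:
  assumes "\<And>m::nat. m > 0 \<Longrightarrow> q ^ m \<noteq> 1" "m > 0"
  shows "nrm (- int m) = 0 \<longleftrightarrow> nrm (int m) = 0 \<or> q ^ m * t\<^sup>2 = 1"
  using nrm_down[OF assms(2)] qt[OF assms(2)] assms(1)[OF assms(2)] by auto

lemma orth_lincomb:
  assumes j: "nrm j \<noteq> 0" "j \<in> supp c" and i: "\<And>i. i \<in> supp c \<Longrightarrow> rk i < rk j \<Longrightarrow> nrm i = 0"
  shows "W (lincomb (E q t) c * mon (- j)) = cf c j * nrm j"
proof -
  have "W (lincomb (E q t) c * mon (- j)) = (\<Sum>i\<in>supp c. cf c i * W (E q t i * mon (- j)))"
    by (simp add: lincomb_def sum_distrib_right scal_mult_left ct_simps)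
  also have "\<dots> = (\<Sum>i\<in>supp c. if i = j then cf c j * nrm j else 0)"
  proof (intro sum.cong refl)
    fix k assume k: "k \<in> supp c"
    consider "k = j" | "prec j k" | "rk k < rk j" by (metis prec_rk linorder_neqE_nat rk_inj)
    then show "cf c k * W (E q t k * mon (- j)) = (if k = j then cf c j * nrm j else 0)"
      using W_E_orth[of j k] W_E_null[of k j] i[OF k] by cases (auto simp: nrm_def prec_def)
  qed
  finally show ?thesis using j by simp
qed

end

section \<open>The coefficients of the weight function\<close>

type_synonym 'a qx = "'a fls fps"

text \<open>
  The coefficient of \<open>q\<^sup>N X\<^sup>m\<close>. It is extended by zero to negative \<open>N\<close>, so that recursions
  need no side conditions.
\<close>

definition qx_cf :: "'a::field qx \<Rightarrow> int \<Rightarrow> int \<Rightarrow> 'a" where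
  "qx_cf F N m = (if N < 0 then 0 else fls_nth (fps_nth F (nat N)) m)"

lemma qx_cf_neg [simp]: "N < 0 \<Longrightarrow> qx_cf F N m = 0"
  by (simp add: qx_cf_def)

lemma qx_cf_nat: "qx_cf F (int N) m = fls_nth (fps_nth F N) m"
  by (simp add: qx_cf_def)

lemma qx_cf_add [simp]: "qx_cf (F + G) N m = qx_cf F N m + qx_cf G N m"
  and qx_cf_diff [simp]: "qx_cf (F - G) N m = qx_cf F N m - qx_cf G N m"
  by (auto simp: qx_cf_def)

lemma qx_cf_one: "qx_cf 1 N m = (if N = 0 \<and> m = 0 then 1 else 0)"
  by (auto simp: qx_cf_def)

definition qX :: "'a::field \<Rightarrow> nat \<Rightarrow> int \<Rightarrow> 'a qx" where
  "qX c j i = fps_const (fls_const c) * fps_X ^ j * fps_const (fls_X_intpow i)"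

lemma qx_cf_qX [simp]: "qx_cf (qX c j i * F) N m = c * qx_cf F (N - int j) (m - i)"
proof -
  have e: "qX c j i * F = fps_const (fls_const c) * (fps_X ^ j * (fps_const (fls_X_intpow i) * F))"
    by (simp only: qX_def mult.assoc)
  have 1: "qx_cf (fps_const (fls_const c) * G) N m = c * qx_cf G N m" for G :: "'a qx" and N m
    by (simp add: qx_cf_def)
  have 2: "qx_cf (fps_X ^ j * G) N m = qx_cf G (N - int j) m" for G :: "'a qx" and N m
    by (auto simp: qx_cf_def fps_X_power_mult_nth nat_diff_distrib' nat_less_iff)
  have 3: "qx_cf (fps_const (fls_X_intpow i) * G) N m = qx_cf G N (m - i)" for G :: "'a qx" and N m
    by (simp add: qx_cf_def fls_X_intpow_times_conv_shift)
  show ?thesis unfolding e 1 2 3 ..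
qed

text \<open>
  \<open>(1 - c q\<^sup>i X\<^sup>2)(1 - c q\<^sup>j X\<^sup>-\<^sup>2)\<close>, the shape of the numerators and denominators of the
  factors of \<open>\<mu>\<close>.
\<close>

definition PP :: "'a::field \<Rightarrow> nat \<Rightarrow> nat \<Rightarrow> 'a qx" where
  "PP c i j = (1 - qX c i 2) * (1 - qX c j (- 2))"

lemma qx_cf_PP: "qx_cf (PP c i j * F) N m = qx_cf F N m - c * qx_cf F (N - int i) (m - 2)
    - c * qx_cf F (N - int j) (m + 2) + c\<^sup>2 * qx_cf F (N - int i - int j) m"
  by (simp add: PP_def left_diff_distrib mult.assoc power2_eq_square right_diff_distrib)

subsection \<open>Symmetry under \<open>\<pi>\<close>\<close>

text \<open>
  Invariance under \<open>X \<mapsto> q\<^sup>1\<^sup>/\<^sup>2 X\<^sup>-\<^sup>1\<close> for series in \<open>X\<^sup>2\<close>. It is expressed by coefficients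
  because the substitution itself makes no sense for arbitrary series of this type.
\<close>

definition pisym :: "'a::field qx \<Rightarrow> bool" where
  "pisym F \<longleftrightarrow> (\<forall>N m. odd m \<longrightarrow> qx_cf F N m = 0) \<and> (\<forall>N m. qx_cf F N (2 * m) = qx_cf F (N + m) (- (2 * m)))"

lemma pisym_one: "pisym 1"
  by (auto simp: pisym_def qx_cf_one)

lemma pisym_PP_mult:
  assumes "pisym F" shows "pisym (PP c j (Suc j) * F)"
proof -
  have o: "qx_cf F N m = 0" if "odd m" for N m using assms that by (auto simp: pisym_def)
  have s: "qx_cf F N (2 * m) = qx_cf F (N + m) (- (2 * m))" for N m using assms by (auto simp: pisym_def)
  show ?thesis unfolding pisym_def
  proof (intro conjI allI impI)
    fix N m :: int assume "odd m"
    then show "qx_cf (PP c j (Suc j) * F) N m = 0" by (simp add: qx_cf_PP o)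
  next
    fix N m :: int
    have 1: "qx_cf F (N - int j) (2 * m - 2) = qx_cf F (N + m - int (Suc j)) (- (2 * m) + 2)"
      using s[of "N - int j" "m - 1"] by (simp add: algebra_simps)
    have 2: "qx_cf F (N - int (Suc j)) (2 * m + 2) = qx_cf F (N + m - int j) (- (2 * m) - 2)"
    proof -
      have e: "2 * (m + 1) = 2 * m + 2" "- (2 * m + 2) = - (2 * m) - 2" "N - int (Suc j) + (m + 1) = N + m - int j"
        by simp_all
      show ?thesis using s[of "N - int (Suc j)" "m + 1"] unfolding e .
    qed
    have 3: "qx_cf F (N - int j - int (Suc j)) (2 * m) = qx_cf F (N + m - int j - int (Suc j)) (- (2 * m))"
      using s[of "N - int j - int (Suc j)" "m"] by (simp add: algebra_simps)
    show "qx_cf (PP c j (Suc j) * F) N (2 * m) = qx_cf (PP c j (Suc j) * F) (N + m) (- (2 * m))"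
      unfolding qx_cf_PP 1 2 3 s[of N m] by simp
  qed
qed

lemma qx_cf_eq0_below: "\<exists>M. \<forall>m\<le>M. qx_cf F N m = 0"
  by (cases "N < 0") (auto simp: qx_cf_def intro!: exI[of _ "fls_subdegree (fps_nth F (nat N)) - 1"])

text \<open>
  The coefficients of the quotient are determined recursively by those of the product, and
  the recursion is compatible with the symmetry. One first has to know that the coefficient
  of \<open>q\<^sup>N X\<^sup>2\<^sup>m\<close> vanishes for \<open>N + m < 0\<close>. The symmetry exchanges \<open>N\<close> and \<open>N + m\<close>, so an
  induction on their sum is possible.
\<close>

lemma pisym_PP_div:
  assumes H: "pisym (PP c j (Suc j) * F)" shows "pisym F"
proof -
  let ?H = "PP c j (Suc j) * F"
  have o: "qx_cf ?H N m = 0" if "odd m" for N m using H that by (auto simp: pisym_def)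
  have s: "qx_cf ?H N (2 * m) = qx_cf ?H (N + m) (- (2 * m))" for N m using H by (auto simp: pisym_def)
  have rec: "qx_cf F N m = qx_cf ?H N m + c * qx_cf F (N - int j) (m - 2) + c * qx_cf F (N - int (Suc j)) (m + 2)
      - c\<^sup>2 * qx_cf F (N - int j - int (Suc j)) m" for N m
    unfolding qx_cf_PP by simp
  have zH: "qx_cf ?H N m = 0" if "odd m \<or> 2 * N + m < 0" for N m
  proof (cases "odd m")
    case False
    then obtain l where l: "m = 2 * l" by blast
    with that have "N + l < 0" by auto
    then show ?thesis using s[of N l] by (simp add: l)
  qed (simp add: o)
  \<comment> \<open>For \<open>j = 0\<close> the recursion does not decrease \<open>N\<close>; then the degree in \<open>X\<close> is bounded below.\<close>
  have z: "qx_cf F (int N) m = 0" if "odd m \<or> 2 * int N + m < 0" for N m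
    using that
  proof (induction N arbitrary: m rule: less_induct)
    case (less N)
    have IH: "qx_cf F N' m = 0" if "N' < int N" "odd m \<or> 2 * N' + m < 0" for N' m
      using less.IH[of "nat N'" m] that by (cases "N' < 0") auto
    show ?case
    proof (cases "j = 0")
      case False
      then show ?thesis
        unfolding rec[of "int N" m] using less.prems zH[of m "int N"]
        by (subst (1 2 3) IH) auto
    next
      case True
      obtain M where M: "\<And>m. m \<le> M \<Longrightarrow> qx_cf F (int N) m = 0"
        using qx_cf_eq0_below[of F "int N"] by blast
      show ?thesis using less.prems
      proof (induction "nat (m - M)" arbitrary: m rule: less_induct)
        case (less m)
        show ?case
        proof (cases "m \<le> M")
          case False
          have "qx_cf F (int N) (m - 2) = 0" using less.prems False by (intro less.hyps) auto
          then show ?thesis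
            unfolding rec[of "int N" m] using less.prems zH[of m "int N"] True
            by (subst (2 3) IH) auto
        qed (simp add: M)
      qed
    qed
  qed
  have z': "qx_cf F N m = 0" if "odd m \<or> 2 * N + m < 0" for N m
    using z[of m "nat N"] that by (cases "N < 0") auto
  have d: "qx_cf F N (2 * m) = qx_cf F (N + m) (- (2 * m))" for N m
  proof (induction "nat (2 * N + m)" arbitrary: N m rule: less_induct)
    case less
    show ?case
    proof (cases "N < 0 \<or> N + m < 0 \<or> (N = 0 \<and> m = 0)")
      case True
      then show ?thesis using z'[of "2 * m" N] z'[of "- (2 * m)" "N + m"] by auto
    next
      case False
      then have pos: "2 * N + m > 0" by linarith
      have 1: "qx_cf F (N - int j) (2 * m - 2) = qx_cf F (N + m - int (Suc j)) (- (2 * m) + 2)"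
        using less[of "N - int j" "m - 1"] pos by (simp add: algebra_simps)
      have 2: "qx_cf F (N - int (Suc j)) (2 * m + 2) = qx_cf F (N + m - int j) (- (2 * m) - 2)"
      proof -
        have e: "2 * (m + 1) = 2 * m + 2" "- (2 * m + 2) = - (2 * m) - 2" "N - int (Suc j) + (m + 1) = N + m - int j"
          by simp_all
        have "nat (2 * (N - int (Suc j)) + (m + 1)) < nat (2 * N + m)" using pos by simp
        from less[OF this] show ?thesis unfolding e .
      qed
      have 3: "qx_cf F (N - int j - int (Suc j)) (2 * m) = qx_cf F (N + m - int j - int (Suc j)) (- (2 * m))"
        using less[of "N - int j - int (Suc j)" "m"] pos by (simp add: algebra_simps)
      show ?thesis
        unfolding rec[of N "2 * m"] rec[of "N + m" "- (2 * m)"] 1 2 3 s[of N m] by simp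
    qed
  qed
  show ?thesis using z' d by (auto simp: pisym_def)
qed

subsection \<open>Symmetry under \<open>s\<close>\<close>

definition ssym :: "'a::field qx \<Rightarrow> bool" where
  "ssym F \<longleftrightarrow> (\<forall>N m. qx_cf F N m = qx_cf F N (- m))"

lemma ssym_one: "ssym 1"
  by (auto simp: ssym_def qx_cf_one)

lemma ssym_PP_mult:
  assumes "ssym F" shows "ssym (PP c j j * F)"
proof -
  have s: "qx_cf F N m = qx_cf F N (- m)" for N m using assms by (simp add: ssym_def)
  show ?thesis unfolding ssym_def qx_cf_PP
    using s[of _ "_ - 2"] s[of _ "_ + 2"] s by (simp add: algebra_simps)
qed

lemma ssym_PP_div:
  assumes "ssym (PP c (Suc j) (Suc j) * F)" shows "ssym F"
proof -
  let ?H = "PP c (Suc j) (Suc j) * F" and ?j = "int (Suc j)"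
  have s: "qx_cf ?H N m = qx_cf ?H N (- m)" for N m using assms by (simp add: ssym_def)
  have rec: "qx_cf F N m = qx_cf ?H N m + c * qx_cf F (N - ?j) (m - 2) + c * qx_cf F (N - ?j) (m + 2)
      - c\<^sup>2 * qx_cf F (N - ?j - ?j) m" for N m
    unfolding qx_cf_PP by simp
  have "qx_cf F (int N) m = qx_cf F (int N) (- m)" for N m
  proof (induction N arbitrary: m rule: less_induct)
    case (less N)
    have IH: "qx_cf F N' m = qx_cf F N' (- m)" if "N' < int N" for N' m
      using less.IH[of "nat N'" m] that by (cases "N' < 0") auto
    have 1: "qx_cf F (int N - ?j) (m - 2) = qx_cf F (int N - ?j) (- m + 2)" using IH[of "int N - ?j" "m - 2"] by simp
    have 2: "qx_cf F (int N - ?j) (m + 2) = qx_cf F (int N - ?j) (- m - 2)" using IH[of "int N - ?j" "m + 2"] by simp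
    have 3: "qx_cf F (int N - ?j - ?j) m = qx_cf F (int N - ?j - ?j) (- m)" by (rule IH) simp
    show ?case unfolding rec[of "int N" m] rec[of "int N" "- m"] 1 2 3 s[of "int N" m] by simp
  qed
  then show ?thesis unfolding ssym_def by (metis qx_cf_neg linorder_not_le nonneg_int_cases)
qed

lemma PP_unit: "j > 0 \<Longrightarrow> inverse (PP c i j) * PP c i j = 1"
proof (rule inverse_mult_eq_1)
  assume "j > 0"
  then have "qx_cf (PP c i j * 1) 0 0 = 1" by (simp only: qx_cf_PP) (auto simp: qx_cf_one)
  then show "fps_nth (PP c i j) 0 \<noteq> 0" by (auto simp: qx_cf_def)
qed

subsection \<open>The infinite product\<close>

context
  fixes T :: "'a::field"
begin

definition mfac :: "nat \<Rightarrow> 'a qx" where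
  "mfac j = PP 1 j (Suc j) * inverse (PP T j (Suc j))"

definition mpart :: "nat \<Rightarrow> 'a qx" where "mpart N = (\<Prod>j<N. mfac j)"

text \<open>
  The factors of \<open>\<mu> (1 - t X\<^sup>2)/(1 - X\<^sup>2)\<close>, regrouped such that each of them is invariant
  under \<open>s\<close>.
\<close>

definition sfac :: "nat \<Rightarrow> 'a qx" where
  "sfac j = PP 1 (Suc j) (Suc j) * inverse (PP T (Suc j) (Suc j))"

definition spart :: "nat \<Rightarrow> 'a qx" where "spart N = (\<Prod>j<N. sfac j)"

lemma mpart_Suc: "PP T N (Suc N) * mpart (Suc N) = PP 1 N (Suc N) * mpart N"
proof -
  have "PP T N (Suc N) * mpart (Suc N) = (inverse (PP T N (Suc N)) * PP T N (Suc N)) * (PP 1 N (Suc N) * mpart N)"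
    by (simp add: mpart_def mfac_def algebra_simps)
  then show ?thesis by (simp add: PP_unit)
qed

lemma spart_Suc: "PP T (Suc N) (Suc N) * spart (Suc N) = PP 1 (Suc N) (Suc N) * spart N"
proof -
  have "PP T (Suc N) (Suc N) * spart (Suc N) = (inverse (PP T (Suc N) (Suc N)) * PP T (Suc N) (Suc N)) * (PP 1 (Suc N) (Suc N) * spart N)"
    by (simp add: spart_def sfac_def algebra_simps)
  then show ?thesis by (simp add: PP_unit)
qed

lemma pisym_mpart: "pisym (mpart N)"
proof (induction N)
  case (Suc N)
  show ?case
    by (rule pisym_PP_div[of T N]) (simp only: mpart_Suc pisym_PP_mult[OF Suc])
qed (simp add: mpart_def pisym_one)

lemma ssym_spart: "ssym (spart N)"
proof (induction N)
  case (Suc N)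
  show ?case
    by (rule ssym_PP_div[of T N]) (simp only: spart_Suc ssym_PP_mult[OF Suc])
qed (simp add: spart_def ssym_one)

text \<open>
  The regrouping of the factors telescopes, up to a factor that tends to \<open>1\<close> in the \<open>q\<close>-adic
  topology.
\<close>

lemma mpart_spart: "(1 - qX T 0 2) * (1 - qX 1 N 2) * mpart N = (1 - qX 1 0 2) * (1 - qX T N 2) * spart N"
proof (induction N)
  case 0
  then show ?case by (simp add: mpart_def spart_def mult.commute)
next
  case (Suc N)
  let ?a = "\<lambda>c j. 1 - qX c j 2 :: 'a qx" and ?b = "\<lambda>c j. 1 - qX c j (- 2) :: 'a qx"
  let ?D = "PP T N (Suc N) * PP T (Suc N) (Suc N)"
  have "?D * (?a T 0 * ?a 1 (Suc N) * mpart (Suc N)) = ?a T 0 * ?a 1 (Suc N) * PP T (Suc N) (Suc N) * (PP T N (Suc N) * mpart (Suc N))"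
    by (simp add: algebra_simps)
  also have "\<dots> = PP T (Suc N) (Suc N) * ?a 1 (Suc N) * ?b 1 (Suc N) * (?a T 0 * ?a 1 N * mpart N)"
    unfolding mpart_Suc by (simp add: PP_def ac_simps)
  also have "\<dots> = ?a 1 0 * PP T (Suc N) (Suc N) * ?a T N * (PP 1 (Suc N) (Suc N) * spart N)"
    unfolding Suc by (simp add: PP_def ac_simps)
  also have "\<dots> = ?D * (?a 1 0 * ?a T (Suc N) * spart (Suc N))"
    unfolding spart_Suc[symmetric] by (simp add: PP_def ac_simps)
  finally have eq: "?D * (?a T 0 * ?a 1 (Suc N) * mpart (Suc N)) = ?D * (?a 1 0 * ?a T (Suc N) * spart (Suc N))" .
  have "?D \<noteq> 0"
    using PP_unit[of "Suc N" T N] PP_unit[of "Suc N" T "Suc N"] by auto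
  with eq show ?case by (metis mult_left_cancel)
qed

lemma mpart_stable: "M < int N \<Longrightarrow> qx_cf (mpart (Suc N)) M m = qx_cf (mpart N) M m"
proof -
  assume M: "M < int N"
  have "qx_cf (PP T N (Suc N) * mpart (Suc N)) M m = qx_cf (PP 1 N (Suc N) * mpart N) M m"
    by (simp only: mpart_Suc)
  then show ?thesis unfolding qx_cf_PP using M by simp
qed

lemma mpart_stable': "M < int N \<Longrightarrow> N \<le> N' \<Longrightarrow> qx_cf (mpart N') M m = qx_cf (mpart N) M m"
proof (induction N' rule: nat_induct)
  case (Suc N')
  then show ?case using mpart_stable[of M N' m] by (cases "N = Suc N'") auto
qed auto

definition mlim :: "'a qx" where "mlim = lim mpart"

lemma qx_cf_mlim: "M < int N \<Longrightarrow> qx_cf mlim M m = qx_cf (mpart N) M m"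
proof -
  define L :: "'a qx" where "L = Abs_fps (\<lambda>M. fps_nth (mpart (Suc M)) M)"
  have L: "fps_nth (mpart N) M = fps_nth L M" if "M < N" for M N
    unfolding L_def using mpart_stable'[of "int M" "Suc M" N] that
    by (auto simp: qx_cf_nat fls_eq_iff)
  have "mpart \<longlonglongrightarrow> L"
    unfolding tendsto_fps_iff
    using L by (auto simp: eventually_sequentially) (meson Suc_le_lessD)
  then have "mlim = L" unfolding mlim_def by (rule limI)
  then show "M < int N \<Longrightarrow> qx_cf mlim M m = qx_cf (mpart N) M m"
    using L[of "nat M" N] by (simp add: qx_cf_def)
qed

lemma pisym_mlim: "pisym mlim"
  unfolding pisym_def
proof (intro conjI allI impI)
  fix N m :: int
  { assume "odd m" then show "qx_cf mlim N m = 0"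
      using pisym_mpart[of "nat (N + 1)"] qx_cf_mlim[of N "nat (N + 1)" m] by (cases "N < 0") (auto simp: pisym_def) }
  define K where "K = nat (max N (N + m) + 1)"
  have "N < int K" "N + m < int K" by (auto simp: K_def)
  then show "qx_cf mlim N (2 * m) = qx_cf mlim (N + m) (- (2 * m))"
    using pisym_mpart[of K] by (simp add: qx_cf_mlim pisym_def)
qed

text \<open>
  Coefficientwise, \<open>(1 - T X\<^sup>2) \<mu> = (1 - X\<^sup>2) \<sigma>\<close> with \<open>\<sigma>\<close> invariant under \<open>s\<close>.
\<close>

lemma mlim_antisym:
  "qx_cf mlim N m - T * qx_cf mlim N (m - 2) = - (qx_cf mlim N (2 - m) - T * qx_cf mlim N (- m))"
proof (cases "N < 0")
  case False
  define K where "K = nat (N + 1)"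
  have K: "N < int K" using False by (simp add: K_def)
  have s: "qx_cf (spart K) N m = qx_cf (spart K) N (- m)" for m
    using ssym_spart[of K] by (simp add: ssym_def)
  have "qx_cf mlim N m - T * qx_cf mlim N (m - 2) = qx_cf (spart K) N m - qx_cf (spart K) N (m - 2)" for m
  proof -
    have "qx_cf ((1 - qX T 0 2) * ((1 - qX 1 K 2) * mpart K)) N m = qx_cf ((1 - qX 1 0 2) * ((1 - qX T K 2) * spart K)) N m"
      using mpart_spart[of K] by (simp add: mult.assoc)
    then show ?thesis using K by (simp add: left_diff_distrib qx_cf_mlim)
  qed
  from this[of m] this[of "2 - m"] s[of "2 - m"] s[of "- m"] show ?thesis by simp
qed simp

definition mcoef :: "int \<Rightarrow> 'a fps" where
  "mcoef m = Abs_fps (\<lambda>N. fls_nth (fps_nth mlim N) m)"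

lemma mcoef_nth: "fps_nth (mcoef m) N = qx_cf mlim (int N) m"
  by (simp add: mcoef_def qx_cf_nat)

lemma mcoef_odd: "odd m \<Longrightarrow> mcoef m = 0"
  using pisym_mlim by (auto simp: fps_eq_iff mcoef_nth pisym_def)

lemma mcoef_neg: "mcoef (- (2 * int m)) = fps_X ^ m * mcoef (2 * int m)"
proof (rule fps_ext)
  fix N
  have "qx_cf mlim (int N - int m) (2 * int m) = qx_cf mlim (int N) (- (2 * int m))"
    using pisym_mlim unfolding pisym_def by (metis diff_add_cancel)
  then show "fps_nth (mcoef (- (2 * int m))) N = fps_nth (fps_X ^ m * mcoef (2 * int m)) N"
    by (auto simp: fps_X_power_mult_nth mcoef_nth of_nat_diff)
qed

text \<open>
  The symmetry under \<open>s\<close> relates the exponents \<open>2m + 2\<close>, \<open>2m\<close> with \<open>-2m\<close>, \<open>-2m - 2\<close>, and the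
  symmetry under \<open>\<pi>\<close> leads back to positive exponents.
\<close>

lemma mcoef_rec:
  "mcoef (2 * int (Suc m)) * (1 - fps_const T * fps_X ^ Suc m) = mcoef (2 * int m) * (fps_const T - fps_X ^ m)"
proof -
  have "mcoef (2 * int (Suc m)) - fps_const T * mcoef (2 * int m)
      = - (mcoef (- (2 * int m)) - fps_const T * mcoef (- (2 * int (Suc m))))"
  proof (rule fps_ext)
    fix N
    show "fps_nth (mcoef (2 * int (Suc m)) - fps_const T * mcoef (2 * int m)) N
       = fps_nth (- (mcoef (- (2 * int m)) - fps_const T * mcoef (- (2 * int (Suc m))))) N"
      using mlim_antisym[of "int N" "2 * int (Suc m)"] by (simp add: mcoef_nth algebra_simps)
  qed
  then show ?thesis unfolding mcoef_neg by (simp add: algebra_simps)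
qed

lemma mcoef_0: "fps_nth (mcoef 0) 0 = 1"
proof -
  have "PP T 0 (Suc 0) * mpart (Suc 0) = PP 1 0 (Suc 0) * 1"
    using mpart_Suc[of 0] by (simp add: mpart_def)
  then have "qx_cf (PP T 0 (Suc 0) * mpart (Suc 0)) 0 0 = qx_cf (PP 1 0 (Suc 0) * 1) 0 0" by (simp only:)
  then have *: "qx_cf (mpart (Suc 0)) 0 0 - T * qx_cf (mpart (Suc 0)) 0 (- 2) = 1"
    unfolding qx_cf_PP by (simp add: qx_cf_one)
  have "qx_cf (mpart (Suc 0)) 0 (2 * (- 1)) = qx_cf (mpart (Suc 0)) (0 + - 1) (- (2 * (- 1)))"
    using pisym_mpart[of "Suc 0"] unfolding pisym_def by blast
  then have "qx_cf (mpart (Suc 0)) 0 (- 2) = 0" by simp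
  with * have "qx_cf (mpart (Suc 0)) 0 0 = 1" by simp
  then have "qx_cf mlim 0 0 = 1" using qx_cf_mlim[of 0 "Suc 0" 0] by simp
  then show ?thesis using mcoef_nth[of 0 0] by simp
qed

lemma mcoef_prod:
  "(\<Prod>i<m. 1 - fps_const T * fps_X ^ Suc i) * (mcoef (2 * int m) * inverse (mcoef 0)) = (\<Prod>i<m. fps_const T - fps_X ^ i)"
proof (induction m)
  case 0
  have "inverse (mcoef 0) * mcoef 0 = 1" by (rule inverse_mult_eq_1) (simp add: mcoef_0)
  then show ?case by (simp add: mult.commute)
next
  case (Suc m)
  have "(\<Prod>i<Suc m. 1 - fps_const T * fps_X ^ Suc i) * (mcoef (2 * int (Suc m)) * inverse (mcoef 0))
     = (\<Prod>i<m. 1 - fps_const T * fps_X ^ Suc i) * (inverse (mcoef 0) * (mcoef (2 * int (Suc m)) * (1 - fps_const T * fps_X ^ Suc m)))"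
    by (simp only: prod.lessThan_Suc ac_simps)
  also have "\<dots> = ((\<Prod>i<m. 1 - fps_const T * fps_X ^ Suc i) * (mcoef (2 * int m) * inverse (mcoef 0))) * (fps_const T - fps_X ^ m)"
    unfolding mcoef_rec by (simp only: ac_simps)
  finally show ?case unfolding Suc by simp
qed

end

section \<open>The normalized weight as a rational function\<close>

definition wgt :: "'k::field \<Rightarrow> 'k \<Rightarrow> int \<Rightarrow> 'k" where
  "wgt q t m = (if odd m then 0 else (if m \<ge> 0 then 1 else q ^ nat (- m div 2)) *
     (\<Prod>i<nat (\<bar>m\<bar> div 2). (t - q ^ i) / (1 - t * q ^ Suc i)))"

lemma wgt_odd: "odd m \<Longrightarrow> wgt q t m = 0"
  by (simp add: wgt_def)

lemma wgt_pos: "wgt q t (2 * int m) = (\<Prod>i<m. (t - q ^ i) / (1 - t * q ^ Suc i))"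
  by (simp add: wgt_def)

lemma wgt_neg: "wgt q t (- (2 * int m)) = q ^ m * wgt q t (2 * int m)"
  by (cases "m = 0") (simp_all add: wgt_def)

context dunkl
begin

lemma wgt_rec: "wgt q t (2 * int (Suc m)) * (1 - t * q ^ Suc m) = wgt q t (2 * int m) * (t - q ^ m)"
  unfolding wgt_pos prod.lessThan_Suc using qt[of "Suc m"] by (simp add: mult.commute)

text \<open>
  For negative exponents the recursion is the one for positive exponents read backwards.
\<close>

lemma wgt_form: "dunkl_form q t \<chi> (wgt q t)"
proof
  show "wgt q t j = 0" if "odd j" for j using that by (rule wgt_odd)
  show "wgt q t 0 = 1" by (simp add: wgt_def)
  show "wgt q t (- (2 * m)) = q powi m * wgt q t (2 * m)" for m
  proof (cases m rule: int_cases2)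
    case (nonneg n) then show ?thesis using wgt_neg[of q t n] by simp
  next
    case (nonpos n) then show ?thesis using wgt_neg[of q t n] by (simp add: power_int_minus)
  qed
  show "wgt q t (2 * m + 2) * (1 - t * q powi (m + 1)) = wgt q t (2 * m) * (t - q powi m)" for m
  proof (cases "m \<ge> 0")
    case True
    then obtain n where n: "m = int n" using nonneg_int_cases by blast
    have e: "2 * m + 2 = 2 * int (Suc n)" "m + 1 = int (Suc n)" "2 * m = 2 * int n" by (simp_all add: n)
    have p: "q powi (m + 1) = q ^ Suc n" "q powi m = q ^ n"
      unfolding e(2) unfolding n by (rule power_int_of_nat)+
    show ?thesis using wgt_rec[of n] unfolding p unfolding e(1) unfolding e(3) .
  next
    case False
    define n where "n = nat (- m - 1)"
    have m: "m = - int n - 1" using False by (simp add: n_def)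
    have e: "2 * m + 2 = - (2 * int n)" "m + 1 = - int n" "2 * m = - (2 * int (Suc n))" "m = - int (Suc n)"
      by (simp_all add: m)
    have "wgt q t (2 * int (Suc n)) * (q ^ Suc n * t - 1) = wgt q t (2 * int n) * (q ^ n - t)"
      using wgt_rec[of n] by (simp add: algebra_simps)
    moreover have p: "q powi (m + 1) = inverse (q ^ n)" "q powi m = inverse (q ^ Suc n)"
    proof -
      show "q powi (m + 1) = inverse (q ^ n)" by (simp only: e(2) power_int_of_nat power_int_minus)
      show "q powi m = inverse (q ^ Suc n)" by (subst e(4)) (simp only: power_int_of_nat power_int_minus)
    qed
    ultimately show ?thesis
    proof -
      assume h: "wgt q t (2 * int (Suc n)) * (q ^ Suc n * t - 1) = wgt q t (2 * int n) * (q ^ n - t)"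
      have "q ^ n * wgt q t (2 * int n) * (1 - t * inverse (q ^ n)) = wgt q t (2 * int n) * (q ^ n - t)"
        by (simp add: field_simps)
      also have "\<dots> = wgt q t (2 * int (Suc n)) * (q ^ Suc n * t - 1)" by (rule h[symmetric])
      also have "\<dots> = q ^ Suc n * wgt q t (2 * int (Suc n)) * (t - inverse (q ^ Suc n))"
        by (simp add: field_simps del: power_Suc)
      finally show ?thesis unfolding p unfolding e(1) unfolding e(3) wgt_neg .
    qed
  qed
qed

end

lemma mu_factor_mfac: "mu_factor = mfac (Fract [:0, 1:] 1)"
  by (simp add: fun_eq_iff mu_factor_def mfac_def PP_def qX_def mu_t_def mu_X_def flip: fps_const_mult)

lemma mu_mlim: "mu = mlim (Fract [:0, 1:] 1)"
proof -
  have "(\<lambda>N. \<Prod>j<N. mu_factor j) = mpart (Fract [:0, 1:] 1)"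
    by (simp add: fun_eq_iff mpart_def mu_factor_mfac)
  then show ?thesis by (simp add: mu_def mlim_def)
qed

lemma mu_coeff_mcoef: "mu_coeff = mcoef (Fract [:0, 1:] 1)"
  by (simp add: fun_eq_iff mu_coeff_def mcoef_def mu_mlim)

lemma Fract_add_1: "Fract (a + b) (1::'a::idom) = Fract a 1 + Fract b 1"
  by simp

lemma Fract_sum: "Fract (sum f A) (1::'a::idom) = (\<Sum>i\<in>A. Fract (f i) 1)"
  by (induction A rule: infinite_finite_induct) (simp_all add: Zero_fract_def Fract_add_1 del: add_fract)

lemma poly2_series_mult: "poly2_series (A * B) = poly2_series A * poly2_series B"
  by (rule fps_ext) (simp add: poly2_series_def fps_mult_nth coeff_mult Fract_sum atMost_atLeast0)

lemma poly2_series_diff: "poly2_series (A - B) = poly2_series A - poly2_series B"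
  by (rule fps_ext) (simp add: poly2_series_def)

lemma poly2_series_1 [simp]: "poly2_series 1 = 1"
  by (rule fps_ext) (simp add: poly2_series_def One_fract_def Zero_fract_def)

lemma poly2_series_q [simp]: "poly2_series [:0, 1:] = fps_X"
  by (rule fps_ext) (auto simp: poly2_series_def One_fract_def Zero_fract_def coeff_pCons split: nat.split)

lemma poly2_series_t [simp]: "poly2_series [:[:0, 1:]:] = fps_const (Fract [:0, 1:] 1)"
  by (rule fps_ext) (auto simp: poly2_series_def Zero_fract_def coeff_pCons split: nat.split)

lemma poly2_series_power: "poly2_series (A ^ n) = poly2_series A ^ n"
  by (induction n) (simp_all add: poly2_series_mult)

lemma poly2_series_prod: "poly2_series (prod f A) = (\<Prod>i\<in>A. poly2_series (f i))"
  by (induction A rule: infinite_finite_induct) (simp_all add: poly2_series_mult)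

lemma poly2_series_inj: "poly2_series A = poly2_series B \<Longrightarrow> A = B"
  by (simp add: poly2_series_def fps_eq_iff poly_eq_iff eq_fract)

lemma mu0_eqI:
  assumes "B \<noteq> 0" "poly2_series B * mu0_series m = poly2_series A"
  shows "mu0 m = Fract A B"
  unfolding mu0_def
proof (rule the_equality)
  show "\<exists>A' B'. B' \<noteq> 0 \<and> Fract A B = Fract A' B' \<and> poly2_series B' * mu0_series m = poly2_series A'"
    using assms by blast
  fix r assume "\<exists>A' B'. B' \<noteq> 0 \<and> r = Fract A' B' \<and> poly2_series B' * mu0_series m = poly2_series A'"
  then obtain A' B' where *: "B' \<noteq> 0" "r = Fract A' B'" "poly2_series B' * mu0_series m = poly2_series A'" by blast
  have "poly2_series (A' * B) = poly2_series (A * B')"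
    unfolding poly2_series_mult *(3)[symmetric] assms(2)[symmetric] by (simp add: ac_simps)
  then have "A' * B = A * B'" by (rule poly2_series_inj)
  then show "r = Fract A B" using * assms by (simp add: eq_fract)
qed

definition qG :: ratfun2 where "qG = Fract [:0, 1:] 1"
definition tG :: ratfun2 where "tG = Fract [:[:0, 1:]:] 1"

abbreviation "qpoly \<equiv> ([:0, 1:] :: int poly poly)"
abbreviation "tpoly \<equiv> ([:[:0, 1:]:] :: int poly poly)"

lemma Fract_power: "Fract A 1 ^ n = Fract (A ^ n) (1 :: 'a::idom)"
  by (induction n) (simp_all add: One_fract_def)

lemma Fract_prod: "(\<And>i. i \<in> I \<Longrightarrow> (B i :: 'a::idom) \<noteq> 0) \<Longrightarrow> Fract (prod A I) (prod B I) = (\<Prod>i\<in>I. Fract (A i) (B i))"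
  by (induction I rule: infinite_finite_induct) (simp_all add: One_fract_def flip: mult_fract)

definition pnum :: "nat \<Rightarrow> int poly poly" where "pnum i = tpoly - qpoly ^ i"
definition pden :: "nat \<Rightarrow> int poly poly" where "pden i = 1 - tpoly * qpoly ^ Suc i"

lemma pden_nz [simp]: "pden i \<noteq> 0"
proof
  assume "pden i = 0"
  then have "poly (pden i) 0 = poly 0 0" by (simp only:)
  then show False by (simp add: pden_def)
qed

lemma Fract_factor: "Fract (pnum i) (pden i) = (tG - qG ^ i) / (1 - tG * qG ^ Suc i)"
proof -
  have "tG - qG ^ i = Fract (pnum i) 1"
    by (simp add: tG_def qG_def Fract_power pnum_def)
  moreover have "1 - tG * qG ^ Suc i = Fract (pden i) 1"
    unfolding tG_def qG_def Fract_power One_fract_def pden_def by (simp del: power_Suc)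
  ultimately show ?thesis by (simp del: power_Suc)
qed

lemma poly2_series_0: "poly2_series 0 = 0"
  by (simp add: poly2_series_def fps_eq_iff Zero_fract_def)

text \<open>
  The recursion for the coefficients of \<open>\<mu>\<close> shows that the quotients of power series are
  rational.
\<close>

theorem mu0_wgt: "mu0 m = wgt qG tG m"
proof -
  have pos: "poly2_series (\<Prod>i<n. pden i) * mu0_series (2 * int n) = poly2_series (\<Prod>i<n. pnum i)" for n
    unfolding pnum_def pden_def poly2_series_prod poly2_series_diff poly2_series_mult poly2_series_power mu0_series_def mu_coeff_mcoef
    using mcoef_prod[of "Fract [:0, 1:] 1" n] by (simp del: power_Suc)
  have nz: "(\<Prod>i<n. pden i) \<noteq> 0" for n by simp
  have F: "Fract (\<Prod>i<n. pnum i) (\<Prod>i<n. pden i) = wgt qG tG (2 * int n)" for n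
    unfolding wgt_pos by (subst Fract_prod) (simp_all del: power_Suc add: Fract_factor)
  show ?thesis
  proof (cases "odd m")
    case True
    then have "mu0_series m = 0" by (simp add: mu0_series_def mu_coeff_mcoef mcoef_odd)
    then have "mu0 m = Fract 0 1" by (intro mu0_eqI) (simp_all add: poly2_series_0)
    with True show ?thesis by (simp add: wgt_odd Zero_fract_def)
  next
    case False
    then obtain l where l: "m = 2 * l" by blast
    show ?thesis
    proof (cases l rule: int_cases2)
      case (nonneg n)
      then show ?thesis using mu0_eqI[OF nz pos] F l by simp
    next
      case (nonpos n)
      have "mu0_series (- (2 * int n)) = fps_X ^ n * mu0_series (2 * int n)"
        by (simp add: mu0_series_def mu_coeff_mcoef mcoef_neg mult.assoc)
      then have "poly2_series (\<Prod>i<n. pden i) * mu0_series (- (2 * int n))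
          = poly2_series (qpoly ^ n * (\<Prod>i<n. pnum i))"
        unfolding poly2_series_mult poly2_series_power pos[symmetric] by (simp add: ac_simps)
      from mu0_eqI[OF nz this] have "mu0 (- (2 * int n)) = Fract (qpoly ^ n) 1 * Fract (\<Prod>i<n. pnum i) (\<Prod>i<n. pden i)"
        unfolding mult_fract mult_1 .
      then show ?thesis using nonpos l unfolding F by (simp add: wgt_neg qG_def Fract_power)
    qed
  qed
qed

section \<open>Specialization\<close>

text \<open>
  Evaluation through a ring homomorphism \<open>h\<close> of the coefficients. Nesting two of these gives
  \<open>poly2_eval\<close>, so that its multiplicativity is proved once for both variables.
\<close>

definition peval :: "('a::comm_ring_1 \<Rightarrow> 'b::comm_ring_1) \<Rightarrow> 'b \<Rightarrow> 'a poly \<Rightarrow> 'b" where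
  "peval h x A = poly (map_poly h A) x"

context
  fixes h :: "'a::comm_ring_1 \<Rightarrow> 'b::comm_ring_1" and x :: 'b
  assumes h0: "h 0 = 0" and h1: "h 1 = 1" and hadd: "\<And>a b. h (a + b) = h a + h b"
    and hmult: "\<And>a b. h (a * b) = h a * h b"
begin

lemma peval_pCons: "peval h x (pCons a A) = h a + x * peval h x A"
  by (simp add: peval_def map_poly_pCons h0)

lemma peval_0: "peval h x 0 = 0"
  by (simp add: peval_def)

lemma peval_1: "peval h x 1 = 1"
  unfolding one_pCons by (simp only: peval_pCons peval_0 h1) simp

lemma peval_add: "peval h x (A + B) = peval h x A + peval h x B"
proof (induction A arbitrary: B)
  case (pCons a A)
  then show ?case
    by (cases B) (simp add: peval_pCons hadd distrib_left add_ac)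
qed (simp add: peval_0)

lemma peval_smult: "peval h x (smult c A) = h c * peval h x A"
  by (induction A) (simp_all add: peval_0 peval_pCons hmult algebra_simps)

lemma peval_mult: "peval h x (A * B) = peval h x A * peval h x B"
  by (induction A) (simp_all add: peval_0 peval_pCons peval_add peval_smult h0 algebra_simps)

end

lemma poly2_eval_peval: "poly2_eval q t = peval (peval of_int t) q"
  by (simp add: fun_eq_iff poly2_eval_def peval_def[abs_def])

lemma of_int_h: "of_int 0 = (0::'k::field)" "of_int 1 = (1::'k)" "of_int (a + b) = (of_int a + of_int b :: 'k)"
  "of_int (a * b) = (of_int a * of_int b :: 'k)"
  by simp_all

lemmas pev1 = peval_0[of of_int, OF of_int_h] peval_1[of of_int, OF of_int_h] peval_add[of of_int, OF of_int_h] peval_mult[of of_int, OF of_int_h]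

lemma p2_0: "poly2_eval q t 0 = 0" and p2_1: "poly2_eval q t 1 = 1"
  and p2_add: "poly2_eval q t (A + B) = poly2_eval q t A + poly2_eval q t B"
  and p2_mult: "poly2_eval q t (A * B) = poly2_eval q t A * poly2_eval q t B"
  unfolding poly2_eval_peval
  by (rule peval_0 peval_1 peval_add peval_mult; rule pev1)+

lemma p2_minus: "poly2_eval q t (- A) = - poly2_eval q t A"
  using p2_add[of q t A "- A"] by (simp add: p2_0 eq_neg_iff_add_eq_0 add.commute)

lemma p2_q: "poly2_eval q t qpoly = q"
  by (simp add: poly2_eval_def map_poly_pCons)

lemma p2_t: "poly2_eval q t tpoly = t"
  by (simp add: poly2_eval_def map_poly_pCons)

context
  fixes q t :: "'k::field"
begin

text \<open>
  By cross multiplication the value does not depend on the fraction.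
\<close>

lemma spec_eq: "poly2_eval q t B \<noteq> 0 \<Longrightarrow> spec q t (Fract A B) = poly2_eval q t A / poly2_eval q t B"
  unfolding spec_def
proof (rule the_equality)
  assume B: "poly2_eval q t B \<noteq> 0"
  then show "\<exists>A' B'. Fract A B = Fract A' B' \<and> poly2_eval q t B' \<noteq> 0 \<and>
      poly2_eval q t A / poly2_eval q t B = poly2_eval q t A' / poly2_eval q t B'" by blast
  fix a assume "\<exists>A' B'. Fract A B = Fract A' B' \<and> poly2_eval q t B' \<noteq> 0 \<and> a = poly2_eval q t A' / poly2_eval q t B'"
  then obtain A' B' where *: "Fract A B = Fract A' B'" "poly2_eval q t B' \<noteq> 0" "a = poly2_eval q t A' / poly2_eval q t B'"
    by blast
  have "B \<noteq> 0" "B' \<noteq> 0" using B *(2) by (auto simp: p2_0)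
  then have "A * B' = A' * B" using * by (simp add: eq_fract)
  then have "poly2_eval q t A * poly2_eval q t B' = poly2_eval q t A' * poly2_eval q t B"
    by (metis p2_mult)
  then show "a = poly2_eval q t A / poly2_eval q t B" using * B by (simp add: frac_eq_eq)
qed

abbreviation "reg \<equiv> regular_at q t"
abbreviation "sp \<equiv> spec q t"

lemma regI: "poly2_eval q t B \<noteq> 0 \<Longrightarrow> reg (Fract A B)"
  by (auto simp: regular_at_def)

lemma regE: assumes "reg r"
  obtains A B where "r = Fract A B" "poly2_eval q t B \<noteq> 0" "B \<noteq> 0" "sp r = poly2_eval q t A / poly2_eval q t B"
  using assms spec_eq unfolding regular_at_def by (metis p2_0)

lemma reg_poly: "reg (Fract A 1)" "sp (Fract A 1) = poly2_eval q t A"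
  by (auto intro!: regI simp: spec_eq p2_1)

lemma reg_0 [simp]: "reg 0" "sp 0 = 0"
  using reg_poly[of 0] by (simp_all add: Zero_fract_def p2_0)

lemma reg_1 [simp]: "reg 1" "sp 1 = 1"
  using reg_poly[of 1] by (simp_all add: One_fract_def p2_1)

lemma reg_q [simp]: "reg qG" "sp qG = q"
  using reg_poly[of qpoly] by (simp_all add: qG_def p2_q)

lemma reg_t [simp]: "reg tG" "sp tG = t"
  using reg_poly[of tpoly] by (simp_all add: tG_def p2_t)

lemma reg_add: assumes "reg r" "reg s" shows "reg (r + s)" "sp (r + s) = sp r + sp s"
proof -
  obtain A B where 1: "r = Fract A B" "poly2_eval q t B \<noteq> 0" "B \<noteq> 0" "sp r = poly2_eval q t A / poly2_eval q t B"
    using assms(1) by (rule regE)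
  obtain C D where 2: "s = Fract C D" "poly2_eval q t D \<noteq> 0" "D \<noteq> 0" "sp s = poly2_eval q t C / poly2_eval q t D"
    using assms(2) by (rule regE)
  have e: "r + s = Fract (A * D + C * B) (B * D)" using 1 2 by simp
  have n: "poly2_eval q t (B * D) \<noteq> 0" using 1 2 by (simp add: p2_mult)
  show "reg (r + s)" unfolding e by (rule regI[OF n])
  show "sp (r + s) = sp r + sp s" unfolding e spec_eq[OF n] using 1 2 by (simp add: p2_mult p2_add field_simps)
qed

lemma reg_mult: assumes "reg r" "reg s" shows "reg (r * s)" "sp (r * s) = sp r * sp s"
proof -
  obtain A B where 1: "r = Fract A B" "poly2_eval q t B \<noteq> 0" "B \<noteq> 0" "sp r = poly2_eval q t A / poly2_eval q t B"
    using assms(1) by (rule regE)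
  obtain C D where 2: "s = Fract C D" "poly2_eval q t D \<noteq> 0" "D \<noteq> 0" "sp s = poly2_eval q t C / poly2_eval q t D"
    using assms(2) by (rule regE)
  have e: "r * s = Fract (A * C) (B * D)" using 1 2 by simp
  have n: "poly2_eval q t (B * D) \<noteq> 0" using 1 2 by (simp add: p2_mult)
  show "reg (r * s)" unfolding e by (rule regI[OF n])
  show "sp (r * s) = sp r * sp s" unfolding e spec_eq[OF n] using 1 2 by (simp add: p2_mult)
qed

lemma reg_minus: assumes "reg r" shows "reg (- r)" "sp (- r) = - sp r"
proof -
  obtain A B where 1: "r = Fract A B" "poly2_eval q t B \<noteq> 0" "B \<noteq> 0" "sp r = poly2_eval q t A / poly2_eval q t B"
    using assms(1) by (rule regE)
  have e: "- r = Fract (- A) B" using 1 by simp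
  show "reg (- r)" unfolding e by (rule regI[OF 1(2)])
  show "sp (- r) = - sp r" unfolding e spec_eq[OF 1(2)] using 1 by (simp add: p2_minus)
qed

lemma reg_diff: assumes "reg r" "reg s" shows "reg (r - s)" "sp (r - s) = sp r - sp s"
  using reg_add[OF assms(1) reg_minus(1)[OF assms(2)]] reg_minus[OF assms(2)] by simp_all

lemma reg_inverse: assumes "reg r" "sp r \<noteq> 0" shows "reg (inverse r)" "sp (inverse r) = inverse (sp r)"
proof -
  obtain A B where 1: "r = Fract A B" "poly2_eval q t B \<noteq> 0" "B \<noteq> 0" "sp r = poly2_eval q t A / poly2_eval q t B"
    using assms(1) by (rule regE)
  have n: "poly2_eval q t A \<noteq> 0" using assms 1 by auto
  have e: "inverse r = Fract B A" using 1 by simp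
  show "reg (inverse r)" unfolding e by (rule regI[OF n])
  show "sp (inverse r) = inverse (sp r)" unfolding e spec_eq[OF n] using 1 by simp
qed

lemma reg_divide: assumes "reg r" "reg s" "sp s \<noteq> 0" shows "reg (r / s)" "sp (r / s) = sp r / sp s"
  using reg_mult[OF assms(1) reg_inverse(1)[OF assms(2,3)]] reg_inverse[OF assms(2,3)]
  by (simp_all add: divide_inverse)

lemma reg_power: assumes "reg r" shows "reg (r ^ n)" "sp (r ^ n) = sp r ^ n"
  by (induction n) (simp_all add: reg_mult assms)

lemma reg_powi: assumes "reg r" "sp r \<noteq> 0" shows "reg (r powi n)" "sp (r powi n) = sp r powi n"
  using reg_power[OF assms(1), of "nat n"] reg_power[OF reg_inverse(1)[OF assms], of "nat (- n)"] reg_inverse[OF assms]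
  by (simp_all add: power_int_def)

lemma reg_sum: assumes "\<And>i. i \<in> I \<Longrightarrow> reg (r i)" shows "reg (sum r I)" "sp (sum r I) = (\<Sum>i\<in>I. sp (r i))"
proof -
  have "reg (sum r I) \<and> sp (sum r I) = (\<Sum>i\<in>I. sp (r i))"
    using assms by (induction I rule: infinite_finite_induct) (auto simp: reg_add)
  then show "reg (sum r I)" "sp (sum r I) = (\<Sum>i\<in>I. sp (r i))" by auto
qed

lemma reg_prod: assumes "\<And>i. i \<in> I \<Longrightarrow> reg (r i)" shows "reg (prod r I)" "sp (prod r I) = (\<Prod>i\<in>I. sp (r i))"
proof -
  have "reg (prod r I) \<and> sp (prod r I) = (\<Prod>i\<in>I. sp (r i))"
    using assms by (induction I rule: infinite_finite_induct) (auto simp: reg_mult)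
  then show "reg (prod r I)" "sp (prod r I) = (\<Prod>i\<in>I. sp (r i))" by auto
qed

lemmas reg_intros = reg_add reg_mult reg_minus reg_diff reg_power

definition regp :: "ratfun2 lpoly \<Rightarrow> bool" where "regp f \<longleftrightarrow> (\<forall>j. reg (cf f j))"
abbreviation SP :: "ratfun2 lpoly \<Rightarrow> 'k lpoly" where "SP f \<equiv> Poly_Mapping.map sp f"

lemma cf_SP [simp]: "cf (SP f) j = sp (cf f j)"
  by (simp add: Poly_Mapping.map.rep_eq when_def)

lemma supp_SP: "supp (SP f) \<subseteq> supp f"
  by (auto simp: in_keys_iff)

lemma SP_scal: "reg c \<Longrightarrow> regp f \<Longrightarrow> regp (scal c f) \<and> SP (scal c f) = scal (sp c) (SP f)"
  by (auto simp: regp_def reg_mult intro!: poly_mapping_eqI)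

lemma SP_add: "regp f \<Longrightarrow> regp g \<Longrightarrow> regp (f + g) \<and> SP (f + g) = SP f + SP g"
  by (auto simp: regp_def reg_add lookup_add intro!: poly_mapping_eqI)

lemma cf_Th_superset: "finite A \<Longrightarrow> supp f \<subseteq> A \<Longrightarrow> cf (Th u f) k = (\<Sum>j\<in>A. cf f j * cf (Th u (mon j)) k)"
  for f :: "'b::field lpoly"
  by (subst cf_Th_expand) (auto intro!: sum.mono_neutral_left simp: in_keys_iff)

lemma reg_Th_mon: "reg (cf (Th tG (mon j)) k) \<and> sp (cf (Th tG (mon j)) k) = cf (Th t (mon j)) k"
  by (auto simp: cf_Th_mon cf_dmon reg_intros)

lemma SP_Th: "regp f \<Longrightarrow> regp (Th tG f) \<and> SP (Th tG f) = Th t (SP f)"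
proof -
  assume f: "regp f"
  have "reg (cf (Th tG f) k) \<and> sp (cf (Th tG f) k) = cf (Th t (SP f)) k" for k
  proof -
    have 1: "cf (Th tG f) k = (\<Sum>j\<in>supp f. cf f j * cf (Th tG (mon j)) k)"
      by (rule cf_Th_superset) auto
    have 2: "cf (Th t (SP f)) k = (\<Sum>j\<in>supp f. cf (SP f) j * cf (Th t (mon j)) k)"
      by (rule cf_Th_superset) (use supp_SP in auto)
    show ?thesis unfolding 1 2 using f reg_Th_mon by (auto simp: regp_def reg_sum reg_mult)
  qed
  then show ?thesis by (auto simp: regp_def intro!: poly_mapping_eqI)
qed

lemma SP_up: "q \<noteq> 0 \<Longrightarrow> regp f \<Longrightarrow> regp (up qG m f) \<and> SP (up qG m f) = up q m (SP f)"
  by (auto simp: regp_def cf_up reg_mult reg_powi intro!: poly_mapping_eqI)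

text \<open>
  The recursion for \<open>E\<close> divides only by \<open>q\<^sup>m t - 1\<close> with \<open>m > 0\<close>, so it commutes with
  specialization.
\<close>

lemma SP_Eneg:
  assumes q: "q \<noteq> 0" and qt: "\<And>m::nat. m > 0 \<Longrightarrow> q ^ m * t \<noteq> 1"
  shows "regp (Eneg qG tG m) \<and> SP (Eneg qG tG m) = Eneg q t m"
proof (induction m)
  case 0
  show ?case by (auto simp: regp_def lookup_one when_def intro!: poly_mapping_eqI)
next
  case (Suc m)
  let ?u = "up qG m (Eneg qG tG m)"
  have u: "regp ?u" "SP ?u = up q m (Eneg q t m)" using SP_up[OF q] Suc by auto
  have a: "reg (alph qG tG (Suc m))" "sp (alph qG tG (Suc m)) = alph q t (Suc m)"
    using qt[of "Suc m"] unfolding alph_def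
    by (subst reg_divide; simp add: reg_diff reg_mult reg_power del: power_Suc)+
  have 1: "regp (Th tG ?u)" "SP (Th tG ?u) = Th t (SP ?u)" using SP_Th[OF u(1)] by auto
  have 2: "regp (scal (alph qG tG (Suc m)) ?u)" "SP (scal (alph qG tG (Suc m)) ?u) = scal (alph q t (Suc m)) (SP ?u)"
    using SP_scal[OF a(1) u(1)] a by auto
  show ?case using SP_add[OF 1(1) 2(1)] 1 2 u by simp
qed

lemma SP_E:
  assumes q: "q \<noteq> 0" and qt: "\<And>m::nat. m > 0 \<Longrightarrow> q ^ m * t \<noteq> 1"
  shows "regp (E qG tG n)" "SP (E qG tG n) = E q t n"
  using SP_Eneg[OF assms] SP_up[OF q] by (auto simp: E_def)

lemma spec_wgt:
  assumes qt: "\<And>m::nat. m > 0 \<Longrightarrow> q ^ m * t \<noteq> 1"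
  shows "reg (wgt qG tG m)" "sp (wgt qG tG m) = wgt q t m"
proof -
  have nz: "1 - t * q ^ Suc i \<noteq> 0" for i using qt[of "Suc i"] by (simp add: mult.commute)
  have f: "reg ((tG - qG ^ i) / (1 - tG * qG ^ Suc i))" "sp ((tG - qG ^ i) / (1 - tG * qG ^ Suc i)) = (t - q ^ i) / (1 - t * q ^ Suc i)" for i
    using nz[of i] by (subst reg_divide; simp add: reg_diff reg_mult reg_power del: power_Suc)+
  show "reg (wgt qG tG m)" "sp (wgt qG tG m) = wgt q t m"
    unfolding wgt_def using f by (auto simp: reg_mult reg_power reg_prod simp del: power_Suc)
qed

end

section \<open>The generic nonsymmetric polynomials\<close>

text \<open>
  Inequalities between rational functions are read off at a rational point, with \<open>q = 2\<close> and
  \<open>t = -1\<close> or \<open>1\<close>.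
\<close>

lemma generic_neqI: "spec q t r \<noteq> spec q t s \<Longrightarrow> r \<noteq> s"
  by auto

lemma qG_nz [simp]: "qG \<noteq> 0" by (rule generic_neqI[of 2 "1::rat"]) simp
lemma tG_nz [simp]: "tG \<noteq> 0" by (rule generic_neqI[of 2 "1::rat"]) simp

lemma spec_qG_powi: "spec 2 t (qG powi a) = (2::rat) powi a"
  by (subst reg_powi) simp_all

lemma two_powi_inj: "(2::rat) powi a = 2 powi b \<Longrightarrow> a = b"
  using power_int_strict_increasing[of a b "2::rat"] power_int_strict_increasing[of b a "2::rat"]
  by (cases a b rule: linorder_cases) auto

lemma two_powi_pos: "(2::rat) powi a > 0"
  by (rule zero_less_power_int) simp

global_interpretation G: dunkl qG tG "\<lambda>j. qG powi (j div 2)"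
proof
  show "qG powi (0 div 2) = 1" by simp
  show "qG powi (j div 2) \<noteq> 0" for j by simp
  show "qG powi ((j + 2) div 2) = qG * qG powi (j div 2)" for j by (simp add: power_int_add)
  show "qG ^ m * tG \<noteq> 1" if "m > 0" for m
  proof (rule generic_neqI[of 2 "- 1 :: rat"])
    have "(2::rat) ^ m \<noteq> - 1"
    proof
      assume eq: "(2::rat) ^ m = - 1"
      have "(0::rat) < 2 ^ m" by simp
      then show False unfolding eq by simp
    qed
    then show "spec 2 (- 1) (qG ^ m * tG) \<noteq> (spec 2 (- 1) 1 :: rat)"
      by (simp add: reg_mult reg_power)
  qed
qed simp_all

global_interpretation GS: dunkl_sep qG tG "\<lambda>j. qG powi (j div 2)" "wgt qG tG"
proof -
  interpret dunkl_form qG tG "\<lambda>j. qG powi (j div 2)" "wgt qG tG" by (rule G.wgt_form)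
  have inj: "qG powi a = qG powi b \<Longrightarrow> a = b" for a b
    using two_powi_inj[of a b] by (metis spec_qG_powi)
  have no: "qG powi a * tG \<noteq> qG powi b" for a b
  proof (rule generic_neqI[of 2 "- 1 :: rat"])
    show "spec 2 (- 1) (qG powi a * tG) \<noteq> (spec 2 (- 1) (qG powi b) :: rat)"
    proof -
      have "- (2 powi a) \<noteq> (2::rat) powi b" using two_powi_pos[of a] two_powi_pos[of b] by linarith
      then show ?thesis by (simp add: reg_mult reg_powi)
    qed
  qed
  show "dunkl_sep qG tG (\<lambda>j. qG powi (j div 2)) (wgt qG tG)"
  proof
    fix m n :: int
    assume *: "G.lam m = G.lam n" "even (m - n)"
    then have "(- m) div 2 = (- n) div 2"
      using inj[of "(- m) div 2" "(- n) div 2"] no[of "(- m) div 2" "(- n) div 2"] no[of "(- n) div 2" "(- m) div 2"]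
      unfolding G.lam_def by (auto split: if_splits)
    with *(2) show "m = n" by presburger
  qed
qed

lemma GS_nrm_nz: "GS.nrm n \<noteq> 0"
proof -
  have two: "(2::rat) ^ m \<noteq> 1" if "m > 0" for m
  proof -
    have "1 < (2::rat) ^ m" by (rule one_less_power) (use that in auto)
    then show ?thesis by linarith
  qed
  have q1: "qG ^ m \<noteq> 1" if "m > 0" for m
    by (rule generic_neqI[of 2 "1 :: rat"]) (use two[OF that] in \<open>simp add: reg_power\<close>)
  have q2: "qG ^ m * tG\<^sup>2 \<noteq> 1" if "m > 0" for m
    by (rule generic_neqI[of 2 "1 :: rat"]) (use two[OF that] in \<open>simp add: reg_power reg_mult\<close>)
  have neg: "GS.nrm (- int m) \<noteq> 0" for m
  proof (induction m)
    case (Suc m)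
    have "GS.nrm (int (Suc m)) \<noteq> 0" using GS.nrm_up[of m] Suc by (simp add: add.commute)
    then show ?case using GS.nrm_eq_0_iff[of "Suc m", OF q1] q2[of "Suc m"] by blast
  qed (simp add: GS.nrm_0)
  show ?thesis using neg GS.nrm_up by (cases n rule: E_cases) auto
qed

text \<open>
  The difference of two solutions is a combination of lower \<open>E q t j\<close>. Its pairing with
  \<open>X\<^sup>j\<close>, for the lowest \<open>j\<close> that occurs, is the coefficient at \<open>j\<close> times a non-zero norm;
  but it has to vanish.
\<close>

theorem e_gen_E: "e_gen n = E qG tG n"
  unfolding e_gen_def
proof (rule the_equality, intro conjI)
  have mu: "mu0 = wgt qG tG" by (simp add: fun_eq_iff mu0_wgt)
  show "cf (E qG tG n) n = 1" by simp
  show "\<forall>j\<in>supp (E qG tG n). j = n \<or> prec j n" using tri_E[of n qG tG] by (auto simp: tri_def rk_le)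
  show "\<forall>m. prec m n \<longrightarrow> const_term mu0 (E qG tG n * mon (- m)) = 0" using GS.W_E_orth by (simp add: mu)
  fix f assume f: "cf f n = 1 \<and> (\<forall>j\<in>supp f. j = n \<or> prec j n) \<and> (\<forall>m. prec m n \<longrightarrow> const_term mu0 (f * mon (- m)) = 0)"
  define d where "d = f - E qG tG n"
  have d: "rk j < rk n" if "j \<in> supp d" for j
  proof -
    have "cf d n = 0" using f by (simp add: d_def lookup_minus)
    then have "j \<noteq> n" using that by (auto simp: in_keys_iff)
    moreover have "j \<in> supp f \<or> j \<in> supp (E qG tG n)" using that by (auto simp: in_keys_iff d_def lookup_minus)
    ultimately show ?thesis using f tri_E[of n qG tG] by (auto simp: tri_def rk_le prec_rk)
  qed
  have dW: "const_term mu0 (d * mon (- m)) = 0" if "prec m n" for m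
    using f GS.W_E_orth[OF that] that by (simp add: d_def left_diff_distrib ct_simps mu)
  obtain c where c: "d = lincomb (E qG tG) c" "\<And>B. (\<forall>j\<in>supp d. rk j \<le> B) \<Longrightarrow> (\<forall>j\<in>supp c. rk j \<le> B)"
    using tri_expand[of "E qG tG" d] tri_E by blast
  have "d = 0"
  proof (rule ccontr)
    assume "d \<noteq> 0"
    then have ne: "supp d \<noteq> {}" "supp c \<noteq> {}" using c by auto
    have "\<forall>j\<in>supp d. rk j \<le> rk n - 1" using d by fastforce
    then have cn: "\<forall>j\<in>supp c. rk j \<le> rk n - 1" by (rule c(2))
    have "rk n > 0" using d ne by fastforce
    obtain j where j: "j \<in> supp c" "rk j = Min (rk ` supp c)"
      by (metis (mono_tags, lifting) Min_in finite_imageI finite_keys imageE image_is_empty ne(2))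
    have "const_term (wgt qG tG) (d * mon (- j)) = cf c j * GS.nrm j"
      unfolding c(1) by (rule GS.orth_lincomb[OF GS_nrm_nz j(1)])
         (metis Min_le finite_imageI finite_keys imageI j(2) leD)
    moreover have "prec j n" using cn j \<open>rk n > 0\<close> by (fastforce simp: prec_rk)
    ultimately have "cf c j * GS.nrm j = 0" using dW[of j] by (simp add: mu)
    then show False using GS_nrm_nz j by (simp add: in_keys_iff)
  qed
  then show "f = E qG tG n" by (simp add: d_def)
qed

lemma e_pol_E:
  fixes q t :: "'k::field"
  assumes q: "q \<noteq> 0" and qt: "\<And>m::nat. m > 0 \<Longrightarrow> q ^ m * t \<noteq> 1"
  shows "e_pol q t n = E q t n" "e_well_defined q t n"
  using SP_E[OF assms, of n] by (auto simp: e_pol_def e_gen_E e_well_defined_def regp_def)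

lemma mu0_spec:
  fixes q t :: "'k::field"
  assumes qt: "\<And>m::nat. m > 0 \<Longrightarrow> q ^ m * t \<noteq> 1"
  shows "spec q t (mu0 m) = wgt q t m" "regular_at q t (mu0 m)"
  using spec_wgt[OF qt] by (simp_all add: mu0_wgt)

lemma const_term_mu0_regular:
  fixes q t :: "'k::field"
  assumes qt: "\<And>m::nat. m > 0 \<Longrightarrow> q ^ m * t \<noteq> 1"
  shows "regular_at q t (const_term mu0 (mon i * mon (- j)))"
  using mu0_spec(2)[OF qt] by simp

section \<open>Linear algebra in the space of Laurent polynomials\<close>

definition subsp :: "'k::field lpoly set \<Rightarrow> bool" where
  "subsp S \<longleftrightarrow> 0 \<in> S \<and> (\<forall>f\<in>S. \<forall>g\<in>S. f + g \<in> S) \<and> (\<forall>c. \<forall>f\<in>S. scal c f \<in> S)"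

lemma subspI: "0 \<in> S \<Longrightarrow> (\<And>f g. f \<in> S \<Longrightarrow> g \<in> S \<Longrightarrow> f + g \<in> S) \<Longrightarrow> (\<And>c f. f \<in> S \<Longrightarrow> scal c f \<in> S) \<Longrightarrow> subsp S"
  by (simp add: subsp_def)

lemma subsp_0: "subsp S \<Longrightarrow> 0 \<in> S"
  and subsp_add: "subsp S \<Longrightarrow> f \<in> S \<Longrightarrow> g \<in> S \<Longrightarrow> f + g \<in> S"
  and subsp_scal: "subsp S \<Longrightarrow> f \<in> S \<Longrightarrow> scal c f \<in> S"
  by (auto simp: subsp_def)

lemma subsp_minus: "subsp S \<Longrightarrow> f \<in> S \<Longrightarrow> - f \<in> S"
  by (metis scal_neg_one subsp_scal)

lemma subsp_diff: "subsp S \<Longrightarrow> f \<in> S \<Longrightarrow> g \<in> S \<Longrightarrow> f - g \<in> S"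
  by (metis subsp_add subsp_minus diff_conv_add_uminus)

lemma subsp_sum: "subsp S \<Longrightarrow> (\<And>i. i \<in> I \<Longrightarrow> f i \<in> S) \<Longrightarrow> sum f I \<in> S"
  by (induction I rule: infinite_finite_induct) (auto simp: subsp_0 subsp_add)

lemma subsp_lincomb: "subsp S \<Longrightarrow> (\<And>i. i \<in> supp c \<Longrightarrow> b i \<in> S) \<Longrightarrow> lincomb b c \<in> S"
  unfolding lincomb_def by (rule subsp_sum) (auto intro: subsp_scal)

lemma subsp_scal_iff: "subsp S \<Longrightarrow> c \<noteq> 0 \<Longrightarrow> scal c f \<in> S \<longleftrightarrow> f \<in> S"
  by (metis subsp_scal scal_scal scal_one left_inverse)

lemma subsp_UNIV [simp]: "subsp UNIV" and subsp_zero [simp]: "subsp {0}"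
  by (auto simp: subsp_def)

text \<open>
  Eigenvectors to distinct eigenvalues are independent, also modulo an invariant subspace.
\<close>

lemma eig_sum:
  assumes A: "lin A" and J: "subsp J" "\<And>f. f \<in> J \<Longrightarrow> A f \<in> J" and "finite I"
    and "\<And>i. i \<in> I \<Longrightarrow> A (u i) = scal (l i) (u i)" "inj_on l I" "(\<Sum>i\<in>I. u i) \<in> J" "i \<in> I"
  shows "u i \<in> J"
  using assms(4-)
proof (induction I arbitrary: u i rule: finite_induct)
  case (insert a I)
  have "A (\<Sum>i\<in>insert a I. u i) - scal (l a) (\<Sum>i\<in>insert a I. u i) \<in> J"
    by (intro subsp_diff subsp_scal J insert.prems)
  also have "A (\<Sum>i\<in>insert a I. u i) - scal (l a) (\<Sum>i\<in>insert a I. u i)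
      = (\<Sum>i\<in>insert a I. scal (l i - l a) (u i))"
    by (simp add: lin_simps[OF A] insert.prems(1) scal_sum scal_diff_left sum_subtractf del: sum.insert)
  also have "\<dots> = (\<Sum>i\<in>I. scal (l i - l a) (u i))"
    using insert.hyps by simp
  finally have s: "(\<Sum>i\<in>I. scal (l i - l a) (u i)) \<in> J" .
  have uI: "u j \<in> J" if j: "j \<in> I" for j
  proof -
    have "scal (l j - l a) (u j) \<in> J"
      by (rule insert.IH[OF _ _ s j]) (use insert.prems in \<open>auto simp: lin_simps[OF A] mult.commute\<close>)
    moreover have "l j \<noteq> l a" using insert.prems(2) insert.hyps(2) j by (auto simp: inj_on_def)
    ultimately show ?thesis using J(1) by (simp add: subsp_scal_iff)
  qed
  have "(\<Sum>i\<in>insert a I. u i) - (\<Sum>i\<in>I. u i) \<in> J"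
    by (intro subsp_diff subsp_sum J insert.prems uI)
  then have "u a \<in> J" using insert.hyps by simp
  with uI insert.prems show ?case by auto
qed simp

text \<open>
  Gaussian elimination: fewer equations than unknowns have a non-trivial solution.
\<close>

lemma homog_system:
  fixes A :: "'a \<Rightarrow> 'b \<Rightarrow> 'k::field"
  assumes "finite J"
  shows "finite I \<Longrightarrow> card J < card I \<Longrightarrow> \<exists>x. (\<exists>i\<in>I. x i \<noteq> 0) \<and> (\<forall>j\<in>J. (\<Sum>i\<in>I. x i * A i j) = 0)"
  using assms
proof (induction J arbitrary: I A rule: finite_induct)
  case empty
  then obtain i where "i \<in> I" by (metis card.empty less_irrefl ex_in_conv)
  then show ?case by (intro exI[of _ "\<lambda>_. 1"]) auto
next
  case (insert j0 J)
  show ?case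
  proof (cases "\<forall>i\<in>I. A i j0 = 0")
    case True
    have "card J < card I" using insert by simp
    then obtain x where "\<exists>i\<in>I. x i \<noteq> 0" "\<forall>j\<in>J. (\<Sum>i\<in>I. x i * A i j) = 0"
      using insert.IH[OF insert.prems(1), of A] by blast
    with True show ?thesis by (intro exI[of _ x]) auto
  next
    case False
    then obtain i0 where i0: "i0 \<in> I" "A i0 j0 \<noteq> 0" by blast
    define B where "B = (\<lambda>i j. A i j - A i j0 / A i0 j0 * A i0 j)"
    have "card J < card (I - {i0})" using insert i0 by simp
    then obtain x where x: "\<exists>i\<in>I - {i0}. x i \<noteq> 0" "\<forall>j\<in>J. (\<Sum>i\<in>I - {i0}. x i * B i j) = 0"
      using insert.IH[of "I - {i0}" B] insert.prems by auto
    define S where "S = (\<Sum>i\<in>I - {i0}. x i * A i j0)"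
    define y where "y = x(i0 := - S / A i0 j0)"
    have sum: "(\<Sum>i\<in>I. y i * A i j) = (\<Sum>i\<in>I - {i0}. x i * A i j) - S / A i0 j0 * A i0 j" for j
    proof -
      have "(\<Sum>i\<in>I. y i * A i j) = y i0 * A i0 j + (\<Sum>i\<in>I - {i0}. y i * A i j)"
        using i0 insert.prems by (simp add: sum.remove)
      also have "(\<Sum>i\<in>I - {i0}. y i * A i j) = (\<Sum>i\<in>I - {i0}. x i * A i j)"
        by (intro sum.cong) (auto simp: y_def)
      finally show ?thesis by (simp add: y_def)
    qed
    have "(\<Sum>i\<in>I. y i * A i j) = 0" if j: "j \<in> insert j0 J" for j
    proof (cases "j = j0")
      case True
      then show ?thesis unfolding sum using i0 by (simp add: S_def)
    next
      case False
      then have "(\<Sum>i\<in>I - {i0}. x i * B i j) = 0" using x j by auto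
      moreover have "(\<Sum>i\<in>I - {i0}. x i * B i j) = (\<Sum>i\<in>I - {i0}. x i * A i j) - S / A i0 j0 * A i0 j"
        by (simp add: B_def S_def right_diff_distrib sum_subtractf sum_distrib_right sum_divide_distrib mult.assoc)
      ultimately show ?thesis unfolding sum by simp
    qed
    moreover have "\<exists>i\<in>I. y i \<noteq> 0" using x by (auto simp: y_def)
    ultimately show ?thesis by blast
  qed
qed

definition codim_le :: "'k::field lpoly set \<Rightarrow> nat \<Rightarrow> bool" where
  "codim_le J d \<longleftrightarrow> (\<exists>b. \<forall>f. \<exists>a. f - (\<Sum>j<d. scal (a j) (b j)) \<in> J)"

lemma codim_dep:
  assumes J: "subsp J" and d: "codim_le J d"
  shows "\<exists>x. (\<exists>i\<le>d. x i \<noteq> 0) \<and> (\<Sum>i\<le>d. scal (x i) (u i)) \<in> J"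
proof -
  from d obtain b a where a: "\<And>f. f - (\<Sum>j<d. scal (a f j) (b j)) \<in> J"
    unfolding codim_le_def by metis
  obtain x where x: "\<exists>i\<in>{..d}. x i \<noteq> 0" "\<forall>j\<in>{..<d}. (\<Sum>i\<in>{..d}. x i * a (u i) j) = 0"
    using homog_system[of "{..<d}" "{..d}" "\<lambda>i j. a (u i) j"] by auto
  have "(\<Sum>i\<le>d. scal (x i) (u i - (\<Sum>j<d. scal (a (u i) j) (b j)))) \<in> J"
    by (intro subsp_sum subsp_scal J a)
  also have "(\<Sum>i\<le>d. scal (x i) (u i - (\<Sum>j<d. scal (a (u i) j) (b j))))
      = (\<Sum>i\<le>d. scal (x i) (u i)) - (\<Sum>i\<le>d. \<Sum>j<d. scal (x i * a (u i) j) (b j))"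
    by (simp add: scal_diff scal_sum sum_subtractf)
  also have "(\<Sum>i\<le>d. \<Sum>j<d. scal (x i * a (u i) j) (b j)) = (\<Sum>j<d. scal (\<Sum>i\<le>d. x i * a (u i) j) (b j))"
  proof (subst sum.swap, intro sum.cong refl)
    fix j
    show "(\<Sum>i\<le>d. scal (x i * a (u i) j) (b j)) = scal (\<Sum>i\<le>d. x i * a (u i) j) (b j)"
      by (rule poly_mapping_eqI) (simp add: lookup_sum sum_distrib_right)
  qed
  also have "\<dots> = 0" using x by (intro sum.neutral) auto
  finally show ?thesis using x by auto
qed

lemma codim_eig:
  assumes A: "lin A" and J: "subsp J" "\<And>f. f \<in> J \<Longrightarrow> A f \<in> J" and d: "codim_le J d"
    and u: "\<And>i::nat. A (u i) = scal (l i) (u i)" and l: "inj l"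
  shows "\<exists>i\<le>d. u i \<in> J"
proof -
  obtain x i where x: "i \<le> d" "x i \<noteq> 0" "(\<Sum>i\<le>d. scal (x i) (u i)) \<in> J"
    using codim_dep[OF J(1) d, of u] by blast
  have "scal (x i) (u i) \<in> J"
  proof (rule eig_sum[where u = "\<lambda>i. scal (x i) (u i)" and l = l and I = "{..d}", OF A J])
    show "finite {..d}" "i \<in> {..d}" "(\<Sum>i\<in>{..d}. scal (x i) (u i)) \<in> J" using x by auto
    show "inj_on l {..d}" using l by (rule inj_on_subset) auto
    show "A (scal (x i) (u i)) = scal (l i) (scal (x i) (u i))" for i
      by (simp add: lin_simps[OF A] u mult.commute)
  qed
  then show ?thesis using x J(1) by (auto simp: subsp_scal_iff)
qed

section \<open>Modules presented by Laurent polynomials\<close>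

lemma ring_type_simps [simp]:
  "carrier ring_of_type_algebra = UNIV" "x \<otimes>\<^bsub>ring_of_type_algebra\<^esub> y = x * y" "\<one>\<^bsub>ring_of_type_algebra\<^esub> = 1"
  "\<zero>\<^bsub>ring_of_type_algebra\<^esub> = 0" "x \<oplus>\<^bsub>ring_of_type_algebra\<^esub> y = x + y"
  by (simp_all add: ring_of_type_algebra_def)

text \<open>
  \<open>M\<close> is the image of the subspace \<open>S\<close> under the linear map \<open>h\<close>, whose kernel on \<open>S\<close> is \<open>R\<close>.
  Every module that occurs is of this form, and thus statements about it become statements
  about Laurent polynomials modulo \<open>R\<close>.
\<close>

locale presented =
  fixes M :: "('k::field, 'v, 'c) module_scheme" and h :: "'k lpoly \<Rightarrow> 'v" and S R :: "'k lpoly set"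
  assumes S: "subsp S" and car: "carrier M = h ` S" and h0: "\<zero>\<^bsub>M\<^esub> = h 0"
    and hadd: "\<And>f g. f \<in> S \<Longrightarrow> g \<in> S \<Longrightarrow> h f \<oplus>\<^bsub>M\<^esub> h g = h (f + g)"
    and hscal: "\<And>c f. f \<in> S \<Longrightarrow> c \<odot>\<^bsub>M\<^esub> h f = h (scal c f)"
    and ker: "\<And>f. f \<in> S \<Longrightarrow> h f = h 0 \<longleftrightarrow> f \<in> R"
begin

lemma abelian_group: "abelian_group M"
proof (rule abelian_groupI)
  fix x assume "x \<in> carrier M"
  then obtain f where f: "x = h f" "f \<in> S" by (auto simp: car)
  then show "\<exists>y\<in>carrier M. y \<oplus>\<^bsub>M\<^esub> x = \<zero>\<^bsub>M\<^esub>"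
    using S by (intro bexI[of _ "h (- f)"]) (auto simp: car hadd h0 subsp_minus)
qed (use S in \<open>auto simp: car hadd h0 subsp_add subsp_0 add.commute add.left_commute\<close>)

sublocale mod: module ring_of_type_algebra M
  by (rule moduleI) (use S abelian_group cring_from_type_algebra in
      \<open>auto simp: car hadd hscal subsp_add subsp_scal scal_add scal_add_left\<close>)

lemma h_in: "f \<in> S \<Longrightarrow> h f \<in> carrier M"
  by (auto simp: car)

lemma hminus: "f \<in> S \<Longrightarrow> \<ominus>\<^bsub>M\<^esub> h f = h (- f)"
  by (rule mod.minus_equality) (use S in \<open>auto simp: car hadd h0 subsp_minus\<close>)

lemma hdiff: "f \<in> S \<Longrightarrow> g \<in> S \<Longrightarrow> h f \<ominus>\<^bsub>M\<^esub> h g = h (f - g)"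
  using S by (simp add: a_minus_def hminus hadd subsp_minus)

lemma h_eq_iff: "f \<in> S \<Longrightarrow> g \<in> S \<Longrightarrow> h f = h g \<longleftrightarrow> f - g \<in> R"
proof -
  assume fg: "f \<in> S" "g \<in> S"
  then have fg': "f - g \<in> S" "- g \<in> S" using S by (auto simp: subsp_diff subsp_minus)
  show "h f = h g \<longleftrightarrow> f - g \<in> R"
  proof
    assume eq: "h f = h g"
    have "h (f - g) = h f \<oplus>\<^bsub>M\<^esub> h (- g)" using fg fg' by (simp add: hadd)
    also have "\<dots> = h 0" using fg fg' by (simp add: eq hadd)
    finally show "f - g \<in> R" using ker fg' by blast
  next
    assume "f - g \<in> R"
    then have "h (f - g) = h 0" using ker fg' by blast
    then have "h (f - g) \<oplus>\<^bsub>M\<^esub> h g = h 0 \<oplus>\<^bsub>M\<^esub> h g" by simp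
    then show "h f = h g" using fg fg' S by (simp add: hadd subsp_0)
  qed
qed

lemma hsum: "(\<And>i. i \<in> I \<Longrightarrow> g i \<in> S) \<Longrightarrow> finite I \<Longrightarrow> (\<Oplus>\<^bsub>M\<^esub>i\<in>I. h (g i)) = h (sum g I)"
proof (induction I rule: infinite_finite_induct)
  case (insert a I)
  have "(\<Oplus>\<^bsub>M\<^esub>i\<in>insert a I. h (g i)) = h (g a) \<oplus>\<^bsub>M\<^esub> (\<Oplus>\<^bsub>M\<^esub>i\<in>I. h (g i))"
    using insert by (intro mod.finsum_insert) (auto intro: h_in)
  also have "\<dots> = h (g a) \<oplus>\<^bsub>M\<^esub> h (sum g I)" using insert by auto
  also have "\<dots> = h (g a + sum g I)" using insert S by (intro hadd subsp_sum) auto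
  finally show ?case using insert by simp
qed (auto simp: h0)

lemma hlincomb:
  assumes "\<And>i. i \<in> supp c \<Longrightarrow> b i \<in> S \<and> B i = h (b i)"
  shows "(\<Oplus>\<^bsub>M\<^esub>i\<in>supp c. cf c i \<odot>\<^bsub>M\<^esub> B i) = h (lincomb b c)"
proof -
  have "(\<Oplus>\<^bsub>M\<^esub>i\<in>supp c. cf c i \<odot>\<^bsub>M\<^esub> B i) = (\<Oplus>\<^bsub>M\<^esub>i\<in>supp c. h (scal (cf c i) (b i)))"
    using assms S by (intro mod.finsum_cong') (auto simp: hscal intro!: h_in subsp_scal)
  also have "\<dots> = h (lincomb b c)"
    unfolding lincomb_def using assms S by (intro hsum) (auto intro: subsp_scal)
  finally show ?thesis .
qed

lemma has_basisI:
  assumes b: "\<And>i. i \<in> I \<Longrightarrow> b i \<in> S \<and> B i = h (b i)"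
    and span: "\<And>f. f \<in> S \<Longrightarrow> \<exists>c. supp c \<subseteq> I \<and> f - lincomb b c \<in> R"
    and indep: "\<And>c. supp c \<subseteq> I \<Longrightarrow> lincomb b c \<in> R \<Longrightarrow> c = 0"
  shows "has_basis M B I"
  unfolding has_basis_def
proof (intro conjI ballI)
  show "B \<in> I \<rightarrow> carrier M" using b h_in by auto
  fix v assume "v \<in> carrier M"
  then obtain f where f: "v = h f" "f \<in> S" by (auto simp: car)
  have lc: "(\<Oplus>\<^bsub>M\<^esub>i\<in>supp c. cf c i \<odot>\<^bsub>M\<^esub> B i) = h (lincomb b c)" "lincomb b c \<in> S" if "supp c \<subseteq> I" for c
    using b that S by (auto intro!: hlincomb subsp_lincomb)
  show "\<exists>!c. supp c \<subseteq> I \<and> v = (\<Oplus>\<^bsub>M\<^esub>i\<in>supp c. cf c i \<odot>\<^bsub>M\<^esub> B i)"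
  proof (rule ex_ex1I)
    obtain c where "supp c \<subseteq> I" "f - lincomb b c \<in> R" using span[OF f(2)] by blast
    then show "\<exists>c. supp c \<subseteq> I \<and> v = (\<Oplus>\<^bsub>M\<^esub>i\<in>supp c. cf c i \<odot>\<^bsub>M\<^esub> B i)"
      using lc f h_eq_iff by auto
    fix c d assume *: "supp c \<subseteq> I \<and> v = (\<Oplus>\<^bsub>M\<^esub>i\<in>supp c. cf c i \<odot>\<^bsub>M\<^esub> B i)"
      "supp d \<subseteq> I \<and> v = (\<Oplus>\<^bsub>M\<^esub>i\<in>supp d. cf d i \<odot>\<^bsub>M\<^esub> B i)"
    then have "lincomb b c - lincomb b d \<in> R" using lc h_eq_iff by metis
    then have "lincomb b (c - d) \<in> R" by (simp add: lincomb_diff)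
    moreover have "supp (c - d) \<subseteq> I" using * keys_diff[of c d] by blast
    ultimately have "c - d = 0" by (intro indep)
    then show "c = d" by simp
  qed
qed

lemma has_basis_span:
  assumes "has_basis M B I" and b: "\<And>i. i \<in> I \<Longrightarrow> b i \<in> S \<and> B i = h (b i)" and f: "f \<in> S"
  shows "\<exists>c. supp c \<subseteq> I \<and> f - lincomb b c \<in> R"
proof -
  obtain c where c: "supp c \<subseteq> I" "h f = (\<Oplus>\<^bsub>M\<^esub>i\<in>supp c. cf c i \<odot>\<^bsub>M\<^esub> B i)"
    using assms(1) h_in[OF f] unfolding has_basis_def by blast
  then have "h f = h (lincomb b c)" using b by (subst hlincomb[symmetric]) auto
  moreover have "lincomb b c \<in> S" using b c S by (intro subsp_lincomb) auto
  ultimately show ?thesis using h_eq_iff[OF f] c by blast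
qed

lemma lin_span_eq:
  assumes "\<And>i. i \<in> I \<Longrightarrow> b i \<in> S \<and> B i = h (b i)"
  shows "lin_span M B I = h ` {lincomb b c | c. supp c \<subseteq> I}"
proof -
  have "(\<Oplus>\<^bsub>M\<^esub>i\<in>supp c. cf c i \<odot>\<^bsub>M\<^esub> B i) = h (lincomb b c)" if "supp c \<subseteq> I" for c
    using assms that by (intro hlincomb) auto
  then show ?thesis unfolding lin_span_def by (auto simp: image_def) metis+
qed

lemma submodule_image:
  assumes "subsp N" "N \<subseteq> S"
  shows "submodule (h ` N) ring_of_type_algebra M"
proof (rule mod.submoduleI)
  show "h ` N \<subseteq> carrier M" using assms by (auto simp: car)
  show "\<zero>\<^bsub>M\<^esub> \<in> h ` N" using assms by (auto simp: h0 subsp_0)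
  show "\<ominus>\<^bsub>M\<^esub> a \<in> h ` N" if "a \<in> h ` N" for a
    using that assms by (force simp: hminus intro: subsp_minus)
  show "a \<oplus>\<^bsub>M\<^esub> b \<in> h ` N" if ab: "a \<in> h ` N" "b \<in> h ` N" for a b
  proof -
    obtain f g where "f \<in> N" "g \<in> N" "a = h f" "b = h g" using ab by blast
    then show ?thesis using hadd[of f g] subsp_add[OF assms(1), of f g] assms(2) by auto
  qed
  show "c \<odot>\<^bsub>M\<^esub> a \<in> h ` N" if "a \<in> h ` N" for c a
    using that assms by (force simp: hscal intro: subsp_scal)
qed

end

locale presented_rep = presented M h S R
  for M :: "('k::field, 'v) hh_module" and h S R +
  fixes Xo Yo To :: "'k lpoly \<Rightarrow> 'k lpoly"
  assumes ops: "\<And>f. f \<in> S \<Longrightarrow> Xo f \<in> S \<and> Yo f \<in> S \<and> To f \<in> S"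
    and opX: "\<And>f. f \<in> S \<Longrightarrow> opX M (h f) = h (Xo f)"
    and opY: "\<And>f. f \<in> S \<Longrightarrow> opY M (h f) = h (Yo f)"
    and opT: "\<And>f. f \<in> S \<Longrightarrow> opT M (h f) = h (To f)"

text \<open>
  A linear map of representatives that intertwines the operators and induces a bijection
  modulo the kernels descends to an isomorphism of modules.
\<close>

lemma hh_iso_presented:
  assumes 1: "presented_rep M h S R Xo Yo To" and 2: "presented_rep M' h' S' R' Xo' Yo' To'"
    and psi: "lin \<psi>" "\<And>f. f \<in> S \<Longrightarrow> \<psi> f \<in> S'" "\<And>f. f \<in> S \<Longrightarrow> \<psi> f \<in> R' \<longleftrightarrow> f \<in> R"
    and surj: "\<And>g. g \<in> S' \<Longrightarrow> \<exists>f\<in>S. g - \<psi> f \<in> R'"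
    and ops: "\<And>f. f \<in> S \<Longrightarrow> \<psi> (Xo f) = Xo' (\<psi> f) \<and> \<psi> (Yo f) = Yo' (\<psi> f) \<and> \<psi> (To f) = To' (\<psi> f)"
  shows "\<exists>\<phi>\<in>hh_iso M M'. \<forall>f\<in>S. \<phi> (h f) = h' (\<psi> f)"
proof -
  interpret A: presented_rep M h S R Xo Yo To by (rule 1)
  interpret B: presented_rep M' h' S' R' Xo' Yo' To' by (rule 2)
  define \<phi> where "\<phi> v = h' (\<psi> (SOME f. f \<in> S \<and> h f = v))" for v
  have phi: "\<phi> (h f) = h' (\<psi> f)" if f: "f \<in> S" for f
  proof -
    define g where "g = (SOME g. g \<in> S \<and> h g = h f)"
    have g: "g \<in> S" "h g = h f" using someI[of "\<lambda>g. g \<in> S \<and> h g = h f" f] f by (auto simp: g_def)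
    then have "g - f \<in> R" "g - f \<in> S" using f A.h_eq_iff A.S by (auto intro: subsp_diff)
    then have "\<psi> g - \<psi> f \<in> R'" using psi(3) by (simp flip: lin_diff[OF psi(1)])
    then have "h' (\<psi> g) = h' (\<psi> f)" using B.h_eq_iff psi(2) f g by auto
    then show ?thesis by (simp add: \<phi>_def g_def)
  qed
  have inj: "inj_on \<phi> (carrier M)"
  proof (rule inj_onI)
    fix x y assume "x \<in> carrier M" "y \<in> carrier M" "\<phi> x = \<phi> y"
    then obtain f g where fg: "f \<in> S" "g \<in> S" "x = h f" "y = h g" "h' (\<psi> f) = h' (\<psi> g)"
      by (auto simp: A.car phi)
    then have "\<psi> (f - g) \<in> R'" using B.h_eq_iff psi(2) by (simp add: lin_diff[OF psi(1)])
    then have "f - g \<in> R" using psi(3) fg A.S by (simp add: subsp_diff)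
    then show "x = y" using fg A.h_eq_iff by auto
  qed
  have im: "\<phi> ` carrier M = carrier M'"
  proof (intro subset_antisym subsetI)
    fix y assume "y \<in> carrier M'"
    then obtain g where g: "g \<in> S'" "y = h' g" by (auto simp: B.car)
    then obtain f where f: "f \<in> S" "g - \<psi> f \<in> R'" using surj by blast
    then have "y = \<phi> (h f)" using g B.h_eq_iff[of g "\<psi> f"] psi(2) phi by auto
    then show "y \<in> \<phi> ` carrier M" using f by (auto simp: A.car)
  qed (auto simp: A.car B.car phi psi(2))
  have "\<phi> \<in> hh_hom M M'"
    unfolding hh_hom_def
  proof (intro CollectI conjI ballI allI)
    show "\<phi> \<in> carrier M \<rightarrow> carrier M'" using im by auto
  next
    fix x y assume "x \<in> carrier M" "y \<in> carrier M"
    then obtain f g where fg: "f \<in> S" "g \<in> S" "x = h f" "y = h g" by (auto simp: A.car)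
    then show "\<phi> (x \<oplus>\<^bsub>M\<^esub> y) = \<phi> x \<oplus>\<^bsub>M'\<^esub> \<phi> y"
      using A.S psi(2) by (simp add: A.hadd B.hadd phi subsp_add lin_add[OF psi(1)])
  next
    fix c x assume "x \<in> carrier M"
    then obtain f where f: "f \<in> S" "x = h f" by (auto simp: A.car)
    then show "\<phi> (c \<odot>\<^bsub>M\<^esub> x) = c \<odot>\<^bsub>M'\<^esub> \<phi> x"
      using A.S psi(2) by (simp add: A.hscal B.hscal phi subsp_scal lin_scal[OF psi(1)])
  next
    fix x assume "x \<in> carrier M"
    then obtain f where f: "f \<in> S" "x = h f" by (auto simp: A.car)
    with ops psi(2) A.ops[OF f(1)]
    show "\<phi> (opX M x) = opX M' (\<phi> x)" "\<phi> (opY M x) = opY M' (\<phi> x)" "\<phi> (opT M x) = opT M' (\<phi> x)"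
      by (auto simp: A.opX A.opY A.opT B.opX B.opY B.opT phi)
  qed
  then have "\<phi> \<in> hh_iso M M'" using inj im by (simp add: hh_iso_def bij_betw_def)
  with phi show ?thesis by blast
qed

lemma presented_carrier:
  assumes "presented M h S R" "subsp N" "N \<subseteq> S"
  shows "presented (M\<lparr>carrier := h ` N\<rparr>) h N R"
proof -
  interpret presented M h S R by fact
  have N: "f \<in> N \<Longrightarrow> f \<in> S" for f using assms by blast
  show ?thesis
    by unfold_locales (use assms(2) N h0 hadd hscal ker in auto)
qed

section \<open>The polynomial representation\<close>

text \<open>
  The representation depends only on \<open>q\<^sup>1\<^sup>/\<^sup>2\<close> and \<open>t\<^sup>1\<^sup>/\<^sup>2\<close>.
\<close>

locale hecke =
  fixes qh th :: "'k::field"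
  assumes qh0 [simp]: "qh \<noteq> 0" and th0 [simp]: "th \<noteq> 0"
begin

abbreviation "Tp \<equiv> T_op th"
abbreviation "pp \<equiv> pi_op qh"
definition "Yp f = pp (Tp f)"
definition "Tinv f = Tp f - scal (th - inverse th) f"
definition "Yinv f = Tinv (pp f)"

lemma Tp_Th: "Tp f = scal (inverse th) (Th (th\<^sup>2) f)"
  by (rule T_op_Th) simp

lemma lin_Tp: "lin Tp"
  using lin_scale[OF lin_Th] by (simp add: lin_def Tp_Th)

lemma lin_pp: "lin pp"
  unfolding pi_op_flipx by (rule lin_flipx)

lemma lin_Yp: "lin Yp"
  unfolding Yp_def[abs_def] by (rule lin_compose[OF lin_pp lin_Tp])

lemma lin_Tinv: "lin Tinv"
  unfolding Tinv_def[abs_def] by (rule lin_sub[OF lin_Tp lin_scale[OF lin_id]])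

lemma lin_Yinv: "lin Yinv"
  unfolding Yinv_def[abs_def] by (rule lin_compose[OF lin_Tinv lin_pp])

lemma Tp_Tp: "Tp (Tp f) = scal (th - inverse th) (Tp f) + f"
proof -
  have "Tp (Tp f) = scal (inverse th * inverse th) (Th (th\<^sup>2) (Th (th\<^sup>2) f))"
    by (simp add: Tp_Th lin_scal[OF lin_Th])
  also have "\<dots> = scal (inverse th * inverse th * (th\<^sup>2 - 1)) (Th (th\<^sup>2) f) + scal (inverse th * inverse th * th\<^sup>2) f"
    by (simp add: Th_Th scal_add)
  also have "inverse th * inverse th * th\<^sup>2 = 1" by (simp add: field_simps power2_eq_square)
  also have "inverse th * inverse th * (th\<^sup>2 - 1) = (th - inverse th) * inverse th"
    by (simp add: field_simps power2_eq_square)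
  finally show ?thesis by (simp add: Tp_Th)
qed

lemma Tp_Tinv [simp]: "Tp (Tinv f) = f"
  by (simp add: Tinv_def lin_simps[OF lin_Tp] Tp_Tp)

lemma Tinv_Tp [simp]: "Tinv (Tp f) = f"
  by (simp add: Tinv_def Tp_Tp)

lemma pp_pp [simp]: "pp (pp f) = f"
  by (rule poly_mapping_eqI) (simp add: pi_op_flipx power_int_minus)

lemma Yp_Yinv [simp]: "Yp (Yinv f) = f" and Yinv_Yp [simp]: "Yinv (Yp f) = f"
  by (simp_all add: Yp_def Yinv_def)

lemma pp_X: "pp (mon 1 * f) = scal qh (mon (- 1) * pp f)"
proof (rule poly_mapping_eqI)
  fix k
  have L: "cf (pp (mon 1 * f)) k = cf f (- k - 1) * qh powi (- k)"
    by (simp add: pi_op_flipx)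
  have R: "cf (scal qh (mon (- 1) * pp f)) k = qh * (cf f (- k - 1) * qh powi (- k - 1))"
    by (simp add: pi_op_flipx)
  have "qh powi (- k) = qh * qh powi (- k - 1)" by (simp add: power_int_diff)
  then show "cf (pp (mon 1 * f)) k = cf (scal qh (mon (- 1) * pp f)) k"
    unfolding L R by simp
qed

lemma pp_Xinv: "pp (mon (- 1) * f) = scal (inverse qh) (mon 1 * pp f)"
  using pp_X[of "mon (- 1) * f", symmetric, THEN arg_cong[where f = "\<lambda>g. scal (inverse qh) (mon 1 * g)"]]
  by (simp add: scal_mult_right)

lemma Tp_X: "Tp (mon 1 * f) = mon (- 1) * Tp f - scal (th - inverse th) (mon (- 1) * f)"
proof -
  have "inverse th * (th\<^sup>2 - 1) = th - inverse th" by (simp add: field_simps power2_eq_square)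
  then show ?thesis by (simp add: Tp_Th Th_X scal_diff scal_mult_right)
qed

lemma Tp_Xinv: "Tp (mon (- 1) * f) = mon 1 * Tp f + scal (th - inverse th) (mon (- 1) * f)"
proof -
  have "inverse th * (th\<^sup>2 - 1) = th - inverse th" by (simp add: field_simps power2_eq_square)
  then show ?thesis by (simp add: Tp_Th Th_Xinv scal_add scal_mult_right)
qed

lemma TXT: "Tp (mon 1 * Tp f) = mon (- 1) * f"
  by (simp add: Tp_X Tp_Tp distrib_left scal_mult_right)

lemma Tp_1: "Tp 1 = scal th 1"
  by (simp add: Tp_Th field_simps power2_eq_square)

lemma pp_1: "pp 1 = 1"
  using flipx_mon[of "\<lambda>j. qh powi j" 0] by (simp add: pi_op_flipx)

lemma relation3: "scal qh (Yinv (mon (- 1) * Yp (mon 1 * Tp (Tp f)))) = f"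
proof -
  have "Yp (mon 1 * Tp (Tp f)) = scal (inverse qh) (mon 1 * Yp f)"
    by (simp add: Yp_def TXT pp_Xinv)
  then show ?thesis by (simp add: scal_mult_right lin_simps[OF lin_Yinv])
qed

lemma relation4: "Tp (Tp f + scal (inverse th) f) - scal th (Tp f + scal (inverse th) f) = 0"
  by (simp add: lin_simps[OF lin_Tp] Tp_Tp scal_add scal_diff_left)

definition stable :: "'k lpoly set \<Rightarrow> bool" where
  "stable N \<longleftrightarrow> subsp N \<and> (\<forall>f\<in>N. \<forall>g. g * f \<in> N) \<and> (\<forall>f\<in>N. pp f \<in> N) \<and> (\<forall>f\<in>N. Tp f \<in> N)"

lemma stableD:
  assumes "stable N"
  shows "subsp N" "f \<in> N \<Longrightarrow> g * f \<in> N" "f \<in> N \<Longrightarrow> pp f \<in> N" "f \<in> N \<Longrightarrow> Tp f \<in> N"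
    "f \<in> N \<Longrightarrow> Tinv f \<in> N" "f \<in> N \<Longrightarrow> Yp f \<in> N" "f \<in> N \<Longrightarrow> Yinv f \<in> N" "f \<in> N \<Longrightarrow> Th (th\<^sup>2) f \<in> N"
proof -
  show s: "subsp N" and m: "f \<in> N \<Longrightarrow> g * f \<in> N" and p: "f \<in> N \<Longrightarrow> pp f \<in> N" and T: "f \<in> N \<Longrightarrow> Tp f \<in> N" for f g
    using assms by (auto simp: stable_def)
  show Ti: "f \<in> N \<Longrightarrow> Tinv f \<in> N" for f
    unfolding Tinv_def using s T by (intro subsp_diff subsp_scal) auto
  show "f \<in> N \<Longrightarrow> Yp f \<in> N" "f \<in> N \<Longrightarrow> Yinv f \<in> N" by (auto simp: Yp_def Yinv_def p T Ti)
  assume "f \<in> N"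
  then have "scal th (Tp f) \<in> N" using s T by (auto intro: subsp_scal)
  then show "Th (th\<^sup>2) f \<in> N" by (simp add: Tp_Th)
qed

end

locale polynomial_rep = hecke qh th for qh th :: "'k::field" +
  fixes p :: "rat \<Rightarrow> 'k" and P :: "('k, 'k lpoly) hh_module"
  assumes p_half: "p (1/2) = qh" and P_def: "P = polrep p th"
begin

lemma P_simps [simp]:
  "carrier P = UNIV" "\<zero>\<^bsub>P\<^esub> = 0" "f \<oplus>\<^bsub>P\<^esub> g = f + g" "c \<odot>\<^bsub>P\<^esub> f = scal c f" "opX P f = mon 1 * f"
  "opY P f = Yp f" "opT P f = Tp f" "f \<otimes>\<^bsub>P\<^esub> g = f * g" "\<one>\<^bsub>P\<^esub> = 1"
  by (simp_all add: P_def polrep_def Yp_def p_half)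

sublocale P: presented_rep P "\<lambda>f. f" UNIV "{0}" "\<lambda>f. mon 1 * f" Yp Tp
  by unfold_locales auto

lemma P_cring: "cring P"
proof (rule cringI)
  show "abelian_group P" by (rule P.abelian_group)
  show "comm_monoid P" by unfold_locales (auto simp: algebra_simps)
qed (auto simp: algebra_simps)

lemma Idl_P: "Idl\<^bsub>P\<^esub> {g} = {f * g | f. True}"
  using cring.cgenideal_eq_genideal[OF P_cring, of g] by (simp add: cgenideal_def)

lemma submodule_P: "submodule N ring_of_type_algebra P \<longleftrightarrow> subsp N"
proof
  assume "subsp N"
  then show "submodule N ring_of_type_algebra P" using P.submodule_image[of N] by simp
next
  assume N: "submodule N ring_of_type_algebra P"
  have "0 \<in> N" using submodule.axioms(1)[OF N] subgroup.one_closed by fastforce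
  then show "subsp N"
    using P.mod.submoduleE[OF N] by (intro subspI) auto
qed

lemma stable_X: "stable N \<Longrightarrow> (\<lambda>f. mon 1 * f) ` N = N"
proof (intro subset_antisym subsetI)
  fix f assume "stable N" "f \<in> N"
  then have "mon (- 1) * f \<in> N" by (rule stableD)
  then show "f \<in> (\<lambda>f. mon 1 * f) ` N" by (rule rev_image_eqI) simp
qed (auto intro: stableD)

lemma stable_Y: "stable N \<Longrightarrow> Yp ` N = N"
proof (intro subset_antisym subsetI)
  fix f assume "stable N" "f \<in> N"
  then have "Yinv f \<in> N" by (rule stableD)
  then show "f \<in> Yp ` N" by (rule rev_image_eqI) simp
qed (auto intro: stableD)

text \<open>
  \<open>X N = N\<close> yields stability under \<open>X\<^sup>-\<^sup>1\<close> and so an ideal, and \<open>\<pi> = Y T\<^sup>-\<^sup>1\<close> with \<open>T\<^sup>-\<^sup>1\<close> a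
  polynomial in \<open>T\<close>.
\<close>

theorem subrep_P: "subrep N P \<longleftrightarrow> stable N"
proof
  assume N: "subrep N P"
  have s: "subsp N" and X: "(\<lambda>f. mon 1 * f) ` N = N" and Y: "Yp ` N = N" and T: "Tp ` N \<subseteq> N"
    using N by (auto simp: subrep_def submodule_P image_def)
  have Xi: "mon (- 1) * f \<in> N" if f: "f \<in> N" for f
  proof -
    obtain g where "g \<in> N" "f = mon 1 * g" using f X by blast
    then show ?thesis by simp
  qed
  have Xp: "mon 1 * f \<in> N" if "f \<in> N" for f using that X by blast
  have pow: "mon (int i) * f \<in> N \<and> mon (- int i) * f \<in> N" if "f \<in> N" for f i
  proof (induction i)
    case (Suc i)
    have "mon (int (Suc i)) * f = mon 1 * (mon (int i) * f)" "mon (- int (Suc i)) * f = mon (- 1) * (mon (- int i) * f)"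
      by simp_all
    then show ?case using Suc Xp Xi by metis
  qed (use that in simp)
  have mon: "mon j * f \<in> N" if "f \<in> N" for f j
    using pow[OF that, of "nat \<bar>j\<bar>"] by (cases "j \<ge> 0") auto
  have ideal: "g * f \<in> N" if f: "f \<in> N" for f g
  proof -
    have "g * f = (\<Sum>j\<in>supp g. scal (cf g j) (mon j * f))"
      by (subst lp_expand[of g]) (simp add: sum_distrib_right scal_mult_left)
    also have "\<dots> \<in> N" using s mon[OF f] by (auto intro!: subsp_sum subsp_scal)
    finally show ?thesis .
  qed
  have pi: "pp f \<in> N" if f: "f \<in> N" for f
  proof -
    have "Tp f - scal (th - inverse th) f \<in> N" using s T f by (auto intro!: subsp_diff subsp_scal)
    then have "Yp (Tinv f) \<in> N" using Y by (auto simp: Tinv_def)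
    then show ?thesis by (simp add: Yp_def)
  qed
  show "stable N" unfolding stable_def using s ideal pi T by auto
next
  assume N: "stable N"
  then show "subrep N P"
    using stable_X[OF N] stable_Y[OF N] stableD[OF N] by (auto simp: subrep_def submodule_P)
qed

text \<open>
  A name for cosets that does not unfold, to be used as the map that presents a quotient.
\<close>

definition cs :: "'k lpoly set \<Rightarrow> 'k lpoly \<Rightarrow> 'k lpoly set" where "cs R f = R +>\<^bsub>P\<^esub> f"

lemma cs_eq: "cs R f = (\<lambda>r. r + f) ` R"
  by (auto simp: cs_def a_r_coset_def')

lemma cs_self: "subsp R \<Longrightarrow> f \<in> cs R f"
  by (force simp: cs_eq subsp_def)

lemma cs_eq_iff: "subsp R \<Longrightarrow> cs R f = cs R g \<longleftrightarrow> f - g \<in> R"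
proof
  assume R: "subsp R" and "cs R f = cs R g"
  then have "f \<in> cs R g" using cs_self by blast
  then show "f - g \<in> R" by (auto simp: cs_eq)
next
  assume R: "subsp R" and fg: "f - g \<in> R"
  show "cs R f = cs R g"
  proof (intro subset_antisym subsetI)
    fix x assume "x \<in> cs R f"
    then obtain r where r: "x = r + f" "r \<in> R" by (auto simp: cs_eq)
    then have "x = (r + (f - g)) + g" "r + (f - g) \<in> R" using R fg by (auto intro: subsp_add)
    then show "x \<in> cs R g" unfolding cs_eq by blast
  next
    fix x assume "x \<in> cs R g"
    then obtain r where r: "x = r + g" "r \<in> R" by (auto simp: cs_eq)
    then have "x = (r - (f - g)) + f" "r - (f - g) \<in> R" using R fg by (auto intro: subsp_diff)
    then show "x \<in> cs R f" unfolding cs_eq by blast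
  qed
qed

lemma cs_0: "cs R 0 = R"
  by (simp add: cs_eq)

lemma cs_UN:
  assumes R: "subsp R" and A: "lin A" "\<And>r. r \<in> R \<Longrightarrow> A r \<in> R"
  shows "(\<Union>x\<in>cs R f. cs R (A x)) = cs R (A f)"
proof -
  have "cs R (A x) = cs R (A f)" if "x \<in> cs R f" for x
  proof -
    have "x - f \<in> R" using that by (auto simp: cs_eq)
    then have "A x - A f \<in> R" using A by (simp flip: lin_diff[OF A(1)])
    then show ?thesis using cs_eq_iff[OF R] by blast
  qed
  then show ?thesis using cs_self[OF R, of f] by blast
qed

lemma cs_add: "subsp R \<Longrightarrow> set_add P (cs R f) (cs R g) = cs R (f + g)"
proof (intro subset_antisym subsetI)
  fix x assume R: "subsp R" and "x \<in> set_add P (cs R f) (cs R g)"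
  then obtain r s where "r \<in> R" "s \<in> R" "x = (r + f) + (s + g)" by (auto simp: set_add_def' cs_eq)
  then have "x = (r + s) + (f + g)" "r + s \<in> R" using R by (auto simp: algebra_simps subsp_add)
  then show "x \<in> cs R (f + g)" unfolding cs_eq by blast
next
  fix x assume R: "subsp R" and "x \<in> cs R (f + g)"
  then obtain r where r: "r \<in> R" "x = r + (f + g)" by (auto simp: cs_eq)
  then have "x = (r + f) + g" "r + f \<in> cs R f" by (auto simp: cs_eq)
  then show "x \<in> set_add P (cs R f) (cs R g)" using cs_self[OF R, of g] by (auto simp: set_add_def')
qed

lemma quot_presented:
  assumes R: "stable R"
  shows "presented_rep (quot_rep P R) (cs R) UNIV R (\<lambda>f. mon 1 * f) Yp Tp"
proof -
  note s = stableD(1)[OF R]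
  have car: "a_rcosets\<^bsub>P\<^esub> R = range (cs R)"
    by (auto simp: A_RCOSETS_def RCOSETS_def cs_def a_r_coset_def)
  show ?thesis
  proof
    show "carrier (quot_rep P R) = cs R ` UNIV" by (simp add: quot_rep_def car)
    show "\<zero>\<^bsub>quot_rep P R\<^esub> = cs R 0" by (simp add: quot_rep_def cs_0)
    show "cs R f \<oplus>\<^bsub>quot_rep P R\<^esub> cs R g = cs R (f + g)" for f g
      by (simp add: quot_rep_def cs_add[OF s])
    show "c \<odot>\<^bsub>quot_rep P R\<^esub> cs R f = cs R (scal c f)" for c f
      using cs_UN[OF s lin_scale[OF lin_id], of c f] s
      by (simp add: quot_rep_def cs_def subsp_scal)
    show "cs R f = cs R 0 \<longleftrightarrow> f \<in> R" for f using cs_eq_iff[OF s, of f 0] by simp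
    show "opX (quot_rep P R) (cs R f) = cs R (mon 1 * f)" for f
      using cs_UN[OF s lin_mult, of "mon 1" f] stableD(2)[OF R] by (simp add: quot_rep_def cs_def)
    show "opY (quot_rep P R) (cs R f) = cs R (Yp f)" for f
      using cs_UN[OF s lin_Yp, of f] stableD(6)[OF R] by (simp add: quot_rep_def cs_def)
    show "opT (quot_rep P R) (cs R f) = cs R (Tp f)" for f
      using cs_UN[OF s lin_Tp, of f] stableD(4)[OF R] by (simp add: quot_rep_def cs_def)
  qed auto
qed

lemma sub_quot_presented:
  assumes R: "stable R" and S: "stable S"
  shows "presented_rep ((quot_rep P R)\<lparr>carrier := cs R ` S\<rparr>) (cs R) S R (\<lambda>f. mon 1 * f) Yp Tp"
proof -
  interpret Q: presented_rep "quot_rep P R" "cs R" UNIV R "\<lambda>f. mon 1 * f" Yp Tp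
    by (rule quot_presented[OF R])
  interpret V: presented "(quot_rep P R)\<lparr>carrier := cs R ` S\<rparr>" "cs R" S R
    by (rule presented_carrier[OF Q.presented_axioms stableD(1)[OF S]]) simp
  show ?thesis
    by unfold_locales (auto simp: Q.opX Q.opY Q.opT stableD[OF S])
qed

lemma subrep_quot:
  assumes R: "stable R" and S: "stable S"
  shows "subrep (cs R ` S) (quot_rep P R)"
proof -
  interpret Q: presented_rep "quot_rep P R" "cs R" UNIV R "\<lambda>f. mon 1 * f" Yp Tp
    by (rule quot_presented[OF R])
  have "opX (quot_rep P R) ` cs R ` S = cs R ` ((\<lambda>f. mon 1 * f) ` S)"
    "opY (quot_rep P R) ` cs R ` S = cs R ` (Yp ` S)" "opT (quot_rep P R) ` cs R ` S = cs R ` (Tp ` S)"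
    by (simp_all add: image_image Q.opX Q.opY Q.opT)
  then show ?thesis
    using Q.submodule_image[OF stableD(1)[OF S]] stableD[OF S]
    by (auto simp: subrep_def stable_X[OF S] stable_Y[OF S])
qed

lemma sigma_x_presented:
  assumes "presented_rep M h S R Xo Yo To"
  shows "presented_rep (sigma_x M) h S R (\<lambda>f. - Xo f) Yo To"
proof -
  interpret presented_rep M h S R Xo Yo To by fact
  show ?thesis
    unfolding sigma_x_def
    by unfold_locales (use S car h0 hadd hscal ker ops opX opY opT in \<open>auto simp: subsp_minus hminus\<close>)
qed

lemma finite_dim_codim:
  assumes R: "stable R" and fd: "finite_dim (quot_rep P R)"
  shows "\<exists>d. codim_le R d"
proof -
  interpret Q: presented_rep "quot_rep P R" "cs R" UNIV R "\<lambda>f. mon 1 * f" Yp Tp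
    by (rule quot_presented[OF R])
  obtain d :: nat and B where B: "has_basis (quot_rep P R) B {..<d}" using fd by (auto simp: finite_dim_def has_dim_def)
  then have "\<forall>i\<in>{..<d}. \<exists>b. B i = cs R b" unfolding has_basis_def Q.car by blast
  then obtain b where b: "\<And>i. i < d \<Longrightarrow> B i = cs R (b i)" by (metis lessThan_iff)
  have "\<exists>a. f - (\<Sum>j<d. scal (a j) (b j)) \<in> R" for f
  proof -
    obtain c where "supp c \<subseteq> {..<d}" "f - lincomb b c \<in> R"
      using Q.has_basis_span[OF B, of b f] b by auto
    then show ?thesis using lincomb_superset[of "{..<d}" c b] by (intro exI[of _ "cf c"]) auto
  qed
  then show ?thesis unfolding codim_le_def by (intro exI[of _ d] exI[of _ b] allI)
qed

text \<open>
  The relations are verified on representatives.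
\<close>

lemma HH_module_image:
  assumes M: "presented_rep M h UNIV R (\<lambda>f. mon 1 * f) Yp Tp" and R: "stable R"
  shows "HH_module qh th M"
proof -
  interpret presented_rep M h UNIV R "\<lambda>f. mon 1 * f" Yp Tp by (rule M)
  have lin: "lin_op M A" if "\<And>f. A (h f) = h (B f)" "lin B" for A B
    unfolding lin_op_def using that by (auto simp: car hadd hscal lin_simps[OF that(2)])
  have inj: "h f = h g \<longleftrightarrow> f - g \<in> R" for f g by (rule h_eq_iff) auto
  have bij: "bij_betw A (carrier M) (carrier M) \<and> (\<forall>f. inv_into (carrier M) A (h f) = h (Bi f))"
    if A: "\<And>f. A (h f) = h (B f)" and BBi: "\<And>f. B (Bi f) = f" "\<And>f. Bi (B f) = f" "lin Bi" and st: "\<And>f. f \<in> R \<Longrightarrow> Bi f \<in> R"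
    for A B Bi
  proof -
    have I: "inj_on A (carrier M)"
    proof (rule inj_onI)
      fix x y assume "x \<in> carrier M" "y \<in> carrier M" "A x = A y"
      then obtain f g where fg: "x = h f" "y = h g" "h (B f) = h (B g)" by (auto simp: car A)
      then have "Bi (B f - B g) \<in> R" using inj st by blast
      then show "x = y" using fg by (simp add: inj lin_simps[OF BBi(3)] BBi)
    qed
    have "A ` carrier M = carrier M"
    proof (intro subset_antisym subsetI)
      fix x assume "x \<in> carrier M"
      then obtain f where "x = A (h (Bi f))" by (auto simp: car A BBi)
      then show "x \<in> A ` carrier M" by (auto simp: car)
    qed (auto simp: car A)
    moreover have "inv_into (carrier M) A (h f) = h (Bi f)" for f
      by (rule inv_into_f_eq[OF I]) (auto simp: car A BBi)
    ultimately show ?thesis using I by (simp add: bij_betw_def)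
  qed
  have X: "bij_betw (hh_module.opX M) (carrier M) (carrier M) \<and> (\<forall>f. inv_into (carrier M) (hh_module.opX M) (h f) = h (mon (- 1) * f))"
    by (rule bij[of _ "\<lambda>f. mon 1 * f" "\<lambda>f. mon (- 1) * f"]) (auto simp: opX lin_mult stableD[OF R])
  have Y: "bij_betw (hh_module.opY M) (carrier M) (carrier M) \<and> (\<forall>f. inv_into (carrier M) (hh_module.opY M) (h f) = h (Yinv f))"
    by (rule bij[of _ Yp Yinv]) (auto simp: opY lin_Yinv stableD[OF R])
  show ?thesis
    unfolding HH_module_def Let_def
  proof (intro conjI ballI)
    show "module ring_of_type_algebra M" by (rule mod.module_axioms)
    show "lin_op M (hh_module.opX M)" by (rule lin[OF opX[OF UNIV_I] lin_mult])
    show "lin_op M (hh_module.opY M)" by (rule lin[OF opY[OF UNIV_I] lin_Yp])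
    show "lin_op M (hh_module.opT M)" by (rule lin[OF opT[OF UNIV_I] lin_Tp])
    show "bij_betw (hh_module.opX M) (carrier M) (carrier M)" "bij_betw (hh_module.opY M) (carrier M) (carrier M)"
      using X Y by auto
    fix v assume "v \<in> carrier M"
    then obtain f where f: "v = h f" by (auto simp: car)
    show "hh_module.opT M (hh_module.opX M (hh_module.opT M v)) = inv_into (carrier M) (hh_module.opX M) v"
      using X by (simp add: f opT opX TXT)
    show "hh_module.opT M (inv_into (carrier M) (hh_module.opY M) (hh_module.opT M v)) = hh_module.opY M v"
      using Y by (simp add: f opT opY) (simp add: Yinv_def Yp_def)
    show "qh \<odot>\<^bsub>M\<^esub> inv_into (carrier M) (hh_module.opY M) (inv_into (carrier M) (hh_module.opX M)
          (hh_module.opY M (hh_module.opX M (hh_module.opT M (hh_module.opT M v))))) = v"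
      using X Y by (simp add: f opT opY opX hscal relation3)
    show "hh_module.opT M (hh_module.opT M v \<oplus>\<^bsub>M\<^esub> inverse th \<odot>\<^bsub>M\<^esub> v) \<ominus>\<^bsub>M\<^esub>
         th \<odot>\<^bsub>M\<^esub> (hh_module.opT M v \<oplus>\<^bsub>M\<^esub> inverse th \<odot>\<^bsub>M\<^esub> v) = \<zero>\<^bsub>M\<^esub>"
      by (simp add: f opT hadd hscal hdiff h0 relation4)
  qed
qed

end

section \<open>Laurent polynomials with exponents in an interval\<close>

lemma ev_window:
  fixes f :: "'k::field lpoly"
  assumes "\<And>j. j \<in> supp f \<Longrightarrow> u \<le> j \<and> j < u + int d" and x: "x \<noteq> 0"
  shows "ev x f = x powi u * poly (\<Sum>i<d. Polynomial.monom (cf f (u + int i)) i) x"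
proof -
  have "supp f \<subseteq> (\<lambda>i. u + int i) ` {..<d}"
  proof
    fix j assume "j \<in> supp f"
    with assms(1)[OF this] show "j \<in> (\<lambda>i. u + int i) ` {..<d}"
      by (intro image_eqI[of _ _ "nat (j - u)"]) auto
  qed
  then have "ev x f = (\<Sum>j\<in>(\<lambda>i. u + int i) ` {..<d}. cf f j * x powi j)"
    by (intro ev_superset) auto
  also have "\<dots> = (\<Sum>i<d. cf f (u + int i) * x powi (u + int i))"
    by (subst sum.reindex) (auto simp: inj_on_def)
  also have "\<dots> = x powi u * poly (\<Sum>i<d. Polynomial.monom (cf f (u + int i)) i) x"
    using x by (simp add: poly_sum poly_monom sum_distrib_left power_int_add mult_ac)
  finally show ?thesis .
qed

text \<open>
  Up to a power of \<open>X\<close> this is a polynomial of degree less than \<open>d\<close>, with \<open>d\<close> zeros.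
\<close>

lemma zero_window:
  fixes f :: "'k::field lpoly"
  assumes "\<And>j. j \<in> supp f \<Longrightarrow> u \<le> j \<and> j < u + int d" and "finite A" "card A \<ge> d"
    and "\<And>x. x \<in> A \<Longrightarrow> x \<noteq> 0 \<and> ev x f = 0"
  shows "f = 0"
proof -
  define r where "r = (\<Sum>i<d. Polynomial.monom (cf f (u + int i)) i)"
  have ev: "ev x f = x powi u * poly r x" if x: "x \<noteq> 0" for x
    unfolding r_def by (rule ev_window[OF assms(1) x])
  have "r = 0"
  proof (rule ccontr)
    assume r: "r \<noteq> 0"
    have "d > 0" using r by (cases d) (auto simp: r_def)
    have "degree r \<le> d - 1"
      unfolding r_def by (rule degree_sum_le) (auto intro: order_trans[OF degree_monom_le])
    then have deg: "degree r < d" using \<open>d > 0\<close> by simp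
    have "A \<subseteq> {x. poly r x = 0}"
    proof
      fix x assume "x \<in> A"
      with assms(4)[OF this] ev[of x] show "x \<in> {x. poly r x = 0}" by auto
    qed
    then have "d \<le> card {x. poly r x = 0}"
      using assms(3) card_mono[OF poly_roots_finite[OF r]] by (meson order_trans)
    with card_poly_roots_bound[OF r] deg show False by simp
  qed
  show "f = 0"
  proof (rule poly_mapping_eqI)
    fix j
    show "cf f j = cf 0 j"
    proof (cases "j \<in> supp f")
      case True
      then have j: "u \<le> j" "j < u + int d" using assms(1) by auto
      have "Polynomial.coeff r (nat (j - u)) = (\<Sum>i<d. if i = nat (j - u) then cf f (u + int i) else 0)"
        by (simp add: r_def Polynomial.coeff_sum Polynomial.coeff_monom)
      also have "\<dots> = cf f j" using j by simp
      finally show ?thesis using \<open>r = 0\<close> by simp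
    qed (simp add: in_keys_iff)
  qed
qed

text \<open>
  Division with remainder by \<open>g\<close>. It works in both directions since the two extreme
  coefficients of \<open>g\<close> are invertible; the set of dividends is closed under \<open>X\<close> and \<open>X\<^sup>-\<^sup>1\<close>
  because one subtraction of a multiple of \<open>g\<close> restores the window.
\<close>

lemma reduce_window:
  fixes g :: "'k::field lpoly"
  assumes g: "\<And>j. j \<in> supp g \<Longrightarrow> u \<le> j \<and> j \<le> v" "cf g u \<noteq> 0" "cf g v \<noteq> 0" and uv: "u < v"
  shows "\<exists>h. \<forall>j\<in>supp (f - h * g). u \<le> j \<and> j < v"
proof -
  define ok where "ok f \<longleftrightarrow> (\<exists>h. \<forall>j\<in>supp (f - h * g). u \<le> j \<and> j < v)" for f
  have okI: "ok f" if "\<And>j. cf (f - h * g) j \<noteq> 0 \<Longrightarrow> u \<le> j \<and> j < v" for f h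
    unfolding ok_def by (rule exI[of _ h]) (use that in \<open>auto simp: in_keys_iff\<close>)
  have g0: "cf g j = 0" if "j < u \<or> v < j" for j using g(1)[of j] that unfolding in_keys_iff by force
  have ok0: "ok 0" by (rule okI[where h = 0]) simp
  have oks: "ok (f + scal c f')" if ff: "ok f" "ok f'" for f f' c
  proof -
    obtain h h' where h: "\<forall>j\<in>supp (f - h * g). u \<le> j \<and> j < v" "\<forall>j\<in>supp (f' - h' * g). u \<le> j \<and> j < v"
      using ff unfolding ok_def by blast
    show ?thesis
    proof (rule okI[where h = "h + scal c h'"])
      fix j assume "cf (f + scal c f' - (h + scal c h') * g) j \<noteq> 0"
      moreover have "f + scal c f' - (h + scal c h') * g = (f - h * g) + scal c (f' - h' * g)"
        by (simp add: scal_diff distrib_right scal_mult_left)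
      ultimately have "cf (f - h * g) j \<noteq> 0 \<or> cf (f' - h' * g) j \<noteq> 0" by (auto simp: lookup_add)
      then show "u \<le> j \<and> j < v" using h by (auto simp: in_keys_iff)
    qed
  qed
  have okX: "ok (mon 1 * f)" if ff: "ok f" for f
  proof -
    obtain h where h: "\<forall>j\<in>supp (f - h * g). u \<le> j \<and> j < v" using ff unfolding ok_def by blast
    define w where "w = f - h * g"
    have w: "cf w j = 0" if j: "j < u \<or> v \<le> j" for j
    proof (rule ccontr)
      assume "cf w j \<noteq> 0"
      then have "j \<in> supp (f - h * g)" by (simp add: w_def in_keys_iff)
      with h have "u \<le> j \<and> j < v" by blast
      with j show False by linarith
    qed
    define c where "c = cf w (v - 1) / cf g v"
    show ?thesis
    proof (rule okI[where h = "mon 1 * h + scal c 1"])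
      have e: "mon 1 * f - (mon 1 * h + scal c 1) * g = mon 1 * w - scal c g"
        by (simp add: w_def right_diff_distrib distrib_right scal_mult_left mult.assoc diff_diff_eq)
      fix j assume "cf (mon 1 * f - (mon 1 * h + scal c 1) * g) j \<noteq> 0"
      then have nz: "cf w (j - 1) - c * cf g j \<noteq> 0" unfolding e by (simp add: lookup_minus)
      show "u \<le> j \<and> j < v"
      proof (rule ccontr)
        assume "\<not> ?thesis"
        then consider "j < u" | "j = v" | "j > v" by linarith
        then have "cf w (j - 1) - c * cf g j = 0"
          using w[of "j - 1"] g0[of j] g(3) by cases (auto simp: c_def)
        with nz show False by simp
      qed
    qed
  qed
  have okXi: "ok (mon (- 1) * f)" if ff: "ok f" for f
  proof -
    obtain h where h: "\<forall>j\<in>supp (f - h * g). u \<le> j \<and> j < v" using ff unfolding ok_def by blast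
    define w where "w = f - h * g"
    have w: "cf w j = 0" if j: "j < u \<or> v \<le> j" for j
    proof (rule ccontr)
      assume "cf w j \<noteq> 0"
      then have "j \<in> supp (f - h * g)" by (simp add: w_def in_keys_iff)
      with h have "u \<le> j \<and> j < v" by blast
      with j show False by linarith
    qed
    define c where "c = cf w u / cf g u"
    show ?thesis
    proof (rule okI[where h = "mon (- 1) * h + scal c (mon (- 1))"])
      have e: "mon (- 1) * f - (mon (- 1) * h + scal c (mon (- 1))) * g = mon (- 1) * w - scal c (mon (- 1) * g)"
        by (simp add: w_def right_diff_distrib distrib_right scal_mult_left mult.assoc diff_diff_eq)
      fix j assume "cf (mon (- 1) * f - (mon (- 1) * h + scal c (mon (- 1))) * g) j \<noteq> 0"
      then have nz: "cf w (j + 1) - c * cf g (j + 1) \<noteq> 0" unfolding e by (simp add: lookup_minus)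
      show "u \<le> j \<and> j < v"
      proof (rule ccontr)
        assume "\<not> ?thesis"
        then consider "j + 1 < u" | "j + 1 = u" | "j + 1 > v" by linarith
        then have "cf w (j + 1) - c * cf g (j + 1) = 0"
          using w[of "j + 1"] g0[of "j + 1"] g(2) by cases (auto simp: c_def)
        with nz show False by simp
      qed
    qed
  qed
  have oku: "ok (mon u)" by (rule okI[where h = 0]) (use uv in \<open>auto simp: cf_mon split: if_splits\<close>)
  have up: "ok (mon (u + int i))" for i
  proof (induction i)
    case (Suc i)
    have "mon (u + int (Suc i)) = mon 1 * (mon (u + int i) :: 'k lpoly)" by (simp add: algebra_simps)
    then show ?case using okX[OF Suc] by (simp only:)
  qed (simp add: oku)
  have down: "ok (mon (u - int i))" for i
  proof (induction i)
    case (Suc i)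
    have "mon (u - int (Suc i)) = mon (- 1) * (mon (u - int i) :: 'k lpoly)" by (simp add: algebra_simps)
    then show ?case using okXi[OF Suc] by (simp only:)
  qed (simp add: oku)
  have mon: "ok (mon j)" for j
    using up[of "nat (j - u)"] down[of "nat (u - j)"] by (cases "j \<ge> u") auto
  have "ok (\<Sum>j\<in>I. scal (c j) (mon j))" if "finite I" for I c
    using that
  proof (induction I rule: finite_induct)
    case (insert j I)
    then show ?case using oks[OF insert.IH mon[of j], of "c j"] by (simp add: add.commute)
  qed (simp add: ok0)
  then have "ok f" using lp_expand[of f] by (metis finite_keys)
  then show ?thesis by (simp add: ok_def)
qed

section \<open>The special parameter\<close>

lemma lincomb_eig:
  assumes A: "lin A" and e: "\<And>i. i \<in> supp c \<Longrightarrow> A (e i) = scal (g i) (e i)"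
  shows "A (lincomb e c) = lincomb e (Poly_Mapping.mapp (\<lambda>i x. g i * x) c)"
proof -
  have "A (lincomb e c) = (\<Sum>i\<in>supp c. scal (g i * cf c i) (e i))"
    by (simp add: lincomb_def lin_simps[OF A] e mult.commute)
  also have "\<dots> = lincomb e (Poly_Mapping.mapp (\<lambda>i x. g i * x) c)"
    by (subst lincomb_superset[of "supp c"]) (auto simp: lookup_mapp keys_mapp_subset when_def)
  finally show ?thesis .
qed

text \<open>
  A triangular eigenbasis diagonalizes the operator, so an eigenvector only involves basis
  elements of its own eigenvalue.
\<close>

lemma eig_supp:
  assumes "\<And>n. tri n (e n)" and A: "lin A" and e: "\<And>i. A (e i) = scal (g i) (e i)"
    and f: "A (lincomb e c) = scal l (lincomb e c)" and i: "i \<in> supp c"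
  shows "g i = l"
proof -
  have "scal l (lincomb e c) = lincomb e (Poly_Mapping.mapp (\<lambda>i x. l * x) c)"
    by (rule lincomb_eig) (auto intro: lin_scale lin_id)
  then have "lincomb e (Poly_Mapping.mapp (\<lambda>i x. g i * x) c - Poly_Mapping.mapp (\<lambda>i x. l * x) c) = 0"
    using f lincomb_eig[of A c e g, OF A e] by (simp add: lincomb_diff)
  from tri_lincomb_eq_0[OF assms(1) this] have "cf (Poly_Mapping.mapp (\<lambda>i x. g i * x) c - Poly_Mapping.mapp (\<lambda>i x. l * x) c) i = 0"
    by simp
  then show ?thesis using i by (simp add: lookup_minus lookup_mapp in_keys_iff)
qed

text \<open>
  \<open>p a\<close> is \<open>q\<^sup>a\<close>; injectivity says that \<open>q\<close> is not a root of unity. The numbers and the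
  formal powers of \<open>q\<close> are both of this kind.
\<close>

locale powers =
  fixes p :: "rat \<Rightarrow> 'k::field"
  assumes padd: "p (a + b) = p a * p b" and p0 [simp]: "p 0 = 1" and pinj: "p a = 1 \<Longrightarrow> a = 0"
    and two: "(2::'k) \<noteq> 0"
begin

lemma pnz [simp]: "p x \<noteq> 0"
proof
  assume "p x = 0"
  moreover have "p x * p (- x) = 1" using padd[of x "- x"] by simp
  ultimately show False by simp
qed

lemma pminus: "p (- x) = inverse (p x)"
proof -
  have "p x * p (- x) = 1" using padd[of x "- x"] by simp
  then show ?thesis by (simp add: field_simps)
qed

lemma pdiff: "p (x - y) = p x / p y"
  using padd[of x "- y"] by (simp add: pminus divide_inverse)

lemma p_eq [simp]: "p x = p y \<longleftrightarrow> x = y"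
proof
  assume "p x = p y"
  then have "p (x - y) = 1" by (simp add: pdiff)
  then show "x = y" using pinj by fastforce
qed simp

lemma p_eq_1: "p x = 1 \<longleftrightarrow> x = 0"
  using p_eq[of x 0] by simp

lemma ppow: "p x ^ m = p (of_nat m * x)"
  by (induction m) (auto simp: padd algebra_simps)

lemma ppowi: "p x powi j = p (of_int j * x)"
proof (cases "j \<ge> 0")
  case False
  then have "p x powi j = p (- x) ^ nat (- j)" by (simp add: power_int_def pminus)
  then show ?thesis using False by (simp add: ppow)
qed (simp add: power_int_def ppow)

lemma pprod: "finite I \<Longrightarrow> (\<Prod>i\<in>I. p (f i)) = p (\<Sum>i\<in>I. f i)"
  by (induction I rule: finite_induct) (auto simp: padd)

end

locale special = powers p for p :: "rat \<Rightarrow> 'k::field" +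
  fixes n :: nat
begin

definition "th = p (- 1/4 - of_nat n / 2)"
abbreviation "t \<equiv> th\<^sup>2"
abbreviation "q \<equiv> p 1"
abbreviation "qh \<equiv> p (1/2)"
definition "a = inverse th"
definition "NN = 2 * int n + 1"
abbreviation "P \<equiv> polrep p th"

lemma th_nz [simp]: "th \<noteq> 0" and a_nz [simp]: "a \<noteq> 0"
  by (auto simp: th_def a_def)

lemma t_eq: "t = p (- 1/2 - of_nat n)"
  unfolding th_def ppow by simp

lemma a_eq: "a = p (1/4 + of_nat n / 2)"
  unfolding a_def th_def pminus[symmetric] by simp

lemma t_ne_1: "t \<noteq> 1"
proof -
  have "(- 1/2 - of_nat n :: rat) \<noteq> 0"
  proof
    assume "(- 1/2 - of_nat n :: rat) = 0"
    then have "(of_int (- 1 - 2 * int n) :: rat) = of_int 0" by (simp add: field_simps)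
    then show False unfolding of_int_eq_iff by presburger
  qed
  then show ?thesis unfolding t_eq p_eq_1 .
qed

sublocale PR: polynomial_rep qh th p P
  by unfold_locales auto

text \<open>
  The eigenvalue of \<open>Y'\<close> on \<open>e\<^sub>m\<close> is \<open>q\<close> to this power.
\<close>

definition lamr :: "int \<Rightarrow> rat" where
  "lamr m = (if m \<le> 0 then - of_int m / 2 - 1/2 - of_nat n else - of_int m / 2)"

lemma qt_exp: "q ^ m * t = p (of_int (2 * int m - 1 - 2 * int n) / 2)"
  unfolding t_eq ppow padd[symmetric] by (simp add: field_simps)

lemma half_odd_ne_0: "odd j \<Longrightarrow> (of_int j / 2 :: rat) \<noteq> 0"
  by (metis dvd_0_right of_int_0 of_int_eq_iff divide_eq_0_iff numeral_neq_zero zero_neq_numeral)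

sublocale D0: dunkl q t "\<lambda>j. qh powi j"
proof
  show "qh powi (j + 2) = q * qh powi j" for j
    unfolding ppowi padd[symmetric] by (simp add: field_simps)
  show "q ^ m * t \<noteq> 1" for m :: nat
    unfolding qt_exp p_eq_1 by (rule half_odd_ne_0) simp
qed auto

lemma lam_eq: "D0.lam m = p (lamr m)"
proof -
  have "D0.lam m = qh powi (- m) * (if m \<le> 0 then t else 1)" by (rule D0.lam_def)
  then show ?thesis unfolding lamr_def t_eq ppowi by (auto simp flip: padd)
qed

text \<open>
  The only coincidences are between \<open>m\<close> and \<open>m - N\<close> for \<open>1 \<le> m \<le> N\<close>. As \<open>N\<close> is odd, the
  spectrum remains simple within each parity class.
\<close>

lemma lamr_eq_iff: "lamr i = lamr j \<longleftrightarrow> i = j \<or> (i \<le> 0 \<and> j = i + NN \<and> j > 0) \<or> (j \<le> 0 \<and> i = j + NN \<and> i > 0)"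
proof -
  have L: "lamr m = of_int (if m \<le> 0 then - m - NN else - m) / 2" for m
    by (simp add: lamr_def NN_def field_simps)
  have "lamr i = lamr j \<longleftrightarrow> (if i \<le> 0 then - i - NN else - i) = (if j \<le> 0 then - j - NN else - j)"
    unfolding L by simp
  then show ?thesis by (auto simp: NN_def)
qed

sublocale D: dunkl_sep q t "\<lambda>j. qh powi j" "wgt q t"
proof -
  interpret dunkl_form q t "\<lambda>j. qh powi j" "wgt q t" by (rule D0.wgt_form)
  show "dunkl_sep q t ((powi) qh) (wgt q t)"
  proof
    fix i j assume *: "D0.lam i = D0.lam j" "even (i - j)"
    then have "lamr i = lamr j" by (simp add: lam_eq)
    with *(2) show "i = j" unfolding lamr_eq_iff NN_def by auto
  qed
qed

abbreviation "e \<equiv> E q t"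
abbreviation "W \<equiv> const_term (wgt q t)"

lemma Y'_Yp: "D0.Y' f = scal th (PR.Yp f)"
  by (simp add: D0.Y'_def PR.Yp_def PR.Tp_Th pi_op_flipx lin_simps[OF lin_flipx])

lemma stable_Y': "PR.stable J \<Longrightarrow> f \<in> J \<Longrightarrow> D0.Y' f \<in> J"
  by (simp add: Y'_Yp PR.stableD subsp_scal)

lemma qt2: "q ^ m * t\<^sup>2 = 1 \<longleftrightarrow> int m = NN"
proof -
  have "q ^ m * t\<^sup>2 = p (of_int (int m - NN))"
    unfolding t_eq ppow padd[symmetric] by (simp add: NN_def field_simps)
  then show ?thesis by (simp only: p_eq_1 of_int_eq_0_iff) auto
qed

lemma q_pow_ne_1: "m > 0 \<Longrightarrow> q ^ m \<noteq> 1"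
  unfolding ppow p_eq_1 by simp

abbreviation "MM \<equiv> M_set n"

text \<open>
  Along the chain of the \<open>e\<^sub>m\<close> the norm is multiplied by non-zero factors, except for the
  step from \<open>N\<close> to \<open>-N\<close>, where \<open>q\<^sup>N t\<^sup>2 = 1\<close>.
\<close>

lemma nrm_MM: "D.nrm m \<noteq> 0 \<longleftrightarrow> m \<in> MM"
proof -
  have neg: "D.nrm (- int m) \<noteq> 0 \<longleftrightarrow> m \<le> 2 * n" for m
  proof (induction m)
    case (Suc m)
    have "D.nrm (int (Suc m)) = D.nrm (- int m)" using D.nrm_up[of m] by (simp add: add.commute)
    then show ?case
      using D.nrm_eq_0_iff[of "Suc m", OF q_pow_ne_1] Suc qt2[of "Suc m"] by (auto simp: NN_def)
  qed (simp add: D.nrm_0)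
  show ?thesis
  proof (cases m rule: E_cases)
    case (1 k) then show ?thesis using neg[of k] by (auto simp: M_set_def)
  next
    case (2 k) then show ?thesis using neg[of k] D.nrm_up[of k] by (auto simp: M_set_def)
  qed
qed

definition R0 :: "'k lpoly set" where "R0 = numeric_radical (wgt q t)"

lemma R0_iff: "f \<in> R0 \<longleftrightarrow> (\<forall>g. W (f * g) = 0)"
proof
  assume f: "f \<in> R0"
  show "\<forall>g. W (f * g) = 0"
  proof
    fix g
    have 0: "W (f * mon j) = 0" for j
    proof -
      have "W (f * mon (- (- j))) = 0" using f unfolding R0_def numeric_radical_def by blast
      then show ?thesis by simp
    qed
    have "W (f * g) = W (f * (\<Sum>j\<in>supp g. scal (cf g j) (mon j)))" using lp_expand[of g] by simp
    also have "\<dots> = 0" by (simp add: sum_distrib_left scal_mult_right ct_simps 0)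
    finally show "W (f * g) = 0" .
  qed
qed (simp add: R0_def numeric_radical_def)

text \<open>
  The operators \<open>T\<close>, \<open>\<pi>\<close> and multiplications are self-adjoint.
\<close>

lemma R0_stable: "PR.stable R0"
  unfolding PR.stable_def
proof (intro conjI ballI allI)
  show "subsp R0"
    by (rule subspI) (auto simp: R0_iff distrib_right ct_simps scal_mult_left)
  fix f assume f: "f \<in> R0"
  show "g * f \<in> R0" for g
  proof -
    have "W (g * f * h) = W (f * (g * h))" for h by (simp add: ac_simps)
    then show ?thesis using f by (simp add: R0_iff)
  qed
  show "pi_op qh f \<in> R0" using f by (simp add: R0_iff pi_op_flipx D.flipx_adj)
  show "T_op th f \<in> R0" using f by (simp add: R0_iff PR.Tp_Th D.Th_adj scal_mult_left ct_simps)
qed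

lemma e_R0: "e m \<in> R0 \<longleftrightarrow> m \<notin> MM"
proof
  assume "e m \<in> R0"
  then show "m \<notin> MM" using nrm_MM[of m] unfolding D.nrm_def R0_iff by blast
next
  assume "m \<notin> MM"
  then have "D.nrm m = 0" using nrm_MM by blast
  then show "e m \<in> R0" using D.W_E_null unfolding R0_def numeric_radical_def by blast
qed

text \<open>
  Among the \<open>e\<^sub>m\<close> with non-zero norm that occur, the lowest one can be detected by its
  leading monomial.
\<close>

lemma R0_lincomb: "lincomb e c \<in> R0 \<longleftrightarrow> supp c \<inter> MM = {}"
proof
  assume "supp c \<inter> MM = {}"
  then show "lincomb e c \<in> R0" by (intro subsp_lincomb PR.stableD(1)[OF R0_stable]) (auto simp: e_R0)
next
  assume c: "lincomb e c \<in> R0"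
  show "supp c \<inter> MM = {}"
  proof (rule ccontr)
    assume ne: "supp c \<inter> MM \<noteq> {}"
    let ?A = "rk ` (supp c \<inter> MM)"
    have fin: "finite ?A" by simp
    then have "Min ?A \<in> ?A" using ne by (intro Min_in) auto
    then obtain j where j: "j \<in> supp c" "j \<in> MM" "rk j = Min ?A" by auto
    have "W (lincomb e c * mon (- j)) = cf c j * D.nrm j"
    proof (rule D.orth_lincomb)
      show "D.nrm j \<noteq> 0" "j \<in> supp c" using j nrm_MM by auto
      fix i assume i: "i \<in> supp c" "rk i < rk j"
      have "i \<notin> MM"
      proof
        assume "i \<in> MM"
        then have "Min ?A \<le> rk i" using i fin by (intro Min_le) auto
        then show False using i j by simp
      qed
      then show "D.nrm i = 0" using nrm_MM by blast
    qed
    then show False using c j nrm_MM[of j] by (auto simp: R0_iff in_keys_iff)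
  qed
qed

lemma e_expand: "\<exists>c. f = lincomb e c \<and> (\<forall>B. (\<forall>j\<in>supp f. rk j \<le> B) \<longrightarrow> (\<forall>j\<in>supp c. rk j \<le> B))"
  by (rule tri_expand) (rule tri_E)

lemma e_indep: "lincomb e c = 0 \<Longrightarrow> c = 0"
  by (rule tri_lincomb_eq_0) (rule tri_E)

section \<open>Values at the special point\<close>

lemma ta2: "t * a\<^sup>2 = 1"
  by (simp add: a_def field_simps)

text \<open>
  At \<open>a = t\<^sup>-\<^sup>1\<^sup>/\<^sup>2\<close> the value of \<open>f\<close> at \<open>1/a\<close> drops out of the formula for \<open>T\<close>.
\<close>

lemma ev_a_Th: "ev a (Th t f) = t * ev a f"
proof -
  have h: "(a\<^sup>2 - 1) * ev a (Th t f) = - ((t - 1) * ev a f)"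
    using ev_Th[of a t f] ta2 by simp
  have eq: "t - 1 = - (t * (a\<^sup>2 - 1))" using ta2 by (simp add: algebra_simps)
  have "(t - 1) * x = - (t * ((a\<^sup>2 - 1) * x))" for x
    unfolding eq by (simp only: mult.assoc mult_minus_left)
  then have "(t - 1) * ev a (Th t f) = - (t * ((a\<^sup>2 - 1) * ev a (Th t f)))" .
  also have "\<dots> = (t - 1) * (t * ev a f)" unfolding h by simp
  finally show ?thesis using t_ne_1 by simp
qed

lemma chi_inv: "qh powi m * qh powi (- m) = 1"
  by (simp add: power_int_minus)

lemma ev_a_pi:
  assumes "par m f" "D0.Y' f = scal l f" "l \<noteq> 0"
  shows "ev a (mon 1 * pi_op qh f) = a * t / l * ev a f"
  using D0.flipx_eigen[OF assms] by (simp add: pi_op_flipx chi_inv ev_mult ev_simps ev_a_Th)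

lemma ev_a_up: "ev a (e (int m + 1)) = a * ev a (e (- int m))"
proof -
  have p: "par (int m) (e (- int m))" using par_E[of "- int m" q t] by (simp add: D0.par_neg)
  show ?thesis
    unfolding E_pos D0.up_flipx[OF p]
    using ev_a_pi[OF p D0.Y'_E D0.lam_nz]
    by (simp add: ev_simps pi_op_flipx D0.lam_def power_int_minus field_simps)
qed

lemma ev_a_down: "m > 0 \<Longrightarrow> ev a (e (- int m)) * (q ^ m * t - 1) = (q ^ m * t\<^sup>2 - 1) * ev a (e (int m))"
proof -
  assume m: "m > 0"
  have "ev a (e (- int m)) = (t + alph q t m) * ev a (e (int m))"
    unfolding E_neg'[OF m] by (simp add: ev_simps ev_a_Th algebra_simps)
  moreover have "(t + alph q t m) * (q ^ m * t - 1) = q ^ m * t\<^sup>2 - 1"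
    using D0.alph_eq[OF m] by (simp add: algebra_simps power2_eq_square)
  moreover have "(t + alph q t m) * ev a (e (int m)) * (q ^ m * t - 1) = ((t + alph q t m) * (q ^ m * t - 1)) * ev a (e (int m))"
    by (simp only: ac_simps)
  ultimately show ?thesis by (simp only:)
qed

text \<open>
  Along the chain of intertwiners the value at \<open>a\<close> is multiplied by explicit factors, which
  vanish only for \<open>q\<^sup>m t\<^sup>2 = 1\<close>, that is in the step from \<open>N\<close> to \<open>-N\<close>.
\<close>

lemma ev_a_nz: "m \<in> MM \<Longrightarrow> ev a (e m) \<noteq> 0"
proof -
  have neg: "m \<le> 2 * n \<Longrightarrow> ev a (e (- int m)) \<noteq> 0" for m
  proof (induction m)
    case (Suc m)
    have "ev a (e (int (Suc m))) \<noteq> 0" using ev_a_up[of m] Suc by (simp add: add.commute)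
    moreover have "q ^ Suc m * t\<^sup>2 \<noteq> 1" unfolding qt2 using Suc by (simp add: NN_def)
    ultimately show ?case using ev_a_down[of "Suc m"] by auto
  qed simp
  assume m: "m \<in> MM"
  show ?thesis
  proof (cases m rule: E_cases)
    case (1 k) then show ?thesis using neg[of k] m by (auto simp: M_set_def)
  next
    case (2 k) then show ?thesis using neg[of k] ev_a_up[of k] m by (auto simp: M_set_def)
  qed
qed

definition eps :: "int \<Rightarrow> 'k lpoly" where "eps m = scal (inverse (ev a (e m))) (e m)"
definition epsp :: "'k \<Rightarrow> int \<Rightarrow> 'k lpoly" where "epsp s m = eps m + scal s (eps (m - 2 * int n - 1))"

lemma ev_a_eps: "m \<in> MM \<Longrightarrow> ev a (eps m) = 1"
  using ev_a_nz[of m] by (simp add: eps_def ev_simps)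

lemma Y'_eps: "D0.Y' (eps m) = scal (D0.lam m) (eps m)"
  by (simp add: eps_def lin_simps[OF D0.lin_Y'] D0.Y'_E mult.commute)

lemma par_eps: "par m (eps m)"
  unfolding eps_def by (intro par_scal par_E)

text \<open>Within a parity class the spectrum of \<open>Y\<close> is simple.\<close>

lemma eig_unique:
  assumes f: "par j f" "D0.Y' f = scal (D0.lam j) f"
  shows "\<exists>c. f = scal c (e j)"
proof -
  obtain c where c: "f = lincomb e c" using e_expand by blast
  have "i = j" if i: "i \<in> supp c" for i
  proof -
    have 1: "D0.lam i = D0.lam j"
      by (rule eig_supp[OF tri_E D0.lin_Y' D0.Y'_E _ i]) (use f c in simp)
    have 2: "(- 1) powi i = ((- 1) powi j :: 'k)"
      by (rule eig_supp[OF tri_E lin_flip_X par_flip_X[OF par_E] _ i]) (use par_flip_X[OF f(1)] c in simp)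
    have "even (i - j)"
    proof (rule ccontr)
      assume "odd (i - j)"
      then have "(- 1) powi i = - ((- 1) powi j :: 'k)" by (auto simp: power_int_minus_left)
      then have "(2::'k) * (- 1) powi j = 0" using 2 by simp
      then show False using two by simp
    qed
    with 1 show "i = j" by (rule D.sep)
  qed
  then have "supp c \<subseteq> {j}" by blast
  then have "f = scal (cf c j) (e j)" using c lincomb_superset[of "{j}" c e] by simp
  then show ?thesis by blast
qed

lemma eig_eps:
  assumes "par j f" "D0.Y' f = scal (D0.lam j) f" "j \<in> MM"
  shows "f = scal (ev a f) (eps j)"
proof -
  obtain c where c: "f = scal c (e j)" using eig_unique[OF assms(1,2)] by blast
  then have "ev a f = c * ev a (e j)" by (simp add: ev_simps)
  then show ?thesis using c ev_a_nz[OF assms(3)] by (simp add: eps_def mult.assoc)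
qed

lemma lam_neg: "m \<noteq> 0 \<Longrightarrow> t / D0.lam m = D0.lam (- m)"
  using chi_inv[of m] by (auto simp: D0.lam_def field_simps)

text \<open>
  The intertwiner maps to an eigenspace that is spanned by \<open>eps (- m)\<close>; evaluation at \<open>a\<close>
  yields the constant.
\<close>

lemma T_eps:
  assumes m: "- m \<in> MM" "m \<in> MM" "m \<noteq> 0" and al: "al * (t - (D0.lam m)\<^sup>2) = (t - 1) * (D0.lam m)\<^sup>2"
  shows "Th t (eps m) + scal al (eps m) = scal (t + al) (eps (- m))"
proof -
  let ?f = "Th t (eps m) + scal al (eps m)"
  have tt: "t * qh powi m * qh powi (- m) = t" using chi_inv[of m] by (simp add: mult.assoc)
  have "D0.Y' ?f = scal (t * qh powi m * qh powi (- m) / D0.lam m) ?f"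
    by (rule D0.intertwine_T[OF par_eps Y'_eps D0.lam_nz]) (simp only: tt al)
  then have "D0.Y' ?f = scal (D0.lam (- m)) ?f" unfolding tt lam_neg[OF m(3)] .
  moreover have "par (- m) ?f"
    unfolding D0.par_neg by (intro par_add par_Th par_scal par_eps)
  ultimately have "?f = scal (ev a ?f) (eps (- m))" using m by (intro eig_eps) auto
  then show ?thesis using ev_a_eps[OF m(2)] by (simp add: ev_simps ev_a_Th)
qed

lemma X_eps:
  assumes m: "m \<in> MM"
  shows "mon 1 * pi_op qh (eps m) = scal (a * t / D0.lam m) (eps (1 - m))"
proof -
  let ?f = "mon 1 * pi_op qh (eps m)"
  have "t * qh powi (m - 1) * qh powi (- m) / D0.lam m = D0.lam (1 - m)"
    by (auto simp: D0.lam_def)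
  then have "D0.Y' ?f = scal (D0.lam (1 - m)) ?f"
    using D0.intertwine_X[OF par_eps Y'_eps D0.lam_nz, of m] by (simp add: pi_op_flipx)
  moreover have "par (1 - m) ?f"
  proof -
    have "par m (pi_op qh (eps m))" unfolding pi_op_flipx by (intro D0.par_flipx par_eps)
    then show ?thesis unfolding par_def
    proof (intro ballI)
      fix j assume *: "\<forall>j\<in>supp (pi_op qh (eps m)). even (j - m)" and "j \<in> supp ?f"
      then have "j - 1 \<in> supp (pi_op qh (eps m))" by (simp add: in_keys_iff)
      with * have "even (j - 1 - m)" by blast
      then show "even (j - (1 - m))" by presburger
    qed
  qed
  moreover have "1 - m \<in> MM" using m by (auto simp: M_set_def)
  ultimately have "?f = scal (ev a ?f) (eps (1 - m))" by (intro eig_eps) auto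
  then show ?thesis using ev_a_pi[OF par_eps Y'_eps D0.lam_nz, of m] ev_a_eps[OF m] by simp
qed

end

section \<open>The two ideals of functions vanishing on half of the points\<close>

context special
begin

abbreviation "sgns \<equiv> {1, - 1 :: 'k}"

definition node :: "int \<Rightarrow> 'k" where "node m = p (1/4 + of_int m / 2)"
text \<open>
  For \<open>s = -1\<close> the points are the \<open>q\<^sup>z\<close> and for \<open>s = 1\<close> the \<open>-q\<^sup>z\<close>, with \<open>z\<close> in \<open>bowtie n\<close>.
  The sign is chosen such that \<open>half_ideal s\<close> contains \<open>epsp s m\<close>.
\<close>

definition half_ideal :: "'k \<Rightarrow> 'k lpoly set" where
  "half_ideal s = {f. \<forall>m\<in>{- int n .. int n}. ev (- s * node m) f = 0}"

lemma node_nz [simp]: "node m \<noteq> 0"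
  by (simp add: node_def)

lemma node_inj: "node m = node m' \<longleftrightarrow> m = m'"
  by (simp add: node_def)

lemma node_disjoint: "node i \<noteq> - node j"
proof
  assume eq: "node i = - node j"
  then have "node i ^ 2 = node j ^ 2" by simp
  then have "i = j" by (simp add: node_def ppow)
  with eq have "2 * node i = 0" by (simp add: eq_neg_iff_add_eq_0)
  then show False using two by simp
qed

lemma sgn_nz: "s \<in> sgns \<Longrightarrow> s \<noteq> 0" and sgn_sq: "s \<in> sgns \<Longrightarrow> s * s = 1"
  by auto

lemma node_a: "node (int n) = a"
  by (simp add: node_def a_eq)

lemma half_ideal_subsp: "subsp (half_ideal s)"
  by (rule subspI) (auto simp: half_ideal_def ev_simps)

text \<open>
  The set of points \<open>z\<close> is closed under \<open>z \<mapsto> 1/2 - z\<close>, and under \<open>z \<mapsto> -z\<close> except for the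
  largest element; there \<open>t q\<^sup>2\<^sup>z = 1\<close>, and \<open>ev_Th\<close> does not involve the value at \<open>-z\<close>. No
  point satisfies \<open>q\<^sup>2\<^sup>z = 1\<close>.
\<close>

lemma half_ideal_stable: assumes s: "s \<in> sgns" shows "PR.stable (half_ideal s)"
  unfolding PR.stable_def
proof (intro conjI ballI allI)
  fix f assume f: "f \<in> half_ideal s"
  have f0: "ev (- s * node m) f = 0" if "- int n \<le> m" "m \<le> int n" for m using f that by (auto simp: half_ideal_def)
  show "g * f \<in> half_ideal s" for g using f s by (auto simp: half_ideal_def ev_mult)
  show "pi_op qh f \<in> half_ideal s"
    unfolding half_ideal_def
  proof (intro CollectI ballI)
    fix m assume m: "m \<in> {- int n .. int n}"
    have "1/2 - (1/4 + of_int m / 2) = (1/4 + of_int (- m) / 2 :: rat)" by simp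
    then have "qh / node m = node (- m)" unfolding node_def pdiff[symmetric] by (simp only:)
    then have "qh / (- s * node m) = - s * node (- m)" using s by auto
    then show "ev (- s * node m) (pi_op qh f) = 0" unfolding ev_pi_op using f0[of "- m"] m by simp
  qed
  have "Th t f \<in> half_ideal s"
    unfolding half_ideal_def
  proof (intro CollectI ballI)
    fix m assume m: "m \<in> {- int n .. int n}"
    let ?x = "- s * node m"
    have x2: "?x\<^sup>2 = p (1/2 + of_int m)"
      using s by (auto simp: power_mult_distrib node_def ppow)
    have h: "(1/2 + of_int m :: rat) = of_int (1 + 2 * m) / 2" by (simp add: add_divide_distrib)
    have "?x\<^sup>2 \<noteq> 1" unfolding x2 p_eq_1 h by (rule half_odd_ne_0) simp
    then have ne: "?x\<^sup>2 - 1 \<noteq> 0" by simp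
    have A: "(t * ?x\<^sup>2 - 1) * ev (inverse ?x) f = 0"
    proof (cases "m = int n")
      case True
      then have "t * ?x\<^sup>2 = 1" unfolding x2 t_eq padd[symmetric] by simp
      then show ?thesis by simp
    next
      case False
      have "- (1/4 + of_int m / 2) = (1/4 + of_int (- 1 - m) / 2 :: rat)" by (simp add: diff_divide_distrib)
      then have "inverse (node m) = node (- 1 - m)"
        unfolding node_def pminus[symmetric] by (simp only:)
      then have "inverse ?x = - s * node (- 1 - m)" using s by auto
      then show ?thesis using f0[of "- 1 - m"] m False by simp
    qed
    have x0: "?x \<noteq> 0" using s by auto
    have B: "ev ?x f = 0" by (rule f0) (use m in auto)
    have "(?x\<^sup>2 - 1) * ev ?x (Th t f) = 0" unfolding ev_Th[OF x0] A B by simp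
    then show "ev ?x (Th t f) = 0" using ne by (simp only: mult_eq_0_iff) simp
  qed
  then show "T_op th f \<in> half_ideal s" by (simp add: PR.Tp_Th subsp_scal[OF half_ideal_subsp])
qed (rule half_ideal_subsp)

definition half_gen :: "'k \<Rightarrow> 'k lpoly" where
  "half_gen s = mon (- int n) * (\<Prod>m\<in>{- int n .. int n}. mon 1 + Poly_Mapping.single 0 (s * p (1/4 + of_int m / 2)))"

lemma linear_prod:
  fixes c :: "int \<Rightarrow> 'k"
  assumes "finite I"
  shows "(\<forall>j\<in>supp (\<Prod>m\<in>I. mon 1 + Poly_Mapping.single 0 (c m)). 0 \<le> j \<and> j \<le> int (card I)) \<and>
    cf (\<Prod>m\<in>I. mon 1 + Poly_Mapping.single 0 (c m)) (int (card I)) = 1 \<and>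
    cf (\<Prod>m\<in>I. mon 1 + Poly_Mapping.single 0 (c m)) 0 = (\<Prod>m\<in>I. c m)"
  using assms
proof (induction I rule: finite_induct)
  case empty
  then show ?case by (auto simp: lookup_one)
next
  case (insert x I)
  let ?p = "\<Prod>m\<in>I. mon 1 + Poly_Mapping.single 0 (c m)"
  have z: "cf ?p j = 0" if "j < 0 \<or> j > int (card I)" for j
  proof (rule ccontr)
    assume "cf ?p j \<noteq> 0"
    then have "j \<in> supp ?p" by (simp add: in_keys_iff)
    with insert.IH have "0 \<le> j \<and> j \<le> int (card I)" by blast
    with that show False by linarith
  qed
  have e: "(\<Prod>m\<in>insert x I. mon 1 + Poly_Mapping.single 0 (c m)) = mon 1 * ?p + scal (c x) ?p"
    using insert by (simp add: distrib_right scal_def)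
  have c: "cf (\<Prod>m\<in>insert x I. mon 1 + Poly_Mapping.single 0 (c m)) j = cf ?p (j - 1) + c x * cf ?p j" for j
    unfolding e by (simp add: lookup_add)
  have "0 \<le> j \<and> j \<le> int (card (insert x I))" if j: "j \<in> supp (\<Prod>m\<in>insert x I. mon 1 + Poly_Mapping.single 0 (c m))" for j
  proof (rule ccontr)
    assume "\<not> ?thesis"
    then have "cf ?p (j - 1) = 0" "cf ?p j = 0" using insert.hyps by (auto intro!: z)
    with j show False unfolding in_keys_iff c by simp
  qed
  then show ?case unfolding c using insert z[of "- 1"] z[of "1 + int (card I)"] by auto
qed

lemma
  assumes s: "s \<in> sgns"
  shows half_gen_supp: "j \<in> supp (half_gen s) \<Longrightarrow> - int n \<le> j \<and> j \<le> int n + 1"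
    and half_gen_top: "cf (half_gen s) (int n + 1) = 1"
    and half_gen_bot: "cf (half_gen s) (- int n) = s * a"
proof -
  let ?I = "{- int n .. int n}"
  let ?c = "\<lambda>m. s * p (1/4 + of_int m / 2)"
  have card: "int (card ?I) = NN" by (simp add: NN_def)
  note L = linear_prod[of ?I ?c, unfolded card]
  show "j \<in> supp (half_gen s) \<Longrightarrow> - int n \<le> j \<and> j \<le> int n + 1"
    using L unfolding half_gen_def by (force simp: in_keys_iff NN_def)
  show "cf (half_gen s) (int n + 1) = 1"
    using L unfolding half_gen_def by (simp add: NN_def algebra_simps)
  have "(\<Sum>m\<in>?I. of_int m :: rat) = 0"
  proof -
    have "(\<Sum>m\<in>?I. of_int m :: rat) = (\<Sum>m\<in>?I. of_int (- m))"
      by (rule sum.reindex_bij_witness[of _ uminus uminus]) auto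
    also have "\<dots> = - (\<Sum>m\<in>?I. of_int m :: rat)" by (simp add: sum_negf)
    finally show ?thesis by simp
  qed
  then have sum: "(\<Sum>m\<in>?I. 1/4 + of_int m / 2 :: rat) = 1/4 + of_nat n / 2"
    by (simp add: sum.distrib flip: sum_divide_distrib)
  have "(\<Prod>m\<in>?I. ?c m) = s ^ card ?I * p (\<Sum>m\<in>?I. 1/4 + of_int m / 2)"
    by (simp add: prod.distrib pprod)
  also have "s ^ card ?I = s" using s by (auto simp: card_atLeastAtMost_int nat_add_distrib nat_mult_distrib)
  finally have "(\<Prod>m\<in>?I. ?c m) = s * a" by (simp add: sum a_eq)
  then show "cf (half_gen s) (- int n) = s * a" using L unfolding half_gen_def by simp
qed

lemma half_gen_half_ideal: assumes s: "s \<in> sgns" shows "half_gen s \<in> half_ideal s"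
  unfolding half_ideal_def
proof (intro CollectI ballI)
  fix m assume m: "m \<in> {- int n .. int n}"
  have nz: "- s * node m \<noteq> 0" using s by auto
  have "ev (- s * node m) (mon 1 + Poly_Mapping.single 0 (s * p (1/4 + of_int m / 2))) = 0"
    using ev_single[of "- s * node m" 0] by (simp add: ev_simps node_def)
  then show "ev (- s * node m) (half_gen s) = 0"
    unfolding half_gen_def ev_mult[OF nz] ev_prod[OF nz] using m by (auto intro!: prod_zero)
qed

text \<open>
  The number of points is \<open>N\<close>.
\<close>

lemma half_ideal_zero:
  assumes s: "s \<in> sgns" and f: "f \<in> half_ideal s" "\<And>j. j \<in> supp f \<Longrightarrow> u \<le> j \<and> j < u + NN"
  shows "f = 0"
proof (rule zero_window[where u = u and d = "2 * n + 1"])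
  let ?A = "(\<lambda>m. - s * node m) ` {- int n .. int n}"
  have "inj_on (\<lambda>m. - s * node m) {- int n .. int n}"
    using sgn_nz[OF s] by (auto simp: inj_on_def node_inj)
  then show "2 * n + 1 \<le> card ?A" by (simp add: card_image)
  show "x \<noteq> 0 \<and> ev x f = 0" if "x \<in> ?A" for x using that f sgn_nz[OF s] by (auto simp: half_ideal_def)
  show "u \<le> j \<and> j < u + int (2 * n + 1)" if "j \<in> supp f" for j using f(2)[OF that] by (simp add: NN_def)
qed auto

lemma half_ideal_Idl: assumes s: "s \<in> sgns" shows "half_ideal s = Idl\<^bsub>P\<^esub> {half_gen s}"
  unfolding PR.Idl_P
proof (intro subset_antisym subsetI)
  fix f assume f: "f \<in> half_ideal s"
  obtain h where h: "\<forall>j\<in>supp (f - h * half_gen s). - int n \<le> j \<and> j < int n + 1"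
    using reduce_window[of "half_gen s" "- int n" "int n + 1" f] half_gen_supp[OF s] half_gen_top[OF s] half_gen_bot[OF s] s by auto
  have "f - h * half_gen s \<in> half_ideal s"
    using f half_gen_half_ideal[OF s] half_ideal_stable[OF s] by (intro subsp_diff half_ideal_subsp PR.stableD) auto
  then have "f - h * half_gen s = 0" by (rule half_ideal_zero[OF s, where u = "- int n"]) (use h in \<open>auto simp: NN_def\<close>)
  then show "f \<in> {h * half_gen s |h. True}" by auto
qed (use half_gen_half_ideal[OF s] half_ideal_stable[OF s] in \<open>auto intro: PR.stableD\<close>)

lemma supp_Y':
  assumes "\<And>j. j \<in> supp f \<Longrightarrow> rk j \<le> B" and j: "j \<in> supp (D0.Y' f)"
  shows "rk j \<le> B"
proof -
  obtain c where c: "f = lincomb e c" "\<forall>j\<in>supp c. rk j \<le> B" using e_expand[of f] assms(1) by blast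
  have "D0.Y' f = (\<Sum>i\<in>supp c. scal (cf c i * D0.lam i) (e i))"
    by (simp add: c(1) lincomb_def lin_simps[OF D0.lin_Y'] D0.Y'_E)
  then obtain i where i: "i \<in> supp c" "cf (e i) j \<noteq> 0"
    using j by (force simp: in_keys_iff lookup_sum intro: sum.neutral)
  then have "rk j \<le> rk i" using tri_E[of i q t] by (auto simp: tri_def in_keys_iff)
  then show ?thesis using c i by fastforce
qed

text \<open>
  The ideal meets the span of the monomials \<open>X\<^sup>-\<^sup>n, \<dots>, X\<^sup>n\<^sup>+\<^sup>1\<close> in the line of its
  generator. Both are stable under \<open>Y\<close>, the second as a step of the filtration by \<open>\<prec>\<close>, so
  the generator is an eigenvector. Its leading term determines the eigenvalue, which only \<open>n
  + 1\<close> and \<open>-n\<close> have.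
\<close>

lemma half_gen_e: assumes s: "s \<in> sgns" shows "half_gen s = e (int n + 1) + scal (s * a) (e (- int n))"
proof -
  have win: "rk j \<le> rk (int n + 1) \<longleftrightarrow> - int n \<le> j \<and> j \<le> int n + 1" for j
    by (auto simp: rk_def)
  have Yg: "D0.Y' (half_gen s) \<in> half_ideal s" using half_gen_half_ideal[OF s] by (rule stable_Y'[OF half_ideal_stable[OF s]])
  have Ysupp: "- int n \<le> j \<and> j \<le> int n + 1" if "j \<in> supp (D0.Y' (half_gen s))" for j
    using supp_Y'[OF _ that, of "rk (int n + 1)"] half_gen_supp[OF s] win by blast
  define mu where "mu = cf (D0.Y' (half_gen s)) (int n + 1)"
  have "D0.Y' (half_gen s) - scal mu (half_gen s) = 0"
  proof (rule half_ideal_zero[OF s, where u = "- int n"])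
    show "D0.Y' (half_gen s) - scal mu (half_gen s) \<in> half_ideal s"
      using Yg half_gen_half_ideal[OF s] by (intro subsp_diff subsp_scal half_ideal_subsp)
    fix j assume j: "j \<in> supp (D0.Y' (half_gen s) - scal mu (half_gen s))"
    then have nz: "cf (D0.Y' (half_gen s)) j - mu * cf (half_gen s) j \<noteq> 0" by (simp add: in_keys_iff lookup_minus)
    then have "j \<noteq> int n + 1" using half_gen_top[OF s] by (auto simp: mu_def)
    moreover have "j \<in> supp (D0.Y' (half_gen s)) \<or> j \<in> supp (half_gen s)" using nz by (auto simp: in_keys_iff)
    ultimately show "- int n \<le> j \<and> j < - int n + NN" using Ysupp half_gen_supp[OF s] by (force simp: NN_def)
  qed
  then have Y: "D0.Y' (half_gen s) = scal mu (half_gen s)" by simp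
  obtain c where c: "half_gen s = lincomb e c" "\<forall>j\<in>supp c. rk j \<le> rk (int n + 1)"
    using e_expand[of "half_gen s"] half_gen_supp[OF s] win by blast
  have lam: "D0.lam i = mu" if "i \<in> supp c" for i
    by (rule eig_supp[OF tri_E D0.lin_Y' D0.Y'_E _ that]) (use Y c in simp)
  have top: "cf c (int n + 1) = 1"
  proof (cases "int n + 1 \<in> supp c")
    case True
    then show ?thesis using tri_lincomb_top[OF tri_E True] c half_gen_top[OF s] by auto
  next
    case False
    have "cf (lincomb e c) (int n + 1) = 0"
      unfolding lincomb_def lookup_sum
    proof (intro sum.neutral ballI)
      fix i assume i: "i \<in> supp c"
      then have "rk i < rk (int n + 1)" using c False by (metis le_neq_implies_less rk_inj)
      then have "int n + 1 \<notin> supp (e i)" using tri_E[of i q t] by (auto simp: tri_def)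
      then show "cf (scal (cf c i) (e i)) (int n + 1) = 0" by (simp add: in_keys_iff)
    qed
    then show ?thesis using c half_gen_top[OF s] by simp
  qed
  have "i = int n + 1 \<or> i = - int n" if i: "i \<in> supp c" for i
  proof -
    have "int n + 1 \<in> supp c" using top by (simp add: in_keys_iff)
    then have "lamr i = lamr (int n + 1)" using lam i by (simp flip: p_eq add: lam_eq[symmetric])
    then show ?thesis unfolding lamr_eq_iff using c(2) i win by (auto simp: NN_def)
  qed
  then have "supp c \<subseteq> {int n + 1, - int n}" by blast
  then have g: "half_gen s = e (int n + 1) + scal (cf c (- int n)) (e (- int n))"
    using c(1) top lincomb_superset[of "{int n + 1, - int n}" c e] by simp
  have "cf (e (int n + 1)) (- int n) = 0"
  proof (rule ccontr)
    assume "cf (e (int n + 1)) (- int n) \<noteq> 0"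
    then have "- int n \<in> supp (e (int n + 1))" by (simp add: in_keys_iff)
    then have "even (- int n - (int n + 1))" using par_E[of "int n + 1" q t] unfolding par_def by blast
    then show False by simp
  qed
  then have "cf (half_gen s) (- int n) = cf c (- int n)" unfolding g by (simp add: lookup_add)
  then show ?thesis using g half_gen_bot[OF s] by simp
qed

lemma MM_mem: "m \<in> {1..NN} \<Longrightarrow> m \<in> MM" "m \<in> {1..NN} \<Longrightarrow> m - NN \<in> MM" "m \<in> {1..NN} \<Longrightarrow> m - 2 * int n - 1 \<in> MM"
  by (auto simp: M_set_def NN_def)

lemma epsp_NN: "epsp s m = eps m + scal s (eps (m - NN))"
  by (simp add: epsp_def NN_def diff_diff_eq)

lemma lam_NN: "m \<in> {1..NN} \<Longrightarrow> D0.lam (m - NN) = D0.lam m"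
  by (auto simp: lam_eq lamr_eq_iff)

lemma Y'_epsp: "m \<in> {1..NN} \<Longrightarrow> D0.Y' (epsp s m) = scal (D0.lam m) (epsp s m)"
  by (simp add: epsp_NN lin_simps[OF D0.lin_Y'] Y'_eps lam_NN scal_add mult.commute)

lemma epsp_half_gen: assumes s: "s \<in> sgns"
  shows "epsp s (int n + 1) = scal (inverse (ev a (e (int n + 1)))) (half_gen s)"
proof -
  have "inverse (ev a (e (int n + 1))) * (s * a) = s * inverse (ev a (e (- int n)))"
    unfolding ev_a_up by (simp add: field_simps)
  moreover have "epsp s (int n + 1) = scal (inverse (ev a (e (int n + 1)))) (e (int n + 1))
      + scal (s * inverse (ev a (e (- int n)))) (e (- int n))"
    by (simp add: epsp_def eps_def)
  ultimately show ?thesis unfolding half_gen_e[OF s] scal_add scal_scal by (simp only:)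
qed

lemma epsp_X: assumes s: "s \<in> sgns" and m: "m \<in> {1..NN}"
  shows "mon 1 * pi_op qh (epsp s m) = scal (a * t / D0.lam m * s) (epsp s (NN + 1 - m))"
proof -
  have "mon 1 * pi_op qh (epsp s m) = scal (a * t / D0.lam m) (eps (1 - m)) + scal (s * (a * t / D0.lam m)) (eps (1 - (m - NN)))"
    using X_eps[of m] X_eps[of "m - NN"] MM_mem[OF m] lam_NN[OF m]
    by (simp add: epsp_NN lin_simps[OF PR.lin_pp] distrib_left scal_mult_right)
  also have "\<dots> = scal (a * t / D0.lam m * s) (epsp s (NN + 1 - m))"
    using s by (auto simp: epsp_NN scal_add algebra_simps)
  finally show ?thesis .
qed

lemma alph_lam: "m > 0 \<Longrightarrow> alph q t m * (t - (D0.lam (int m))\<^sup>2) = (t - 1) * (D0.lam (int m))\<^sup>2"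
proof -
  assume m: "m > 0"
  have l: "q ^ m * (D0.lam (int m))\<^sup>2 = 1"
  proof -
    have lm: "D0.lam (int m) = p (- of_int (int m) / 2)" using m by (simp add: lam_eq lamr_def)
    show ?thesis unfolding lm ppow padd[symmetric] by simp
  qed
  have "q ^ m * (alph q t m * (t - (D0.lam (int m))\<^sup>2)) = alph q t m * (q ^ m * t - q ^ m * (D0.lam (int m))\<^sup>2)"
    by (simp add: algebra_simps)
  also have "\<dots> = (t - 1) * (q ^ m * (D0.lam (int m))\<^sup>2)" unfolding l using D0.alph_eq[OF m] by simp
  finally show ?thesis by (simp add: mult.left_commute)
qed

lemma epsp_T: assumes s: "s \<in> sgns" and m: "m > 0" "int m < NN"
  shows "Th t (epsp s (int m)) + scal (alph q t m) (epsp s (int m)) = scal ((t + alph q t m) * s) (epsp s (NN - int m))"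
    and "t + alph q t m \<noteq> 0"
proof -
  have mm: "int m \<in> {1..NN}" using m by auto
  have 1: "Th t (eps (int m)) + scal (alph q t m) (eps (int m)) = scal (t + alph q t m) (eps (- int m))"
    by (rule T_eps[OF _ _ _ alph_lam]) (use m in \<open>auto simp: M_set_def NN_def\<close>)
  have 2: "Th t (eps (int m - NN)) + scal (alph q t m) (eps (int m - NN)) = scal (t + alph q t m) (eps (- (int m - NN)))"
    by (rule T_eps) (use m alph_lam[of m] lam_NN[OF mm] in \<open>auto simp: M_set_def NN_def\<close>)
  have "Th t (epsp s (int m)) + scal (alph q t m) (epsp s (int m))
      = (Th t (eps (int m)) + scal (alph q t m) (eps (int m)))
        + scal s (Th t (eps (int m - NN)) + scal (alph q t m) (eps (int m - NN)))"
    by (simp add: epsp_NN lin_simps[OF lin_Th] scal_add mult.commute)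
  also have "\<dots> = scal ((t + alph q t m) * s) (epsp s (NN - int m))"
    unfolding 1 2 using s by (auto simp: epsp_NN scal_add add.commute)
  finally show "Th t (epsp s (int m)) + scal (alph q t m) (epsp s (int m)) = scal ((t + alph q t m) * s) (epsp s (NN - int m))" .
  have "(t + alph q t m) * (q ^ m * t - 1) = q ^ m * t\<^sup>2 - 1"
    using D0.alph_eq[OF m(1)] by (simp add: algebra_simps power2_eq_square)
  moreover have "q ^ m * t\<^sup>2 \<noteq> 1" using qt2[of m] m by simp
  ultimately show "t + alph q t m \<noteq> 0" by auto
qed

lemma scal_in: "subsp J \<Longrightarrow> c \<noteq> 0 \<Longrightarrow> scal c f \<in> J \<Longrightarrow> f \<in> J"
  by (simp add: subsp_scal_iff)

text \<open>
  Starting from \<open>n + 1\<close>, the reflections \<open>m \<mapsto> N + 1 - m\<close> and \<open>m \<mapsto> N - m\<close> of the intertwiners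
  reach all indices.
\<close>

lemma epsp_stable:
  assumes s: "s \<in> sgns" and J: "PR.stable J" and g: "epsp s (int n + 1) \<in> J" and m: "m \<in> {1..NN}"
  shows "epsp s m \<in> J"
proof -
  note sub = PR.stableD(1)[OF J]
  have stX: "epsp s (NN + 1 - m) \<in> J" if "m \<in> {1..NN}" "epsp s m \<in> J" for m
  proof -
    have "scal (a * t / D0.lam m * s) (epsp s (NN + 1 - m)) \<in> J"
      unfolding epsp_X[OF s that(1), symmetric] using that(2) J by (intro PR.stableD) auto
    then show ?thesis by (rule scal_in[OF sub, rotated]) (use s in auto)
  qed
  have stT: "epsp s (NN - m) \<in> J" if "m > 0" "m < NN" "epsp s m \<in> J" for m
  proof -
    have m: "m = int (nat m)" "nat m > 0" "int (nat m) < NN" using that by auto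
    have "scal ((t + alph q t (nat m)) * s) (epsp s (NN - int (nat m))) \<in> J"
      unfolding epsp_T(1)[OF s m(2,3), symmetric] using that(3) m(1) J
      by (intro subsp_add subsp_scal sub PR.stableD(8)) auto
    then have "epsp s (NN - int (nat m)) \<in> J"
      by (rule scal_in[OF sub, rotated]) (use s epsp_T(2)[OF s m(2,3)] in auto)
    then show ?thesis using m(1) by simp
  qed
  have up: "epsp s (int n + 1 + int i) \<in> J" if "i \<le> n" for i
    using that
  proof (induction i)
    case (Suc i)
    have "epsp s (NN - (int n + 1 + int i)) \<in> J"
      by (rule stT) (use Suc in \<open>auto simp: NN_def\<close>)
    then have "epsp s (NN + 1 - (NN - (int n + 1 + int i))) \<in> J"
      by (intro stX) (use Suc in \<open>auto simp: NN_def\<close>)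
    then show ?case by (simp add: algebra_simps)
  qed (simp add: g)
  have "epsp s (int n + 1 - int i) \<in> J" if "i \<le> n" for i
  proof -
    have "epsp s (NN + 1 - (int n + 1 + int i)) \<in> J"
      by (rule stX) (use up[OF that] that in \<open>auto simp: NN_def\<close>)
    then show ?thesis by (simp add: NN_def algebra_simps)
  qed
  from this[of "nat (int n + 1 - m)"] up[of "nat (m - int n - 1)"] m show ?thesis
    by (cases "m \<le> int n + 1") (auto simp: NN_def)
qed

lemma epsp_half_ideal: "s \<in> sgns \<Longrightarrow> m \<in> {1..NN} \<Longrightarrow> epsp s m \<in> half_ideal s"
  by (rule epsp_stable[OF _ half_ideal_stable]) (auto simp: epsp_half_gen intro!: subsp_scal half_ideal_subsp half_gen_half_ideal)

lemma alph_NN: "alph q t (nat NN) = - t"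
proof -
  have N: "int (nat NN) = NN" "nat NN > 0" by (auto simp: NN_def)
  have "t * (q ^ nat NN * t - 1) = 1 - t"
    using qt2[of "nat NN"] N by (simp add: algebra_simps power2_eq_square)
  then have "(alph q t (nat NN) + t) * (q ^ nat NN * t - 1) = 0"
    using D0.alph_eq[OF N(2)] by (simp add: distrib_right)
  then have "alph q t (nat NN) + t = 0" using D0.qt[OF N(2)] by simp
  then show ?thesis by (simp only: eq_neg_iff_add_eq_0)
qed

lemma e_NN: "e (- NN) = Th t (e NN) - scal t (e NN)"
proof -
  have N: "int (nat NN) = NN" "nat NN > 0" by (auto simp: NN_def)
  show ?thesis using E_neg'[OF N(2), of q t] unfolding N alph_NN by (simp add: scal_minus_left)
qed

text \<open>
  \<open>X \<pi>\<close> is invertible, so this step of the chain can be followed in both directions.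
\<close>

lemma e_up_stable:
  assumes J: "PR.stable J" shows "e (int m + 1) \<in> J \<longleftrightarrow> e (- int m) \<in> J"
proof -
  note sub = PR.stableD(1)[OF J]
  have p: "par (int m) (e (- int m))" using par_E[of "- int m" q t] by (simp add: D0.par_neg)
  have "e (int m + 1) \<in> J \<longleftrightarrow> mon 1 * pi_op qh (e (- int m)) \<in> J"
    unfolding E_pos D0.up_flipx[OF p] by (simp add: subsp_scal_iff[OF sub] pi_op_flipx)
  also have "\<dots> \<longleftrightarrow> e (- int m) \<in> J"
  proof
    assume "mon 1 * pi_op qh (e (- int m)) \<in> J"
    then have "pi_op qh (mon (- 1) * (mon 1 * pi_op qh (e (- int m)))) \<in> J"
      by (rule PR.stableD(3)[OF J PR.stableD(2)[OF J]])
    then show "e (- int m) \<in> J" by simp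
  qed (intro PR.stableD J)
  finally show ?thesis .
qed

lemma e_down_stable:
  assumes J: "PR.stable J" and m: "m > 0" "e (int m) \<in> J" shows "e (- int m) \<in> J"
  unfolding E_neg'[OF m(1)] using m J by (intro subsp_add subsp_scal PR.stableD) auto

text \<open>
  Beyond \<open>-N\<close> the chain of intertwiners passes through all \<open>e\<^sub>m\<close> that span \<open>R0\<close>.
\<close>

lemma R0_subset:
  assumes J: "PR.stable J" and N: "e (- NN) \<in> J" shows "R0 \<subseteq> J"
proof
  have neg: "e (- NN - int i) \<in> J" for i
  proof (induction i)
    case (Suc i)
    have "e (int (nat (NN + int i)) + 1) \<in> J"
      unfolding e_up_stable[OF J] using Suc by (simp add: NN_def)
    then have "e (int (nat (NN + int i) + 1)) \<in> J" by (simp add: add.commute)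
    then have "e (- int (nat (NN + int i) + 1)) \<in> J" by (intro e_down_stable J) auto
    moreover have "- int (nat (NN + int i) + 1) = - NN - int (Suc i)" by (simp add: NN_def)
    ultimately show ?case by metis
  qed (simp add: N)
  have e: "e m \<in> J" if m: "m \<notin> MM" for m
  proof (cases "m \<le> 0")
    case True
    then show ?thesis using neg[of "nat (- NN - m)"] m by (auto simp: M_set_def NN_def)
  next
    case False
    have "e (- int (nat (m - 1))) \<in> J"
      using neg[of "nat (m - 1 - NN)"] m False by (auto simp: M_set_def NN_def)
    then have "e (int (nat (m - 1)) + 1) \<in> J" by (simp only: e_up_stable[OF J])
    then show ?thesis using False by simp
  qed
  fix f assume f: "f \<in> R0"
  obtain c where c: "f = lincomb e c" using e_expand by blast
  then have "supp c \<inter> MM = {}" using f R0_lincomb by simp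
  then show "f \<in> J" unfolding c using e by (intro subsp_lincomb PR.stableD(1)[OF J]) auto
qed

text \<open>
  \<open>epsp s N\<close> is \<open>eps N + s\<close>. The intertwiner \<open>Th - t\<close> annihilates the constant, and maps
  \<open>e\<^sub>N\<close> to \<open>e\<^bsub>-N\<^esub>\<close>.
\<close>

lemma R0_half_ideal: assumes s: "s \<in> sgns" shows "R0 \<subseteq> half_ideal s"
proof (rule R0_subset[OF half_ideal_stable[OF s]])
  have N1: "NN \<in> {1..NN}" by (simp add: NN_def)
  have "Th t (epsp s NN) - scal t (epsp s NN) \<in> half_ideal s"
    using epsp_half_ideal[OF s N1] half_ideal_stable[OF s] by (intro subsp_diff subsp_scal half_ideal_subsp PR.stableD(8)) auto
  also have "Th t (epsp s NN) - scal t (epsp s NN) = scal (inverse (ev a (e NN))) (e (- NN))"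
    by (simp add: epsp_NN e_NN eps_def lin_simps[OF lin_Th] scal_add scal_diff mult.commute)
  finally show "e (- NN) \<in> half_ideal s"
    by (rule scal_in[OF half_ideal_subsp, rotated]) (use ev_a_nz[OF MM_mem(1)[OF N1]] in simp)
qed

lemma half_ideal_both_zero:
  assumes f: "f \<in> half_ideal 1" "f \<in> half_ideal (- 1)" "\<And>j. j \<in> supp f \<Longrightarrow> u \<le> j \<and> j < u + 2 * NN"
  shows "f = 0"
proof (rule zero_window[where u = u and d = "2 * (2 * n + 1)"])
  let ?I = "{- int n .. int n}"
  let ?A = "node ` ?I" and ?B = "(\<lambda>m. - node m) ` ?I"
  have disj: "?A \<inter> ?B = {}" using node_disjoint by auto
  have "inj_on node ?I" "inj_on (\<lambda>m. - node m) ?I" by (auto simp: inj_on_def node_inj)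
  then show "2 * (2 * n + 1) \<le> card (?A \<union> ?B)"
    by (subst card_Un_disjoint[OF _ _ disj]) (auto simp: card_image)
  show "x \<noteq> 0 \<and> ev x f = 0" if "x \<in> ?A \<union> ?B" for x using that f by (auto simp: half_ideal_def)
  show "u \<le> j \<and> j < u + int (2 * (2 * n + 1))" if "j \<in> supp f" for j using f(3)[OF that] by (simp add: NN_def)
qed auto

lemma e_NN_win: "j \<in> supp (e (- NN)) \<Longrightarrow> - NN \<le> j \<and> j \<le> NN"
  using tri_E[of "- NN" q t] by (auto simp: tri_def rk_def NN_def split: if_splits)

text \<open>
  The generator \<open>e\<^bsub>-N\<^esub>\<close> of the radical has extreme exponents \<open>-N\<close> and \<open>N\<close>, and a remainder
  with \<open>2N\<close> exponents that vanishes at all \<open>2N\<close> points is zero.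
\<close>

lemma half_ideal_reduce:
  assumes f: "f \<in> half_ideal 1" "f \<in> half_ideal (- 1)" shows "\<exists>h. f = h * e (- NN)"
proof -
  have N: "int (nat NN) = NN" "nat NN > 0" by (auto simp: NN_def)
  have "cf (e (- NN)) NN \<noteq> 0" using cf_E_neg[OF N(2), of q t] unfolding N alph_NN by simp
  then obtain h where h: "\<forall>j\<in>supp (f - h * e (- NN)). - NN \<le> j \<and> j < NN"
    using reduce_window[of "e (- NN)" "- NN" NN f] e_NN_win by (auto simp: NN_def)
  have "e (- NN) \<in> R0" by (auto simp: e_R0 M_set_def NN_def)
  then have "h * e (- NN) \<in> R0" by (rule PR.stableD[OF R0_stable])
  then have "f - h * e (- NN) \<in> half_ideal 1" "f - h * e (- NN) \<in> half_ideal (- 1)"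
    using R0_half_ideal f by (auto intro: subsp_diff half_ideal_subsp)
  then have "f - h * e (- NN) = 0" by (rule half_ideal_both_zero[where u = "- NN"]) (use h in auto)
  then show ?thesis by auto
qed

lemma R0_eq: "R0 = half_ideal 1 \<inter> half_ideal (- 1)"
proof (intro subset_antisym subsetI)
  fix f assume "f \<in> half_ideal 1 \<inter> half_ideal (- 1)"
  then obtain h where h: "f = h * e (- NN)" using half_ideal_reduce by blast
  have "e (- NN) \<in> R0" by (auto simp: e_R0 M_set_def NN_def)
  then show "f \<in> R0" unfolding h by (rule PR.stableD[OF R0_stable])
qed (use R0_half_ideal in auto)

lemma R0_Idl: "R0 = Idl\<^bsub>P\<^esub> {e (- 2 * int n - 1)}"
proof -
  have N: "- 2 * int n - 1 = - NN" by (simp add: NN_def)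
  have "e (- NN) \<in> R0" by (auto simp: e_R0 M_set_def NN_def)
  then show ?thesis
    unfolding N PR.Idl_P using half_ideal_reduce R0_eq PR.stableD(2)[OF R0_stable] by auto
qed

lemma ev_epsp: assumes s: "s \<in> sgns" and m: "m \<in> {1..NN}" shows "ev (s * a) (epsp s m) \<noteq> 0"
proof -
  have ev: "ev (s * a) f = s powi j * ev a f" if "par j f" for f j
  proof -
    have "ev (- a) f = (- 1) powi j * ev a f"
      using par_flip_X[OF that] ev_flip_X[of a f] by (simp add: ev_simps)
    then show ?thesis using s by auto
  qed
  have NNo: "odd NN" by (simp add: NN_def)
  have "s * s powi (m - NN) = s powi m"
    using s NNo by (auto simp: power_int_minus_left)
  then have "ev (s * a) (epsp s m) = s powi m + s powi m"
    unfolding epsp_NN linf_add[OF linf_ev] linf_scal[OF linf_ev] ev[OF par_eps]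
    using ev_a_eps MM_mem[OF m] by simp
  also have "\<dots> = 2 * s powi m" by simp
  finally show ?thesis using two sgn_nz[OF s] by simp
qed

lemma half_ideal_neg_a: "f \<in> half_ideal (- s) \<Longrightarrow> ev (s * a) f = 0"
  using node_a by (force simp: half_ideal_def)

lemma lam_inj: "i \<in> {1..NN} \<Longrightarrow> j \<in> {1..NN} \<Longrightarrow> D0.lam i = D0.lam j \<Longrightarrow> i = j"
  by (auto simp: lam_eq lamr_eq_iff)

text \<open>
  The \<open>epsp s m\<close> have distinct eigenvalues and do not vanish at \<open>s a\<close>.
\<close>

lemma epsp_indep:
  assumes s: "s \<in> sgns" and c: "supp c \<subseteq> {1..NN}" and K: "subsp K" "\<And>f. f \<in> K \<Longrightarrow> D0.Y' f \<in> K" "\<And>f. f \<in> K \<Longrightarrow> ev (s * a) f = 0"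
    and f: "lincomb (epsp s) c \<in> K"
  shows "c = 0"
proof (rule ccontr)
  assume "c \<noteq> 0"
  then obtain i where i: "i \<in> supp c" by (metis all_not_in_conv keys_eq_empty)
  have "scal (cf c i) (epsp s i) \<in> K"
  proof (rule eig_sum[where u = "\<lambda>i. scal (cf c i) (epsp s i)" and l = D0.lam and I = "supp c", OF D0.lin_Y' K(1,2)])
    show "D0.Y' (scal (cf c i) (epsp s i)) = scal (D0.lam i) (scal (cf c i) (epsp s i))" if "i \<in> supp c" for i
      using Y'_epsp[of i] c that by (auto simp: lin_simps[OF D0.lin_Y'] mult.commute)
    show "inj_on D0.lam (supp c)" using lam_inj c unfolding inj_on_def by blast
    show "(\<Sum>i\<in>supp c. scal (cf c i) (epsp s i)) \<in> K" using f by (simp add: lincomb_def)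
  qed (use i in auto)
  then have "cf c i * ev (s * a) (epsp s i) = 0" using K(3) by (metis linf_scal[OF linf_ev])
  then show False using ev_epsp[OF s, of i] c i by (auto simp: in_keys_iff)
qed

text \<open>
  Modulo \<open>half_ideal (- s)\<close>, which contains \<open>epsp (- s) m\<close> and \<open>R0\<close>, the elements \<open>eps m\<close>
  and \<open>eps (m - N)\<close> are multiples of \<open>epsp s m\<close>.
\<close>

lemma epsp_span: assumes s: "s \<in> sgns"
  shows "\<exists>c. supp c \<subseteq> {1..NN} \<and> f - lincomb (epsp s) c \<in> half_ideal (- s)"
proof -
  define S where "S = {f. \<exists>c. supp c \<subseteq> {1..NN} \<and> f - lincomb (epsp s) c \<in> half_ideal (- s)}"
  have S: "subsp S"
  proof (rule subspI)
    show "0 \<in> S" unfolding S_def using subsp_0[OF half_ideal_subsp] by (auto intro!: exI[of _ 0])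
  next
    fix f g assume "f \<in> S" "g \<in> S"
    then obtain c d where "supp c \<subseteq> {1..NN}" "f - lincomb (epsp s) c \<in> half_ideal (- s)"
       "supp d \<subseteq> {1..NN}" "g - lincomb (epsp s) d \<in> half_ideal (- s)" by (auto simp: S_def)
    moreover from this have "(f - lincomb (epsp s) c) + (g - lincomb (epsp s) d) \<in> half_ideal (- s)"
      by (auto intro: subsp_add half_ideal_subsp)
    moreover have "(f - lincomb (epsp s) c) + (g - lincomb (epsp s) d) = (f + g) - lincomb (epsp s) (c + d)"
      by (simp add: lincomb_add)
    ultimately show "f + g \<in> S" unfolding S_def using keys_add[of c d] by (auto intro!: exI[of _ "c + d"])
  next
    fix a f assume "f \<in> S"
    then obtain c where c: "supp c \<subseteq> {1..NN}" "f - lincomb (epsp s) c \<in> half_ideal (- s)" by (auto simp: S_def)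
    let ?d = "Poly_Mapping.mapp (\<lambda>i x. a * x) c"
    have d: "supp ?d \<subseteq> supp c" by (rule keys_mapp_subset)
    have "scal a (lincomb (epsp s) c) = lincomb (epsp s) ?d"
      by (rule lincomb_eig) (auto intro: lin_scale lin_id)
    then have "scal a f - lincomb (epsp s) ?d = scal a (f - lincomb (epsp s) c)" by (simp add: scal_diff)
    also have "\<dots> \<in> half_ideal (- s)" using c by (auto intro: subsp_scal half_ideal_subsp)
    finally show "scal a f \<in> S" unfolding S_def using c d by blast
  qed
  have J: "f \<in> S" if "f \<in> half_ideal (- s)" for f unfolding S_def using that by (auto intro!: exI[of _ 0])
  have ep: "epsp s m \<in> S" if m: "m \<in> {1..NN}" for m
    unfolding S_def using m subsp_0[OF half_ideal_subsp]
    by (auto intro!: exI[of _ "Poly_Mapping.single m 1"])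
  have ms: "- s \<in> sgns" using s by auto
  have eS: "eps m \<in> S \<and> eps (m - NN) \<in> S" if m: "m \<in> {1..NN}" for m
  proof -
    have in2: "epsp s m \<in> S" "epsp (- s) m \<in> S" using ep[OF m] J[OF epsp_half_ideal[OF ms m]] by auto
    define hf where "hf = inverse (2::'k)"
    have half: "hf + hf = 1" using two by (simp add: hf_def field_simps)
    have hs: "scal hf g + scal hf g = g" for g by (simp add: half flip: scal_add_left)
    have "scal hf (epsp s m) + scal hf (epsp (- s) m) = scal hf (eps m) + scal hf (eps m)"
      by (simp add: epsp_NN scal_add scal_diff scal_minus_left)
    then have "eps m = scal hf (epsp s m) + scal hf (epsp (- s) m)" unfolding hs by (simp only:)
    moreover have "eps (m - NN) = scal (s * hf) (epsp s m) - scal (s * hf) (epsp (- s) m)"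
    proof -
      have sh: "s * hf * s = hf" using s by auto
      have "scal (s * hf) (epsp s m) - scal (s * hf) (epsp (- s) m)
          = scal (s * hf * s) (eps (m - NN)) + scal (s * hf * s) (eps (m - NN))"
        by (simp add: epsp_NN scal_add scal_diff scal_minus_left)
      then have "scal (s * hf) (epsp s m) - scal (s * hf) (epsp (- s) m) = scal hf (eps (m - NN)) + scal hf (eps (m - NN))"
        unfolding sh .
      then show ?thesis unfolding hs by (simp only:)
    qed
    ultimately show ?thesis using in2 S by (metis subsp_add subsp_diff subsp_scal)
  qed
  have eM: "e m \<in> S" if m: "m \<in> MM" for m
  proof -
    have "eps m \<in> S" using eS[of m] eS[of "m + NN"] m by (cases "m > 0") (auto simp: M_set_def NN_def)
    then show ?thesis unfolding eps_def using subsp_scal_iff[OF S] ev_a_nz[OF m] by simp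
  qed
  obtain c where c: "f = lincomb e c" using e_expand by blast
  have "f \<in> S" unfolding c
  proof (rule subsp_lincomb[OF S])
    fix i show "e i \<in> S" using eM[of i] e_R0[of i] R0_half_ideal[OF ms] J[of "e i"] by blast
  qed
  then show ?thesis by (simp add: S_def)
qed

lemma half_ideal_sum: assumes s: "s \<in> sgns" shows "\<exists>g\<in>half_ideal s. f - g \<in> half_ideal (- s)"
proof -
  obtain c where c: "supp c \<subseteq> {1..NN}" "f - lincomb (epsp s) c \<in> half_ideal (- s)" using epsp_span[OF s] by blast
  then have "lincomb (epsp s) c \<in> half_ideal s" using epsp_half_ideal[OF s] by (intro subsp_lincomb half_ideal_subsp) auto
  with c show ?thesis by blast
qed

lemma half_ideal_inter: "s \<in> sgns \<Longrightarrow> f \<in> half_ideal s \<Longrightarrow> f \<in> half_ideal (- s) \<longleftrightarrow> f \<in> R0"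
  unfolding R0_eq by auto

lemma half_ideal_eq: assumes s: "s \<in> sgns"
  shows "f \<in> half_ideal s \<longleftrightarrow> (\<exists>c. supp c \<subseteq> {1..NN} \<and> f - lincomb (epsp s) c \<in> R0)"
proof
  assume f: "f \<in> half_ideal s"
  obtain c where c: "supp c \<subseteq> {1..NN}" "f - lincomb (epsp s) c \<in> half_ideal (- s)" using epsp_span[OF s] by blast
  have "f - lincomb (epsp s) c \<in> half_ideal s"
    using f c epsp_half_ideal[OF s] by (intro subsp_diff subsp_lincomb half_ideal_subsp) auto
  then show "\<exists>c. supp c \<subseteq> {1..NN} \<and> f - lincomb (epsp s) c \<in> R0" using c half_ideal_inter[OF s] by blast
next
  assume "\<exists>c. supp c \<subseteq> {1..NN} \<and> f - lincomb (epsp s) c \<in> R0"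
  then obtain c where c: "supp c \<subseteq> {1..NN}" "f - lincomb (epsp s) c \<in> R0" by blast
  then have "(f - lincomb (epsp s) c) + lincomb (epsp s) c \<in> half_ideal s"
    using R0_half_ideal[OF s] epsp_half_ideal[OF s] by (intro subsp_add subsp_lincomb half_ideal_subsp) auto
  then show "f \<in> half_ideal s" by simp
qed

end

section \<open>The quotient by the radical and its two summands\<close>

lemma lincomb_reindex:
  assumes "inj g"
  shows "\<exists>d. supp d = g ` supp c \<and> (\<forall>i. cf d (g i) = cf c i) \<and> lincomb b d = lincomb (\<lambda>i. b (g i)) c"
proof -
  define d where "d = (\<Sum>i\<in>supp c. Poly_Mapping.single (g i) (cf c i))"
  have cf: "cf d k = (\<Sum>i\<in>supp c. if g i = k then cf c i else 0)" for k
    unfolding d_def lookup_sum by (intro sum.cong) (auto simp: lookup_single when_def)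
  have 1: "cf d (g i) = cf c i" for i
    using assms by (simp add: cf inj_eq in_keys_iff)
  have 2: "supp d = g ` supp c"
  proof (intro subset_antisym subsetI)
    fix k assume "k \<in> supp d"
    then have nz: "(\<Sum>i\<in>supp c. if g i = k then cf c i else 0) \<noteq> 0" by (simp add: in_keys_iff cf)
    show "k \<in> g ` supp c"
    proof (rule ccontr)
      assume "k \<notin> g ` supp c"
      then have "(\<Sum>i\<in>supp c. if g i = k then cf c i else 0) = 0" by (intro sum.neutral) auto
      with nz show False by simp
    qed
  qed (auto simp: in_keys_iff 1)
  have "lincomb b d = lincomb (\<lambda>i. b (g i)) c"
    unfolding lincomb_def 2 using assms by (subst sum.reindex) (auto simp: 1 inj_on_def inj_def)
  then show ?thesis using 1 2 by blast
qed

context presented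
begin

lemma has_basisI_reindex:
  assumes g: "inj g" and b: "\<And>i. i \<in> g ` J \<Longrightarrow> b i \<in> S \<and> B i = h (b i)"
    and span: "\<And>f. f \<in> S \<Longrightarrow> \<exists>c. supp c \<subseteq> g ` J \<and> f - lincomb b c \<in> R"
    and indep: "\<And>c. supp c \<subseteq> g ` J \<Longrightarrow> lincomb b c \<in> R \<Longrightarrow> c = 0"
  shows "has_basis M (\<lambda>i. B (g i)) J"
proof (rule has_basisI[where b = "\<lambda>i. b (g i)"])
  show "b (g i) \<in> S \<and> B (g i) = h (b (g i))" if "i \<in> J" for i using b[of "g i"] that by blast
  show "\<exists>c. supp c \<subseteq> J \<and> f - lincomb (\<lambda>i. b (g i)) c \<in> R" if f: "f \<in> S" for f
  proof -
    obtain c where c: "supp c \<subseteq> g ` J" "f - lincomb b c \<in> R" using span[OF f] by blast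
    let ?d = "Poly_Mapping.map_key g c"
    have d: "supp ?d = g -` supp c" by (rule keys_map_key[OF g])
    have im: "g ` supp ?d = supp c" using c(1) unfolding d by blast
    have "lincomb b c = (\<Sum>k\<in>g ` supp ?d. scal (cf c k) (b k))" by (simp add: lincomb_def im)
    also have "\<dots> = lincomb (\<lambda>i. b (g i)) ?d"
      unfolding lincomb_def using g by (subst sum.reindex) (auto simp: map_key.rep_eq[OF g] inj_on_def inj_def)
    finally have "f - lincomb (\<lambda>i. b (g i)) ?d \<in> R" using c by simp
    moreover have "supp ?d \<subseteq> J" using c(1) g unfolding d by (auto simp: inj_def)
    ultimately show ?thesis by blast
  qed
  show "c = 0" if c: "supp c \<subseteq> J" "lincomb (\<lambda>i. b (g i)) c \<in> R" for c
  proof -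
    obtain d where d: "supp d = g ` supp c" "lincomb b d = lincomb (\<lambda>i. b (g i)) c"
      using lincomb_reindex[OF g, of c b] by blast
    then have "d = 0" by (intro indep) (use c in auto)
    then show ?thesis using d(1) by simp
  qed
qed

end

context special
begin

definition "Q = quot_rep P R0"
definition V :: "'k \<Rightarrow> ('k, 'k lpoly set) hh_module" where
  "V s = Q\<lparr>carrier := lin_span Q (\<lambda>m. R0 +>\<^bsub>P\<^esub> epsp s m) {1 .. 2 * int n + 1}\<rparr>"

lemma NN_int: "{1 .. 2 * int n + 1} = {1..NN}"
  by (simp add: NN_def)

sublocale Q: presented_rep Q "PR.cs R0" UNIV R0 "\<lambda>f. mon 1 * f" PR.Yp PR.Tp
  unfolding Q_def by (rule PR.quot_presented[OF R0_stable])

lemma R0_sub: "subsp R0"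
  by (rule PR.stableD(1)[OF R0_stable])

lemma cs_eq_iff: "PR.cs R0 f = PR.cs R0 g \<longleftrightarrow> f - g \<in> R0"
  by (rule PR.cs_eq_iff[OF R0_sub])

lemma V_carrier: assumes s: "s \<in> sgns"
  shows "lin_span Q (\<lambda>m. R0 +>\<^bsub>P\<^esub> epsp s m) {1 .. 2 * int n + 1} = PR.cs R0 ` half_ideal s"
proof -
  have "lin_span Q (\<lambda>m. R0 +>\<^bsub>P\<^esub> epsp s m) {1 .. 2 * int n + 1} = PR.cs R0 ` {lincomb (epsp s) c | c. supp c \<subseteq> {1..NN}}"
    unfolding NN_int by (rule Q.lin_span_eq) (auto simp: PR.cs_def)
  also have "\<dots> = PR.cs R0 ` half_ideal s"
  proof (intro subset_antisym subsetI)
    fix x assume "x \<in> PR.cs R0 ` {lincomb (epsp s) c | c. supp c \<subseteq> {1..NN}}"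
    then obtain c where c: "x = PR.cs R0 (lincomb (epsp s) c)" "supp c \<subseteq> {1..NN}" by blast
    have "lincomb (epsp s) c \<in> half_ideal s" using epsp_half_ideal[OF s] c by (intro subsp_lincomb half_ideal_subsp) auto
    then show "x \<in> PR.cs R0 ` half_ideal s" using c by blast
  next
    fix x assume "x \<in> PR.cs R0 ` half_ideal s"
    then obtain f where f: "x = PR.cs R0 f" "f \<in> half_ideal s" by blast
    then obtain c where "supp c \<subseteq> {1..NN}" "f - lincomb (epsp s) c \<in> R0" using half_ideal_eq[OF s] by blast
    then show "x \<in> PR.cs R0 ` {lincomb (epsp s) c | c. supp c \<subseteq> {1..NN}}"
      using f cs_eq_iff by blast
  qed
  finally show ?thesis .
qed

lemma V_eq: "s \<in> sgns \<Longrightarrow> V s = Q\<lparr>carrier := PR.cs R0 ` half_ideal s\<rparr>"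
  by (simp add: V_def V_carrier)

lemma V_car: "s \<in> sgns \<Longrightarrow> carrier (V s) = PR.cs R0 ` half_ideal s"
  by (simp add: V_eq)

lemma V_mem: assumes s: "s \<in> sgns" shows "R0 +>\<^bsub>P\<^esub> f \<in> carrier (V s) \<longleftrightarrow> f \<in> half_ideal s"
proof
  assume "R0 +>\<^bsub>P\<^esub> f \<in> carrier (V s)"
  then obtain g where g: "PR.cs R0 f = PR.cs R0 g" "g \<in> half_ideal s" by (auto simp: V_car[OF s] PR.cs_def)
  then have "(f - g) + g \<in> half_ideal s" using R0_half_ideal[OF s] unfolding cs_eq_iff by (intro subsp_add half_ideal_subsp) auto
  then show "f \<in> half_ideal s" by simp
qed (auto simp: V_car[OF s] PR.cs_def)

lemma V_rep: "s \<in> sgns \<Longrightarrow> presented_rep (V s) (PR.cs R0) (half_ideal s) R0 (\<lambda>f. mon 1 * f) PR.Yp PR.Tp"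
  unfolding V_eq Q_def by (rule PR.sub_quot_presented[OF R0_stable half_ideal_stable])

theorem basis_P: "has_basis P e UNIV"
proof (rule PR.P.has_basisI[where b = e])
  show "\<exists>c. supp c \<subseteq> UNIV \<and> f - lincomb e c \<in> {0}" for f
    using e_expand[of f] by auto
qed (auto dest: e_indep)

theorem flip_e: "flip_X (e m) = scal ((- 1) powi m) (e m)"
  by (rule par_flip_X[OF par_E])

theorem basis_R0: "has_basis (P\<lparr>carrier := R0\<rparr>) e (- M_set n)"
proof -
  interpret R: presented "P\<lparr>carrier := R0\<rparr>" "\<lambda>f. f" R0 "{0}"
    using presented_carrier[OF PR.P.presented_axioms R0_sub] by simp
  show ?thesis
  proof (rule R.has_basisI[where b = e])
    show "e i \<in> R0 \<and> e i = e i" if "i \<in> - M_set n" for i using that by (simp add: e_R0)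
    show "\<exists>c. supp c \<subseteq> - M_set n \<and> f - lincomb e c \<in> {0}" if "f \<in> R0" for f
      using e_expand[of f] that R0_lincomb by auto
  qed (use e_indep in auto)
qed

text \<open>
  The intertwiner \<open>Th + \<alpha>\<close> is inverted up to a scalar by \<open>Th - (t - 1 + \<alpha>)\<close>; this scalar
  vanishes only for \<open>q\<^sup>m t\<^sup>2 = 1\<close>.
\<close>

lemma e_down_inv:
  assumes J: "PR.stable J" and m: "m > 0" "int m \<noteq> NN" and e: "e (- int m) \<in> J"
  shows "e (int m) \<in> J"
proof -
  note sub = PR.stableD(1)[OF J]
  let ?al = "alph q t m"
  have "Th t (e (- int m)) - scal (t - 1 + ?al) (e (- int m)) \<in> J"
    using e J by (intro subsp_diff subsp_scal sub PR.stableD(8)) auto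
  also have "Th t (e (- int m)) - scal (t - 1 + ?al) (e (- int m)) = scal (t - ?al * (t - 1 + ?al)) (e (int m))"
    unfolding E_neg'[OF m(1)]
    by (simp add: lin_simps[OF lin_Th] Th_Th scal_add scal_add_left scal_diff_left algebra_simps)
  finally have "scal (t - ?al * (t - 1 + ?al)) (e (int m)) \<in> J" .
  moreover have "t - ?al * (t - 1 + ?al) \<noteq> 0"
  proof
    assume 0: "t - ?al * (t - 1 + ?al) = 0"
    define z where "z = q ^ m * t"
    have a: "?al * (z - 1) = t - 1" using D0.alph_eq[OF m(1)] by (simp add: z_def)
    have "(t - ?al * (t - 1 + ?al)) * (z - 1)\<^sup>2 = t * (z - 1)\<^sup>2 - (?al * (z - 1)) * ((t - 1) * (z - 1) + ?al * (z - 1))"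
      by (simp add: algebra_simps power2_eq_square)
    also have "\<dots> = t * ((z * t - 1) * (q ^ m - 1))"
      unfolding a by (simp add: z_def algebra_simps power2_eq_square)
    finally have "t * ((z * t - 1) * (q ^ m - 1)) = 0" using 0 by simp
    then have "z * t = 1 \<or> q ^ m = 1" by simp
    then show False using qt2[of m] m q_pow_ne_1[OF m(1)] by (auto simp: z_def power2_eq_square mult.assoc)
  qed
  ultimately show ?thesis by (simp add: subsp_scal_iff[OF sub])
qed

text \<open>
  The \<open>e\<^sub>m\<close> with \<open>m > N\<close> have distinct eigenvalues, so one of them lies in \<open>J\<close>. From there
  the chain of intertwiners can be followed down to \<open>e\<^bsub>N+1\<^esub>\<close> and \<open>e\<^bsub>-N\<^esub>\<close>.
\<close>

theorem R0_least:
  assumes J: "PR.stable J" and d: "codim_le J d"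
  shows "R0 \<subseteq> J"
proof -
  have inj: "inj (\<lambda>i. D0.lam (NN + 1 + int i))"
    by (rule injI) (auto simp: lam_eq lamr_eq_iff NN_def)
  have "\<exists>i\<le>d. e (NN + 1 + int i) \<in> J"
  proof (rule codim_eig[where A = D0.Y' and l = "\<lambda>i. D0.lam (NN + 1 + int i)"])
    show "D0.Y' f \<in> J" if "f \<in> J" for f using stable_Y'[OF J that] .
  qed (use D0.lin_Y' PR.stableD(1)[OF J] d inj D0.Y'_E in auto)
  then obtain i where i: "e (NN + 1 + int i) \<in> J" by blast
  have "e (NN + 1) \<in> J" using i
  proof (induction i)
    case (Suc i)
    let ?m = "nat (NN + 1 + int i)"
    have "e (int ?m + 1) \<in> J" using Suc by (simp add: NN_def algebra_simps)
    then have "e (- int ?m) \<in> J" by (simp only: e_up_stable[OF J])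
    then have "e (int ?m) \<in> J" by (intro e_down_inv[OF J]) (auto simp: NN_def)
    then show ?case using Suc.IH by (simp add: NN_def)
  qed simp
  then have "e (int (nat NN) + 1) \<in> J" by (simp add: NN_def)
  then have "e (- NN) \<in> J" unfolding e_up_stable[OF J] by (simp add: NN_def)
  then show ?thesis by (rule R0_subset[OF J])
qed

theorem greatest: "greatest_fin_dim_quotient P R0"
  unfolding greatest_fin_dim_quotient_def
proof (intro conjI allI impI)
  show "subrep R0 P" using R0_stable by (simp add: PR.subrep_P)
  let ?g = "\<lambda>i. int i - 2 * int n"
  have im: "?g ` {..<4 * n + 2} = MM"
  proof (intro subset_antisym subsetI)
    fix k assume "k \<in> MM"
    then show "k \<in> ?g ` {..<4 * n + 2}"
      by (intro image_eqI[of _ _ "nat (k + 2 * int n)"]) (auto simp: M_set_def)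
  qed (auto simp: M_set_def)
  have "has_basis Q (\<lambda>i. PR.cs R0 (e (?g i))) {..<4 * n + 2}"
  proof (rule Q.has_basisI_reindex[where g = ?g and b = e], unfold im)
    show "inj ?g" by (simp add: inj_def)
    show "\<exists>c. supp c \<subseteq> MM \<and> f - lincomb e c \<in> R0" for f
    proof -
      obtain c where c: "f = lincomb e c" using e_expand by blast
      define d where "d = Poly_Mapping.mapp (\<lambda>i x. if i \<in> MM then x else 0) c"
      have d: "cf d i = (if i \<in> MM then cf c i else 0)" for i
        by (auto simp: d_def lookup_mapp when_def in_keys_iff)
      have "lincomb e (c - d) \<in> R0" unfolding R0_lincomb by (auto simp: in_keys_iff lookup_minus d)
      then show ?thesis unfolding c lincomb_diff[symmetric]
        by (intro exI[of _ d]) (auto simp: in_keys_iff d lincomb_diff split: if_splits)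
    qed
    show "c = 0" if "supp c \<subseteq> MM" "lincomb e c \<in> R0" for c
      using that R0_lincomb[of c] by (metis Int_absorb2 keys_eq_empty)
  qed auto
  then show "finite_dim (quot_rep P R0)"
    unfolding finite_dim_def has_dim_def Q_def[symmetric] by blast
  fix J assume "subrep J P \<and> finite_dim (quot_rep P J)"
  then have J: "PR.stable J" "finite_dim (quot_rep P J)" by (auto simp: PR.subrep_P)
  then obtain d where "codim_le J d" using PR.finite_dim_codim by blast
  then show "R0 \<subseteq> J" by (rule R0_least[OF J(1)])
qed

theorem V_subrep: "s \<in> sgns \<Longrightarrow> subrep (carrier (V s)) Q"
  unfolding V_car Q_def by (rule PR.subrep_quot[OF R0_stable half_ideal_stable])

lemma V_indep: assumes s: "s \<in> sgns" and "supp c \<subseteq> {1..NN}" "lincomb (epsp s) c \<in> R0" shows "c = 0"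
proof (rule epsp_indep[OF s assms(2) R0_sub _ _ assms(3)])
  show "D0.Y' f \<in> R0" if "f \<in> R0" for f using stable_Y'[OF R0_stable that] .
  have "- s \<in> sgns" using s by auto
  then show "ev (s * a) f = 0" if "f \<in> R0" for f using half_ideal_neg_a R0_half_ideal that by blast
qed

theorem V_basis: assumes s: "s \<in> sgns"
  shows "has_basis (V s) (\<lambda>m. R0 +>\<^bsub>P\<^esub> epsp s m) {1 .. 2 * int n + 1}" and "has_dim (V s) (2 * n + 1)"
proof -
  interpret V: presented_rep "V s" "PR.cs R0" "half_ideal s" R0 "\<lambda>f. mon 1 * f" PR.Yp PR.Tp
    by (rule V_rep[OF s])
  show "has_basis (V s) (\<lambda>m. R0 +>\<^bsub>P\<^esub> epsp s m) {1 .. 2 * int n + 1}"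
    unfolding NN_int
    by (rule V.has_basisI[where b = "epsp s"]) (use V_indep[OF s] half_ideal_eq[OF s] epsp_half_ideal[OF s] in \<open>auto simp: PR.cs_def\<close>)
  let ?g = "\<lambda>i. int i + 1"
  have im: "?g ` {..<2 * n + 1} = {1..NN}"
  proof (intro subset_antisym subsetI)
    fix k assume "k \<in> {1..NN}"
    then show "k \<in> ?g ` {..<2 * n + 1}"
      by (intro image_eqI[of _ _ "nat (k - 1)"]) (auto simp: NN_def)
  qed (auto simp: NN_def)
  have "has_basis (V s) (\<lambda>i. PR.cs R0 (epsp s (?g i))) {..<2 * n + 1}"
    by (rule V.has_basisI_reindex[where g = ?g and b = "epsp s"], unfold im)
       (use V_indep[OF s] half_ideal_eq[OF s] epsp_half_ideal[OF s] in \<open>auto simp: inj_def\<close>)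
  then show "has_dim (V s) (2 * n + 1)" unfolding has_dim_def by blast
qed

theorem V_sum: "carrier (V 1) <+>\<^bsub>Q\<^esub> carrier (V (- 1)) = carrier Q"
proof (intro subset_antisym subsetI)
  fix x assume "x \<in> carrier Q"
  then obtain f where f: "x = PR.cs R0 f" by (auto simp: Q.car)
  obtain g where "g \<in> half_ideal 1" "f - g \<in> half_ideal (- 1)" using half_ideal_sum[of 1] by auto
  moreover have "PR.cs R0 g \<oplus>\<^bsub>Q\<^esub> PR.cs R0 (f - g) = x" by (simp add: Q.hadd f)
  ultimately show "x \<in> carrier (V 1) <+>\<^bsub>Q\<^esub> carrier (V (- 1))"
    unfolding set_add_def' V_car[of 1, simplified] V_car[of "- 1", simplified] by blast
next
  fix x assume "x \<in> carrier (V 1) <+>\<^bsub>Q\<^esub> carrier (V (- 1))"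
  then show "x \<in> carrier Q"
    unfolding set_add_def' V_car[of 1, simplified] V_car[of "- 1", simplified] by (auto simp: Q.hadd Q.car)
qed

theorem V_inter: "carrier (V 1) \<inter> carrier (V (- 1)) = {\<zero>\<^bsub>Q\<^esub>}"
proof (intro subset_antisym subsetI)
  fix x assume x: "x \<in> carrier (V 1) \<inter> carrier (V (- 1))"
  then obtain f where f: "f \<in> half_ideal 1" "x = PR.cs R0 f" by (auto simp: V_car[of 1, simplified])
  then have "f \<in> half_ideal (- 1)" using x V_mem[of "- 1" f] by (simp add: PR.cs_def)
  then have "f - 0 \<in> R0" using f by (simp add: R0_eq)
  then show "x \<in> {\<zero>\<^bsub>Q\<^esub>}" unfolding f Q.h0 using cs_eq_iff by blast
next
  fix x assume "x \<in> {\<zero>\<^bsub>Q\<^esub>}"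
  then have "x = PR.cs R0 0" by (simp add: Q.h0)
  then show "x \<in> carrier (V 1) \<inter> carrier (V (- 1))"
    using subsp_0[OF half_ideal_subsp] by (auto simp: V_car)
qed

text \<open>
  The eigenvalues of \<open>X\<close> are the points \<open>q\<^sup>z\<close> in one module and \<open>-q\<^sup>z\<close> in the other. The
  class \<open>u\<close> of a function supported at \<open>a\<close> is an eigenvector with eigenvalue \<open>a\<close>; its image
  would be a class supported nowhere.
\<close>

theorem V_not_iso: "\<not> hh_isomorphic (V 1) (V (- 1))"
proof
  assume "hh_isomorphic (V 1) (V (- 1))"
  then obtain \<phi> where \<phi>: "\<phi> \<in> hh_iso (V 1) (V (- 1))" by (auto simp: hh_isomorphic_def)
  interpret A: presented_rep "V 1" "PR.cs R0" "half_ideal 1" R0 "\<lambda>f. mon 1 * f" PR.Yp PR.Tp by (rule V_rep) simp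
  interpret B: presented_rep "V (- 1)" "PR.cs R0" "half_ideal (- 1)" R0 "\<lambda>f. mon 1 * f" PR.Yp PR.Tp by (rule V_rep) simp
  \<comment> \<open>The product vanishes at all points \<open>q\<^sup>z\<close> but \<open>a\<close>, the generator at all points \<open>-q\<^sup>z\<close>.\<close>
  define r where "r = (\<Prod>m\<in>{- int n..int n} - {int n}. mon 1 - Poly_Mapping.single 0 (node m))"
  define u where "u = r * half_gen 1"
  have evf: "ev x (mon 1 - Poly_Mapping.single 0 c) = x - c" for x c :: 'k
    using ev_single[of x 0 c] by (simp add: ev_simps)
  have u1: "u \<in> half_ideal 1" unfolding u_def by (rule PR.stableD(2)[OF half_ideal_stable half_gen_half_ideal]) auto
  have "ev a (half_gen 1) \<noteq> 0"
    using ev_epsp[of 1 "int n + 1"] epsp_half_gen[of 1] by (auto simp: ev_simps NN_def)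
  moreover have "ev a r \<noteq> 0"
    unfolding r_def ev_prod[OF a_nz] evf by (auto simp: node_inj simp flip: node_a)
  ultimately have "ev a u \<noteq> 0" by (simp add: u_def ev_mult)
  then have u0: "u \<notin> R0" using R0_half_ideal[of "- 1"] half_ideal_neg_a[of u 1] by auto
  have Xu: "mon 1 * u - scal a u \<in> R0"
    unfolding R0_eq
  proof
    have eq: "mon 1 * u - scal a u = (mon 1 - Poly_Mapping.single 0 a) * u"
      by (simp add: left_diff_distrib scal_def)
    show "mon 1 * u - scal a u \<in> half_ideal 1" unfolding eq by (rule PR.stableD(2)[OF half_ideal_stable u1]) simp
    show "mon 1 * u - scal a u \<in> half_ideal (- 1)"
      unfolding half_ideal_def
    proof (intro CollectI ballI)
      fix m assume m: "m \<in> {- int n..int n}"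
      have "(node m - a) * ev (node m) r = 0"
      proof (cases "m = int n")
        case False
        then have "ev (node m) r = 0"
          unfolding r_def ev_prod[OF node_nz] evf using m by (intro prod_zero) (auto intro!: bexI[of _ m])
        then show ?thesis by simp
      qed (simp add: node_a)
      then show "ev (- (- 1) * node m) (mon 1 * u - scal a u) = 0"
        unfolding eq by (auto simp: ev_mult evf u_def)
    qed
  qed
  have hom: "\<phi> \<in> hh_hom (V 1) (V (- 1))" and bij: "bij_betw \<phi> (carrier (V 1)) (carrier (V (- 1)))"
    using \<phi> by (auto simp: hh_iso_def)
  have cu: "PR.cs R0 u \<in> carrier (V 1)" "PR.cs R0 0 \<in> carrier (V 1)"
    using u1 subsp_0[OF half_ideal_subsp] by (auto simp: A.car)
  then have "\<phi> (PR.cs R0 u) \<in> carrier (V (- 1))" using hom by (auto simp: hh_hom_def)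
  then obtain f where f: "f \<in> half_ideal (- 1)" "\<phi> (PR.cs R0 u) = PR.cs R0 f" by (auto simp: B.car)
  have "PR.cs R0 (mon 1 * f) = \<phi> (hh_module.opX (V 1) (PR.cs R0 u))"
    using hom cu f by (simp add: hh_hom_def B.opX)
  also have "hh_module.opX (V 1) (PR.cs R0 u) = a \<odot>\<^bsub>V 1\<^esub> PR.cs R0 u"
    unfolding A.opX[OF u1] A.hscal[OF u1] using Xu by (simp add: cs_eq_iff)
  also have "\<phi> \<dots> = PR.cs R0 (scal a f)" using hom cu f by (simp add: hh_hom_def B.hscal)
  finally have Xf: "mon 1 * f - scal a f \<in> R0" by (simp add: cs_eq_iff)
  have "f \<in> half_ideal 1"
    unfolding half_ideal_def
  proof (intro CollectI ballI)
    fix m assume m: "m \<in> {- int n..int n}"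
    have "ev (- 1 * node m) (mon 1 * f - scal a f) = 0" using Xf m unfolding R0_eq half_ideal_def by blast
    then have "(- node m - a) * ev (- node m) f = 0" by (simp add: ev_simps ev_mult left_diff_distrib)
    moreover have "- node m - a \<noteq> 0" using node_disjoint[of "int n" m] by (auto simp: node_a)
    ultimately show "ev (- 1 * node m) f = 0" by simp
  qed
  then have "f \<in> R0" using f by (simp add: R0_eq)
  then have "PR.cs R0 f = PR.cs R0 0" by (simp add: cs_eq_iff)
  moreover have "\<phi> (PR.cs R0 0) = PR.cs R0 0"
  proof -
    have "\<phi> ((0::'k) \<odot>\<^bsub>V 1\<^esub> PR.cs R0 u) = 0 \<odot>\<^bsub>V (- 1)\<^esub> \<phi> (PR.cs R0 u)" using hom cu by (simp add: hh_hom_def)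
    then show ?thesis by (simp add: A.hscal[OF u1] f B.hscal)
  qed
  ultimately have "\<phi> (PR.cs R0 u) = \<phi> (PR.cs R0 0)" using f by simp
  then have "PR.cs R0 u = PR.cs R0 0" using bij cu by (auto simp: bij_betw_def inj_on_def)
  then show False using u0 by (simp add: cs_eq_iff)
qed

lemma Idl_epsp: assumes s: "s \<in> sgns" shows "Idl\<^bsub>P\<^esub> {epsp s (int n + 1)} = half_ideal s"
proof -
  let ?c = "inverse (ev a (e (int n + 1)))"
  have c: "?c \<noteq> 0" using ev_a_nz[of "int n + 1"] by (simp add: M_set_def)
  have "{f * scal ?c (half_gen s) | f. True} = {f * half_gen s | f. True}"
  proof (intro subset_antisym subsetI)
    fix x assume "x \<in> {f * half_gen s | f. True}"
    then obtain f where "x = f * half_gen s" by blast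
    then have "x = scal (inverse ?c) f * scal ?c (half_gen s)" using c by (simp add: scal_mult_left scal_mult_right)
    then show "x \<in> {f * scal ?c (half_gen s) | f. True}" by blast
  next
    fix x assume "x \<in> {f * scal ?c (half_gen s) | f. True}"
    then obtain f where "x = f * scal ?c (half_gen s)" by blast
    then have "x = scal ?c f * half_gen s" by (simp add: scal_mult_left scal_mult_right)
    then show "x \<in> {f * half_gen s | f. True}" by blast
  qed
  then show ?thesis unfolding epsp_half_gen[OF s] half_ideal_Idl[OF s] PR.Idl_P .
qed

lemma sgn_neg: "s \<in> sgns \<Longrightarrow> - s \<in> sgns"
  by auto

lemma V_iso_half_ideal: assumes s: "s \<in> sgns" shows "hh_isomorphic (V s) (quot_rep P (half_ideal (- s)))"
proof -
  have "\<exists>\<phi>\<in>hh_iso (V s) (quot_rep P (half_ideal (- s))). \<forall>f\<in>half_ideal s. \<phi> (PR.cs R0 f) = PR.cs (half_ideal (- s)) f"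
    by (rule hh_iso_presented[where \<psi> = "\<lambda>f. f", OF V_rep[OF s] PR.quot_presented[OF half_ideal_stable[OF sgn_neg[OF s]]]])
       (use half_ideal_inter[OF s] half_ideal_sum[OF s] in \<open>auto simp: lin_id\<close>)
  then show ?thesis unfolding hh_isomorphic_def by blast
qed

theorem V_iso: assumes s: "s \<in> sgns"
  shows "subrep (Idl\<^bsub>P\<^esub> {epsp (- s) (int n + 1)}) P"
    and "hh_isomorphic (V s) (quot_rep P (Idl\<^bsub>P\<^esub> {epsp (- s) (int n + 1)}))"
  unfolding Idl_epsp[OF sgn_neg[OF s]] PR.subrep_P
  using half_ideal_stable[OF sgn_neg[OF s]] V_iso_half_ideal[OF s] by auto

lemma flip_half_ideal: "f \<in> half_ideal s \<longleftrightarrow> flip_X f \<in> half_ideal (- s)"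
  by (simp add: half_ideal_def ev_flip_X)

lemma flip_Yp: "flip_X (PR.Yp f) = PR.Yp (flip_X f)" and flip_Tp: "flip_X (PR.Tp f) = PR.Tp (flip_X f)"
proof -
  show T: "flip_X (PR.Tp f) = PR.Tp (flip_X f)" for f
    by (simp add: PR.Tp_Th Th_flip_X lin_simps[OF lin_flip_X])
  have "flip_X (pi_op qh g) = pi_op qh (flip_X g)" for g
    by (rule poly_mapping_eqI) (simp add: pi_op_flipx power_int_minus_one_minus)
  then show "flip_X (PR.Yp f) = PR.Yp (flip_X f)" by (simp add: PR.Yp_def T)
qed

theorem V_sigma_x: "hh_isomorphic (V (- 1)) (sigma_x (V 1))"
proof -
  have "\<exists>\<phi>\<in>hh_iso (V (- 1)) (sigma_x (V 1)). \<forall>f\<in>half_ideal (- 1). \<phi> (PR.cs R0 f) = PR.cs R0 (flip_X f)"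
  proof (rule hh_iso_presented[where \<psi> = flip_X, OF V_rep PR.sigma_x_presented[OF V_rep]])
    show "lin flip_X" by (rule lin_flip_X)
    show "flip_X f \<in> half_ideal 1" if "f \<in> half_ideal (- 1)" for f using that flip_half_ideal[of f "- 1"] by simp
    show "flip_X f \<in> R0 \<longleftrightarrow> f \<in> R0" for f using flip_half_ideal[of f "- 1"] flip_half_ideal[of f 1] by (auto simp: R0_eq)
    show "\<exists>f\<in>half_ideal (- 1). g - flip_X f \<in> R0" if "g \<in> half_ideal 1" for g
      using that flip_half_ideal[of g 1] subsp_0[OF R0_sub] by (intro bexI[of _ "flip_X g"]) auto
    show "flip_X (mon 1 * f) = - (mon 1 * flip_X f) \<and> flip_X (PR.Yp f) = PR.Yp (flip_X f) \<and> flip_X (PR.Tp f) = PR.Tp (flip_X f)" for f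
      by (simp add: flip_X_mult flip_Yp flip_Tp scal_neg_one)
  qed auto
  then show ?thesis unfolding hh_isomorphic_def by blast
qed

section \<open>The evaluation pairing\<close>

text \<open>
  \<open>Y\<^sup>-\<^sup>j\<close>, the operator that is substituted for \<open>X\<^sup>j\<close>.
\<close>

definition Ypow :: "int \<Rightarrow> 'k lpoly \<Rightarrow> 'k lpoly" where
  "Ypow j g = (if 0 \<le> j then (PR.Yinv ^^ nat j) g else (PR.Yp ^^ nat (- j)) g)"

lemma inv_Yp: "inv_into UNIV PR.Yp = PR.Yinv"
  by (rule inv_unique_comp) (auto simp: fun_eq_iff)

lemma subst_Ypow: "subst_Yinv P f g = (\<Sum>j\<in>supp f. scal (cf f j) (Ypow j g))"
proof -
  have "opY P = PR.Yp" by (simp add: fun_eq_iff)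
  then show ?thesis unfolding subst_Yinv_def Ypow_def \<open>opY P = PR.Yp\<close> inv_Yp by simp
qed

lemma Ypow_stable: "PR.stable J \<Longrightarrow> g \<in> J \<Longrightarrow> Ypow j g \<in> J"
proof -
  assume J: "PR.stable J" and g: "g \<in> J"
  have "(PR.Yinv ^^ i) g \<in> J \<and> (PR.Yp ^^ i) g \<in> J" for i
    using g by (induction i) (auto intro: PR.stableD[OF J])
  then show ?thesis by (simp add: Ypow_def)
qed

lemma lin_Ypow: "lin (Ypow j)"
  unfolding Ypow_def[abs_def] using lin_funpow[OF PR.lin_Yp] lin_funpow[OF PR.lin_Yinv] by (cases "0 \<le> j") auto

lemma Ypow_Yp: "Ypow j (PR.Yp g) = Ypow (j - 1) g"
proof (cases "0 < j")
  case True
  then have "nat j = Suc (nat (j - 1))" by simp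
  then have "(PR.Yinv ^^ nat j) (PR.Yp g) = (PR.Yinv ^^ nat (j - 1)) g" by (simp add: funpow_swap1)
  then show ?thesis using True by (simp add: Ypow_def)
next
  case False
  then have e: "nat (- (j - 1)) = Suc (nat (- j))" by simp
  have "(PR.Yp ^^ nat (- j)) (PR.Yp g) = (PR.Yp ^^ nat (- (j - 1))) g" unfolding e by (simp add: funpow_swap1)
  then show ?thesis using False by (auto simp: Ypow_def)
qed

text \<open>
  The stable ideal \<open>half_ideal (- s)\<close> vanishes at \<open>s a\<close>. Conversely, the values of all \<open>Y\<^sup>j
  g\<close> at \<open>s a\<close> determine the components of \<open>g\<close> in the span of the \<open>epsp s m\<close>, whose
  eigenvalues are distinct.
\<close>

lemma eval_radical_half_ideal: assumes s: "s \<in> sgns" shows "eval_radical P (s * a) = half_ideal (- s)"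
proof (intro subset_antisym subsetI)
  fix g assume g: "g \<in> half_ideal (- s)"
  show "g \<in> eval_radical P (s * a)"
    unfolding eval_radical_def eval_pairing_def subst_Ypow
  proof (intro CollectI allI half_ideal_neg_a subsp_sum half_ideal_subsp subsp_scal)
    fix j show "Ypow j g \<in> half_ideal (- s)" by (rule Ypow_stable[OF half_ideal_stable[OF sgn_neg[OF s]] g])
  qed
next
  fix g assume "g \<in> eval_radical P (s * a)"
  then have g0: "ev (s * a) (\<Sum>j\<in>supp f. scal (cf f j) (Ypow j g)) = 0" for f
    unfolding eval_radical_def eval_pairing_def subst_Ypow by blast
  have g1: "ev (s * a) (Ypow j g) = 0" for j using g0[of "mon j"] by simp
  define K where "K = {g. \<forall>j. ev (s * a) (Ypow j g) = 0}"
  have K: "subsp K"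
    by (rule subspI) (auto simp: K_def lin_simps[OF lin_Ypow] ev_simps)
  have JK: "f \<in> K" if "f \<in> half_ideal (- s)" for f
    unfolding K_def using Ypow_stable[OF half_ideal_stable[OF sgn_neg[OF s]] that] half_ideal_neg_a by blast
  have gK: "g \<in> K" using g1 by (simp add: K_def)
  obtain c where c: "supp c \<subseteq> {1..NN}" "g - lincomb (epsp s) c \<in> half_ideal (- s)" using epsp_span[OF s] by blast
  have "g - (g - lincomb (epsp s) c) \<in> K" by (rule subsp_diff[OF K gK JK[OF c(2)]])
  then have lK: "lincomb (epsp s) c \<in> K" by simp
  have "c = 0"
  proof (rule epsp_indep[OF s c(1) K _ _ lK])
    show "D0.Y' f \<in> K" if "f \<in> K" for f
      using that by (simp add: Y'_Yp K_def lin_simps[OF lin_Ypow] ev_simps Ypow_Yp)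
    show "ev (s * a) f = 0" if "f \<in> K" for f
    proof -
      have "ev (s * a) (Ypow 0 f) = 0" using that unfolding K_def by blast
      then show ?thesis by (simp add: Ypow_def)
    qed
  qed
  then show "g \<in> half_ideal (- s)" using c by simp
qed

theorem eval_rad: assumes s: "s \<in> sgns"
  shows "eval_radical P (s * a) = {f. R0 +>\<^bsub>P\<^esub> f \<in> carrier (V (- s))}"
    and "hh_isomorphic (V s) (quot_rep P (eval_radical P (s * a)))"
  unfolding eval_radical_half_ideal[OF s] V_mem[OF sgn_neg[OF s]] using V_iso_half_ideal[OF s] by auto

section \<open>The function representation\<close>

abbreviation "F \<equiv> fun_rep p th n"

lemma bowtie_iff: "z \<in> bowtie n \<longleftrightarrow> (\<exists>m\<in>{- int n..int n}. z = 1/4 + of_int m / 2)"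
  by (auto simp: bowtie_def)

lemma bowtie_fin: "finite (bowtie n)"
proof -
  have "bowtie n = (\<lambda>m. 1/4 + of_int m / 2) ` {- int n..int n}" by (auto simp: bowtie_iff)
  then show ?thesis by simp
qed

lemma disc_ker: "discretize p n f = discretize p n 0 \<longleftrightarrow> f \<in> half_ideal (- 1)"
proof -
  have "discretize p n f = discretize p n 0 \<longleftrightarrow> (\<forall>z\<in>bowtie n. ev (p z) f = 0)"
    by (auto simp: discretize_def fun_eq_iff restrict_def ev_simps)
  also have "\<dots> \<longleftrightarrow> f \<in> half_ideal (- 1)"
    unfolding half_ideal_def node_def by (auto simp: bowtie_iff)
  finally show ?thesis .
qed

text \<open>
  Lagrange interpolation.
\<close>

lemma disc_surj:
  assumes "G \<in> bowtie n \<rightarrow>\<^sub>E UNIV" shows "\<exists>f. discretize p n f = G"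
proof -
  define L where "L z = (\<Prod>z'\<in>bowtie n - {z}. scal (inverse (p z - p z')) (mon 1 - Poly_Mapping.single 0 (p z')))" for z
  have evL: "ev (p w) (L z) = (if w = z then 1 else 0)" if "w \<in> bowtie n" for w z
  proof -
    have "ev (p w) (L z) = (\<Prod>z'\<in>bowtie n - {z}. inverse (p z - p z') * (p w - p z'))"
      unfolding L_def ev_prod[OF pnz] using ev_single[of "p w" 0] by (simp add: ev_simps)
    also have "\<dots> = (if w = z then 1 else 0)"
    proof (cases "w = z")
      case True
      then show ?thesis by (auto intro!: prod.neutral)
    next
      case False
      then show ?thesis using that bowtie_fin by (auto intro!: prod_zero bexI[of _ w])
    qed
    finally show ?thesis .
  qed
  have "discretize p n (\<Sum>z\<in>bowtie n. scal (G z) (L z)) = G"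
  proof
    fix w
    show "discretize p n (\<Sum>z\<in>bowtie n. scal (G z) (L z)) w = G w"
    proof (cases "w \<in> bowtie n")
      case True
      have "ev (p w) (\<Sum>z\<in>bowtie n. scal (G z) (L z)) = (\<Sum>z\<in>bowtie n. if w = z then G z else 0)"
        unfolding ev_simps evL[OF True] by (intro sum.cong) auto
      then show ?thesis using True bowtie_fin by (simp add: discretize_def)
    next
      case False
      then show ?thesis using assms by (auto simp: discretize_def PiE_def extensional_def)
    qed
  qed
  then show ?thesis by blast
qed

text \<open>
  For the largest \<open>z\<close> the value of the discretization at \<open>-z\<close> is undefined, but its
  coefficient is zero.
\<close>

lemma fun_T_disc: assumes z: "z \<in> bowtie n" shows "fun_T p th (discretize p n f) z = ev (p z) (PR.Tp f)"
proof -
  obtain m where m: "- int n \<le> m" "m \<le> int n" "z = 1/4 + of_int m / 2" using z by (auto simp: bowtie_iff)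
  have x2: "(p z)\<^sup>2 = p (2 * z)" by (simp add: ppow)
  have h: "2 * z = of_int (1 + 2 * m) / 2" by (simp add: m add_divide_distrib)
  have ne: "p (2 * z) \<noteq> 1" unfolding h p_eq_1 by (rule half_odd_ne_0) simp
  have T: "(p (2 * z) - 1) * ev (p z) (Th t f) = (t * p (2 * z) - 1) * ev (p (- z)) f - (t - 1) * ev (p z) f"
    using ev_Th[of "p z" t f] by (simp add: x2 pminus)
  have D: "(t * p (2 * z) - 1) * discretize p n f (- z) = (t * p (2 * z) - 1) * ev (p (- z)) f"
  proof (cases "m = int n")
    case True
    then have "t * p (2 * z) = 1" unfolding t_eq padd[symmetric] by (simp add: m)
    then show ?thesis by simp
  next
    case False
    have "- z \<in> bowtie n" unfolding bowtie_iff
      by (rule bexI[of _ "- 1 - m"]) (use m False in \<open>auto simp: diff_divide_distrib\<close>)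
    then show ?thesis by (simp add: discretize_def)
  qed
  have i: "th * x - inverse th = inverse th * (t * x - 1)" "th - inverse th = inverse th * (t - 1)" for x
    by (simp_all add: field_simps power2_eq_square)
  have "fun_T p th (discretize p n f) z
      = inverse th * ((t * p (2 * z) - 1) * discretize p n f (- z) - (t - 1) * ev (p z) f) / (p (2 * z) - 1)"
  proof -
    have alg: "u * x / w * A - u * y / w * B = u * (x * A - y * B) / w" for u x y w A B :: 'k
      by (simp add: diff_divide_distrib right_diff_distrib mult.assoc)
    have "discretize p n f z = ev (p z) f" using z by (simp add: discretize_def)
    then show ?thesis unfolding fun_T_def i alg by (simp only:)
  qed
  also have "\<dots> = inverse th * ((p (2 * z) - 1) * ev (p z) (Th t f)) / (p (2 * z) - 1)"
    unfolding D T[symmetric] ..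
  also have "\<dots> = ev (p z) (PR.Tp f)" using ne by (simp add: PR.Tp_Th ev_simps)
  finally show ?thesis .
qed

lemma F_rep: "presented_rep F (discretize p n) UNIV (half_ideal (- 1)) (\<lambda>f. mon 1 * f) PR.Yp PR.Tp"
proof
  show "carrier F = discretize p n ` UNIV"
  proof (intro subset_antisym subsetI)
    fix G assume "G \<in> carrier F"
    then have "G \<in> bowtie n \<rightarrow>\<^sub>E UNIV" by (simp add: fun_rep_def)
    then show "G \<in> range (discretize p n)" using disc_surj by (metis rangeI)
  qed (auto simp: fun_rep_def discretize_def)
  show "\<zero>\<^bsub>F\<^esub> = discretize p n 0"
    by (auto simp: fun_rep_def discretize_def ev_simps fun_eq_iff restrict_def)
  show "discretize p n f \<oplus>\<^bsub>F\<^esub> discretize p n g = discretize p n (f + g)" for f g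
    by (auto simp: fun_rep_def discretize_def ev_simps fun_eq_iff restrict_def)
  show "c \<odot>\<^bsub>F\<^esub> discretize p n f = discretize p n (scal c f)" for c f
    by (auto simp: fun_rep_def discretize_def ev_simps fun_eq_iff restrict_def)
  show "discretize p n f = discretize p n 0 \<longleftrightarrow> f \<in> half_ideal (- 1)" for f by (rule disc_ker)
  show "hh_module.opX F (discretize p n f) = discretize p n (mon 1 * f)" for f
    by (auto simp: fun_rep_def discretize_def ev_mult fun_eq_iff restrict_def)
  show "hh_module.opT F (discretize p n f) = discretize p n (PR.Tp f)" for f
  proof -
    have "hh_module.opT F (discretize p n f) = (\<lambda>z\<in>bowtie n. fun_T p th (discretize p n f) z)"
      by (simp add: fun_rep_def)
    also have "\<dots> = discretize p n (PR.Tp f)"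
      unfolding discretize_def[of p n "PR.Tp f"] by (rule restrict_ext) (rule fun_T_disc)
    finally show ?thesis .
  qed
  show "hh_module.opY F (discretize p n f) = discretize p n (PR.Yp f)" for f
  proof -
    have "hh_module.opY F (discretize p n f) = (\<lambda>z\<in>bowtie n. fun_T p th (discretize p n f) (1/2 - z))"
      by (simp add: fun_rep_def)
    also have "\<dots> = discretize p n (PR.Yp f)"
      unfolding discretize_def[of p n "PR.Yp f"]
    proof (rule restrict_ext)
      fix z assume "z \<in> bowtie n"
      then obtain m where m: "m \<in> {- int n..int n}" "z = 1/4 + of_int m / 2" by (auto simp: bowtie_iff)
      have z': "1/2 - z \<in> bowtie n" unfolding bowtie_iff by (rule bexI[of _ "- m"]) (use m in auto)
      show "fun_T p th (discretize p n f) (1/2 - z) = ev (p z) (PR.Yp f)"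
        unfolding fun_T_disc[OF z'] PR.Yp_def ev_pi_op pdiff ..
    qed
    finally show ?thesis .
  qed
qed auto

theorem F_HH: "HH_module qh th F"
  by (rule PR.HH_module_image[OF F_rep half_ideal_stable]) simp

theorem V_F: "\<exists>\<phi>\<in>hh_iso (V 1) F. \<forall>f. R0 +>\<^bsub>P\<^esub> f \<in> carrier (V 1) \<longrightarrow> \<phi> (R0 +>\<^bsub>P\<^esub> f) = discretize p n f"
proof -
  have "\<exists>\<phi>\<in>hh_iso (V 1) F. \<forall>f\<in>half_ideal 1. \<phi> (PR.cs R0 f) = discretize p n f"
    by (rule hh_iso_presented[where \<psi> = "\<lambda>f. f", OF V_rep F_rep])
       (use half_ideal_inter[of 1] half_ideal_sum[of 1] in \<open>auto simp: lin_id\<close>)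
  then show ?thesis using V_mem[of 1] by (auto simp: PR.cs_def)
qed

theorem epm: assumes s: "s \<in> sgns"
  shows "\<exists>c. c \<noteq> 0 \<and> epsp s (int n + 1) = scal c (e (int n + 1) + scal (s * a) (e (- int n)))"
    and "e (int n + 1) + scal (s * a) (e (- int n)) = mon (- int n) *
       (\<Prod>m\<in>{- int n .. int n}. mon 1 + Poly_Mapping.single 0 (s * p (1/4 + of_int m / 2)))"
proof -
  have "inverse (ev a (e (int n + 1))) \<noteq> 0" using ev_a_nz[of "int n + 1"] by (simp add: M_set_def)
  then show "\<exists>c. c \<noteq> 0 \<and> epsp s (int n + 1) = scal c (e (int n + 1) + scal (s * a) (e (- int n)))"
    using epsp_half_gen[OF s] unfolding half_gen_e[OF s] by blast
  show "e (int n + 1) + scal (s * a) (e (- int n)) = mon (- int n) *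
       (\<Prod>m\<in>{- int n .. int n}. mon 1 + Poly_Mapping.single 0 (s * p (1/4 + of_int m / 2)))"
    unfolding half_gen_e[OF s, symmetric] half_gen_def ..
qed

section \<open>The sesquilinear pairing\<close>

context
  fixes cj :: "'k \<Rightarrow> 'k"
  assumes cj_add: "cj (x + y) = cj x + cj y" and cj_mult: "cj (x * y) = cj x * cj y" and cj_1: "cj 1 = 1"
    and cj_p: "cj (p r) = p (- r)"
begin

lemma cj_0: "cj 0 = 0"
proof -
  have "cj 0 + cj 0 = cj 0 + 0" using cj_add[of 0 0] by (simp only: add_0_right)
  then show ?thesis by (simp only: add_left_cancel)
qed

lemma cj_minus: "cj (- x) = - cj x"
  using cj_add[of x "- x"] by (simp add: cj_0 eq_neg_iff_add_eq_0 add.commute)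

lemma cf_bar: "cf (bar_lpoly cj g) j = cj (cf g (- j))"
  by (simp add: bar_lpoly_def map_key.rep_eq Poly_Mapping.map.rep_eq when_def cj_0)

lemma bar_mon: "bar_lpoly cj (mon j) = mon (- j)"
  by (rule poly_mapping_eqI) (auto simp: cf_bar cf_mon cj_0 cj_1)

lemma bar_add: "bar_lpoly cj (f + g) = bar_lpoly cj f + bar_lpoly cj g"
  by (rule poly_mapping_eqI) (simp add: cf_bar lookup_add cj_add)

lemma bar_scal: "bar_lpoly cj (scal c f) = scal (cj c) (bar_lpoly cj f)"
  by (rule poly_mapping_eqI) (simp add: cf_bar cj_mult)

lemma bar_sum: "bar_lpoly cj (sum f I) = (\<Sum>i\<in>I. bar_lpoly cj (f i))"
  by (induction I rule: infinite_finite_induct) (auto simp: bar_add intro!: poly_mapping_eqI simp: cf_bar cj_0)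

lemma bar_expand: "bar_lpoly cj g = (\<Sum>j\<in>supp g. scal (cj (cf g j)) (mon (- j)))"
proof -
  have "bar_lpoly cj g = bar_lpoly cj (\<Sum>j\<in>supp g. scal (cf g j) (mon j))" using lp_expand[of g] by simp
  then show ?thesis by (simp add: bar_sum bar_scal bar_mon)
qed

theorem pairing_radical_R0: "pairing_radical cj (wgt q t) = R0"
proof (intro subset_antisym subsetI)
  fix f assume "f \<in> pairing_radical cj (wgt q t)"
  then have "pairing cj (wgt q t) f (mon j) = 0" for j unfolding pairing_radical_def by blast
  then show "f \<in> R0" by (simp add: R0_def numeric_radical_def pairing_def bar_mon)
next
  fix f assume "f \<in> R0"
  then show "f \<in> pairing_radical cj (wgt q t)"
    by (simp add: pairing_radical_def pairing_def R0_iff)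
qed

theorem pairing_e: "pairing cj (wgt q t) (e m) (e m) \<noteq> 0 \<longleftrightarrow> m \<in> M_set n"
proof -
  have "pairing cj (wgt q t) (e m) (e m) = (\<Sum>j\<in>supp (e m). cj (cf (e m) j) * W (e m * mon (- j)))"
    unfolding pairing_def bar_expand by (simp add: sum_distrib_left scal_mult_right ct_simps)
  also have "\<dots> = (\<Sum>j\<in>supp (e m). if j = m then D.nrm m else 0)"
  proof (intro sum.cong refl)
    fix j assume j: "j \<in> supp (e m)"
    show "cj (cf (e m) j) * W (e m * mon (- j)) = (if j = m then D.nrm m else 0)"
    proof (cases "j = m")
      case False
      then have "prec j m" using tri_E[of m q t] j by (auto simp: tri_def rk_le)
      then show ?thesis using False by (simp add: D.W_E_orth)
    qed (simp add: D.nrm_def cj_1)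
  qed
  also have "\<dots> = D.nrm m" by (simp add: in_keys_iff)
  finally show ?thesis by (simp add: nrm_MM)
qed

lemma ev_bar: "ev (p x) (bar_lpoly cj g) = cj (ev (p x) g)"
proof -
  have cjs: "cj (sum f I) = (\<Sum>i\<in>I. cj (f i))" for f :: "int \<Rightarrow> 'k" and I
    by (induction I rule: infinite_finite_induct) (auto simp: cj_0 cj_add)
  show ?thesis
    unfolding bar_expand ev_def[of "p x" g] by (simp add: ev_simps cjs cj_mult ppowi cj_p)
qed

lemma ev_minus_bar: "ev (- p x) (bar_lpoly cj g) = cj (ev (- p x) g)"
proof -
  have "ev (- p x) (bar_lpoly cj g) = ev (p x) (bar_lpoly cj (flip_X g))"
  proof -
    have "cj ((- 1) powi j) = (- 1) powi j" for j
      by (cases "even j") (auto simp: cj_minus cj_1)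
    then have "flip_X (bar_lpoly cj g) = bar_lpoly cj (flip_X g)"
      by (intro poly_mapping_eqI) (simp add: cf_bar cj_mult power_int_minus_one_minus)
    then show ?thesis using ev_flip_X[of "p x" "bar_lpoly cj g"] by simp
  qed
  then show ?thesis by (simp add: ev_bar ev_flip_X)
qed

text \<open>
  A product of elements of the two ideals vanishes at all points \<open>q\<^sup>z\<close> and \<open>-q\<^sup>z\<close>, so it
  lies in the radical. The bar maps each ideal to itself, because it inverts both scalars
  and points.
\<close>

theorem V_orth:
  assumes "R0 +>\<^bsub>P\<^esub> f \<in> carrier (V 1)" "R0 +>\<^bsub>P\<^esub> g \<in> carrier (V (- 1))"
  shows "pairing cj (wgt q t) f g = 0" "pairing cj (wgt q t) g f = 0"
proof -
  have fg: "f \<in> half_ideal 1" "g \<in> half_ideal (- 1)" using assms V_mem[of 1] V_mem[of "- 1"] by auto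
  have bg: "bar_lpoly cj g \<in> half_ideal (- 1)" "bar_lpoly cj f \<in> half_ideal 1"
    using fg by (auto simp: half_ideal_def node_def ev_bar ev_minus_bar cj_0)
  have "f * bar_lpoly cj g \<in> R0"
  proof -
    have "bar_lpoly cj g * f \<in> half_ideal 1" "f * bar_lpoly cj g \<in> half_ideal (- 1)"
      using fg bg half_ideal_stable by (auto intro!: PR.stableD(2))
    then show ?thesis by (simp add: R0_eq mult.commute)
  qed
  then have "W (f * bar_lpoly cj g * 1) = 0" unfolding R0_iff by blast
  then show "pairing cj (wgt q t) f g = 0" by (simp add: pairing_def)
  have "g * bar_lpoly cj f \<in> R0"
  proof -
    have "g * bar_lpoly cj f \<in> half_ideal 1" "bar_lpoly cj f * g \<in> half_ideal (- 1)"
      using fg bg half_ideal_stable by (auto intro!: PR.stableD(2))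
    then show ?thesis by (simp add: R0_eq mult.commute)
  qed
  then have "W (g * bar_lpoly cj f * 1) = 0" unfolding R0_iff by blast
  then show "pairing cj (wgt q t) g f = 0" by (simp add: pairing_def)
qed

end

end

section \<open>The field generated by the fractional powers of a formal parameter\<close>

lemma pm_induct:
  assumes "P 0" "\<And>f k c. P f \<Longrightarrow> P (f + Poly_Mapping.single k c)"
  shows "P (f :: 'a \<Rightarrow>\<^sub>0 'b::comm_monoid_add)"
proof (induction f rule: update_induct)
  case (update f a b)
  have "Poly_Mapping.update a b f = f + Poly_Mapping.single a b"
    using update by (intro poly_mapping_eqI) (auto simp: lookup_update lookup_add lookup_single in_keys_iff when_def)
  then show ?case using assms(2) update by simp
qed (rule assms)

abbreviation "bpm \<equiv> Poly_Mapping.map_key uminus :: (rat \<Rightarrow>\<^sub>0 complex) \<Rightarrow> _"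

lemma cf_bpm: "cf (bpm A) k = cf A (- k)"
  by (simp add: map_key.rep_eq)

lemma bpm_add: "bpm (A + B) = bpm A + bpm B"
  by (rule poly_mapping_eqI) (simp add: cf_bpm lookup_add)

lemma bpm_single: "bpm (Poly_Mapping.single a c) = Poly_Mapping.single (- a) c"
  by (rule poly_mapping_eqI) (auto simp: cf_bpm lookup_single when_def)

lemma bpm_0: "bpm 0 = 0"
  by (rule poly_mapping_eqI) (simp add: cf_bpm)

lemma bpm_mult: "bpm (A * B) = bpm A * bpm B"
proof (induction A rule: pm_induct)
  case (2 A k c)
  have "bpm (Poly_Mapping.single k c * B) = Poly_Mapping.single (- k) c * bpm B"
    by (induction B rule: pm_induct) (simp_all add: bpm_0 distrib_left bpm_add mult_single bpm_single)
  then show ?case using 2 by (simp add: distrib_right bpm_add bpm_single)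
qed (simp add: bpm_0)

lemma bpm_nz: "B \<noteq> 0 \<Longrightarrow> bpm B \<noteq> 0"
  by (metis cf_bpm lookup_zero minus_minus poly_mapping_eqI)

text \<open>
  The value of \<open>formal_bar\<close> is independent of the fraction.
\<close>

lemma formal_bar_Fract: "B \<noteq> 0 \<Longrightarrow> formal_bar (Fract A B) = Fract (bpm A) (bpm B)"
  unfolding formal_bar_def
proof (rule the_equality)
  assume B: "B \<noteq> 0"
  then show "\<exists>A' B'. B' \<noteq> 0 \<and> Fract A B = Fract A' B' \<and> Fract (bpm A) (bpm B) = Fract (bpm A') (bpm B')" by blast
  fix y assume "\<exists>A' B'. B' \<noteq> 0 \<and> Fract A B = Fract A' B' \<and> y = Fract (bpm A') (bpm B')"
  then obtain A' B' where *: "B' \<noteq> 0" "Fract A B = Fract A' B'" "y = Fract (bpm A') (bpm B')" by blast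
  then have "A * B' = A' * B" using B by (simp add: eq_fract)
  then have "bpm A * bpm B' = bpm A' * bpm B" by (metis bpm_mult)
  then show "y = Fract (bpm A) (bpm B)" using * B bpm_nz by (simp add: eq_fract)
qed

lemma formal_bar_add: "formal_bar (x + y) = formal_bar x + formal_bar y"
  by (cases x; cases y) (simp add: formal_bar_Fract bpm_add bpm_mult bpm_nz)

lemma formal_bar_mult: "formal_bar (x * y) = formal_bar x * formal_bar y"
  by (cases x; cases y) (simp add: formal_bar_Fract bpm_mult bpm_nz)

lemma bpm_1: "bpm 1 = 1"
  using bpm_single[of 0 1] by simp

lemma formal_bar_1: "formal_bar 1 = 1"
  unfolding One_fract_def by (simp add: formal_bar_Fract bpm_1)

lemma formal_bar_q: "formal_bar (formal_q r) = formal_q (- r)"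
  by (simp add: formal_q_def formal_bar_Fract bpm_1 bpm_single)

lemma formal_powers: "powers formal_q"
proof
  show "formal_q (a + b) = formal_q a * formal_q b" for a b by (simp add: formal_q_def mult_single)
  show "formal_q 0 = 1" by (simp add: formal_q_def One_fract_def)
  show "a = 0" if "formal_q a = 1" for a
  proof -
    have "Poly_Mapping.single a 1 = (1 :: rat \<Rightarrow>\<^sub>0 complex)"
      using that by (simp add: formal_q_def One_fract_def eq_fract)
    then have "cf (Poly_Mapping.single a 1 :: rat \<Rightarrow>\<^sub>0 complex) 0 = cf 1 0" by simp
    then show "a = 0" by (simp add: lookup_single when_def split: if_splits)
  qed
  have A: "(2::formal) = Fract (1 + 1) 1"
    unfolding one_add_one[symmetric] One_fract_def by simp
  have "(1 + 1 :: rat \<Rightarrow>\<^sub>0 complex) \<noteq> 0"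
  proof
    assume "(1 + 1 :: rat \<Rightarrow>\<^sub>0 complex) = 0"
    then have "cf (1 + 1 :: rat \<Rightarrow>\<^sub>0 complex) 0 = cf (0 :: rat \<Rightarrow>\<^sub>0 complex) 0" by (rule arg_cong)
    then show False unfolding lookup_add by simp
  qed
  then have B: "Fract (1 + 1 :: rat \<Rightarrow>\<^sub>0 complex) 1 \<noteq> Fract 0 1"
    by (subst eq_fract) (simp_all del: one_add_one)
  show "(2::formal) \<noteq> 0" unfolding A Zero_fract_def by (rule B)
qed

section \<open>The polynomials and the weight at the special parameter\<close>

context special
begin

lemma e_pol_e: "e_pol q t = e" and e_wd: "e_well_defined q t m"
  using e_pol_E[of q t] D0.qt by (auto simp: fun_eq_iff)

lemma w_wgt: "(\<lambda>m. spec q t (mu0 m)) = wgt q t" and mu0_reg: "regular_at q t (mu0 m)"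
  "regular_at q t (const_term mu0 (mon i * mon (- j)))"
  using mu0_spec[of q t] const_term_mu0_regular[of q t] D0.qt by (auto simp: fun_eq_iff)

end

section \<open>Semisimplicity of the polynomial representation\<close>

text \<open>
  \<open>e i\<close> determines \<open>i\<close> as the exponent of its leading term.
\<close>

lemma tri_inj:
  fixes e :: "int \<Rightarrow> 'k::field lpoly"
  assumes "\<And>n. tri n (e n)" shows "inj e"
proof (rule injI)
  fix i j assume eq: "e i = e j"
  have "i \<in> supp (e j)" using assms[of i] eq by (simp add: tri_def in_keys_iff)
  moreover have "j \<in> supp (e i)" using assms[of j] eq by (simp add: tri_def in_keys_iff)
  ultimately have "rk i \<le> rk j" "rk j \<le> rk i" using assms[of i] assms[of j] unfolding tri_def by blast+
  then show "i = j" by simp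
qed

text \<open>
  A generalized eigenvector that is a sum of eigenvectors is an eigenvector, modulo \<open>J\<close>.
\<close>

lemma eigenvector_sum_square:
  assumes A: "lin A" and J: "subsp J" "\<And>f. f \<in> J \<Longrightarrow> A f \<in> J"
    and v: "v = lincomb (\<lambda>u. u) c" and m: "\<And>u. u \<in> supp c \<Longrightarrow> A u = scal (m u) u"
    and sq: "A (A v - scal l v) - scal l (A v - scal l v) \<in> J"
  shows "A v - scal l v \<in> J"
proof -
  define part where "part x = (\<Sum>u\<in>{u \<in> supp c. m u = x}. scal (cf c u) u)" for x
  define L where "L = m ` supp c"
  have v': "v = (\<Sum>x\<in>L. part x)"
    unfolding v lincomb_def L_def part_def by (rule sum.image_gen) simp
  have Ap: "A (part x) = scal x (part x)" for x
    by (simp add: part_def lin_simps[OF A] scal_sum m mult.commute)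
  have step: "A (\<Sum>x\<in>L. scal (k x) (part x)) - scal l (\<Sum>x\<in>L. scal (k x) (part x))
      = (\<Sum>x\<in>L. scal ((x - l) * k x) (part x))" for k
    unfolding lin_sum[OF A] lin_scal[OF A] Ap scal_sum sum_subtractf[symmetric]
    by (intro sum.cong refl) (simp add: left_diff_distrib scal_diff_left mult.commute[of "k _"])
  have N: "A v - scal l v = (\<Sum>x\<in>L. scal (x - l) (part x))"
    using step[of "\<lambda>_. 1"] by (simp add: v')
  have "A (A v - scal l v) - scal l (A v - scal l v) = (\<Sum>x\<in>L. scal ((x - l) * (x - l)) (part x))"
    unfolding N by (rule step)
  then have s: "(\<Sum>x\<in>L. scal ((x - l) * (x - l)) (part x)) \<in> J" using sq by simp
  have "scal (x - l) (part x) \<in> J" if x: "x \<in> L" for x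
  proof -
    have "scal ((x - l) * (x - l)) (part x) \<in> J"
      by (rule eig_sum[OF A J _ _ _ s x, where l = "\<lambda>x. x"])
        (auto simp: L_def lin_simps[OF A] Ap mult.commute)
    then have "scal (x - l) (scal (x - l) (part x)) \<in> J" by simp
    then show ?thesis
      by (cases "x = l") (use J(1) in \<open>simp_all add: subsp_scal_iff subsp_0\<close>)
  qed
  then show ?thesis unfolding N by (intro subsp_sum J)
qed

text \<open>
  If \<open>t\<^sup>2 q\<^sup>s = 1\<close>, the number \<open>t\<^sup>1\<^sup>/\<^sup>2 q\<^sup>s\<^sup>/\<^sup>4\<close> is a root of unity; it is then required to
  be \<open>1\<close>.
\<close>

locale generic_powers = powers p for p :: "rat \<Rightarrow> complex" +
  fixes th :: complex
  assumes th0: "th \<noteq> 0" and torsion: "th ^ 4 * p (of_int s) = 1 \<Longrightarrow> th = p (- of_int s / 4)"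
begin

abbreviation "P \<equiv> polrep p th"
abbreviation "t \<equiv> th\<^sup>2"
abbreviation "q \<equiv> p 1"
abbreviation "qh \<equiv> p (1/2)"

sublocale PR: polynomial_rep qh th p P
  by unfold_locales (auto simp: th0)

lemma torsion2: "t * p (of_int m) = 1 \<Longrightarrow> th = p (- of_int m / 2)"
proof -
  assume m: "t * p (of_int m) = 1"
  have "th ^ 4 * p (of_int (2 * m)) = (t * p (of_int m)) * (t * p (of_int m))"
    by (simp add: power2_eq_square power4_eq_xxxx mult_ac flip: padd)
  then have "th = p (- of_int (2 * m) / 4)" by (intro torsion) (simp add: m)
  then show ?thesis by simp
qed

lemma Y_semisimple_P:
  assumes "\<not> (\<exists>j::nat. j > 0 \<and> th = p (- of_nat j / 2))"
  shows "Y_semisimple P"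
proof -
  interpret D: dunkl q t "\<lambda>j. qh powi j"
  proof
    show "qh powi (j + 2) = q * qh powi j" for j
      unfolding ppowi padd[symmetric] by (simp add: field_simps)
    show "q ^ m * t \<noteq> 1" if "m > 0" for m :: nat
    proof
      assume "q ^ m * t = 1"
      then have "t * p (of_int (int m)) = 1" by (simp add: ppow mult.commute)
      then have "th = p (- of_nat m / 2)" using torsion2[of "int m"] by simp
      with assms that show False by blast
    qed
  qed (auto simp: th0)
  let ?e = "E q t"
  have Y: "PR.Yp (?e m) = scal (inverse th * D.lam m) (?e m)" for m
  proof -
    have "PR.Yp (?e m) = scal (inverse th) (D.Y' (?e m))"
      by (simp add: PR.Yp_def PR.Tp_Th D.Y'_def pi_op_flipx lin_simps[OF lin_flipx])
    then show ?thesis by (simp add: D.Y'_E)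
  qed
  have inj: "inj ?e" by (rule tri_inj[OF tri_E])
  have "has_basis P (\<lambda>v. v) (range ?e)"
  proof (rule PR.P.has_basisI[where b = "\<lambda>v. v"])
    fix f :: "complex lpoly"
    obtain c where c: "f = lincomb ?e c" using tri_expand[of ?e f, OF tri_E] by blast
    obtain d where "supp d = ?e ` supp c" "lincomb (\<lambda>v. v) d = lincomb ?e c"
      using lincomb_reindex[OF inj, of c "\<lambda>v. v"] by blast
    then show "\<exists>d. supp d \<subseteq> range ?e \<and> f - lincomb (\<lambda>v. v) d \<in> {0}" using c by (intro exI[of _ d]) auto
  next
    fix d assume d: "supp d \<subseteq> range ?e" "lincomb (\<lambda>v. v) d \<in> {0}"
    define c where "c = Poly_Mapping.map_key ?e d"
    have cf: "cf c i = cf d (?e i)" for i using inj by (simp add: c_def map_key.rep_eq)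
    have s: "supp d = ?e ` supp c"
    proof (intro subset_antisym subsetI)
      fix v assume "v \<in> supp d"
      moreover then obtain i where "v = ?e i" using d(1) by blast
      ultimately show "v \<in> ?e ` supp c" by (auto simp: in_keys_iff cf)
    qed (auto simp: in_keys_iff cf)
    have "lincomb ?e c = lincomb (\<lambda>v. v) d"
      unfolding lincomb_def s by (subst sum.reindex) (use inj in \<open>auto simp: cf inj_on_def inj_def\<close>)
    then have "c = 0" using d(2) tri_lincomb_eq_0[of ?e, OF tri_E] by simp
    then show "d = 0" using s by simp
  qed auto
  then show ?thesis unfolding Y_semisimple_def using Y by (intro exI[of _ "range ?e"]) auto
qed

text \<open>
  \<open>X\<^sup>-\<^sup>j\<close> and \<open>X\<^sup>j\<close> have the same eigenvalue modulo lower terms, but the coefficient of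
  \<open>X\<^sup>j\<close> in \<open>Y' X\<^sup>-\<^sup>j\<close> is not zero. So \<open>X\<^sup>-\<^sup>j\<close> is a generalized eigenvector and not an
  eigenvector modulo the span of the \<open>X\<^sup>i\<close> with \<open>\<bar>i\<bar> < j\<close>.
\<close>

lemma not_Y_semisimple_P:
  assumes j: "(j::nat) > 0" and th: "th = p (- of_nat j / 2)"
  shows "\<not> Y_semisimple P"
proof
  assume "Y_semisimple P"
  then obtain B where B: "has_basis P (\<lambda>v. v) B" "\<forall>v\<in>B. \<exists>c. PR.Yp v = scal c v"
    by (auto simp: Y_semisimple_def)
  let ?J = "{f::complex lpoly. \<forall>k\<in>supp f. \<bar>k\<bar> < int j}"
  let ?v = "mon (- int j) :: complex lpoly"
  define A where "A f = flipx (\<lambda>j. qh powi j) (Th t f)" for f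
  define l where "l = p (- of_nat j / 2)"
  have A: "lin A" unfolding A_def[abs_def] by (rule lin_compose[OF lin_flipx lin_Th])
  have AY: "A f = scal th (PR.Yp f)" for f
    by (simp add: A_def PR.Yp_def PR.Tp_Th pi_op_flipx lin_simps[OF lin_flipx] th0)
  have cfA: "cf (A f) k = cf (Th t f) (- k) * qh powi (- k)" for f k by (simp add: A_def)
  have t: "t = p (- of_nat j)" unfolding th ppow by simp
  have J: "subsp ?J" by (rule subspI) (auto dest!: supp_plus dest: subsetD[OF supp_scal])
  have AJ: "A f \<in> ?J" if f: "f \<in> ?J" for f
  proof (intro CollectI ballI)
    fix k assume "k \<in> supp (A f)"
    then have "- k \<in> supp (Th t f)" by (simp add: in_keys_iff cfA)
    then obtain i where "i \<in> supp f" "\<bar>- k\<bar> \<le> \<bar>i\<bar>" using supp_Th by blast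
    with f show "\<bar>k\<bar> < int j" by force
  qed
  have in_J: "f \<in> ?J" if "\<And>k. \<bar>k\<bar> \<ge> int j \<Longrightarrow> cf f k = 0" for f
    using that by (force simp: in_keys_iff)
  have qj: "qh powi (- int j) = l" "qh ^ j = inverse l"
    unfolding l_def ppowi ppow by (simp_all flip: pminus)
  have tl: "t = l * l" unfolding t l_def by (simp flip: padd)
  have l0: "l \<noteq> 0" by (simp add: l_def)
  have t1: "t \<noteq> 1" unfolding t p_eq_1 using j by simp
  have out: "cf (Th t (mon i)) k = 0" if "\<bar>i\<bar> \<le> int j" "\<bar>k\<bar> \<ge> int j" "k \<noteq> i" "k \<noteq> - i" for i k
  proof (rule ccontr)
    assume "cf (Th t (mon i)) k \<noteq> 0"
    then have "k \<in> supp (Th t (mon i))" by (simp add: in_keys_iff)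
    then have "\<bar>k\<bar> \<le> \<bar>i\<bar>" using supp_Th_mon(3) that by blast
    with that show False by linarith
  qed
  have pos: "A (mon (int j)) - scal l (mon (int j)) \<in> ?J"
  proof (rule in_J)
    fix k assume k: "\<bar>k\<bar> \<ge> int j"
    consider "k = int j" | "k = - int j" | "\<bar>k\<bar> > int j" using k by linarith
    then show "cf (A (mon (int j)) - scal l (mon (int j))) k = 0"
    proof cases
      case 1 then show ?thesis using j by (simp add: lookup_minus cfA cf_Th_mon_lead cf_mon qj)
    next
      case 2 then show ?thesis using j by (simp add: lookup_minus cfA cf_Th_mon cf_dmon cf_mon)
    next
      case 3 then show ?thesis using out[of "int j" "- k"] by (auto simp: lookup_minus cfA cf_mon)
    qed
  qed
  define c where "c = (t - 1) * l"
  have c0: "c \<noteq> 0" using t1 l0 by (simp add: c_def)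
  have neg: "A ?v - scal l ?v - scal c (mon (int j)) \<in> ?J"
  proof (rule in_J)
    fix k assume k: "\<bar>k\<bar> \<ge> int j"
    consider "k = int j" | "k = - int j" | "\<bar>k\<bar> > int j" using k by linarith
    then show "cf (A ?v - scal l ?v - scal c (mon (int j))) k = 0"
    proof cases
      case 1 then show ?thesis using j by (simp add: lookup_minus cfA cf_Th_mon cf_dmon cf_mon qj c_def)
    next
      case 2
      then show ?thesis using j l0 cf_Th_mon_lead[of t "- int j"]
        by (simp add: lookup_minus cfA cf_mon qj tl)
    next
      case 3 then show ?thesis using out[of "- int j" "- k"] by (auto simp: lookup_minus cfA cf_mon)
    qed
  qed
  obtain d where d: "supp d \<subseteq> B" "?v - lincomb (\<lambda>v. v) d \<in> {0}"
    using PR.P.has_basis_span[OF B(1), of "\<lambda>v. v" ?v] by auto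
  obtain m where m: "\<And>v. v \<in> B \<Longrightarrow> PR.Yp v = scal (m v) v" using B(2) by metis
  have "A ?v - scal l ?v \<in> ?J"
  proof (rule eigenvector_sum_square[OF A J AJ])
    show "?v = lincomb (\<lambda>v. v) d" using d by simp
    show "A u = scal (th * m u) u" if "u \<in> supp d" for u
      using that d m by (simp add: AY subset_iff)
    let ?N = "\<lambda>f. A f - scal l f"
    have "?N (?N ?v) = ?N (?N ?v - scal c (mon (int j))) + scal c (?N (mon (int j)))"
      by (simp add: lin_simps[OF A] scal_diff mult.commute)
    also have "\<dots> \<in> ?J"
      by (intro subsp_add[OF J] subsp_diff[OF J] subsp_scal[OF J] AJ pos neg)
    finally show "?N (?N ?v) \<in> ?J" .
  qed
  then have "(A ?v - scal l ?v) - (A ?v - scal l ?v - scal c (mon (int j))) \<in> ?J"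
    by (rule subsp_diff[OF J _ neg])
  then have "scal c (mon (int j)) \<in> ?J" by simp
  then have "mon (int j) \<in> ?J" using c0 J by (simp add: subsp_scal_iff del: mem_Collect_eq)
  then show False by simp
qed

theorem Y_semisimple_iff: "Y_semisimple P \<longleftrightarrow> \<not> (\<exists>j::nat. j > 0 \<and> th = p (- of_nat j / 2))"
  using Y_semisimple_P not_Y_semisimple_P by blast

end

section \<open>Irreducibility of the polynomial representation\<close>

text \<open>
  By division with remainder, an ideal is generated by an element of minimal width.
\<close>

lemma ideal_zero:
  fixes J :: "'k::alg_closed_field lpoly set"
  assumes J: "subsp J" "\<And>f g. f \<in> J \<Longrightarrow> g * f \<in> J" and ne: "J \<noteq> {0}" "J \<noteq> UNIV"
  shows "\<exists>z. z \<noteq> 0 \<and> (\<forall>f\<in>J. ev z f = 0)" and "finite {z. z \<noteq> 0 \<and> (\<forall>f\<in>J. ev z f = 0)}"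
proof -
  define wd where "wd f = nat (Max (supp f) - Min (supp f))" for f :: "'k lpoly"
  have "\<exists>f. f \<in> J \<and> f \<noteq> 0" using ne(1) subsp_0[OF J(1)] by blast
  then obtain g where g: "g \<in> J" "g \<noteq> 0" and least: "\<And>f. f \<in> J \<Longrightarrow> f \<noteq> 0 \<Longrightarrow> wd g \<le> wd f"
    using ex_has_least_nat[of "\<lambda>f. f \<in> J \<and> f \<noteq> 0" _ wd] by metis
  define u v where "u = Min (supp g)" and "v = Max (supp g)"
  have gne: "supp g \<noteq> {}" using g by simp
  have uv: "u \<le> j \<and> j \<le> v" if "j \<in> supp g" for j using that by (simp add: u_def v_def)
  have nz: "cf g u \<noteq> 0" "cf g v \<noteq> 0"
    using Min_in[OF finite_keys gne] Max_in[OF finite_keys gne] by (simp_all add: u_def v_def in_keys_iff)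
  have lt: "u < v"
  proof (rule ccontr)
    assume "\<not> u < v"
    then have s: "supp g \<subseteq> {u}" using uv by force
    have "cf g j = cf (scal (cf g u) (mon u)) j" for j using s by (auto simp: cf_mon in_keys_iff subset_iff)
    then have gu: "g = scal (cf g u) (mon u)" by (rule poly_mapping_eqI)
    have "h \<in> J" for h
    proof -
      have "scal (inverse (cf g u)) (mon (- u)) * g = 1"
        by (subst gu) (simp add: scal_mult_left scal_mult_right nz)
      then have "h = (h * scal (inverse (cf g u)) (mon (- u))) * g" by (simp add: mult.assoc)
      then show ?thesis using J(2)[OF g(1)] by metis
    qed
    then show False using ne(2) by blast
  qed
  \<comment> \<open>The remainder lies in \<open>J\<close> and has smaller width than \<open>g\<close>.\<close>
  have mult: "\<exists>h. f = h * g" if f: "f \<in> J" for f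
  proof -
    obtain h where h: "\<forall>j\<in>supp (f - h * g). u \<le> j \<and> j < v" using reduce_window[OF uv nz lt] by blast
    have r: "f - h * g \<in> J" using f J g by (intro subsp_diff) auto
    have "f - h * g = 0"
    proof (rule ccontr)
      assume n0: "f - h * g \<noteq> 0"
      then have ne: "supp (f - h * g) \<noteq> {}" by simp
      have "u \<le> Min (supp (f - h * g))" "Max (supp (f - h * g)) < v"
        using h Min_in[OF finite_keys ne] Max_in[OF finite_keys ne] by blast+
      then have "wd (f - h * g) < wd g" using lt unfolding wd_def u_def[symmetric] v_def[symmetric] by linarith
      with least[OF r n0] show False by simp
    qed
    then show ?thesis by auto
  qed
  define d where "d = Suc (nat (v - u))"
  have win: "u \<le> j \<and> j < u + int d" if "j \<in> supp g" for j using uv[OF that] lt by (auto simp: d_def)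
  define r where "r = (\<Sum>i<d. Polynomial.monom (cf g (u + int i)) i)"
  have cr: "Polynomial.coeff r i = (if i < d then cf g (u + int i) else 0)" for i
    by (simp add: r_def Polynomial.coeff_sum Polynomial.coeff_monom)
  have "Polynomial.coeff r (nat (v - u)) \<noteq> 0" using nz lt by (simp add: cr d_def)
  then have "nat (v - u) \<le> degree r" by (rule le_degree)
  then have "degree r > 0" using lt by simp
  then obtain z where z: "poly r z = 0" using alg_closed_imp_poly_has_root by blast
  have "poly r 0 = cf g u" using cr[of 0] by (simp add: poly_0_coeff_0 d_def)
  then have z0: "z \<noteq> 0" using z nz by auto
  have "ev z g = 0" using ev_window[of g u d z, OF win z0] z by (simp add: r_def)
  then show "\<exists>z. z \<noteq> 0 \<and> (\<forall>f\<in>J. ev z f = 0)"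
    using z0 by (intro exI[of _ z]) (auto dest!: mult simp: ev_mult)
  show "finite {z. z \<noteq> 0 \<and> (\<forall>f\<in>J. ev z f = 0)}" (is "finite ?Z")
  proof (rule ccontr)
    assume "infinite ?Z"
    then obtain Z where Z: "Z \<subseteq> ?Z" "finite Z" "card Z = d" using infinite_arbitrarily_large by blast
    have "g = 0" by (rule zero_window[OF win Z(2)]) (use Z g in auto)
    with g show False by simp
  qed
qed

text \<open>
  The derivation \<open>X d/dX\<close>. Its values at a zero detect multiplicity.
\<close>

definition euler :: "'k::field lpoly \<Rightarrow> 'k lpoly" where
  "euler f = Poly_Mapping.mapp (\<lambda>j c. of_int j * c) f"

lemma cf_euler [simp]: "cf (euler f) j = of_int j * cf f j"
  by (simp add: euler_def lookup_mapp when_def in_keys_iff)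

lemma lin_euler: "lin euler"
  by (rule linI; rule poly_mapping_eqI) (simp_all add: lookup_add algebra_simps)

lemma euler_X2: "euler (mon 2 * f) = scal 2 (mon 2 * f) + mon 2 * euler f"
  by (rule poly_mapping_eqI) (simp add: lookup_add left_diff_distrib)

lemma euler_s_op: "euler (s_op f) = - s_op (euler f)"
  by (rule poly_mapping_eqI) simp

lemma euler_pi_op: "euler (pi_op qh f) = - pi_op qh (euler f)"
  by (rule poly_mapping_eqI) (simp add: pi_op_flipx)

text \<open>
  The derivative of the identity \<open>ev_Th\<close>.
\<close>

lemma ev_euler_Th:
  assumes z: "z \<noteq> 0"
  shows "(z\<^sup>2 - 1) * ev z (euler (Th t f)) + 2 * z\<^sup>2 * ev z (Th t f) =
    2 * t * z\<^sup>2 * ev (inverse z) f - (t * z\<^sup>2 - 1) * ev (inverse z) (euler f) - (t - 1) * ev z (euler f)"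
proof -
  have p: "z powi 2 = z\<^sup>2" using power_int_of_nat[of z 2] by simp
  have "mon 2 * Th t f - Th t f = scal t (mon 2 * s_op f) - s_op f - scal (t - 1) f"
    using Th[of t f] by (simp add: left_diff_distrib scal_mult_left)
  then have "euler (mon 2 * Th t f - Th t f) = euler (scal t (mon 2 * s_op f) - s_op f - scal (t - 1) f)"
    by (rule arg_cong)
  then have "scal 2 (mon 2 * Th t f) + mon 2 * euler (Th t f) - euler (Th t f) =
      scal t (scal 2 (mon 2 * s_op f) - mon 2 * s_op (euler f)) + s_op (euler f) - scal (t - 1) (euler f)"
    by (simp add: lin_simps[OF lin_euler] euler_X2 euler_s_op)
  then have "ev z (scal 2 (mon 2 * Th t f) + mon 2 * euler (Th t f) - euler (Th t f)) =
      ev z (scal t (scal 2 (mon 2 * s_op f) - mon 2 * s_op (euler f)) + s_op (euler f) - scal (t - 1) (euler f))"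
    by (rule arg_cong)
  then show ?thesis using z by (simp add: ev_simps ev_mult ev_s_op p algebra_simps)
qed

context generic_powers
begin

lemma p_infinite: "z \<noteq> 0 \<Longrightarrow> inj (\<lambda>i::nat. qh ^ i * z)"
  by (auto simp: inj_def ppow)

text \<open>
  The set \<open>Z\<close> of common zeros is closed under \<open>z \<mapsto> q\<^sup>1\<^sup>/\<^sup>2/z\<close>, and under \<open>z \<mapsto> 1/z\<close> unless \<open>t
  z\<^sup>2 = 1\<close>. Multiplication by \<open>q\<^sup>1\<^sup>/\<^sup>2\<close>, the composite, therefore has to reach such an
  exception from every \<open>z\<close>, and likewise from \<open>q\<^sup>1\<^sup>/\<^sup>2/z\<close>. Hence \<open>t\<^sup>2 q\<^sup>s = 1\<close> for some \<open>s >
  0\<close>. If \<open>s = 2l\<close>, then \<open>z\<^sup>2 = q\<^sup>e\<close> with \<open>1 - l \<le> e \<le> l\<close> for all \<open>z\<close> in \<open>Z\<close>. Some zero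
  satisfies \<open>z\<^sup>2 = 1\<close>; it is a multiple zero, because \<open>T\<close> divides by \<open>X\<^sup>2 - 1\<close>. Multiplicity
  is carried along to \<open>e = l\<close>, where it implies that \<open>1/z\<close> is a zero as well, with the
  forbidden exponent \<open>-l\<close>.
\<close>

lemma no_common_zero:
  assumes J: "PR.stable J" "J \<noteq> {0}" "J \<noteq> UNIV"
    and exc: "\<And>n::nat. th \<noteq> p (- 1/4 - of_nat n / 2)"
  shows False
proof -
  define Z where "Z = {z. z \<noteq> 0 \<and> (\<forall>f\<in>J. ev z f = 0)}"
  have Zne: "Z \<noteq> {}" and Zfin: "finite Z"
    unfolding Z_def using ideal_zero[of J] PR.stableD[OF J(1)] J(2,3) by auto
  have Z0: "z \<noteq> 0" if "z \<in> Z" for z using that by (simp add: Z_def)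
  have Zev: "ev z f = 0" if "z \<in> Z" "f \<in> J" for z f using that by (simp add: Z_def)
  have TJ: "Th t f \<in> J" and piJ: "pi_op qh f \<in> J" if "f \<in> J" for f
    using that PR.stableD[OF J(1)] by auto
  have inv: "inverse z \<in> Z" if z: "z \<in> Z" "t * z\<^sup>2 \<noteq> 1" for z
  proof -
    have "ev (inverse z) f = 0" if f: "f \<in> J" for f
      using ev_Th[OF Z0[OF z(1)], of t f] Zev[OF z(1)] TJ[OF f] f z(2) by simp
    then show ?thesis using Z0[OF z(1)] by (simp add: Z_def)
  qed
  have refl: "qh / z \<in> Z" if z: "z \<in> Z" for z
    using Zev[OF z piJ] Z0[OF z] by (auto simp: Z_def ev_pi_op)
  have shift: "qh * z \<in> Z" if "z \<in> Z" "t * z\<^sup>2 \<noteq> 1" for z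
    using refl[OF inv[OF that]] by (simp add: field_simps)
  have low: "\<exists>i::nat. z\<^sup>2 * (t * p (of_nat i)) = 1" if z: "z \<in> Z" for z
  proof (rule ccontr)
    assume no: "\<not> ?thesis"
    have "qh ^ i * z \<in> Z" for i
    proof (induction i)
      case (Suc i)
      have "t * (qh ^ i * z)\<^sup>2 = z\<^sup>2 * (t * p (of_nat i))"
        by (simp add: power_mult_distrib ppow mult_ac)
      then have "t * (qh ^ i * z)\<^sup>2 \<noteq> 1" using no by metis
      from shift[OF Suc this] show ?case by (simp add: mult_ac)
    qed (use z in simp)
    then have "range (\<lambda>i::nat. qh ^ i * z) \<subseteq> Z" by auto
    then show False using Zfin p_infinite[OF Z0[OF z]] finite_imageD[of "\<lambda>i::nat. qh ^ i * z" UNIV]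
      by (auto dest: finite_subset)
  qed
  have high: "\<exists>i::nat. z\<^sup>2 = t * p (1 + of_nat i)" if z: "z \<in> Z" for z
  proof -
    obtain i :: nat where i: "(qh / z)\<^sup>2 * (t * p (of_nat i)) = 1" using low[OF refl[OF z]] by blast
    have "(qh / z)\<^sup>2 * z\<^sup>2 = p 1" using Z0[OF z] by (simp add: power_divide ppow)
    then have "z\<^sup>2 = (qh / z)\<^sup>2 * (t * p (of_nat i)) * z\<^sup>2" using i by simp
    also have "\<dots> = t * p (1 + of_nat i)" using \<open>(qh / z)\<^sup>2 * z\<^sup>2 = p 1\<close> by (simp add: padd mult_ac)
    finally show ?thesis by blast
  qed
  obtain z0 where z0: "z0 \<in> Z" using Zne by blast
  obtain i m :: nat where im: "z0\<^sup>2 * (t * p (of_nat i)) = 1" "z0\<^sup>2 = t * p (1 + of_nat m)"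
    using low[OF z0] high[OF z0] by blast
  define s where "s = 1 + int m + int i"
  have "th ^ 4 * p (of_int s) = (t * p (1 + of_nat m)) * (t * p (of_nat i))"
    by (simp add: s_def padd power2_eq_square power4_eq_xxxx mult_ac)
  then have ths: "th = p (- of_int s / 4)" using im by (intro torsion) simp
  have "even s"
  proof (rule ccontr)
    assume "odd s"
    then obtain k where k: "s = 2 * int k + 1"
      by (intro that[of "nat (s div 2)"]) (simp add: s_def odd_two_times_div_two_succ)
    have "(- of_int s / 4 :: rat) = - 1/4 - of_nat k / 2" unfolding k by (simp add: field_simps)
    with ths exc show False by metis
  qed
  define l where "l = s div 2"
  have sl: "s = 2 * l" using \<open>even s\<close> by (simp add: l_def)
  then have l1: "l \<ge> 1" unfolding s_def by linarith
  have t: "t = p (- of_int l)" unfolding ths ppow sl by simp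
  have ex: "\<exists>e. z\<^sup>2 = p (of_int e) \<and> 1 - l \<le> e \<and> e \<le> l" if z: "z \<in> Z" for z
  proof -
    obtain i m :: nat where im: "z\<^sup>2 * (t * p (of_nat i)) = 1" "z\<^sup>2 = t * p (1 + of_nat m)"
      using low[OF z] high[OF z] by blast
    have 1: "z\<^sup>2 = p (of_int (1 + int m - l))" unfolding im(2) t padd[symmetric] by simp
    then have "p (of_int (1 + int m - l)) * p (of_int (int i - l)) = 1"
      using im(1) by (simp add: t flip: padd)
    then have "of_int (1 + int m - l) + of_int (int i - l) = (0::rat)" using p_eq_1 padd by metis
    then have "1 + int m - l + (int i - l) = 0" by (metis of_int_add of_int_eq_0_iff)
    then show ?thesis using 1 by (intro exI[of _ "1 + int m - l"]) auto
  qed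
  have tz: "t * z\<^sup>2 \<noteq> 1" if "z\<^sup>2 = p (of_int e)" "e \<noteq> l" for z e
    using that by (simp add: t p_eq_1 flip: padd)
  have shift2: "(qh * z)\<^sup>2 = p (of_int (e + 1))" if "z\<^sup>2 = p (of_int e)" for z e
    using that by (simp add: power_mult_distrib ppow mult.commute flip: padd)
  \<comment> \<open>Multiplication by \<open>q\<^sup>1\<^sup>/\<^sup>2\<close> raises \<open>e\<close> by one; it is possible as long as \<open>e < l\<close>.\<close>
  have up: "\<exists>\<zeta>\<in>Z. \<zeta>\<^sup>2 = 1" if "z \<in> Z" "z\<^sup>2 = p (of_int (- int k))" for z k
    using that
  proof (induction k arbitrary: z)
    case (Suc k)
    have "t * z\<^sup>2 \<noteq> 1" using tz[OF Suc.prems(2)] l1 by simp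
    then have "qh * z \<in> Z" using shift Suc.prems by blast
    moreover have "(qh * z)\<^sup>2 = p (of_int (- int k))" using shift2[OF Suc.prems(2)] by simp
    ultimately show ?case by (rule Suc.IH)
  qed auto
  obtain e where e: "z0\<^sup>2 = p (of_int e)" using ex[OF z0] by blast
  obtain \<zeta> where zeta: "\<zeta> \<in> Z" "\<zeta>\<^sup>2 = 1"
  proof (cases "e \<le> 0")
    case True
    then show ?thesis using up[OF z0, of "nat (- e)"] e that by auto
  next
    case False
    have "(qh / z0)\<^sup>2 = p (of_int (1 - e))" using e by (simp add: power_divide ppow pdiff)
    then show ?thesis using up[OF refl[OF z0], of "nat (e - 1)"] False that by auto
  qed
  define D where "D z \<longleftrightarrow> z \<in> Z \<and> (\<forall>f\<in>J. ev z (euler f) = 0)" for z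
  have t1: "t \<noteq> 1" unfolding t p_eq_1 using l1 by simp
  have Dz: "D \<zeta>"
  proof -
    have i: "inverse \<zeta> = \<zeta>" using zeta(2) by (metis inverse_unique power2_eq_square)
    have "ev \<zeta> (euler f) = 0" if f: "f \<in> J" for f
    proof -
      have "2 * ((t - 1) * ev \<zeta> (euler f)) = 0"
        using ev_euler_Th[OF Z0[OF zeta(1)], of t f] Zev[OF zeta(1)] f TJ[OF f]
        by (auto simp: i zeta(2))
      then show ?thesis using t1 by auto
    qed
    then show ?thesis using zeta by (simp add: D_def)
  qed
  have Dinv: "D (inverse z)" if z: "D z" "t * z\<^sup>2 \<noteq> 1" for z
  proof -
    have zZ: "z \<in> Z" using z by (simp add: D_def)
    have iZ: "inverse z \<in> Z" by (rule inv[OF zZ z(2)])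
    have "ev (inverse z) (euler f) = 0" if f: "f \<in> J" for f
      using ev_euler_Th[OF Z0[OF zZ], of t f] z TJ[OF f] f Zev[OF zZ] Zev[OF iZ] by (simp add: D_def)
    then show ?thesis using iZ by (simp add: D_def)
  qed
  have Drefl: "D (qh / z)" if z: "D z" for z
  proof -
    have "ev (qh / z) (euler f) = 0" if f: "f \<in> J" for f
    proof -
      have "ev (qh / z) (euler f) = - ev z (euler (pi_op qh f))"
        by (simp add: euler_pi_op ev_pi_op ev_simps)
      then show ?thesis using z piJ[OF f] by (simp add: D_def)
    qed
    then show ?thesis using refl z by (simp add: D_def)
  qed
  have "\<exists>z. D z \<and> z\<^sup>2 = p (of_int (int k))" if "int k \<le> l" for k
    using that
  proof (induction k)
    case 0
    then show ?case using Dz zeta(2) p0 by (intro exI[of _ \<zeta>]) simp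
  next
    case (Suc k)
    then obtain z where z: "D z" "z\<^sup>2 = p (of_int (int k))" by auto
    have "t * z\<^sup>2 \<noteq> 1" using tz[OF z(2)] Suc.prems by simp
    then have "D (qh / inverse z)" by (intro Drefl Dinv z)
    then have "D (qh * z)" by (simp add: field_simps)
    moreover have "(qh * z)\<^sup>2 = p (of_int (int (Suc k)))" using shift2[OF z(2)] by (simp add: add.commute)
    ultimately show ?case by blast
  qed
  from this[of "nat l"] l1 obtain z where z: "D z" "z\<^sup>2 = p (of_int l)" by auto
  have zZ: "z \<in> Z" using z by (simp add: D_def)
  have tz1: "t * z\<^sup>2 = 1" unfolding z(2) t by (simp flip: padd add: p0)
  have "ev (inverse z) f = 0" if f: "f \<in> J" for f
    using ev_euler_Th[OF Z0[OF zZ], of t f] z(1) TJ[OF f] f Zev[OF zZ] tz1 Z0[OF zZ] th0 by (simp add: D_def)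
  then have "inverse z \<in> Z" using Z0[OF zZ] by (simp add: Z_def)
  then obtain e where e: "(inverse z)\<^sup>2 = p (of_int e)" "1 - l \<le> e" using ex by blast
  have "p (of_int e) = p (of_int (- l))" using e(1) z(2) by (simp add: power_inverse pminus)
  then have "e = - l" unfolding p_eq by (simp only: of_int_eq_iff)
  with e(2) show False by simp
qed

theorem irreducible_iff: "irreducible_rep P \<longleftrightarrow> (\<forall>n::nat. th \<noteq> p (- 1/4 - of_nat n / 2))"
proof (intro iffI allI notI)
  fix n assume irr: "irreducible_rep P" and th: "th = p (- 1/4 - of_nat n / 2)"
  interpret R: special p n by unfold_locales
  have tth: "R.th = th" by (simp add: R.th_def th)
  have "subrep R.R0 P" using R.R0_stable R.PR.subrep_P unfolding tth by blast
  then have "R.R0 = {0} \<or> R.R0 = UNIV" using irr by (simp add: irreducible_rep_def)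
  moreover have "R.e (- R.NN) \<in> R.R0" "R.e 0 \<notin> R.R0"
    unfolding R.e_R0 by (auto simp: M_set_def R.NN_def)
  ultimately show False by (metis E_nonzero UNIV_I singletonD)
next
  assume exc: "\<forall>n::nat. th \<noteq> p (- 1/4 - of_nat n / 2)"
  have "N = {0} \<or> N = UNIV" if "subrep N P" for N
    using no_common_zero[of N] that exc by (auto simp: PR.subrep_P)
  moreover have "(UNIV :: complex lpoly set) \<noteq> {0}" by (metis UNIV_I mon_nonzero singletonD)
  ultimately show "irreducible_rep P" by (simp add: irreducible_rep_def)
qed

end

section \<open>Finite-dimensional modules\<close>

lemma lincomb_scal: "lincomb b (scal a c) = scal a (lincomb b c)"
proof -
  have "lincomb b (scal a c) = (\<Sum>i\<in>supp c. scal (cf (scal a c) i) (b i))"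
    by (rule lincomb_superset) (auto simp: supp_scal)
  then show ?thesis by (simp add: lincomb_def scal_sum)
qed

lemma lin_lincomb: "lin (lincomb b)"
  by (rule linI) (simp_all add: lincomb_add lincomb_scal)

lemma subsp_range: "lin A \<Longrightarrow> subsp (range A)"
proof (rule subspI)
  assume A: "lin A"
  show "0 \<in> range A" using lin_0[OF A] by (metis rangeI)
  show "f + g \<in> range A" if "f \<in> range A" "g \<in> range A" for f g
    using that by (auto simp flip: lin_add[OF A])
  show "scal c f \<in> range A" if "f \<in> range A" for c f
    using that by (auto simp flip: lin_scal[OF A])
qed

text \<open>
  Finite dimension in the only form in which it enters: long sequences are dependent.
\<close>

definition fin_dim :: "'k::field lpoly set \<Rightarrow> bool" where
  "fin_dim U \<longleftrightarrow> (\<exists>d. \<forall>u::nat \<Rightarrow> 'k lpoly. (\<forall>i. u i \<in> U) \<longrightarrow>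
     (\<exists>x. (\<exists>i\<le>d. x i \<noteq> 0) \<and> (\<Sum>i\<le>d. scal (x i) (u i)) = 0))"

text \<open>
  \<open>act r\<close> is \<open>r(A)\<close> applied to a fixed vector. For \<open>r \<noteq> 0\<close> annihilating the vector, split
  off linear factors until the result is no longer zero.
\<close>

lemma fin_dim_eigenvector:
  fixes A :: "'k::alg_closed_field lpoly \<Rightarrow> 'k lpoly"
  assumes U: "subsp U" "fin_dim U" "U \<noteq> {0}" and A: "lin A" "\<And>f. f \<in> U \<Longrightarrow> A f \<in> U"
  obtains v l where "v \<in> U" "v \<noteq> 0" "A v = scal l v"
proof -
  obtain v0 where v0: "v0 \<in> U" "v0 \<noteq> 0" using U(3) subsp_0[OF U(1)] by blast
  define act where "act r = (\<Sum>i\<le>degree r. scal (Polynomial.coeff r i) ((A ^^ i) v0))" for r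
  have act: "act r = (\<Sum>i\<le>n. scal (Polynomial.coeff r i) ((A ^^ i) v0))" if "degree r \<le> n" for r n
    unfolding act_def using that
    by (intro sum.mono_neutral_left) (auto simp: coeff_eq_0)
  have pw: "(A ^^ i) v0 \<in> U" for i by (induction i) (auto simp: v0 A)
  have actU: "act r \<in> U" for r unfolding act_def by (intro subsp_sum subsp_scal U pw)
  have act_p: "act (pCons 0 r) = A (act r)" for r
  proof -
    have "act (pCons 0 r) = (\<Sum>i\<le>Suc (degree r). scal (Polynomial.coeff (pCons 0 r) i) ((A ^^ i) v0))"
      by (rule act) (simp add: degree_pCons_le)
    also have "\<dots> = (\<Sum>i\<le>degree r. scal (Polynomial.coeff r i) (A ((A ^^ i) v0)))"
      by (subst sum.atMost_Suc_shift) simp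
    finally show ?thesis by (simp add: act_def lin_simps[OF A(1)])
  qed
  have act_lin: "act (pCons 0 r + smult c r) = A (act r) + scal c (act r)" for r c
  proof -
    let ?n = "Suc (degree r)"
    have "act (pCons 0 r + smult c r) = act (pCons 0 r) + scal c (act r)"
      by (subst (1 2 3) act[where n = ?n])
        (auto simp: degree_pCons_le scal_add scal_add_left sum.distrib scal_sum intro!: degree_add_le order_trans[OF degree_smult_le])
    then show ?thesis by (simp add: act_p)
  qed
  obtain d where d: "\<And>u::nat \<Rightarrow> 'k lpoly. (\<forall>i. u i \<in> U) \<Longrightarrow>
      \<exists>x. (\<exists>i\<le>d. x i \<noteq> 0) \<and> (\<Sum>i\<le>d. scal (x i) (u i)) = 0" using U(2) unfolding fin_dim_def by blast
  obtain x i0 where x: "i0 \<le> d" "x i0 \<noteq> 0" "(\<Sum>i\<le>d. scal (x i) ((A ^^ i) v0)) = 0"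
    using d[of "\<lambda>i. (A ^^ i) v0"] pw by blast
  define r0 where "r0 = (\<Sum>i\<le>d. Polynomial.monom (x i) i)"
  have c0: "Polynomial.coeff r0 i = (if i \<le> d then x i else 0)" for i
    by (simp add: r0_def Polynomial.coeff_sum Polynomial.coeff_monom)
  have "degree r0 \<le> d" by (rule degree_le) (auto simp: c0)
  then have "act r0 = 0" using act[of r0 d] x by (simp add: c0)
  moreover have "r0 \<noteq> 0" using x c0[of i0] by auto
  moreover have "\<exists>v l. v \<in> U \<and> v \<noteq> 0 \<and> A v = scal l v" if "act r = 0" "r \<noteq> 0" for r
    using that
  proof (induction "degree r" arbitrary: r rule: less_induct)
    case less
    have "degree r > 0"
    proof (rule ccontr)
      assume "\<not> degree r > 0"
      then obtain c where "r = [:c:]" by (metis degree_eq_zeroE neq0_conv)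
      with less.prems v0 show False by (simp add: act_def)
    qed
    then obtain z where "poly r z = 0" using alg_closed_imp_poly_has_root by blast
    then obtain s where s: "r = [:- z, 1:] * s" by (metis dvdE poly_eq_0_iff_dvd)
    then have s': "r = pCons 0 s + smult (- z) s" by simp
    have s0: "s \<noteq> 0" using s less.prems by auto
    have "degree r = Suc (degree s)" using s0 unfolding s by (subst degree_mult_eq) auto
    then have deg: "degree s < degree r" by simp
    have "A (act s) = scal z (act s)" using less.prems(1) unfolding s' act_lin by (simp add: scal_minus_left)
    then show ?case using less.hyps[OF deg _ s0] actU by (cases "act s = 0") auto
  qed
  ultimately show ?thesis using that by blast
qed

lemma fin_dim_eigenvalues:
  assumes U: "fin_dim U" and A: "lin A" and u: "\<And>i::nat. u i \<in> U \<and> u i \<noteq> 0 \<and> A (u i) = scal (l i) (u i)"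
  shows "\<not> inj l"
proof
  assume l: "inj l"
  obtain d x i where x: "i \<le> d" "x i \<noteq> 0" "(\<Sum>i\<le>d. scal (x i) (u i)) = 0"
    using U u unfolding fin_dim_def by meson
  have "scal (x i) (u i) \<in> {0}"
  proof (rule eig_sum[where u = "\<lambda>i. scal (x i) (u i)" and l = l and I = "{..d}", OF A])
    show "i \<in> {..d}" "(\<Sum>i\<in>{..d}. scal (x i) (u i)) \<in> {0}" using x by auto
    show "inj_on l {..d}" using l by (rule inj_on_subset) auto
    show "A (scal (x i) (u i)) = scal (l i) (scal (x i) (u i))" for i
      using u by (simp add: lin_simps[OF A] mult.commute)
  qed (auto simp: lin_0[OF A])
  then show False using x u[of i] by simp
qed

text \<open>
  An irreducible module carried over to a subspace \<open>U\<close> of the Laurent polynomials by the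
  choice of a basis, which makes the linear algebra above available. The operators are
  unrelated to the multiplication of Laurent polynomials; \<open>Xi\<close> and \<open>Yi\<close> are the inverses of
  \<open>Xo\<close> and \<open>Yo\<close>.
\<close>

locale hecke_ops = hecke qh th for qh th :: "'k::alg_closed_field" +
  fixes U :: "'k lpoly set" and Xo Xi Yo Yi To :: "'k lpoly \<Rightarrow> 'k lpoly"
  assumes U: "subsp U" "fin_dim U" "U \<noteq> {0}"
    and lin: "lin Xo" "lin Xi" "lin Yo" "lin Yi" "lin To"
    and clo: "f \<in> U \<Longrightarrow> Xo f \<in> U" "f \<in> U \<Longrightarrow> Xi f \<in> U" "f \<in> U \<Longrightarrow> Yo f \<in> U"
      "f \<in> U \<Longrightarrow> Yi f \<in> U" "f \<in> U \<Longrightarrow> To f \<in> U"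
    and inv [simp]: "f \<in> U \<Longrightarrow> Xo (Xi f) = f" "f \<in> U \<Longrightarrow> Xi (Xo f) = f"
      "f \<in> U \<Longrightarrow> Yo (Yi f) = f" "f \<in> U \<Longrightarrow> Yi (Yo f) = f"
    and TXT': "f \<in> U \<Longrightarrow> To (Xo (To f)) = Xi f" and TYT: "f \<in> U \<Longrightarrow> To (Yi (To f)) = Yo f"
    and rel3: "f \<in> U \<Longrightarrow> scal qh (Yi (Xi (Yo (Xo (To (To f)))))) = f"
    and quad: "f \<in> U \<Longrightarrow> To (To f) = scal (th - inverse th) (To f) + f"
    and irr: "subsp N \<Longrightarrow> N \<subseteq> U \<Longrightarrow> (\<And>f. f \<in> N \<Longrightarrow> Xo f \<in> N \<and> Xi f \<in> N \<and> Yo f \<in> N \<and> Yi f \<in> N \<and> To f \<in> N) \<Longrightarrow>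
      N = {0} \<or> N = U"
    and qh_free: "\<And>i::nat. i > 0 \<Longrightarrow> qh ^ i \<noteq> 1"
begin

definition "Ti f = To f - scal (th - inverse th) f"
definition "po f = Yo (Ti f)"

lemma Ti_U: "f \<in> U \<Longrightarrow> Ti f \<in> U"
  by (simp add: Ti_def clo subsp_diff subsp_scal U)

lemma po_U: "f \<in> U \<Longrightarrow> po f \<in> U"
  by (simp add: po_def clo Ti_U)

lemma lin_po: "lin po"
  unfolding po_def[abs_def] Ti_def by (intro lin_compose[OF lin(3)] lin_sub lin(5) lin_scale lin_id)

lemma ToTi [simp]: "f \<in> U \<Longrightarrow> To (Ti f) = f"
  by (simp add: Ti_def lin_simps[OF lin(5)] quad)

lemma TiTo [simp]: "f \<in> U \<Longrightarrow> Ti (To f) = f"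
  by (simp add: Ti_def quad)

lemma po_po [simp]: "f \<in> U \<Longrightarrow> po (po f) = f"
proof -
  assume f: "f \<in> U"
  have "Yi f' = Ti (Yo (Ti f'))" if "f' \<in> U" for f'
    using TYT[OF Ti_U[OF that]] that TiTo[of "Yi f'"] by (simp add: clo Ti_U)
  from this[OF f] have "po (po f) = Yo (Yi f)" by (simp add: po_def)
  then show ?thesis using f by simp
qed

lemma XoTo: "f \<in> U \<Longrightarrow> Xo (To f) = Ti (Xi f)"
  using TiTo[of "Xo (To f)"] by (simp add: clo TXT')

lemma po_Xi: "f \<in> U \<Longrightarrow> po (Xi f) = scal (inverse qh) (Xo (po f))"
proof -
  have *: "po (Xi (To g)) = scal (inverse qh) (Xo (po (To g)))" if g: "g \<in> U" for g
  proof -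
    have "Xo (Yo (scal qh (Yi (Xi (Yo (Xo (To (To g)))))))) = Xo (Yo g)" using rel3[OF g] by simp
    then have "scal qh (Yo (Xo (To (To g)))) = Xo (Yo g)"
      using g by (simp add: lin_simps[OF lin(1)] lin_simps[OF lin(3)] clo)
    then have "Yo (Xo (To (To g))) = scal (inverse qh) (Xo (Yo g))" by (metis scal_scal left_inverse qh0 scal_one)
    then show ?thesis using g XoTo[of "To g"] by (simp add: po_def clo)
  qed
  assume "f \<in> U"
  then show ?thesis using *[OF Ti_U] by simp
qed

lemma po_Xo: "f \<in> U \<Longrightarrow> po (Xo f) = scal qh (Xi (po f))"
proof -
  assume f: "f \<in> U"
  have "Xi (po f) = po (po (Xi (po f)))" using f by (simp add: clo po_U)
  also have "\<dots> = scal (inverse qh) (po (Xo f))" using f by (simp add: po_Xi po_U lin_scal[OF lin_po])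
  finally show ?thesis by simp
qed

lemma To_Xo: "f \<in> U \<Longrightarrow> To (Xo f) = Xi (To f) - scal (th - inverse th) (Xi f)"
proof -
  assume f: "f \<in> U"
  have "To (Xo f) = Xi (Ti f)" using TXT'[OF Ti_U[OF f]] f by simp
  then show ?thesis by (simp add: Ti_def lin_simps[OF lin(2)])
qed

lemma To_Xi: "f \<in> U \<Longrightarrow> To (Xi f) = Xo (To f) + scal (th - inverse th) (Xi f)"
proof -
  assume f: "f \<in> U"
  have "To (To (Xo (To f))) = scal (th - inverse th) (To (Xo (To f))) + Xo (To f)"
    by (rule quad) (simp add: clo f)
  then show ?thesis unfolding TXT'[OF f] by (simp add: add.commute)
qed

lemma eig_nz: "v \<in> U \<Longrightarrow> v \<noteq> 0 \<Longrightarrow> Yo v = scal l v \<Longrightarrow> l \<noteq> 0"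
  using inv(4)[of v] lin_0[OF lin(4)] by auto

text \<open>
  The intertwiner \<open>X \<pi>\<close> inverts the eigenvalue up to \<open>q\<^sup>-\<^sup>1\<^sup>/\<^sup>2\<close>.
\<close>

lemma po_eig:
  assumes v: "v \<in> U" "Yo v = scal l v" and l: "l \<noteq> 0"
  shows "Yo (Xo (po v)) = scal (inverse (qh * l)) (Xo (po v))"
proof -
  have "po (To v) = scal l v" using v by (simp add: po_def)
  then have "po (po (To v)) = scal l (po v)" by (simp add: lin_scal[OF lin_po])
  then have "To v = scal l (po v)" using v(1) by (simp add: clo)
  then have "Ti (To v) = scal l (Ti (po v))" by (simp add: Ti_def lin_simps[OF lin(5)] scal_diff mult.commute)
  then have "v = scal l (Ti (po v))" using v(1) by simp
  then have Tipo: "Ti (po v) = scal (inverse l) v" using l by (metis left_inverse scal_one scal_scal)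
  have "Yo (Xo (po v)) = po (To (Xo (po v)))" using v by (simp add: po_def[of "To _"] clo po_U)
  also have "To (Xo (po v)) = Xi (Ti (po v))"
    using v(1) by (simp add: To_Xo po_U Ti_def lin_simps[OF lin(2)])
  also have "po \<dots> = scal (inverse (qh * l)) (Xo (po v))"
    using v(1) by (simp add: Tipo lin_simps[OF lin(2)] lin_simps[OF lin_po] po_Xi mult.commute)
  finally show ?thesis .
qed

lemma XoPo_nz: "v \<in> U \<Longrightarrow> v \<noteq> 0 \<Longrightarrow> Xo (po v) \<noteq> 0"
  by (metis inv(2) po_po lin_0[OF lin(2)] lin_0[OF lin_po] po_U)

text \<open>
  The intertwiner of \<open>T\<close> inverts the eigenvalue. It may annihilate \<open>v\<close>, which is then an
  eigenvector of \<open>T\<close>.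
\<close>

lemma T_eig:
  assumes v: "v \<in> U" "Yo v = scal l v" and l: "l \<noteq> 0" "l\<^sup>2 \<noteq> 1"
  defines "al \<equiv> (th - inverse th) * l\<^sup>2 / (1 - l\<^sup>2)"
  shows "Yo (To v + scal al v) = scal (inverse l) (To v + scal al v)"
proof -
  have "Yi v = scal (inverse l) v"
    using inv(4)[OF v(1)] l unfolding v(2) lin_scal[OF lin(4)]
    by (metis left_inverse scal_one scal_scal)
  have "To (Yi (To (Ti v))) = Yo (Ti v)" by (rule TYT[OF Ti_U[OF v(1)]])
  then have "scal (inverse l) (To v) = Yo (Ti v)"
    using v(1) \<open>Yi v = scal (inverse l) v\<close> by (simp add: lin_simps[OF lin(5)])
  then have "Yo (To v) = scal (inverse l) (To v) + scal ((th - inverse th) * l) v"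
    by (simp add: Ti_def lin_simps[OF lin(3)] v(2) algebra_simps)
  then have 1: "Yo (To v + scal al v) = scal (inverse l) (To v) + scal ((th - inverse th) * l + al * l) v"
    by (simp add: lin_simps[OF lin(3)] v(2) scal_add_left add.assoc)
  have "(th - inverse th) * l + al * l = inverse l * al"
    using l by (simp add: al_def field_simps power2_eq_square)
  then show ?thesis unfolding 1 by (simp add: scal_add)
qed

lemma qh_inj: "qh ^ i = qh ^ j \<Longrightarrow> i = (j::nat)"
proof -
  have *: False if "qh ^ i = qh ^ j" "i < j" for i j :: nat
  proof -
    have "qh ^ j = qh ^ i * qh ^ (j - i)" using that(2) by (simp flip: power_add)
    then have "qh ^ (j - i) = 1" using that by simp
    then show False using qh_free[of "j - i"] that by simp
  qed
  assume "qh ^ i = qh ^ j"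
  then show ?thesis using *[of i j] *[of j i] by (metis nat_neq_iff)
qed

text \<open>
  Without common eigenvectors of \<open>T\<close> and \<open>Y\<close> both intertwiners are injective on eigenvectors
  of \<open>Y\<close>, and their composites would lead to the eigenvalues \<open>q\<^sup>-\<^sup>i\<^sup>/\<^sup>2 l\<close> for all \<open>i \<ge> 0\<close>.
  The case \<open>l\<^sup>2 = 1\<close>, in which the intertwiner of \<open>T\<close> has a pole, is avoided by starting
  from \<open>l\<close> or from its image under \<open>X \<pi>\<close>. On a common eigenvector the quadratic relation and
  \<open>T Y\<^sup>-\<^sup>1 T = Y\<close> leave only the stated eigenvalues.
\<close>

lemma common_eigenvector:
  obtains v c where "v \<in> U" "v \<noteq> 0" "To v = scal c v" "Yo v = scal c v \<or> Yo v = scal (- c) v"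
    "c = th \<or> c = - inverse th"
proof -
  note result = that
  have fin: thesis if v: "v \<in> U" "v \<noteq> 0" "To v = scal c v" "Yo v = scal l v" for v c l
  proof -
    have l0: "l \<noteq> 0" using eig_nz v by blast
    have "scal (c * c) v = scal ((th - inverse th) * c + 1) v"
      using quad[OF v(1)] by (simp add: v(3) lin_simps[OF lin(5)] scal_add_left)
    then have "scal (c * c - ((th - inverse th) * c + 1)) v = 0" by (simp only: scal_diff_left diff_self)
    then have qx_cf: "c * c = (th - inverse th) * c + 1" using v(2) by simp
    then have "(c - th) * (c + inverse th) = 0" by (simp add: algebra_simps)
    then have c: "c = th \<or> c = - inverse th" by (auto simp: eq_neg_iff_add_eq_0)
    have "Yi v = scal (inverse l) v"
      using inv(4)[OF v(1)] l0 unfolding v(4) lin_scal[OF lin(4)]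
      by (metis left_inverse scal_one scal_scal)
    then have "scal (c * inverse l * c) v = scal l v"
      using TYT[OF v(1)] by (simp add: v lin_simps[OF lin(4)] lin_simps[OF lin(5)] mult_ac)
    then have "scal (c * inverse l * c - l) v = 0" by (simp only: scal_diff_left diff_self)
    then have "c * inverse l * c = l" using v(2) by simp
    then have "c * c = l * l" using l0 by (simp add: field_simps)
    then have "l = c \<or> l = - c" by (metis square_eq_iff)
    then show thesis using result[OF v(1-3) _ c] v(4) by blast
  qed
  show thesis
  proof (rule ccontr)
    assume no: "\<not> thesis"
    have no_eig: False if "v \<in> U" "v \<noteq> 0" "To v = scal c v" "Yo v = scal l v" for v c l
      using fin[OF that] no by blast
    obtain v0 l0 where v0: "v0 \<in> U" "v0 \<noteq> 0" "Yo v0 = scal l0 v0"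
      using fin_dim_eigenvector[OF U lin(3) clo(3)] by blast
    have l0: "l0 \<noteq> 0" using eig_nz v0 by blast
    \<comment> \<open>If \<open>l0\<^sup>2 = q\<^sup>i\<close> with \<open>i \<ge> 0\<close>, then \<open>(q\<^sup>1\<^sup>/\<^sup>2 l0)\<^sup>-\<^sup>2 = q\<^sup>-\<^sup>i\<^sup>-\<^sup>1\<close> is not of this form.\<close>
    obtain v l where v: "v \<in> U" "v \<noteq> 0" "Yo v = scal l v" "\<And>i. l\<^sup>2 \<noteq> (qh\<^sup>2) ^ i" "l \<noteq> 0"
    proof (cases "\<exists>i. l0\<^sup>2 = (qh\<^sup>2) ^ i")
      case True
      then obtain i where i: "l0\<^sup>2 = (qh\<^sup>2) ^ i" by blast
      show ?thesis
      proof (rule that[of "Xo (po v0)" "inverse (qh * l0)"])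
        show "(inverse (qh * l0))\<^sup>2 \<noteq> (qh\<^sup>2) ^ j" for j
        proof
          assume "(inverse (qh * l0))\<^sup>2 = (qh\<^sup>2) ^ j"
          then have "(qh\<^sup>2) ^ j * (qh * l0)\<^sup>2 = (inverse (qh * l0) * (qh * l0))\<^sup>2"
            by (simp only: power_mult_distrib[of "inverse (qh * l0)"])
          also have "inverse (qh * l0) * (qh * l0) = 1" by (rule left_inverse) (use l0 in simp)
          finally have "(qh\<^sup>2) ^ j * (qh * l0)\<^sup>2 = 1" by simp
          moreover have "qh ^ (2 * j + 2 + 2 * i) = (qh\<^sup>2) ^ j * (qh\<^sup>2 * (qh\<^sup>2) ^ i)"
            by (simp only: power_add power_mult mult.assoc)
          ultimately have "qh ^ (2 * j + 2 + 2 * i) = 1"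
            by (simp only: power_mult_distrib i)
          then show False using qh_free[of "2 * j + 2 + 2 * i"] by simp
        qed
      qed (use v0 l0 XoPo_nz po_eig[OF v0(1,3) l0] in \<open>auto simp: clo po_U\<close>)
    qed (use v0 l0 that in blast)
    have "\<exists>u. u \<in> U \<and> u \<noteq> 0 \<and> Yo u = scal (inverse qh ^ i * l) u" for i
    proof (induction i)
      case 0
      then show ?case using v by (intro exI[of _ v]) simp
    next
      case (Suc i)
      then obtain u where u: "u \<in> U" "u \<noteq> 0" "Yo u = scal (inverse qh ^ i * l) u" by blast
      let ?m = "inverse qh ^ i * l"
      define al where "al = (th - inverse th) * ?m\<^sup>2 / (1 - ?m\<^sup>2)"
      have m0: "?m \<noteq> 0" using v by simp
      have "?m\<^sup>2 \<noteq> 1"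
      proof
        assume "?m\<^sup>2 = 1"
        then have "l\<^sup>2 = (qh\<^sup>2) ^ i" by (simp add: power_mult_distrib power_inverse field_simps flip: power_mult)
        with v(4) show False by blast
      qed
      then have w: "Yo (To u + scal al u) = scal (inverse ?m) (To u + scal al u)"
        unfolding al_def by (intro T_eig u m0)
      have wU: "To u + scal al u \<in> U" using u by (intro subsp_add subsp_scal U clo)
      have w0: "To u + scal al u \<noteq> 0"
      proof
        assume "To u + scal al u = 0"
        then have "To u = scal (- al) u" by (simp add: scal_minus_left eq_neg_iff_add_eq_0)
        with no_eig u show False by blast
      qed
      have "inverse (qh * inverse ?m) = inverse qh ^ Suc i * l" using m0 by (simp add: mult.assoc)
      then show ?case using po_eig[OF wU w] XoPo_nz[OF wU w0] m0 wU
        by (intro exI[of _ "Xo (po (To u + scal al u))"]) (auto simp: clo po_U mult.assoc)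
    qed
    then obtain u where u: "\<And>i::nat. u i \<in> U \<and> u i \<noteq> 0 \<and> Yo (u i) = scal (inverse qh ^ i * l) (u i)" by metis
    have "inj (\<lambda>i::nat. inverse qh ^ i * l)"
    proof (rule injI)
      fix i j :: nat assume "inverse qh ^ i * l = inverse qh ^ j * l"
      then have "qh ^ i = qh ^ j" using v(5) by (simp add: power_inverse)
      then show "i = j" by (rule qh_inj)
    qed
    with fin_dim_eigenvalues[OF U(2) lin(3), of u "\<lambda>i. inverse qh ^ i * l"] u show False by blast
  qed
qed

text \<open>
  A common eigenvector behaves like \<open>1\<close> in the polynomial representation for \<open>t\<^sup>1\<^sup>/\<^sup>2\<close> or
  \<open>t\<^sup>-\<^sup>1\<^sup>/\<^sup>2\<close>, with signs \<open>sT\<close>, \<open>sY\<close> in the action of \<open>T\<close> and \<open>Y\<close>. Sending \<open>X\<^sup>j\<close> to \<open>X\<^sup>j v\<close>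
  is then a homomorphism, as the commutation rules of \<open>X\<close> with \<open>T\<close> and \<open>\<pi>\<close> are the same on
  both sides.
\<close>

theorem polynomial_cover:
  obtains \<Phi> sT sY th0 where "lin \<Phi>" "range \<Phi> = U" "sT = 1 \<and> th0 = th \<or> sT = - 1 \<and> th0 = inverse th"
    "sY = 1 \<or> sY = - 1" "\<And>f. \<Phi> (mon 1 * f) = Xo (\<Phi> f)" "\<And>f. \<Phi> (T_op th0 f) = scal sT (To (\<Phi> f))"
    "\<And>f. \<Phi> (pi_op qh (T_op th0 f)) = scal sY (Yo (\<Phi> f))"
proof -
  obtain v c where v: "v \<in> U" "v \<noteq> 0" "To v = scal c v" "Yo v = scal c v \<or> Yo v = scal (- c) v"
    "c = th \<or> c = - inverse th" by (rule common_eigenvector)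
  obtain ep where ep: "Yo v = scal (ep * c) v" "ep = 1 \<or> ep = - 1"
    using v(4) by (metis mult_1 mult_minus1)
  obtain sT th0 where st: "sT = 1 \<and> th0 = th \<or> sT = - 1 \<and> th0 = inverse th" "c = sT * th0"
    using v(5) by (metis mult_1 mult_minus1)
  have sT: "sT * sT = 1" using st(1) by auto
  have ep2: "ep * ep = 1" using ep(2) by auto
  have th00: "th0 \<noteq> 0" using st(1) by auto
  have del: "th0 - inverse th0 = sT * (th - inverse th)" using st(1) by auto
  interpret H: hecke qh th0 by unfold_locales (auto simp: th00)
  define b where "b j = (if j \<ge> 0 then (Xo ^^ nat j) v else (Xi ^^ nat (- j)) v)" for j
  have Xn: "(Xo ^^ i) v \<in> U" "(Xi ^^ i) v \<in> U" for i by (induction i) (auto simp: v clo)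
  have bU: "b j \<in> U" for j by (simp add: b_def Xn)
  have b0: "b 0 = v" by (simp add: b_def)
  have bX: "b (j + 1) = Xo (b j)" for j
  proof (cases "j \<ge> 0")
    case True then show ?thesis by (simp add: b_def nat_add_distrib)
  next
    case False
    then have "nat (- j) = Suc (nat (- (j + 1)))" by simp
    then have "b j = Xi ((Xi ^^ nat (- (j + 1))) v)" using False by (simp add: b_def)
    then have "Xo (b j) = (Xi ^^ nat (- (j + 1))) v" by (simp add: Xn)
    then show ?thesis using False by (auto simp: b_def)
  qed
  have bXi: "b (j - 1) = Xi (b j)" for j using bX[of "j - 1"] bU[of "j - 1"] by simp
  define \<Phi> where "\<Phi> = lincomb b"
  have lP: "lin \<Phi>" unfolding \<Phi>_def by (rule lin_lincomb)
  have Pm: "\<Phi> (mon j) = b j" for j by (simp add: \<Phi>_def)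
  have PU: "\<Phi> f \<in> U" for f unfolding \<Phi>_def by (intro subsp_lincomb U bU)
  have PX: "\<Phi> (mon 1 * f) = Xo (\<Phi> f)" for f
    by (rule lin_eqI[where f = f]) (auto intro: lin_compose[OF lP lin_mult] lin_compose[OF lin(1) lP] simp: Pm bX add.commute)
  have PXi: "\<Phi> (mon (- 1) * f) = Xi (\<Phi> f)" for f
    using PX[of "mon (- 1) * f"] inv(2)[OF PU[of "mon (- 1) * f"]] by simp
  have mon_induct: "Q j" if "Q 0" "\<And>j. Q j \<Longrightarrow> Q (j + 1)" "\<And>j. Q j \<Longrightarrow> Q (j - 1)" for Q and j :: int
    using that by (induction j rule: int_induct[of _ 0]) auto
  have m1: "mon (j + 1) = mon 1 * (mon j :: 'k lpoly)" and m2: "mon (j - 1) = mon (- 1) * (mon j :: 'k lpoly)" for j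
    by (simp_all add: add.commute)
  have PT: "\<Phi> (T_op th0 f) = scal sT (To (\<Phi> f))" for f
  proof (rule lin_eqI[where f = f])
    show "lin (\<lambda>f. \<Phi> (T_op th0 f))" by (rule lin_compose[OF lP H.lin_Tp])
    show "lin (\<lambda>f. scal sT (To (\<Phi> f)))" by (rule lin_scale[OF lin_compose[OF lin(5) lP]])
    show "\<Phi> (T_op th0 (mon j)) = scal sT (To (\<Phi> (mon j)))" for j
    proof (induction j rule: mon_induct)
      case 1
      have "\<Phi> 1 = v" using Pm[of 0] b0 by simp
      then show ?case using sT by (simp add: H.Tp_1 lin_simps[OF lP] v(3) st(2) mult.assoc[symmetric])
    next
      case (2 j)
      have "\<Phi> (T_op th0 (mon (j + 1))) = Xi (\<Phi> (T_op th0 (mon j))) - scal (th0 - inverse th0) (Xi (\<Phi> (mon j)))"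
        unfolding m1 H.Tp_X lin_diff[OF lP] lin_scal[OF lP] PXi ..
      also have "\<dots> = scal sT (To (Xo (\<Phi> (mon j))))"
        by (simp only: 2 To_Xo[OF PU] lin_simps[OF lin(2)] scal_diff scal_scal del)
      finally show ?case by (simp only: m1 PX)
    next
      case (3 j)
      have "\<Phi> (T_op th0 (mon (j - 1))) = Xo (\<Phi> (T_op th0 (mon j))) + scal (th0 - inverse th0) (Xi (\<Phi> (mon j)))"
        unfolding m2 H.Tp_Xinv lin_add[OF lP] lin_scal[OF lP] PXi PX ..
      also have "\<dots> = scal sT (To (Xi (\<Phi> (mon j))))"
        by (simp only: 3 To_Xi[OF PU] lin_simps[OF lin(1)] scal_add scal_scal del)
      finally show ?case by (simp only: m2 PXi)
    qed
  qed
  have pov: "po v = scal ep v"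
  proof -
    have "v = Ti (scal c v)" using TiTo[OF v(1)] v(3) by simp
    then have "v = scal c (Ti v)" by (simp add: Ti_def lin_simps[OF lin(5)] scal_diff mult.commute)
    then have "Yo v = scal c (po v)" by (metis lin_scal[OF lin(3)] po_def)
    then have "scal c (po v) = scal c (scal ep v)" by (simp add: ep(1) mult.commute)
    moreover have "c \<noteq> 0" using v(5) by auto
    ultimately show ?thesis by (metis left_inverse scal_one scal_scal)
  qed
  have Pp: "\<Phi> (pi_op qh f) = scal ep (po (\<Phi> f))" for f
  proof (rule lin_eqI[where f = f])
    show "lin (\<lambda>f. \<Phi> (pi_op qh f))" by (rule lin_compose[OF lP lin_pp])
    show "lin (\<lambda>f. scal ep (po (\<Phi> f)))" by (rule lin_scale[OF lin_compose[OF lin_po lP]])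
    show "\<Phi> (pi_op qh (mon j)) = scal ep (po (\<Phi> (mon j)))" for j
    proof (induction j rule: mon_induct)
      case 1
      have "\<Phi> 1 = v" using Pm[of 0] b0 by simp
      then show ?case using ep2 by (simp add: pp_1 pov)
    next
      case (2 j)
      show ?case unfolding m1 pp_X lin_scal[OF lP] PXi PX
        by (simp only: 2 po_Xo[OF PU] lin_simps[OF lin(2)] scal_scal mult.commute)
    next
      case (3 j)
      show ?case unfolding m2 pp_Xinv lin_scal[OF lP] PXi PX
        by (simp only: 3 po_Xi[OF PU] lin_simps[OF lin(1)] scal_scal mult.commute)
    qed
  qed
  have PY: "\<Phi> (pi_op qh (T_op th0 f)) = scal (ep * sT) (Yo (\<Phi> f))" for f
  proof -
    have "po (To (\<Phi> f)) = Yo (\<Phi> f)" by (simp add: po_def PU)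
    then show ?thesis by (simp add: Pp PT lin_scal[OF lin_po])
  qed
  have s1: "(ep * sT) * (ep * sT) = 1" using ep(2) st(1) by auto
  have "range \<Phi> = {0} \<or> range \<Phi> = U"
  proof (rule irr)
    show "subsp (range \<Phi>)" by (rule subsp_range[OF lP])
    show "range \<Phi> \<subseteq> U" using PU by auto
    fix g assume "g \<in> range \<Phi>"
    then obtain f where g: "g = \<Phi> f" by blast
    have To: "To (\<Phi> f) = \<Phi> (scal sT (T_op th0 f))" for f
      using sT by (simp add: lin_scal[OF lP] PT)
    have Yo: "Yo (\<Phi> f) = \<Phi> (scal (ep * sT) (pi_op qh (T_op th0 f)))" for f
      by (simp only: lin_scal[OF lP] PY scal_scal s1 scal_one)
    have "Yi (\<Phi> f) = \<Phi> (scal (ep * sT) (H.Yinv f))"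
    proof -
      have "\<Phi> f = Yo (\<Phi> (scal (ep * sT) (H.Yinv f)))"
        by (simp only: Yo H.Yp_def[symmetric] lin_scal[OF H.lin_Yp] H.Yp_Yinv scal_scal s1 scal_one)
      then show ?thesis using inv(4)[OF PU] by metis
    qed
    then show "Xo g \<in> range \<Phi> \<and> Xi g \<in> range \<Phi> \<and> Yo g \<in> range \<Phi> \<and> Yi g \<in> range \<Phi> \<and> To g \<in> range \<Phi>"
      unfolding g using To Yo PX PXi by (metis rangeI)
  qed
  moreover have "v \<in> range \<Phi>" using Pm[of 0] b0 by (metis rangeI)
  ultimately have "range \<Phi> = U" using v(2) by blast
  moreover have "ep * sT = 1 \<or> ep * sT = - 1" using ep(2) st(1) by auto
  ultimately show thesis using that[OF lP _ st(1) _ PX PT PY] by blast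
qed

end

locale irreducible_module = hecke qh th for qh th :: "'k::alg_closed_field" +
  fixes V :: "('k, 'v) hh_module" and b :: "nat \<Rightarrow> 'v" and d :: nat
  assumes HH: "HH_module qh th V" and irred: "irreducible_rep V" and bas: "has_basis V b {..<d}"
    and qh_free': "\<And>i::nat. i > 0 \<Longrightarrow> qh ^ i \<noteq> 1"
begin

sublocale mod: module ring_of_type_algebra V
  using HH by (simp add: HH_module_def)

definition U :: "'k lpoly set" where "U = {f. supp f \<subseteq> int ` {..<d}}"
definition h :: "'k lpoly \<Rightarrow> 'v" where "h f = (\<Oplus>\<^bsub>V\<^esub>i\<in>{..<d}. cf f (int i) \<odot>\<^bsub>V\<^esub> b i)"

lemma b_in: "i < d \<Longrightarrow> b i \<in> carrier V"
  using bas by (auto simp: has_basis_def)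

lemma cb_in: "i < d \<Longrightarrow> c \<odot>\<^bsub>V\<^esub> b i \<in> carrier V"
  using b_in by (intro mod.smult_closed) auto

lemma h_in: "h f \<in> carrier V"
  unfolding h_def by (rule mod.M.finsum_closed) (auto intro: cb_in)

lemma h_add: "h f \<oplus>\<^bsub>V\<^esub> h g = h (f + g)"
  unfolding h_def by (subst mod.M.finsum_addf[symmetric])
    (auto intro!: mod.M.finsum_cong' cb_in simp: lookup_add mod.smult_l_distr[OF _ _ b_in, simplified])

lemma h_scal: "c \<odot>\<^bsub>V\<^esub> h f = h (scal c f)"
  unfolding h_def by (subst mod.finsum_smult_ldistr)
    (auto intro!: mod.M.finsum_cong' cb_in mod.smult_closed simp: mod.smult_assoc1[OF _ _ b_in, simplified])

lemma h_0: "h 0 = \<zero>\<^bsub>V\<^esub>"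
  using h_scal[of 0 0] mod.smult_l_null[OF h_in[of 0]] by simp

lemma subsp_U: "subsp U"
  unfolding U_def by (rule subspI) (auto dest!: supp_plus subsetD[OF supp_scal])

lemma h_basis: "supp c \<subseteq> {..<d} \<Longrightarrow> (\<And>i. i < d \<Longrightarrow> cf c i = cf f (int i)) \<Longrightarrow>
    (\<Oplus>\<^bsub>V\<^esub>i\<in>supp c. cf c i \<odot>\<^bsub>V\<^esub> b i) = h f"
  unfolding h_def
proof (rule mod.M.add.finprod_mono_neutral_cong_left)
  assume c: "supp c \<subseteq> {..<d}" "\<And>i. i < d \<Longrightarrow> cf c i = cf f (int i)"
  show "cf f (int i) \<odot>\<^bsub>V\<^esub> b i = \<zero>\<^bsub>V\<^esub>" if "i \<in> {..<d} - supp c" for i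
  proof -
    have "i < d" "cf f (int i) = 0" using that c(2)[of i] by (auto simp: in_keys_iff)
    then show ?thesis using mod.smult_l_null[OF b_in] by simp
  qed
qed (auto intro: cb_in)

lemma h_inj: "f \<in> U \<Longrightarrow> g \<in> U \<Longrightarrow> h f = h g \<Longrightarrow> f = g"
proof -
  assume fg: "f \<in> U" "g \<in> U" "h f = h g"
  define m where "m = (Poly_Mapping.map_key int :: 'k lpoly \<Rightarrow> _)"
  have m: "cf (m f) i = cf f (int i)" for f i by (simp add: m_def map_key.rep_eq)
  have s: "supp (m f) \<subseteq> {..<d}" if "f \<in> U" for f
    using that by (auto simp: U_def m in_keys_iff subset_iff)
  have "\<exists>!c. supp c \<subseteq> {..<d} \<and> h f = (\<Oplus>\<^bsub>V\<^esub>i\<in>supp c. cf c i \<odot>\<^bsub>V\<^esub> b i)"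
    using bas h_in by (simp add: has_basis_def)
  moreover have "h f = (\<Oplus>\<^bsub>V\<^esub>i\<in>supp (m f). cf (m f) i \<odot>\<^bsub>V\<^esub> b i)"
    using h_basis[OF s[OF fg(1)]] m by simp
  moreover have "h f = (\<Oplus>\<^bsub>V\<^esub>i\<in>supp (m g). cf (m g) i \<odot>\<^bsub>V\<^esub> b i)"
    using h_basis[OF s[OF fg(2)]] m fg(3) by simp
  ultimately have eq: "m f = m g" using s[OF fg(1)] s[OF fg(2)] by blast
  show ?thesis
  proof (rule poly_mapping_eqI)
    fix k
    show "cf f k = cf g k"
    proof (cases "k \<in> int ` {..<d}")
      case True then show ?thesis using m[of f] m[of g] eq by auto
    next
      case False
      then have "k \<notin> supp f" "k \<notin> supp g" using fg by (auto simp: U_def)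
      then show ?thesis by (simp add: in_keys_iff)
    qed
  qed
qed

lemma h_surj: "v \<in> carrier V \<Longrightarrow> \<exists>f\<in>U. h f = v"
proof -
  assume "v \<in> carrier V"
  then obtain c where c: "supp c \<subseteq> {..<d}" "v = (\<Oplus>\<^bsub>V\<^esub>i\<in>supp c. cf c i \<odot>\<^bsub>V\<^esub> b i)"
    using bas unfolding has_basis_def by blast
  define f where "f = (\<Sum>i<d. scal (cf c i) (mon (int i)))"
  have "f \<in> U" unfolding f_def by (intro subsp_sum subsp_scal subsp_U) (auto simp: U_def)
  moreover have "cf f (int i) = cf c i" if "i < d" for i
    using that by (simp add: f_def lookup_sum cf_mon if_distrib[of "(*) _"] cong: if_cong)
  ultimately show ?thesis using h_basis[OF c(1), of f] c(2) by auto
qed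

definition sec :: "'v \<Rightarrow> 'k lpoly" where "sec v = (SOME f. f \<in> U \<and> h f = v)"

lemma sec: assumes "v \<in> carrier V" shows sec_U: "sec v \<in> U" and h_sec: "h (sec v) = v"
  using someI_ex[of "\<lambda>f. f \<in> U \<and> h f = v"] h_surj[OF assms] by (auto simp: sec_def)

lemma presented_U: "presented V h U {0}"
proof
  show "carrier V = h ` U" using h_surj h_in by blast
  show "h f = h 0 \<longleftrightarrow> f \<in> {0}" if "f \<in> U" for f using that h_inj subsp_0[OF subsp_U] by blast
qed (auto simp: h_add h_scal h_0 subsp_U)

text \<open>
  The operator on \<open>U\<close> that corresponds to \<open>A\<close>, extended to all Laurent polynomials so that
  it is linear without restrictions.
\<close>

definition hat :: "('v \<Rightarrow> 'v) \<Rightarrow> 'k lpoly \<Rightarrow> 'k lpoly" where "hat A f = sec (A (h f))"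

lemma hat:
  assumes A: "lin_op V A"
  shows lin_hat: "lin (hat A)" and hat_U: "hat A f \<in> U" and h_hat: "h (hat A f) = A (h f)"
proof -
  have in_V: "A (h f) \<in> carrier V" for f using A h_in by (auto simp: lin_op_def)
  show U: "hat A f \<in> U" and h: "h (hat A f) = A (h f)" for f by (simp_all add: hat_def sec in_V)
  show "lin (hat A)"
  proof (rule linI)
    show "hat A (f + g) = hat A f + hat A g" for f g
      by (rule h_inj) (use A h_in in \<open>simp_all add: U subsp_add subsp_U h h_add[symmetric] lin_op_def\<close>)
    show "hat A (scal c f) = scal c (hat A f)" for c f
      by (rule h_inj) (use A h_in in \<open>simp_all add: U subsp_scal subsp_U h h_scal[symmetric] lin_op_def\<close>)
  qed
qed

lemma lin_op_inv:
  assumes A: "lin_op V A" and bij: "bij_betw A (carrier V) (carrier V)"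
  defines "Ai \<equiv> inv_into (carrier V) A"
  shows "lin_op V Ai" and "\<And>v. v \<in> carrier V \<Longrightarrow> A (Ai v) = v" and "\<And>v. v \<in> carrier V \<Longrightarrow> Ai (A v) = v"
proof -
  have car: "Ai v \<in> carrier V" if "v \<in> carrier V" for v
    unfolding Ai_def using that bij by (metis bij_betw_def inv_into_into)
  show r: "A (Ai v) = v" if "v \<in> carrier V" for v
    unfolding Ai_def by (rule bij_betw_inv_into_right[OF bij that])
  show l: "Ai (A v) = v" if "v \<in> carrier V" for v
    unfolding Ai_def by (rule bij_betw_inv_into_left[OF bij that])
  have A': "A (x \<oplus>\<^bsub>V\<^esub> y) = A x \<oplus>\<^bsub>V\<^esub> A y" "A (c \<odot>\<^bsub>V\<^esub> x) = c \<odot>\<^bsub>V\<^esub> A x"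
    if "x \<in> carrier V" "y \<in> carrier V" for x y c using A that by (auto simp: lin_op_def)
  have "Ai (x \<oplus>\<^bsub>V\<^esub> y) = Ai x \<oplus>\<^bsub>V\<^esub> Ai y" if xy: "x \<in> carrier V" "y \<in> carrier V" for x y
    using l[of "Ai x \<oplus>\<^bsub>V\<^esub> Ai y"] car xy by (simp add: A' r)
  moreover have "Ai (c \<odot>\<^bsub>V\<^esub> x) = c \<odot>\<^bsub>V\<^esub> Ai x" if x: "x \<in> carrier V" for x c
    using l[of "c \<odot>\<^bsub>V\<^esub> Ai x"] car x mod.smult_closed[of c "Ai x"] by (simp add: A' r)
  ultimately show "lin_op V Ai" using car by (simp add: lin_op_def)
qed

abbreviation "Xi' \<equiv> inv_into (carrier V) (opX V)"
abbreviation "Yi' \<equiv> inv_into (carrier V) (opY V)"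

lemma ops_V: "lin_op V (opX V)" "lin_op V (opY V)" "lin_op V (opT V)"
    "bij_betw (opX V) (carrier V) (carrier V)" "bij_betw (opY V) (carrier V) (carrier V)"
  using HH by (simp_all add: HH_module_def)

lemmas X_inv = lin_op_inv[OF ops_V(1,4)]
lemmas Y_inv = lin_op_inv[OF ops_V(2,5)]

lemma rels_V: assumes "v \<in> carrier V"
  shows "opT V (opX V (opT V v)) = Xi' v" "opT V (Yi' (opT V v)) = opY V v"
    "qh \<odot>\<^bsub>V\<^esub> Yi' (Xi' (opY V (opX V (opT V (opT V v))))) = v"
    "opT V (opT V v \<oplus>\<^bsub>V\<^esub> inverse th \<odot>\<^bsub>V\<^esub> v) \<ominus>\<^bsub>V\<^esub> th \<odot>\<^bsub>V\<^esub> (opT V v \<oplus>\<^bsub>V\<^esub> inverse th \<odot>\<^bsub>V\<^esub> v) = \<zero>\<^bsub>V\<^esub>"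
  using HH assms by (simp_all add: HH_module_def Let_def)

sublocale O: hecke_ops qh th U "hat (opX V)" "hat Xi'" "hat (opY V)" "hat Yi'" "hat (opT V)"
proof
  interpret PV: presented V h U "{0}" by (rule presented_U)
  note H = h_hat[OF ops_V(1)] h_hat[OF ops_V(2)] h_hat[OF ops_V(3)] h_hat[OF X_inv(1)] h_hat[OF Y_inv(1)]
  note HU = hat_U[OF ops_V(1)] hat_U[OF ops_V(2)] hat_U[OF ops_V(3)] hat_U[OF X_inv(1)] hat_U[OF Y_inv(1)]
  show "subsp U" by (rule subsp_U)
  show "U \<noteq> {0}" using irred h_0 unfolding irreducible_rep_def PV.car by auto
  show "fin_dim U"
    unfolding fin_dim_def
  proof (intro exI[of _ d] allI impI)
    fix u :: "nat \<Rightarrow> 'k lpoly" assume u: "\<forall>i. u i \<in> U"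
    obtain x where x: "\<exists>i\<in>{..d}. x i \<noteq> 0" "\<forall>j\<in>{..<d}. (\<Sum>i\<in>{..d}. x i * cf (u i) (int j)) = 0"
      using homog_system[of "{..<d}" "{..d}" "\<lambda>i j. cf (u i) (int j)"] by auto
    have "(\<Sum>i\<le>d. scal (x i) (u i)) = 0"
    proof (rule poly_mapping_eqI)
      fix k
      show "cf (\<Sum>i\<le>d. scal (x i) (u i)) k = cf 0 k"
      proof (cases "k \<in> int ` {..<d}")
        case True
        then show ?thesis using x(2) by (auto simp: lookup_sum)
      next
        case False
        then have "cf (u i) k = 0" for i using u by (auto simp: U_def in_keys_iff subset_iff)
        then show ?thesis by (simp add: lookup_sum)
      qed
    qed
    then show "\<exists>x. (\<exists>i\<le>d. x i \<noteq> 0) \<and> (\<Sum>i\<le>d. scal (x i) (u i)) = 0" using x(1) by auto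
  qed
  show "lin (hat (opX V))" "lin (hat Xi')" "lin (hat (opY V))" "lin (hat Yi')" "lin (hat (opT V))"
    by (intro lin_hat ops_V X_inv Y_inv)+
  show "hat (opX V) f \<in> U" "hat Xi' f \<in> U" "hat (opY V) f \<in> U" "hat Yi' f \<in> U" "hat (opT V) f \<in> U" for f
    by (rule HU)+
  fix f assume f: "f \<in> U"
  show "hat (opX V) (hat Xi' f) = f" "hat Xi' (hat (opX V) f) = f"
    "hat (opY V) (hat Yi' f) = f" "hat Yi' (hat (opY V) f) = f"
    by (rule h_inj; simp add: HU f H X_inv Y_inv h_in)+
  show "hat (opT V) (hat (opX V) (hat (opT V) f)) = hat Xi' f" "hat (opT V) (hat Yi' (hat (opT V) f)) = hat (opY V) f"
    by (rule h_inj; simp add: HU f H rels_V h_in)+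
  show "scal qh (hat Yi' (hat Xi' (hat (opY V) (hat (opX V) (hat (opT V) (hat (opT V) f)))))) = f"
    by (rule h_inj) (simp_all add: HU f H rels_V h_in subsp_scal subsp_U flip: h_scal)
  have "h (hat (opT V) (hat (opT V) f + scal (inverse th) f)) \<ominus>\<^bsub>V\<^esub> h (scal th (hat (opT V) f + scal (inverse th) f)) = h 0"
    using rels_V(4)[OF h_in[of f]] by (simp add: H h_0 flip: h_scal h_add)
  then have "h (hat (opT V) (hat (opT V) f + scal (inverse th) f) - scal th (hat (opT V) f + scal (inverse th) f)) = h 0"
    by (simp add: PV.hdiff HU f subsp_U subsp_add subsp_scal)
  then have "hat (opT V) (hat (opT V) f + scal (inverse th) f) - scal th (hat (opT V) f + scal (inverse th) f) = 0"
    by (intro h_inj) (simp_all add: HU f subsp_U subsp_add subsp_scal subsp_diff subsp_0)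
  then have "hat (opT V) (hat (opT V) f) + scal (inverse th) (hat (opT V) f) = scal th (hat (opT V) f) + f"
    by (simp add: lin_simps[OF lin_hat[OF ops_V(3)]] scal_add)
  then have "hat (opT V) (hat (opT V) f) = scal th (hat (opT V) f) + f - scal (inverse th) (hat (opT V) f)"
    by (simp add: algebra_simps)
  then show "hat (opT V) (hat (opT V) f) = scal (th - inverse th) (hat (opT V) f) + f"
    by (simp add: scal_diff_left)
next
  interpret PV: presented V h U "{0}" by (rule presented_U)
  note H = h_hat[OF ops_V(1)] h_hat[OF ops_V(2)] h_hat[OF ops_V(3)] h_hat[OF X_inv(1)] h_hat[OF Y_inv(1)]
  fix N assume N: "subsp N" "N \<subseteq> U" and st: "\<And>f. f \<in> N \<Longrightarrow> hat (opX V) f \<in> N \<and> hat Xi' f \<in> N \<and>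
      hat (opY V) f \<in> N \<and> hat Yi' f \<in> N \<and> hat (opT V) f \<in> N"
  have "opX V ` h ` N = h ` N"
  proof (intro subset_antisym subsetI)
    show "v \<in> opX V ` h ` N" if "v \<in> h ` N" for v
    proof -
      obtain f where "v = h f" "f \<in> N" using \<open>v \<in> h ` N\<close> by blast
      then have "v = opX V (h (hat Xi' f))" "hat Xi' f \<in> N" using st by (simp_all add: H X_inv h_in)
      then show ?thesis by blast
    qed
  qed (use st in \<open>auto simp flip: H\<close>)
  moreover have "opY V ` h ` N = h ` N"
  proof (intro subset_antisym subsetI)
    show "v \<in> opY V ` h ` N" if "v \<in> h ` N" for v
    proof -
      obtain f where "v = h f" "f \<in> N" using \<open>v \<in> h ` N\<close> by blast
      then have "v = opY V (h (hat Yi' f))" "hat Yi' f \<in> N" using st by (simp_all add: H Y_inv h_in)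
      then show ?thesis by blast
    qed
  qed (use st in \<open>auto simp flip: H\<close>)
  moreover have "opT V ` h ` N \<subseteq> h ` N" using st by (auto simp flip: H)
  ultimately have "subrep (h ` N) V" using PV.submodule_image[OF N] by (simp add: subrep_def)
  then consider "h ` N = {\<zero>\<^bsub>V\<^esub>}" | "h ` N = carrier V" using irred by (auto simp: irreducible_rep_def)
  then show "N = {0} \<or> N = U"
  proof cases
    case 1
    have "f = 0" if f: "f \<in> N" for f
    proof (rule h_inj)
      show "h f = h 0" using 1 f h_0 by auto
    qed (use f N subsp_0[OF subsp_U] in auto)
    then have "N = {0}" using subsp_0[OF N(1)] by blast
    then show ?thesis by blast
  next
    case 2
    have "U \<subseteq> N"
    proof
      fix f assume f: "f \<in> U"
      then obtain g where "g \<in> N" "h f = h g" using 2 h_in[of f] by blast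
      then show "f \<in> N" using h_inj[OF f, of g] N by auto
    qed
    then show ?thesis using N by blast
  qed
qed (rule qh_free')

theorem quotient_of_polrep:
  assumes p: "p (1/2) = qh"
  shows "(let P = polrep p th; P\<iota> = negate_T (polrep p (inverse th))
        in is_quotient_of V P \<or> is_quotient_of V P\<iota> \<or>
           is_quotient_of V (sigma_y P) \<or> is_quotient_of V (sigma_y P\<iota>))"
proof -
  interpret PV: presented V h U "{0}" by (rule presented_U)
  obtain \<Phi> sT th0 sY where F: "lin \<Phi>" "range \<Phi> = U" "sT = 1 \<and> th0 = th \<or> sT = - 1 \<and> th0 = inverse th"
    "sY = 1 \<or> sY = - 1" "\<And>f. \<Phi> (mon 1 * f) = hat (opX V) (\<Phi> f)" "\<And>f. \<Phi> (T_op th0 f) = scal sT (hat (opT V) (\<Phi> f))"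
    "\<And>f. \<Phi> (pi_op qh (T_op th0 f)) = scal sY (hat (opY V) (\<Phi> f))"
    by (rule O.polynomial_cover, rule that; assumption)
  have th00: "th0 \<noteq> 0" using F(3) by auto
  interpret R: polynomial_rep qh th0 p "polrep p th0" by unfold_locales (auto simp: th00 p)
  have ss: "sT * sT = 1" "sY * sY = 1" using F(3,4) by auto
  have quot: "is_quotient_of V M" if M: "carrier M = UNIV" "\<And>f g. f \<oplus>\<^bsub>M\<^esub> g = f + g" "\<And>c f. c \<odot>\<^bsub>M\<^esub> f = scal c f"
      "\<And>f. opX M f = mon 1 * f" "\<And>f. opY M f = scal sY (R.Yp f)" "\<And>f. opT M f = scal sT (T_op th0 f)"
    for M :: "('k, 'k lpoly) hh_module"
    unfolding is_quotient_of_def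
  proof (rule bexI[of _ "\<lambda>f. h (\<Phi> f)"])
    show "(\<lambda>f. h (\<Phi> f)) ` carrier M = carrier V" unfolding M PV.car F(2)[symmetric] by (simp add: image_image)
    have "h (\<Phi> (opY M f)) = opY V (h (\<Phi> f))" for f
      unfolding M R.Yp_def by (simp add: lin_scal[OF F(1)] F(7) ss h_hat ops_V)
    moreover have "h (\<Phi> (opT M f)) = opT V (h (\<Phi> f))" for f
      unfolding M by (simp add: lin_scal[OF F(1)] F(6) ss h_hat ops_V)
    moreover have "h (\<Phi> (opX M f)) = opX V (h (\<Phi> f))" for f
      unfolding M by (simp add: F(5) h_hat ops_V)
    ultimately show "(\<lambda>f. h (\<Phi> f)) \<in> hh_hom M V"
      unfolding hh_hom_def by (simp add: M h_in h_add h_scal lin_simps[OF F(1)])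
  qed
  have um: "\<ominus>\<^bsub>polrep p th0\<^esub> f = - f" for f using R.P.hminus by simp
  have s1: "scal (- 1) f = - f" for f :: "'k lpoly" by (rule scal_neg_one)
  show ?thesis
    unfolding Let_def
  proof (cases "sT = 1 \<and> th0 = th")
    case True
    show "is_quotient_of V (polrep p th) \<or> is_quotient_of V (negate_T (polrep p (inverse th))) \<or>
      is_quotient_of V (sigma_y (polrep p th)) \<or> is_quotient_of V (sigma_y (negate_T (polrep p (inverse th))))"
      using F(4)
    proof
      assume "sY = 1"
      have "is_quotient_of V (polrep p th0)" by (rule quot) (simp_all add: True[THEN conjunct1] \<open>sY = 1\<close>)
      then show ?thesis using True by simp
    next
      assume "sY = - 1"
      have "is_quotient_of V (sigma_y (polrep p th0))"
        by (rule quot) (simp_all add: True[THEN conjunct1] \<open>sY = - 1\<close> sigma_y_def um s1)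
      then show ?thesis using True by simp
    qed
  next
    case False
    then have st: "sT = - 1" "th0 = inverse th" using F(3) by auto
    show "is_quotient_of V (polrep p th) \<or> is_quotient_of V (negate_T (polrep p (inverse th))) \<or>
      is_quotient_of V (sigma_y (polrep p th)) \<or> is_quotient_of V (sigma_y (negate_T (polrep p (inverse th))))"
      using F(4)
    proof
      assume "sY = 1"
      have "is_quotient_of V (negate_T (polrep p th0))"
        by (rule quot) (simp_all add: st(1) \<open>sY = 1\<close> negate_T_def um s1)
      then show ?thesis using st(2) by simp
    next
      assume "sY = - 1"
      have um': "\<ominus>\<^bsub>negate_T (polrep p th0)\<^esub> f = - f" for f
        using um by (simp add: negate_T_def a_inv_def)
      have "is_quotient_of V (sigma_y (negate_T (polrep p th0)))"
        by (rule quot) (simp_all add: st(1) \<open>sY = - 1\<close> sigma_y_def um' s1, simp_all add: negate_T_def um)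
      then show ?thesis using st(2) by simp
    qed
  qed
qed

end

theorem irreducible_is_quotient:
  fixes V :: "('k::alg_closed_field, 'v) hh_module"
  assumes "HH_module qh th V" "irreducible_rep V" "finite_dim V" and "qh \<noteq> 0" "th \<noteq> 0"
    and "\<And>i::nat. i > 0 \<Longrightarrow> qh ^ i \<noteq> 1" and "p (1/2) = qh"
  shows "(let P = polrep p th; P\<iota> = negate_T (polrep p (inverse th))
        in is_quotient_of V P \<or> is_quotient_of V P\<iota> \<or>
           is_quotient_of V (sigma_y P) \<or> is_quotient_of V (sigma_y P\<iota>))"
proof -
  obtain d :: nat and b where "has_basis V b {..<d}" using assms(3) by (auto simp: finite_dim_def has_dim_def)
  then interpret irreducible_module qh th V b d using assms by unfold_locales auto
  show ?thesis by (rule quotient_of_polrep) (rule assms)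
qed

section \<open>Finite dimensional quotients for general and special parameters\<close>

theorem theorem8p1:
  fixes q t :: complex and qp tp :: "rat \<Rightarrow> complex"
  assumes "fractional_powers q qp" and "fractional_powers t tp"
    and "\<forall>N>0. q ^ N \<noteq> 1"
    and "\<forall>a b. \<forall>N>0. (qp a * tp b) ^ N = 1 \<longrightarrow> qp a * tp b = 1"
  shows "
    (\<forall>V :: (complex, 'v) hh_module.
       HH_module (qp (1/2)) (tp (1/2)) V \<and> irreducible_rep V \<and> finite_dim V \<longrightarrow>
       (let P = polrep qp (tp (1/2)); P\<iota> = negate_T (polrep qp (inverse (tp (1/2))))
        in is_quotient_of V P \<or> is_quotient_of V P\<iota> \<or>
           is_quotient_of V (sigma_y P) \<or> is_quotient_of V (sigma_y P\<iota>))) \<and>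
    (Y_semisimple (polrep qp (tp (1/2))) \<longleftrightarrow>
       \<not> (\<exists>j::nat. j > 0 \<and> tp (1/2) = qp (- of_nat j / 2))) \<and>
    (irreducible_rep (polrep qp (tp (1/2))) \<longleftrightarrow>
       (\<forall>n::nat. tp (1/2) \<noteq> qp (- 1/4 - of_nat n / 2))) \<and>

    (\<forall>n::nat. tp (1/2) = qp (- 1/4 - of_nat n / 2) \<longrightarrow>
     (let th = tp (1/2); P = polrep qp th;
          e = e_pol q t; a = inverse th;
          w = (\<lambda>m. spec q t (mu0 m));
          R0 = numeric_radical w;
          \<epsilon> = (\<lambda>m. scal (inverse (ev a (e m))) (e m));
          \<epsilon>pm = (\<lambda>\<sigma> m. \<epsilon> m + scal \<sigma> (\<epsilon> (m - 2 * int n - 1)));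
          Q = quot_rep P R0;
          V = (\<lambda>\<sigma>. Q\<lparr>carrier := lin_span Q (\<lambda>m. R0 +>\<^bsub>P\<^esub> \<epsilon>pm \<sigma> m) {1 .. 2 * int n + 1}\<rparr>);
          epm = (\<lambda>\<sigma>. e (int n + 1) + scal (\<sigma> * a) (e (- int n)));
          F = fun_rep qp th n
      in
        (\<forall>m. e_well_defined q t m) \<and>
        has_basis P e UNIV \<and>
        (\<forall>m. flip_X (e m) = scal ((- 1) powi m) (e m)) \<and>
        (\<forall>m\<in>M_set n. ev a (e m) \<noteq> 0) \<and>
        (\<forall>m. regular_at q t (mu0 m)) \<and>
        (\<forall>i j. regular_at q t (const_term mu0 (mon i * mon (- j)))) \<and>
        has_basis (P\<lparr>carrier := R0\<rparr>) e (- M_set n) \<and>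

        R0 = Idl\<^bsub>P\<^esub> {e (- 2 * int n - 1)} \<and>
        greatest_fin_dim_quotient P R0 \<and>
        (\<forall>\<sigma>\<in>{1, - 1}. subrep (carrier (V \<sigma>)) Q \<and> has_dim (V \<sigma>) (2 * n + 1) \<and>
           has_basis (V \<sigma>) (\<lambda>m. R0 +>\<^bsub>P\<^esub> \<epsilon>pm \<sigma> m) {1 .. 2 * int n + 1}) \<and>
        carrier (V 1) <+>\<^bsub>Q\<^esub> carrier (V (- 1)) = carrier Q \<and>
        carrier (V 1) \<inter> carrier (V (- 1)) = {\<zero>\<^bsub>Q\<^esub>} \<and>
        \<not> hh_isomorphic (V 1) (V (- 1)) \<and>
        (\<forall>\<sigma>\<in>{1, - 1}. subrep (Idl\<^bsub>P\<^esub> {\<epsilon>pm (- \<sigma>) (int n + 1)}) P \<and>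
           hh_isomorphic (V \<sigma>) (quot_rep P (Idl\<^bsub>P\<^esub> {\<epsilon>pm (- \<sigma>) (int n + 1)}))) \<and>
        hh_isomorphic (V (- 1)) (sigma_x (V 1)) \<and>

        (\<forall>\<sigma>\<in>{1, - 1}. eval_radical P (\<sigma> * a) = {f. R0 +>\<^bsub>P\<^esub> f \<in> carrier (V (- \<sigma>))} \<and>
           hh_isomorphic (V \<sigma>) (quot_rep P (eval_radical P (\<sigma> * a)))) \<and>
        HH_module (qp (1/2)) th F \<and>
        (\<exists>\<phi>\<in>hh_iso (V 1) F.
           \<forall>f. R0 +>\<^bsub>P\<^esub> f \<in> carrier (V 1) \<longrightarrow> \<phi> (R0 +>\<^bsub>P\<^esub> f) = discretize qp n f) \<and>
        (\<forall>\<sigma>\<in>{1, - 1}.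
           (\<exists>c. c \<noteq> 0 \<and> \<epsilon>pm \<sigma> (int n + 1) = scal c (epm \<sigma>)) \<and>
           epm \<sigma> = mon (- int n) *
             (\<Prod>m\<in>{- int n .. int n}. mon 1 + Poly_Mapping.single 0 (\<sigma> * qp (1/4 + of_int m / 2)))))) \<and>

    (\<forall>n::nat.
     (let th = formal_q (- 1/4 - of_nat n / 2); qf = formal_q 1; tf = th ^ 2; P = polrep formal_q th;
          e = e_pol qf tf; a = inverse th;
          w = (\<lambda>m. spec qf tf (mu0 m));
          R0 = pairing_radical formal_bar w;
          \<epsilon> = (\<lambda>m. scal (inverse (ev a (e m))) (e m));
          \<epsilon>pm = (\<lambda>\<sigma> m. \<epsilon> m + scal \<sigma> (\<epsilon> (m - 2 * int n - 1)));
          Q = quot_rep P R0;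
          V = (\<lambda>\<sigma>. Q\<lparr>carrier := lin_span Q (\<lambda>m. R0 +>\<^bsub>P\<^esub> \<epsilon>pm \<sigma> m) {1 .. 2 * int n + 1}\<rparr>);
          epm = (\<lambda>\<sigma>. e (int n + 1) + scal (\<sigma> * a) (e (- int n)));
          F = fun_rep formal_q th n
      in
        (\<forall>m. e_well_defined qf tf m) \<and>
        has_basis P e UNIV \<and>
        (\<forall>m. flip_X (e m) = scal ((- 1) powi m) (e m)) \<and>
        (\<forall>m\<in>M_set n. ev a (e m) \<noteq> 0) \<and>
        (\<forall>m. regular_at qf tf (mu0 m)) \<and>
        (\<forall>i j. regular_at qf tf (const_term mu0 (mon i * mon (- j)))) \<and>
        (\<forall>m. pairing formal_bar w (e m) (e m) \<noteq> 0 \<longleftrightarrow> m \<in> M_set n) \<and>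
        has_basis (P\<lparr>carrier := R0\<rparr>) e (- M_set n) \<and>

        R0 = Idl\<^bsub>P\<^esub> {e (- 2 * int n - 1)} \<and>
        greatest_fin_dim_quotient P R0 \<and>
        (\<forall>\<sigma>\<in>{1, - 1}. subrep (carrier (V \<sigma>)) Q \<and> has_dim (V \<sigma>) (2 * n + 1) \<and>
           has_basis (V \<sigma>) (\<lambda>m. R0 +>\<^bsub>P\<^esub> \<epsilon>pm \<sigma> m) {1 .. 2 * int n + 1}) \<and>
        carrier (V 1) <+>\<^bsub>Q\<^esub> carrier (V (- 1)) = carrier Q \<and>
        carrier (V 1) \<inter> carrier (V (- 1)) = {\<zero>\<^bsub>Q\<^esub>} \<and>
        \<not> hh_isomorphic (V 1) (V (- 1)) \<and>
        (\<forall>\<sigma>\<in>{1, - 1}. subrep (Idl\<^bsub>P\<^esub> {\<epsilon>pm (- \<sigma>) (int n + 1)}) P \<and>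
           hh_isomorphic (V \<sigma>) (quot_rep P (Idl\<^bsub>P\<^esub> {\<epsilon>pm (- \<sigma>) (int n + 1)}))) \<and>
        (\<forall>f g. R0 +>\<^bsub>P\<^esub> f \<in> carrier (V 1) \<and> R0 +>\<^bsub>P\<^esub> g \<in> carrier (V (- 1)) \<longrightarrow>
           pairing formal_bar w f g = 0 \<and> pairing formal_bar w g f = 0) \<and>
        hh_isomorphic (V (- 1)) (sigma_x (V 1)) \<and>

        (\<forall>\<sigma>\<in>{1, - 1}. eval_radical P (\<sigma> * a) = {f. R0 +>\<^bsub>P\<^esub> f \<in> carrier (V (- \<sigma>))} \<and>
           hh_isomorphic (V \<sigma>) (quot_rep P (eval_radical P (\<sigma> * a)))) \<and>
        HH_module (formal_q (1/2)) th F \<and>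
        (\<exists>\<phi>\<in>hh_iso (V 1) F.
           \<forall>f. R0 +>\<^bsub>P\<^esub> f \<in> carrier (V 1) \<longrightarrow> \<phi> (R0 +>\<^bsub>P\<^esub> f) = discretize formal_q n f) \<and>
        (\<forall>\<sigma>\<in>{1, - 1}.
           (\<exists>c. c \<noteq> 0 \<and> \<epsilon>pm \<sigma> (int n + 1) = scal c (epm \<sigma>)) \<and>
           epm \<sigma> = mon (- int n) *
             (\<Prod>m\<in>{- int n .. int n}. mon 1 + Poly_Mapping.single 0 (\<sigma> * formal_q (1/4 + of_int m / 2))))))"
proof -
  have qp: "qp 1 = q" "qp (a + b) = qp a * qp b" and tp: "tp 1 = t" "tp (a + b) = tp a * tp b"
    and q0: "q \<noteq> 0" and t0: "t \<noteq> 0" for a b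
    using assms(1,2) by (auto simp: fractional_powers_def)
  have qp0: "qp 0 = 1"
    using qp(2)[of 0 1] qp(1) q0 by simp
  have qnz: "qp a \<noteq> 0" for a
    using qp(2)[of a "- a"] qp0 by auto
  have qpow: "qp a ^ N = qp (of_nat N * a)" for a N
    by (induction N) (auto simp: qp0 qp(2) distrib_right)
  have qpow1: "qp (of_int m) = 1 \<Longrightarrow> m = 0" for m
  proof (rule ccontr)
    assume m: "qp (of_int m) = 1" "m \<noteq> 0"
    have "qp (of_int (- m)) = 1" using qp(2)[of "of_int m" "of_int (- m)"] m qp0 by simp
    then have "qp (of_nat (nat \<bar>m\<bar>)) = 1" using m by (cases "m \<ge> 0") auto
    then have "q ^ nat \<bar>m\<bar> = 1" using qpow[of 1 "nat \<bar>m\<bar>"] qp(1) by simp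
    then show False using assms(3) m(2) by (metis zero_less_abs_iff zero_less_nat_eq)
  qed
  \<comment> \<open>Clearing the denominator of the exponent turns a relation \<open>q\<^sup>a = 1\<close> into one for an integral power.\<close>
  have qinj: "a = 0" if a: "qp a = 1" for a
  proof -
    obtain m N :: int where mN: "a = of_int m / of_int N" "N > 0"
      by (cases a) (metis Fract_of_int_quotient)
    have "qp a ^ nat N = qp (of_int m)" unfolding qpow using mN by simp
    then show ?thesis using qpow1 a mN by simp
  qed
  have th0: "tp (1/2) \<noteq> 0" and tt: "t = (tp (1/2))\<^sup>2"
    using tp(2)[of "1/2" "1/2"] tp(1) t0 by (auto simp: power2_eq_square)
  interpret G: generic_powers qp "tp (1/2)"
  proof
    fix s :: int
    assume s: "tp (1/2) ^ 4 * qp (of_int s) = 1"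
    then have "(qp (of_int s / 4) * tp (1/2)) ^ 4 = 1" by (simp add: power_mult_distrib qpow mult.commute)
    then have 1: "qp (of_int s / 4) * tp (1/2) = 1" using assms(4) by (metis zero_less_numeral)
    have "qp (- of_int s / 4) * (qp (of_int s / 4) * tp (1/2)) = tp (1/2)"
      using qp(2)[of "- of_int s / 4" "of_int s / 4"] qp0 by simp
    then show "tp (1/2) = qp (- of_int s / 4)" unfolding 1 by simp
  qed (auto simp: qp qp0 th0 intro: qinj)
  have free: "qp (1/2) ^ i \<noteq> 1" if "i > 0" for i :: nat
    using that qinj[of "of_nat i * (1/2)"] by (auto simp: qpow)
  show ?thesis
  proof (intro conjI allI impI, goal_cases)
    case (1 V)
    then show ?case by (intro irreducible_is_quotient) (auto simp: qnz th0 free)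
  next
    case 2
    show ?case by (rule G.Y_semisimple_iff)
  next
    case 3
    show ?case by (rule G.irreducible_iff)
  next
    case (4 n)
    interpret S: special qp n by unfold_locales
    have th: "tp (1/2) = S.th" using 4 by (simp add: S.th_def)
    have q: "q = qp 1" and t: "t = S.th\<^sup>2" using qp(1) tt by (simp_all add: th)
    show ?case
      unfolding Let_def th q t S.e_pol_e S.w_wgt S.R0_def[symmetric]
        S.eps_def[unfolded S.a_def, symmetric] S.epsp_def[symmetric] S.Q_def[symmetric] S.V_def[symmetric]
      unfolding S.a_def[symmetric]
      by (intro conjI allI ballI impI S.e_wd S.basis_P S.flip_e S.mu0_reg S.basis_R0 S.R0_Idl S.greatest
          S.V_subrep S.V_basis S.V_sum S.V_inter S.V_not_iso S.V_iso S.V_sigma_x S.eval_rad S.F_HH S.V_F S.epm)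
        (auto simp: S.ev_a_nz)
  next
    case (5 n)
    interpret S: special formal_q n by (intro special.intro formal_powers)
    note bar = formal_bar_add formal_bar_mult formal_bar_1 formal_bar_q
    have rad: "pairing_radical formal_bar (wgt (formal_q 1) (S.th\<^sup>2)) = S.R0"
      by (rule S.pairing_radical_R0) (rule bar)+
    have orth: "pairing formal_bar (wgt (formal_q 1) (S.th\<^sup>2)) f g = 0 \<and> pairing formal_bar (wgt (formal_q 1) (S.th\<^sup>2)) g f = 0"
      if "S.R0 +>\<^bsub>S.P\<^esub> f \<in> carrier (S.V 1) \<and> S.R0 +>\<^bsub>S.P\<^esub> g \<in> carrier (S.V (- 1))" for f g
      using that by (intro conjI S.V_orth) (auto intro: bar)
    have nrm: "pairing formal_bar (wgt (formal_q 1) (S.th\<^sup>2)) (S.e m) (S.e m) \<noteq> 0 \<longleftrightarrow> m \<in> M_set n" for m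
      by (rule S.pairing_e) (rule bar)+
    show ?case
      unfolding Let_def S.th_def[symmetric] S.e_pol_e S.w_wgt rad
        S.eps_def[unfolded S.a_def, symmetric] S.epsp_def[symmetric] S.Q_def[symmetric] S.V_def[symmetric]
      unfolding S.a_def[symmetric]
      by (intro conjI allI ballI impI S.e_wd S.basis_P S.flip_e S.mu0_reg nrm S.basis_R0 S.R0_Idl S.greatest
          S.V_subrep S.V_basis S.V_sum S.V_inter S.V_not_iso S.V_iso orth S.V_sigma_x S.eval_rad S.F_HH S.V_F S.epm)
        (auto simp: S.ev_a_nz)
  qed
qed

end
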